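(* Let $\mathbf{K}$ be a finite field with $q$ elements and let $n\geqslant 2$ be an integer prime to $q$. Let $\rho : Y\rightarrow X$ be an unramified Galois cover between two smooth projective absolutely integral curves over $\mathbf{K}$, whose Galois group $C$ is cyclic of order $n$. Let $a\in X(\mathbf{K})$, let $n_1$ be the inertial degree of $\rho$ at $a$ (so the fiber $B=\rho^{-1}(a)$, viewed as a reduced effective divisor on $Y$, consists of $n_2:=n/n_1$ closed points, each of degree $n_1$ over $a$). Let $\mathfrak{r}$ be an effective divisor on $Y$ such that $\mathfrak{r}$ and $c.\mathfrak{r}$ are disjoint for every $c\in C$ with $c\neq e$, and let $R=\sum_{c\in C}c.\mathfrak{r}$. Let $D$ be a divisor on $X$ and let $E=\rho^{-1}(D)$ be its pullback to $Y$. Let $g_X$ be the genus of $X$. Assume that either (i) $\deg D\geqslant 2g_X$ and $\deg \mathfrak{r}\geqslant 2\deg D+1$; or (ii) $E-B$ is non-special and $\dim H^0(Y,\mathcal{O}_Y(2E-R))=0$. Then $\nu_q^{sym}(n_1,n_2)\leqslant \sigma$, where $\sigma$ is the symmetric bilinear complexity over $\mathbf{K}$ of the multiplication map $\mathbf{K}[\mathfrak{r}]\times\mathbf{K}[\mathfrak{r}]\rightarrow\mathbf{K}[\mathfrak{r}]$ in the residue ring $\mathbf{K}[\mathfrak{r}]$ of $\mathfrak{r}$.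
   Context: Symmetric bilinear complexity: for a field $\mathbf{K}$, finite-dimensional $\mathbf{K}$-vector spaces $V,W$ and a symmetric $\mathbf{K}$-bilinear map $t:V\times V\to W$, $S_{\mathbf{K}}(t)$ is the smallest integer $k$ such that there exist $\mathbf{K}$-linear maps $\top:V\to\mathbf{K}^k$ and $\bot:\mathbf{K}^k\to W$ with $t(l_1,l_2)=\bot(\top(l_1)\bullet\top(l_2))$ for all $l_1,l_2$, where $\bullet$ is the componentwise product in $\mathbf{K}^k$. Equivariant symmetric complexity: for a finite group $C$, the group algebra $\mathbf{K}[C]$ is identified with the space of maps $C\to\mathbf{K}$ via $\sum_c a_c c\mapsto (c\mapsto a_c)$, and $\diamond$ denotes the resulting componentwise product $(\sum a_c c)\diamond(\sum b_c c)=\sum a_cb_c c$; $\diamond_k$ is the componentwise $\diamond$ product on $\mathbf{K}[C]^k$. For finitely generated left $\mathbf{K}[C]$-modules $L,M$ and a symmetric $\mathbf{K}$-bilinear map $t:L\times L\to M$ with $t(c\cdot l_1,c\cdot l_2)=c\cdot t(l_1,l_2)$, $S_{\mathbf{K},C}(t)$ is the smallest $k$ such that there exist $\mathbf{K}[C]$-linear maps $\top:L\to\mathbf{K}[C]^k$, $\bot:\mathbf{K}[C]^k\to M$ with $t(l_1,l_2)=\bot(\top(l_1)\diamond_k\top(l_2))$. $\nu_q^{sym}(n_1,n_2)$: let $\mathbf{K}$ have $q$ elements, $\mathbf{L}$ a degree $n_1$ extension with Frobenius $F_q$, $\mathbf{M}=\mathbf{L}^{n_2}$, and $C$ the cyclic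 group of order $n=n_1n_2$ generated by the $\mathbf{K}$-automorphism $(x_0,\dots,x_{n_2-1})\mapsto(x_1,\dots,x_{n_2-1},F_q(x_0))$ of $\mathbf{M}$. Then $\nu_q^{sym}(n_1,n_2)=S_{\mathbf{K},C}$ of the multiplication map $\mathbf{M}\times\mathbf{M}\to\mathbf{M}$. A divisor $D$ on a curve $X$ of genus $g$ is non-special if $\dim H^0(X,\mathcal{O}_X(D))=\deg D-g+1$. *)

theory Defs
  imports "HOL-Algebra.Algebra" "HOL-Algebra.Algebraic_Closure_Type" "HOL-Library.Cardinality"
    "HOL-Library.Poly_Mapping"
begin

section \<open>Symmetric bilinear complexity\<close>

text \<open>Linear maps between modules over \<open>R\<close>. Only the carrier of \<open>R\<close> is used, so \<open>R\<close> may be a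
  noncommutative ring. The ring part of the \<open>module\<close> record makes the records below
  algebras, in the sense that \<open>\<otimes>\<close> is their multiplication.\<close>

definition linear_maps ::
    "'r ring \<Rightarrow> ('r, 'v) module \<Rightarrow> ('r, 'w) module \<Rightarrow> ('v \<Rightarrow> 'w) set" where
  "linear_maps R V W = {f \<in> carrier V \<rightarrow> carrier W.
     (\<forall>x\<in>carrier V. \<forall>y\<in>carrier V. f (x \<oplus>\<^bsub>V\<^esub> y) = f x \<oplus>\<^bsub>W\<^esub> f y) \<and>
     (\<forall>a\<in>carrier R. \<forall>x\<in>carrier V. f (a \<odot>\<^bsub>V\<^esub> x) = a \<odot>\<^bsub>W\<^esub> f x)}"

text \<open>Vectors in \<open>K\<^sup>k\<close> are sequences that vanish from index \<open>k\<close> on; \<open>\<otimes>\<close> is the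
  componentwise product.\<close>

definition power_algebra :: "nat \<Rightarrow> ('k::Fields.field, nat \<Rightarrow> 'k) module" where
  "power_algebra k =
    \<lparr>carrier = {x. \<forall>i\<ge>k. x i = 0},
     monoid.mult = (\<lambda>x y i. x i * y i), one = (\<lambda>i. if i < k then 1 else 0),
     ring.zero = (\<lambda>i. 0), add = (\<lambda>x y i. x i + y i), module.smult = (\<lambda>a x i. a * x i)\<rparr>"

definition sym_complexity ::
    "('k::Fields.field, 'v) module \<Rightarrow> ('k, 'w) module \<Rightarrow> ('v \<Rightarrow> 'v \<Rightarrow> 'w) \<Rightarrow> nat" where
  "sym_complexity V W t = (LEAST k.
     \<exists>T\<in>linear_maps ring_of_type_algebra V (power_algebra k).
     \<exists>U\<in>linear_maps ring_of_type_algebra (power_algebra k) W.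
       \<forall>x\<in>carrier V. \<forall>y\<in>carrier V. t x y = U (T x \<otimes>\<^bsub>power_algebra k\<^esub> T y))"

text \<open>The group algebra: functions vanishing outside \<open>C\<close>, with the convolution product.\<close>

definition group_algebra :: "'c monoid \<Rightarrow> ('c \<Rightarrow> 'k::Fields.field) ring" where
  "group_algebra C =
    \<lparr>carrier = {a. \<forall>c. c \<notin> carrier C \<longrightarrow> a c = 0},
     monoid.mult = (\<lambda>a b c. if c \<in> carrier C
        then \<Sum>d\<in>carrier C. a d * b (inv\<^bsub>C\<^esub> d \<otimes>\<^bsub>C\<^esub> c) else 0),
     one = (\<lambda>c. if c = \<one>\<^bsub>C\<^esub> then 1 else 0),
     ring.zero = (\<lambda>c. 0), add = (\<lambda>a b c. a c + b c)\<rparr>"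

text \<open>The free module \<open>K[C]\<^sup>k\<close>: scalars act by convolution in each of the \<open>k\<close> entries, whereas
  \<open>\<otimes>\<close> is the product of functions \<open>C \<rightarrow> K\<close> in each entry.\<close>

definition group_power_algebra ::
    "'c monoid \<Rightarrow> nat \<Rightarrow> ('c \<Rightarrow> 'k::Fields.field, nat \<Rightarrow> 'c \<Rightarrow> 'k) module" where
  "group_power_algebra C k =
    \<lparr>carrier = {x. (\<forall>i<k. x i \<in> carrier (group_algebra C)) \<and> (\<forall>i\<ge>k. x i = (\<lambda>c. 0))},
     monoid.mult = (\<lambda>x y i c. x i c * y i c),
     one = (\<lambda>i c. if i < k \<and> c \<in> carrier C then 1 else 0),
     ring.zero = (\<lambda>i c. 0), add = (\<lambda>x y i c. x i c + y i c),
     module.smult = (\<lambda>a x i. a \<otimes>\<^bsub>group_algebra C\<^esub> x i)\<rparr>"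

definition equivariant_sym_complexity ::
    "'c monoid \<Rightarrow> ('c \<Rightarrow> 'k::Fields.field, 'v) module \<Rightarrow> ('c \<Rightarrow> 'k, 'w) module
      \<Rightarrow> ('v \<Rightarrow> 'v \<Rightarrow> 'w) \<Rightarrow> nat" where
  "equivariant_sym_complexity C V W t = (LEAST k.
     \<exists>T\<in>linear_maps (group_algebra C) V (group_power_algebra C k).
     \<exists>U\<in>linear_maps (group_algebra C) (group_power_algebra C k) W.
       \<forall>x\<in>carrier V. \<forall>y\<in>carrier V. t x y = U (T x \<otimes>\<^bsub>group_power_algebra C k\<^esub> T y))"


section \<open>The complexity \<open>\<nu>\<^sup>s\<^sup>y\<^sup>m\<close> of the algebra \<open>L\<^sup>m\<close> with its twisted shift\<close>

text \<open>The base field \<open>K\<close> is the finite type \<open>'k\<close>, the extension \<open>L\<close> is the type \<open>'l\<close>, with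
  structure map \<open>\<iota>\<close>. The degree of \<open>L\<close> over \<open>K\<close> is determined by \<open>\<iota>\<close>.\<close>

definition ext_power_carrier :: "nat \<Rightarrow> (nat \<Rightarrow> 'l::Fields.field) set" where
  "ext_power_carrier m = {x. \<forall>i\<ge>m. x i = 0}"

definition twisted_shift :: "nat \<Rightarrow> nat \<Rightarrow> (nat \<Rightarrow> 'l::Fields.field) \<Rightarrow> nat \<Rightarrow> 'l" where
  "twisted_shift q m = restrict
     (\<lambda>x i. if i + 1 < m then x (i + 1) else if i + 1 = m then x 0 ^ q else 0)
     (ext_power_carrier m)"

definition twisted_shift_group ::
    "nat \<Rightarrow> nat \<Rightarrow> ((nat \<Rightarrow> 'l::Fields.field) \<Rightarrow> (nat \<Rightarrow> 'l)) monoid" where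
  "twisted_shift_group q m =
     subgroup_generated (BijGroup (ext_power_carrier m)) {twisted_shift q m}"

definition ext_power_module ::
    "('k::{Fields.field,finite} \<Rightarrow> 'l::Fields.field) \<Rightarrow> nat
      \<Rightarrow> (((nat \<Rightarrow> 'l) \<Rightarrow> (nat \<Rightarrow> 'l)) \<Rightarrow> 'k, nat \<Rightarrow> 'l) module" where
  "ext_power_module \<iota> m =
    \<lparr>carrier = ext_power_carrier m,
     monoid.mult = (\<lambda>x y i. x i * y i), one = (\<lambda>i. if i < m then 1 else 0),
     ring.zero = (\<lambda>i. 0), add = (\<lambda>x y i. x i + y i),
     module.smult = (\<lambda>a x i. \<Sum>c\<in>carrier (twisted_shift_group CARD('k) m). \<iota> (a c) * c x i)\<rparr>"

definition nu_sym :: "('k::{Fields.field,finite} \<Rightarrow> 'l::Fields.field) \<Rightarrow> nat \<Rightarrow> nat" where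
  "nu_sym \<iota> m = equivariant_sym_complexity (twisted_shift_group CARD('k) m)
     (ext_power_module \<iota> m) (ext_power_module \<iota> m) (\<lambda>x y. x \<otimes>\<^bsub>ext_power_module \<iota> m\<^esub> y)"


section \<open>Curves over a finite field\<close>

text \<open>An integral separated scheme of finite type over \<open>K\<close> is given by its function field
  \<open>F\<close> and the set of its local rings, viewed as subrings of \<open>F\<close> (a model of \<open>F\<close> in the sense of
  Zariski and Chevalley). So a point is a local subring of the type \<open>'f\<close>, and the generic point
  is \<open>UNIV\<close>. The field \<open>K\<close> is the type \<open>'k\<close>, and \<open>\<iota>\<close> is the inclusion of the constants.\<close>

abbreviation subring_of :: "'f::Fields.field set \<Rightarrow> 'f ring" where
  "subring_of A \<equiv> ring_of_type_algebra\<lparr>carrier := A\<rparr>"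

definition localization :: "'f::Fields.field set \<Rightarrow> 'f set \<Rightarrow> 'f set" where
  "localization A p = {a / b | a b. a \<in> A \<and> b \<in> A - p}"

definition affine_model :: "'f::Fields.field set \<Rightarrow> 'f set set" where
  "affine_model A = {localization A p | p. primeideal p (subring_of A)}"

definition affine_chart ::
    "('k::Fields.field \<Rightarrow> 'f::Fields.field) \<Rightarrow> nat \<Rightarrow> (nat \<Rightarrow> 'f) \<Rightarrow> nat \<Rightarrow> 'f set" where
  "affine_chart \<iota> N x i =
     generate_ring ring_of_type_algebra (range \<iota> \<union> {x j / x i | j. j \<le> N})"

text \<open>An integral closed subscheme of projective \<open>N\<close>-space, \<open>x\<close> being the homogeneous
  coordinates of its generic point. The condition on \<open>UNIV\<close> says that the function field
  is all of \<open>'f\<close>.\<close>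

definition projective_model :: "('k::Fields.field \<Rightarrow> 'f::Fields.field) \<Rightarrow> 'f set set \<Rightarrow> bool" where
  "projective_model \<iota> PX \<longleftrightarrow> (\<exists>N x. (\<exists>i\<le>N. x i \<noteq> 0) \<and>
     PX = (\<Union>i\<in>{i. i \<le> N \<and> x i \<noteq> 0}. affine_model (affine_chart \<iota> N x i)) \<and> UNIV \<in> PX)"

definition closed_points :: "'f::Fields.field set set \<Rightarrow> 'f set set" where
  "closed_points PX = PX - {UNIV}"

definition max_ideal :: "'f::Fields.field set \<Rightarrow> 'f set" where
  "max_ideal P = {x \<in> P. x = 0 \<or> inverse x \<notin> P}"

definition uniformizer :: "'f::Fields.field set \<Rightarrow> 'f \<Rightarrow> bool" where
  "uniformizer P \<pi> \<longleftrightarrow> \<pi> \<in> max_ideal P \<and> \<pi> \<noteq> 0 \<and>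
     (\<forall>x. x \<noteq> 0 \<longrightarrow> (\<exists>k::int. \<exists>u\<in>P - max_ideal P. x = u * \<pi> powi k))"

definition discrete_valuation_ring :: "'f::Fields.field set \<Rightarrow> bool" where
  "discrete_valuation_ring P \<longleftrightarrow>
     subring P ring_of_type_algebra \<and> (\<exists>\<pi>. uniformizer P \<pi>)"

text \<open>Meaningful for \<open>x \<noteq> 0\<close> only.\<close>

definition val :: "'f::Fields.field set \<Rightarrow> 'f \<Rightarrow> int" where
  "val P x = (THE k. \<exists>\<pi>. \<exists>u\<in>P - max_ideal P. uniformizer P \<pi> \<and> x = u * \<pi> powi k)"

definition trdeg_one :: "('k::Fields.field \<Rightarrow> 'f::Fields.field) \<Rightarrow> bool" where
  "trdeg_one \<iota> \<longleftrightarrow> (\<exists>t::'f. ring.transcendental ring_of_type_algebra (range \<iota>) t \<and>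
     (\<forall>y. ring.algebraic ring_of_type_algebra
            (generate_field ring_of_type_algebra (range \<iota> \<union> {t})) y))"

text \<open>As \<open>K\<close> is finite, every finite extension of \<open>K\<close> is \<open>K[T]/(p)\<close> for an irreducible \<open>p\<close>, and
  the base change of the generic point to it is the spectrum of \<open>F[T]/(p)\<close>. So this says that the
  base changes to all finite extensions of \<open>K\<close>, hence also to the algebraic closure, are integral.\<close>

definition absolutely_integral ::
    "('k::{Fields.field,finite} \<Rightarrow> 'f::Fields.field) \<Rightarrow> bool" where
  "absolutely_integral \<iota> \<longleftrightarrow>
     (\<forall>p::'k poly. Factorial_Ring.irreducible p \<longrightarrow> Factorial_Ring.irreducible (map_poly \<iota> p))"

text \<open>As \<open>K\<close> is finite, hence perfect, smooth is the same as regular, which for a curve means that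
  the local rings at the closed points are discrete valuation rings. The curves are absolutely
  integral by definition.\<close>

definition smooth_projective_curve ::
    "('k::{Fields.field,finite} \<Rightarrow> 'f::Fields.field) \<Rightarrow> 'f set set \<Rightarrow> bool" where
  "smooth_projective_curve \<iota> PX \<longleftrightarrow>
     \<iota> \<in> ring_hom ring_of_type_algebra ring_of_type_algebra \<and>
     projective_model \<iota> PX \<and> trdeg_one \<iota> \<and> absolutely_integral \<iota> \<and>
     (\<forall>P\<in>closed_points PX. discrete_valuation_ring P)"

definition residue_field :: "'f::Fields.field set \<Rightarrow> 'f set ring" where
  "residue_field P = subring_of P Quot max_ideal P"

definition point_degree :: "('k::Fields.field \<Rightarrow> 'f::Fields.field) \<Rightarrow> 'f set \<Rightarrow> nat" where
  "point_degree \<iota> P = ring.dim (residue_field P)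
     (range (\<lambda>a. max_ideal P +>\<^bsub>subring_of P\<^esub> \<iota> a)) (carrier (residue_field P))"


subsection \<open>Divisors\<close>

type_synonym 'f divisor = "'f set \<Rightarrow>\<^sub>0 int"

definition divisors :: "'f::Fields.field set set \<Rightarrow> 'f divisor set" where
  "divisors PX = {D. Poly_Mapping.keys D \<subseteq> closed_points PX}"

definition effective :: "'f divisor \<Rightarrow> bool" where
  "effective D \<longleftrightarrow> (\<forall>P. 0 \<le> Poly_Mapping.lookup D P)"

definition div_degree :: "('k::Fields.field \<Rightarrow> 'f::Fields.field) \<Rightarrow> 'f divisor \<Rightarrow> int" where
  "div_degree \<iota> D =
     (\<Sum>P\<in>Poly_Mapping.keys D. Poly_Mapping.lookup D P * int (point_degree \<iota> P))"

definition H0 :: "'f::Fields.field set set \<Rightarrow> 'f divisor \<Rightarrow> 'f set" where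
  "H0 PX D = {f. f \<noteq> 0 \<longrightarrow> (\<forall>P\<in>closed_points PX. 0 \<le> val P f + Poly_Mapping.lookup D P)}"

definition dim_H0 ::
    "('k::Fields.field \<Rightarrow> 'f::Fields.field) \<Rightarrow> 'f set set \<Rightarrow> 'f divisor \<Rightarrow> nat" where
  "dim_H0 \<iota> PX D = ring.dim ring_of_type_algebra (range \<iota>) (H0 PX D)"

text \<open>The genus of a function field, as the maximum of \<open>deg D - dim H\<^sup>0(D) + 1\<close>, which exists by
  Riemann's theorem.\<close>

definition genus :: "('k::Fields.field \<Rightarrow> 'f::Fields.field) \<Rightarrow> 'f set set \<Rightarrow> nat" where
  "genus \<iota> PX =
     (GREATEST g. \<exists>D\<in>divisors PX. int g = div_degree \<iota> D - int (dim_H0 \<iota> PX D) + 1)"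

definition non_special ::
    "('k::Fields.field \<Rightarrow> 'f::Fields.field) \<Rightarrow> 'f set set \<Rightarrow> 'f divisor \<Rightarrow> bool" where
  "non_special \<iota> PX D \<longleftrightarrow> int (dim_H0 \<iota> PX D) = div_degree \<iota> D - int (genus \<iota> PX) + 1"


subsection \<open>The residue ring of an effective divisor\<close>

text \<open>The stalk at \<open>Q\<close> of the ideal sheaf \<open>O(-r)\<close>.\<close>

definition ideal_stalk :: "'g::Fields.field divisor \<Rightarrow> 'g set \<Rightarrow> 'g set" where
  "ideal_stalk r Q = {f \<in> Q. f \<noteq> 0 \<longrightarrow> Poly_Mapping.lookup r Q \<le> val Q f}"

definition stalk_quotient :: "'g::Fields.field divisor \<Rightarrow> 'g set \<Rightarrow> 'g set ring" where
  "stalk_quotient r Q = subring_of Q Quot ideal_stalk r Q"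

text \<open>The global sections of \<open>O/O(-r)\<close>, i.e. the product of the stalks over the support of
  \<open>r\<close>, as an algebra over \<open>K\<close>.\<close>

definition residue_ring_div ::
    "('k::Fields.field \<Rightarrow> 'g::Fields.field) \<Rightarrow> 'g divisor \<Rightarrow> ('k, 'g set \<Rightarrow> 'g set) module" where
  "residue_ring_div \<iota> r =
    \<lparr>carrier = (\<Pi>\<^sub>E Q\<in>Poly_Mapping.keys r. carrier (stalk_quotient r Q)),
     monoid.mult = (\<lambda>x y. \<lambda>Q\<in>Poly_Mapping.keys r. x Q \<otimes>\<^bsub>stalk_quotient r Q\<^esub> y Q),
     one = (\<lambda>Q\<in>Poly_Mapping.keys r. \<one>\<^bsub>stalk_quotient r Q\<^esub>),
     ring.zero = (\<lambda>Q\<in>Poly_Mapping.keys r. \<zero>\<^bsub>stalk_quotient r Q\<^esub>),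
     add = (\<lambda>x y. \<lambda>Q\<in>Poly_Mapping.keys r. x Q \<oplus>\<^bsub>stalk_quotient r Q\<^esub> y Q),
     module.smult = (\<lambda>a x. \<lambda>Q\<in>Poly_Mapping.keys r.
       (ideal_stalk r Q +>\<^bsub>subring_of Q\<^esub> \<iota> a) \<otimes>\<^bsub>stalk_quotient r Q\<^esub> x Q)\<rparr>"


section \<open>Covers\<close>

text \<open>A dominant morphism of curves (with sets of points \<open>PY\<close> and \<open>PX\<close>) is given by the map \<open>\<phi>\<close> of function
  fields. It sends \<open>Q\<close> to the point whose local ring is dominated by \<open>Q\<close>, which for
  smooth projective curves is \<open>\<phi> -` Q\<close>.\<close>

definition curve_morphism ::
    "('k::Fields.field \<Rightarrow> 'f::Fields.field) \<Rightarrow> 'f set set \<Rightarrow>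
     ('k \<Rightarrow> 'g::Fields.field) \<Rightarrow> 'g set set \<Rightarrow> ('f \<Rightarrow> 'g) \<Rightarrow> bool" where
  "curve_morphism \<iota>X PX \<iota>Y PY \<phi> \<longleftrightarrow>
     \<phi> \<in> ring_hom ring_of_type_algebra ring_of_type_algebra \<and> \<phi> \<circ> \<iota>X = \<iota>Y \<and>
     (\<forall>Q\<in>PY. \<phi> -` Q \<in> PX)"

definition fiber :: "('f \<Rightarrow> 'g) \<Rightarrow> 'g::Fields.field set set \<Rightarrow> 'f set \<Rightarrow> 'g set set" where
  "fiber \<phi> PY a = {Q \<in> closed_points PY. \<phi> -` Q = a}"

definition galois_group :: "('f::Fields.field \<Rightarrow> 'g::Fields.field) \<Rightarrow> ('g \<Rightarrow> 'g) monoid" where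
  "galois_group \<phi> =
    \<lparr>carrier = {c \<in> ring_iso ring_of_type_algebra ring_of_type_algebra. \<forall>x. c (\<phi> x) = \<phi> x},
     monoid.mult = (\<circ>), one = id\<rparr>"

definition galois_cover ::
    "('k::Fields.field \<Rightarrow> 'f::Fields.field) \<Rightarrow> 'f set set \<Rightarrow>
     ('k \<Rightarrow> 'g::Fields.field) \<Rightarrow> 'g set set \<Rightarrow> ('f \<Rightarrow> 'g) \<Rightarrow> bool" where
  "galois_cover \<iota>X PX \<iota>Y PY \<phi> \<longleftrightarrow> curve_morphism \<iota>X PX \<iota>Y PY \<phi> \<and>
     finite (carrier (galois_group \<phi>)) \<and>
     {y. \<forall>c\<in>carrier (galois_group \<phi>). c y = y} = range \<phi>"

definition ramification_index :: "('f::Fields.field \<Rightarrow> 'g::Fields.field) \<Rightarrow> 'g set \<Rightarrow> int" where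
  "ramification_index \<phi> Q = val Q (\<phi> (SOME \<pi>. uniformizer (\<phi> -` Q) \<pi>))"

definition inertial_degree :: "('f::Fields.field \<Rightarrow> 'g::Fields.field) \<Rightarrow> 'g set \<Rightarrow> nat" where
  "inertial_degree \<phi> Q = ring.dim (residue_field Q)
     ((\<lambda>x. max_ideal Q +>\<^bsub>subring_of Q\<^esub> \<phi> x) ` (\<phi> -` Q)) (carrier (residue_field Q))"

text \<open>Residue field extensions are separable since the residue fields are finite.\<close>

definition unramified :: "('f::Fields.field \<Rightarrow> 'g::Fields.field) \<Rightarrow> 'g set set \<Rightarrow> bool" where
  "unramified \<phi> PY \<longleftrightarrow> (\<forall>Q\<in>closed_points PY. ramification_index \<phi> Q = 1)"

definition pullback ::
    "('f::Fields.field \<Rightarrow> 'g::Fields.field) \<Rightarrow> 'g set set \<Rightarrow> 'f divisor \<Rightarrow> 'g divisor" where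
  "pullback \<phi> PY D = (\<Sum>a\<in>Poly_Mapping.keys D. \<Sum>Q\<in>fiber \<phi> PY a.
     Poly_Mapping.single Q (ramification_index \<phi> Q * Poly_Mapping.lookup D a))"

definition fiber_divisor ::
    "('f::Fields.field \<Rightarrow> 'g::Fields.field) \<Rightarrow> 'g set set \<Rightarrow> 'f set \<Rightarrow> 'g divisor" where
  "fiber_divisor \<phi> PY a = (\<Sum>Q\<in>fiber \<phi> PY a. Poly_Mapping.single Q 1)"

text \<open>The translate \<open>c.D\<close>: its multiplicity at \<open>c ` Q\<close> is that of \<open>D\<close> at \<open>Q\<close>.\<close>

definition translate :: "('g \<Rightarrow> 'g) \<Rightarrow> 'g divisor \<Rightarrow> 'g divisor" where
  "translate c D = Poly_Mapping.map_key (\<lambda>Q. c -` Q) D"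

end

theory Submission
  imports Defs "HOL-Library.Function_Algebras"
begin

text \<open>
  Sections of \<open>E\<close> are the interpolating functions. Choose a generator \<open>s\<close> of \<open>C\<close> such that \<open>s ^ n2\<close>
  induces the \<open>q\<close>-Frobenius on the residue field of a point \<open>Q\<close> over \<open>a\<close>. Then \<open>y \<mapsto> (s ^ i y mod Q)\<close>
  identifies the residue ring of \<open>B\<close> with \<open>L ^ n2\<close>, and \<open>s\<close> with the twisted shift. After a change of \<open>D\<close> in its
  linear equivalence class, \<open>E\<close> is trivial at all points involved. If \<open>H\<^sup>1(E - B) = 0\<close>, evaluation at \<open>B\<close> is
  surjective on \<open>H\<^sup>0(E)\<close>, so it has a linear section, which by Maschke's argument can be taken \<open>C\<close>-linear;
  if \<open>H\<^sup>0(2E - R) = 0\<close>, a function in \<open>H\<^sup>0(2E)\<close> is determined by its values at the translates of \<open>r\<close>. An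
  optimal algorithm for \<open>K[r]\<close>, applied at all translates of \<open>r\<close> at once, then gives an equivariant one.

  In case (ii), \<open>H\<^sup>1(E - B) = 0\<close> by hypothesis. In case (i) it holds because a nonzero Weil differential of \<open>Y\<close> that
  vanishes on the pullback of \<open>A = D - a\<close> has a nonzero multiple invariant under \<open>C\<close>; as \<open>n\<close> is invertible in \<open>K\<close>,
  that multiple restricts to a nonzero Weil differential of \<open>X\<close> vanishing on a divisor of degree at
  least \<open>deg A > 2g - 2\<close>.
\<close>

text \<open>As K is finite, dimensions are compared by counting elements.

  Case (i) speaks of the genus of X only, so surjectivity at B must be descended from Y. Every
  translate of a nonzero differential \<omega> is a multiple of \<omega>, hence the sum over
  \<open>c\<close> in C of the forms \<open>\<beta> -> \<omega> (y c\<beta>)\<close> is some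
  \<open>f \<omega>\<close>, and Dedekind's independence of automorphisms gives a \<open>y\<close>
  with \<open>f\<close> nonzero. Being invariant, \<open>f \<omega>\<close> vanishes on a pullback
  from X that dominates the divisor on which it was known to vanish, so no degree is lost.

  The twisted shift is a second obstacle. Frobenius must come from an \<open>n2\<close>-th power of
  a generator of C. Inertia being trivial, Frobenius generates the decomposition group, which has
  order \<open>n1\<close>, and a unit modulo \<open>n1\<close> lifts to a unit modulo
  \<open>n\<close>.\<close>

abbreviation "lookup == Poly_Mapping.lookup"
abbreviation "keys == Poly_Mapping.keys"
abbreviation "single == Poly_Mapping.single"
abbreviation residue_class :: "'f::Fields.field set => 'f set => 'f => 'f set"  ("(_ +[_] _)" [81, 0, 80] 80) where
 "I +[P] y == I +>\<^bsub>subring_of P\<^esub> y"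

subsection \<open>Discrete valuation rings of a field\<close>

lemma rota_simps [simp]:
 "carrier ring_of_type_algebra = UNIV"
 "monoid.mult ring_of_type_algebra = (*)"
 "one ring_of_type_algebra = 1"
 "ring.zero ring_of_type_algebra = 0"
 "add ring_of_type_algebra = (+)"
 by (auto simp: ring_of_type_algebra_def fun_eq_iff)

lemma ring_hom_rota_iff:
 "h : ring_hom ring_of_type_algebra ring_of_type_algebra \<longleftrightarrow>
  (\<forall>x y. h (x + y) = h x + h y) & (\<forall>x y. h (x * y) = h x * h y) & h 1 = 1"
 by (auto simp: ring_hom_def)

interpretation rota: cring "ring_of_type_algebra :: 'a::Fields.field ring"
 by (rule cring_from_type_algebra)

lemma rota_uminus [simp]: "\<ominus>\<^bsub>ring_of_type_algebra\<^esub> (x::'a::Fields.field) = - x"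
 using rota.minus_equality[of "- x" x] by simp

lemma rota_minus [simp]: "x \<ominus>\<^bsub>ring_of_type_algebra\<^esub> (y::'a::Fields.field) = x - y"
 by (simp add: a_minus_def)

lemma rota_inv [simp]:
 assumes "x ~= (0::'a::Fields.field)" shows "inv\<^bsub>ring_of_type_algebra\<^esub> x = inverse x"
 using rota.inv_char[of x "inverse x"] assms by simp

lemma subring_rota_iff:
 "subring P (ring_of_type_algebra :: 'a::Fields.field ring) \<longleftrightarrow>
  1 : P & (\<forall>x\<in>P. \<forall>y\<in>P. x - y : P & x * y : P)"
proof
 assume P: "subring P (ring_of_type_algebra :: 'a ring)"
 show "1 : P & (\<forall>x\<in>P. \<forall>y\<in>P. x - y : P & x * y : P)"
  using subringE(3,5,6,7)[OF P] by (simp, metis add_uminus_conv_diff)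
next
 assume *: "1 : P & (\<forall>x\<in>P. \<forall>y\<in>P. x - y : P & x * y : P)"
 then have 0: "0 : P" by (metis diff_self)
 then have m: "- x : P" if "x : P" for x using * that by (metis diff_0)
 show "subring P (ring_of_type_algebra :: 'a ring)"
  by (rule rota.subringI) (use * m in \<open>auto, metis diff_minus_eq_add\<close>)
qed

lemma subring_rotaD:
 assumes "subring P (ring_of_type_algebra :: 'a::Fields.field ring)"
 shows "1 : P" "0 : P" "!!x y. x : P ==> y : P ==> x + y : P"
  "!!x y. x : P ==> y : P ==> x - y : P" "!!x y. x : P ==> y : P ==> x * y : P"
  "!!x. x : P ==> - x : P" "!!x n. x : P ==> x ^ n : P"
proof -
 have *: "1 : P" "!!x y. x : P ==> y : P ==> x - y : P" "!!x y. x : P ==> y : P ==> x * y : P"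
  using assms unfolding subring_rota_iff by auto
 show 0: "0 : P" using *(1,2) by (metis diff_self)
 show m: "- x : P" if "x : P" for x using *(2)[OF 0 that] by simp
 show "x + y : P" if "x : P" "y : P" for x y using *(2)[OF that(1) m[OF that(2)]] by simp
 show "x ^ n : P" if "x : P" for x n by (induction n) (use * that in auto)
qed (use assms in \<open>auto simp: subring_rota_iff\<close>)

definition vset :: "'f::Fields.field set => int => 'f set" where
 "vset P k = {x. x = 0 \<or> k <= val P x}"

locale dvr =
 fixes P :: "'f::Fields.field set"
 assumes dvr: "discrete_valuation_ring P"
begin

lemma subring: "subring P ring_of_type_algebra"
 using dvr by (simp add: discrete_valuation_ring_def)

lemmas closed = subring_rotaD[OF subring]

lemma ex_uniformizer: "\<exists>\<pi>. uniformizer P \<pi>"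
 using dvr by (simp add: discrete_valuation_ring_def)

lemma unit_iff: "u : P - max_ideal P \<longleftrightarrow> u ~= 0 & u : P & inverse u : P"
 by (auto simp: max_ideal_def)

lemma unit_mult: "u : P - max_ideal P ==> w : P - max_ideal P ==> u * w : P - max_ideal P"
 unfolding unit_iff by (simp add: closed)

lemma unit_inverse: "u : P - max_ideal P ==> inverse u : P - max_ideal P"
 unfolding unit_iff by (simp add: closed)

lemma unit_one: "1 : P - max_ideal P"
 unfolding unit_iff by (simp add: closed)

lemma unit_powi: "u : P - max_ideal P ==> u powi k : P - max_ideal P"
 unfolding unit_iff using closed(7)[of u] closed(7)[of "inverse u"]
 by (simp add: power_int_def power_inverse)

text \<open>For either sign of \<open>k\<close>, a unit \<pi>^k puts
  \<open>inverse (\<pi> ^ m)\<close> into \<open>P\<close> with \<open>m = |k|\<close>; multiplying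
  by \<open>\<pi> ^ (m - 1)\<close> then makes \<pi> invertible in \<open>P\<close>.\<close>

lemma uniformizer_power_unit:
 assumes "uniformizer P \<pi>" "\<pi> powi k : P - max_ideal P" shows "k = 0"
proof (rule ccontr)
 assume k: "k ~= 0"
 have \<pi>: "\<pi> : P" "\<pi> ~= 0" "inverse \<pi> ~: P"
  using assms(1) by (auto simp: uniformizer_def max_ideal_def)
 define m where "m = nat \<bar>k\<bar>"
 have m: "m > 0" using k by (simp add: m_def)
 have "inverse (\<pi> ^ m) : P"
  using assms(2) k unfolding unit_iff m_def
  by (cases "k > 0") (simp_all add: power_int_def power_inverse)
 then have "\<pi> ^ (m - 1) * inverse (\<pi> ^ m) : P" using \<pi> by (intro closed)
 moreover have "\<pi> ^ (m - 1) * inverse (\<pi> ^ m) = inverse \<pi>"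
  using m \<pi> by (cases m) (auto simp: field_simps)
 ultimately show False using \<pi> by simp
qed

lemma uniformizer_rep_unique:
 assumes "uniformizer P \<pi>" "u : P - max_ideal P" "w : P - max_ideal P"
  "u * \<pi> powi k = w * \<pi> powi l"
 shows "k = l"
proof -
 have \<pi>: "\<pi> ~= 0" using assms(1) by (auto simp: uniformizer_def)
 have u: "u ~= 0" "w ~= 0" using assms(2,3) unfolding unit_iff by auto
 have "\<pi> powi (k - l) = w * inverse u"
  using assms(4) \<pi> u by (simp add: power_int_diff field_simps)
 then have "\<pi> powi (k - l) : P - max_ideal P"
  using unit_mult unit_inverse assms(2,3) by presburger
 from uniformizer_power_unit[OF assms(1) this] show ?thesis by simp
qed

text \<open>\<open>val\<close> quantifies over all uniformizers, so independence of the choice is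
  the point. Two uniformizers are unit multiples of powers of each other, the exponents multiply to
  1, and exponent -1 would make \<pi> invertible in \<open>P\<close>.\<close>

lemma val_eqI:
 assumes "uniformizer P \<pi>" "u : P - max_ideal P"
 shows "val P (u * \<pi> powi k) = k"
 unfolding val_def
proof (rule the_equality)
 show "\<exists>\<pi>'. \<exists>u'\<in>P - max_ideal P. uniformizer P \<pi>' & u * \<pi> powi k = u' * \<pi>' powi k"
  using assms by blast
next
 fix l assume "\<exists>\<pi>'. \<exists>u'\<in>P - max_ideal P. uniformizer P \<pi>' & u * \<pi> powi k = u' * \<pi>' powi l"
 then obtain \<rho> w where w: "w : P - max_ideal P" "uniformizer P \<rho>" "u * \<pi> powi k = w * \<rho> powi l"
  by blast
 have nz: "\<pi> ~= 0" "\<rho> ~= 0" using assms(1) w(2) by (auto simp: uniformizer_def)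
 obtain i a where a: "a : P - max_ideal P" "\<rho> = a * \<pi> powi i"
  using assms(1) nz unfolding uniformizer_def by metis
 obtain j b where b: "b : P - max_ideal P" "\<pi> = b * \<rho> powi j"
  using w(2) nz unfolding uniformizer_def by metis
 have "\<pi> = b * (a * \<pi> powi i) powi j" using a b by simp
 also have "\<dots> = (b * a powi j) * \<pi> powi (i * j)"
  by (simp add: power_int_mult_distrib power_int_mult mult.assoc)
 finally have "1 * \<pi> powi 1 = (b * a powi j) * \<pi> powi (i * j)" by simp
 then have "1 = i * j"
  by (rule uniformizer_rep_unique[OF assms(1), rotated 2])
   (use unit_mult[OF b(1) unit_powi[OF a(1)]] unit_one in auto)
 then have ij: "i = 1 \<or> i = -1" by (metis zmult_eq_1_iff)
 have "i ~= -1"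
 proof
  assume "i = -1"
  then have "\<rho> * \<pi> = a" using a nz by simp
  moreover have "\<pi> : P" "\<rho> : P" using assms(1) w(2) by (auto simp: uniformizer_def max_ideal_def)
  ultimately have "inverse \<pi> = inverse a * \<rho>" "inverse a : P" "\<rho> : P" using nz a(1)
   unfolding unit_iff by (auto simp: field_simps)
  then have "inverse \<pi> : P" using closed(5) by metis
  then show False using assms(1) by (auto simp: uniformizer_def max_ideal_def)
 qed
 with ij have "i = 1" by simp
 then have "u * \<pi> powi k = (w * a powi l) * \<pi> powi l"
  using w(3) a(2) by (simp add: power_int_mult_distrib mult.assoc)
 then have "k = l"
  by (rule uniformizer_rep_unique[OF assms(1,2), rotated])
   (use unit_mult[OF w(1) unit_powi[OF a(1)]] in auto)
 then show "l = k" by simp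
qed

lemma val_rep:
 assumes "uniformizer P \<pi>" "x ~= 0"
 obtains u where "u : P - max_ideal P" "x = u * \<pi> powi val P x"
 using assms val_eqI[OF assms(1)] unfolding uniformizer_def by metis

lemma val_mult: assumes "x ~= 0" "y ~= 0" shows "val P (x * y) = val P x + val P y"
proof -
 obtain \<pi> where \<pi>: "uniformizer P \<pi>" using ex_uniformizer by blast
 obtain u where u: "u : P - max_ideal P" "x = u * \<pi> powi val P x" using val_rep[OF \<pi> assms(1)] .
 obtain w where w: "w : P - max_ideal P" "y = w * \<pi> powi val P y" using val_rep[OF \<pi> assms(2)] .
 have "\<pi> ~= 0" using \<pi> by (auto simp: uniformizer_def)
 then have "x * y = (u * w) * \<pi> powi (val P x + val P y)"
  by (subst u(2), subst w(2)) (simp add: power_int_add mult_ac)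
 then show ?thesis using val_eqI[OF \<pi> unit_mult[OF u(1) w(1)]] by metis
qed

lemma val_unit: "u : P - max_ideal P ==> val P u = 0"
 using ex_uniformizer val_eqI[of _ u 0] by auto

lemma val_one [simp]: "val P 1 = 0"
 by (rule val_unit) (rule unit_one)

lemma val_inverse: "x ~= 0 ==> val P (inverse x) = - val P x"
 using val_mult[of x "inverse x"] by simp

lemma val_divide: "x ~= 0 ==> y ~= 0 ==> val P (x / y) = val P x - val P y"
 by (simp add: divide_inverse val_mult val_inverse)

lemma val_power: "x ~= 0 ==> val P (x ^ n) = int n * val P x"
 by (induction n) (auto simp: val_mult algebra_simps)

lemma val_powi: "x ~= 0 ==> val P (x powi k) = k * val P x"
 by (cases "k \<ge> 0") (auto simp: power_int_def val_power val_inverse)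

lemma val_uniformizer: "uniformizer P \<pi> ==> val P \<pi> = 1"
 using val_eqI[OF _ unit_one, of \<pi> 1] by simp

lemma mem_iff: "x : P \<longleftrightarrow> x = 0 \<or> 0 <= val P x"
proof (cases "x = 0")
 case False
 obtain \<pi> where \<pi>: "uniformizer P \<pi>" using ex_uniformizer by blast
 then have \<pi>': "\<pi> : P" "\<pi> ~= 0" "inverse \<pi> ~: P" by (auto simp: uniformizer_def max_ideal_def)
 obtain u where u: "u : P - max_ideal P" "x = u * \<pi> powi val P x" using val_rep[OF \<pi> False] .
 show ?thesis
 proof (cases "0 <= val P x")
  case True
  then have "\<pi> powi val P x : P" using \<pi>' by (auto simp: power_int_def closed)
  then show ?thesis using u True closed by (metis Diff_iff)
 next
  case f: False
  have "x ~: P"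
  proof
   assume "x : P"
   then have "inverse u * x : P" using u(1) unfolding unit_iff by (simp add: closed)
   moreover have "inverse u * x = \<pi> powi val P x" using u(1) unfolding unit_iff
    by (subst u(2)) simp
   ultimately have "\<pi> powi val P x : P" by simp
   moreover have "\<pi> powi (- val P x) : P" using \<pi>' f by (simp add: power_int_def closed)
   ultimately have "\<pi> powi val P x : P - max_ideal P"
    unfolding unit_iff using \<pi>' by (simp add: power_int_minus)
   from uniformizer_power_unit[OF \<pi> this] f show False by simp
  qed
  then show ?thesis using f False by simp
 qed
qed (simp add: closed)

lemma max_ideal_iff: "x : max_ideal P \<longleftrightarrow> x = 0 \<or> 1 <= val P x"
 by (cases "x = 0") (auto simp: max_ideal_def mem_iff val_inverse)

lemma uniformizer_iff: "uniformizer P \<pi> \<longleftrightarrow> \<pi> ~= 0 & val P \<pi> = 1"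
proof
 assume \<pi>: "\<pi> ~= 0 & val P \<pi> = 1"
 show "uniformizer P \<pi>" unfolding uniformizer_def
 proof (intro conjI allI impI)
  fix x :: 'f assume x: "x ~= 0"
  have "x / \<pi> powi val P x : P - max_ideal P"
   using \<pi> x by (auto simp: mem_iff max_ideal_iff val_divide val_powi)
  moreover have "x = x / \<pi> powi val P x * \<pi> powi val P x" using \<pi> by simp
  ultimately show "\<exists>k. \<exists>u\<in>P - max_ideal P. x = u * \<pi> powi k" by blast
 qed (use \<pi> in \<open>auto simp: max_ideal_iff\<close>)
qed (auto simp: val_uniformizer uniformizer_def)

lemma vset_0 [simp]: "vset P 0 = P" by (auto simp: vset_def mem_iff)
lemma vset_1 [simp]: "vset P 1 = max_ideal P" by (auto simp: vset_def max_ideal_iff)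

lemma zero_vset [simp]: "0 : vset P k" by (simp add: vset_def)

lemma vset_iff_mult:
 assumes "uniformizer P \<pi>" shows "x : vset P k \<longleftrightarrow> x * \<pi> powi (- k) : P"
 using assms by (cases "x = 0") (auto simp: vset_def mem_iff val_mult val_powi uniformizer_iff)

lemma vset_add: "x : vset P k ==> y : vset P k ==> x + y : vset P k"
proof -
 obtain \<pi> where \<pi>: "uniformizer P \<pi>" using ex_uniformizer by blast
 show "x : vset P k ==> y : vset P k ==> x + y : vset P k"
  unfolding vset_iff_mult[OF \<pi>] by (simp add: distrib_right closed)
qed

lemma vset_uminus: "x : vset P k ==> - x : vset P k"
proof -
 obtain \<pi> where \<pi>: "uniformizer P \<pi>" using ex_uniformizer by blast
 show "x : vset P k ==> - x : vset P k"
  unfolding vset_iff_mult[OF \<pi>] by (simp add: closed)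
qed

lemma vset_diff: "x : vset P k ==> y : vset P k ==> x - y : vset P k"
 using vset_add[OF _ vset_uminus, of x k y] by simp

lemma vset_sum: "(!!i. i : I ==> f i : vset P k) ==> sum f I : vset P k"
 by (induction I rule: infinite_finite_induct) (auto intro: vset_add)

lemma vset_mult: "x : vset P k ==> y : vset P l ==> x * y : vset P (k + l)"
 by (auto simp: vset_def val_mult)

lemma vset_mult_iff: "x ~= 0 ==> x * y : vset P k \<longleftrightarrow> y : vset P (k - val P x)"
 by (auto simp: vset_def val_mult)

lemma vset_mult_left: "x : P ==> y : vset P l ==> x * y : vset P l"
 using vset_mult[of x 0 y l] by simp

lemma vset_mono: "k <= l ==> vset P l \<subseteq> vset P k"
 by (auto simp: vset_def)

lemma val_uminus: "val P (- x) = val P x"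
proof (cases "x = 0")
 case False
 have "val P ((-1) * (-1)) = 2 * val P (-1)" by (subst val_mult) auto
 then have "val P (-1) = 0" by simp
 then show ?thesis using val_mult[of "-1" x] False by simp
qed simp

lemma val_add_less:
 assumes "x ~= 0" "y ~= 0" "val P x < val P y" shows "x + y ~= 0" "val P (x + y) = val P x"
proof -
 show nz: "x + y ~= 0"
 proof
  assume "x + y = 0"
  then have "y = - x" by (simp add: add_eq_0_iff)
  then show False using assms val_uminus by simp
 qed
 have "x + y : vset P (val P x)" using assms by (intro vset_add) (auto simp: vset_def)
 moreover have "x + y ~: vset P (val P x + 1)"
 proof
  assume "x + y : vset P (val P x + 1)"
  moreover have "y : vset P (val P x + 1)" using assms by (auto simp: vset_def)
  ultimately have "x : vset P (val P x + 1)" using vset_diff by (metis add_diff_cancel_right')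
  then show False using assms by (auto simp: vset_def)
 qed
 ultimately show "val P (x + y) = val P x" using nz by (auto simp: vset_def)
qed

lemma not_UNIV: "P ~= UNIV"
 using ex_uniformizer by (auto simp: uniformizer_def max_ideal_def)

text \<open>A ring strictly larger than \<open>P\<close> contains some \<open>x\<close> of negative
  value, and dividing any \<open>y\<close> by a large power of \<open>x\<close> gives an element of
  \<open>P\<close>.\<close>

lemma maximal:
 assumes W: "subring W ring_of_type_algebra" "P \<subseteq> W" shows "W = P \<or> W = UNIV"
proof (rule ccontr)
 assume "\<not> ?thesis"
 then obtain x y where x: "x : W" "x ~: P" and y: "y ~: W" using W(2) by blast
 have "x ~= 0" "val P x < 0" "y ~= 0" using x y W by (auto simp: mem_iff subring_rotaD)
 then have nz: "x ^ nat \<bar>val P y\<bar> ~= 0" by simp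
 have "val P (y / x ^ nat \<bar>val P y\<bar>) = val P y - \<bar>val P y\<bar> * val P x"
  using \<open>x ~= 0\<close> \<open>y ~= 0\<close> by (simp add: val_divide val_power)
 also have "\<dots> \<ge> 0" using \<open>val P x < 0\<close> mult_left_mono[of 1 "- val P x" "\<bar>val P y\<bar>"] by simp
 finally have "y / x ^ nat \<bar>val P y\<bar> : W" using W(2) mem_iff by blast
 then have "y / x ^ nat \<bar>val P y\<bar> * x ^ nat \<bar>val P y\<bar> : W"
  using x subring_rotaD(7)[OF W(1)] subring_rotaD(5)[OF W(1)] by blast
 then show False using y \<open>x ~= 0\<close> by simp
qed

lemma maximal_dvr: "discrete_valuation_ring W ==> P \<subseteq> W ==> W = P"
 using maximal dvr.not_UNIV dvr.subring unfolding dvr_def by metis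

lemma closed_sum: "(!!i. i : I ==> f i : P) ==> sum f I : P"
 by (induction I rule: infinite_finite_induct) (auto intro: closed)

lemma closed_prod: "(!!i. i : I ==> f i : P) ==> prod f I : P"
 by (induction I rule: infinite_finite_induct) (auto intro: closed)

lemma max_ideal_closed:
 "x : max_ideal P ==> y : max_ideal P ==> x + y : max_ideal P"
 "x : max_ideal P ==> y : max_ideal P ==> x - y : max_ideal P"
 "x : P ==> y : max_ideal P ==> x * y : max_ideal P"
 "x : max_ideal P ==> y : P ==> x * y : max_ideal P"
 "x : max_ideal P ==> x : P" "0 : max_ideal P" "1 ~: max_ideal P"
 using vset_add[of x 1 y] vset_diff[of x 1 y] vset_mult[of x 0 y 1] vset_mult[of x 1 y 0]
 by (auto simp: max_ideal_iff mem_iff)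

lemma max_ideal_prime: "x : P ==> y : P ==> x * y : max_ideal P ==> x : max_ideal P \<or> y : max_ideal P"
 by (cases "x = 0"; cases "y = 0") (auto simp: mem_iff max_ideal_iff val_mult)

end

text \<open>By maximality neither ring contains the other; the quotient of two witnesses of this has
  a zero at \<open>P\<close> and a pole at \<open>Q\<close>.\<close>

lemma dvr_separate:
 assumes "dvr P" "dvr Q" "P ~= Q"
 obtains u where "u ~= 0" "val P u > 0" "val Q u < 0"
proof -
 obtain a where a: "a : P" "a ~: Q"
  using dvr.maximal_dvr[OF assms(1)] assms dvr.dvr by (metis subsetI)
 obtain b where b: "b : Q" "b ~: P"
  using dvr.maximal_dvr[OF assms(2)] assms dvr.dvr by (metis subsetI)
 have nz: "a ~= 0" "b ~= 0" using a b assms by (auto simp: dvr.mem_iff)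
 have "val P (a / b) > 0" "val Q (a / b) < 0" "a / b ~= 0"
  using a b assms(1,2) nz by (auto simp: dvr.mem_iff dvr.val_divide)
 then show ?thesis using that by blast
qed

lemma dvr_separate_set:
 assumes "finite S" "dvr P" "\<forall>Q\<in>S. dvr Q" "P ~: S"
 shows "\<exists>u. u ~= 0 & val P u > 0 & (\<forall>Q\<in>S. val Q u < 0)"
 using assms(1,3,4)
proof (induction S)
 case empty
 then show ?case using dvr.ex_uniformizer[OF assms(2)] dvr.uniformizer_iff[OF assms(2)] by force
next
 case (insert Q S)
 then obtain u where u: "u ~= 0" "val P u > 0" "\<forall>Q\<in>S. val Q u < 0" by auto
 have Q: "dvr Q" using insert by simp
 obtain w where w: "w ~= 0" "val P w > 0" "val Q w < 0"
  using dvr_separate[OF assms(2), of Q] insert by auto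
 show ?case
 proof (cases "val Q u < 0")
  case True
  then show ?thesis using u by auto
 next
  case False
  \<comment> \<open>\<open>r\<close> exceeds \<open>|val Q u|\<close> for all \<open>Q\<close> in
    \<open>S\<close>, so at each of these places either \<open>u\<close> or \<open>w ^ r\<close>
    strictly dominates the sum and no cancellation occurs.\<close>
  define r where "r = nat (1 + (\<Sum>Q\<in>S. \<bar>val Q u\<bar>))"    have "0 <= (\<Sum>Q\<in>S. \<bar>val Q u\<bar>)" by (intro sum_nonneg) auto
  then have "0 < 1 + (\<Sum>Q\<in>S. \<bar>val Q u\<bar>)" by linarith
  then have r0: "r > 0" unfolding r_def by simp
  define z where "z = u + w ^ r"
  have "val Q (w ^ r) < 0" using w r0 by (simp add: dvr.val_power[OF Q] mult_pos_neg)
  then have z: "z ~= 0 & val Q z < 0"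
   using dvr.val_add_less[OF Q, of "w ^ r" u] w u False
   by (simp add: z_def add.commute)
  have "val P z > 0"
  proof -
   have "u : vset P 1" using u by (simp add: vset_def)
   moreover have "int r * val P w > 0" using r0 w by simp
   then have "w ^ r : vset P 1" using w by (simp add: vset_def dvr.val_power[OF assms(2)])
   ultimately have "z : vset P 1" unfolding z_def by (rule dvr.vset_add[OF assms(2)])
   then show ?thesis using z by (auto simp: vset_def)
  qed
  moreover have "val Q' z < 0" if Q': "Q' : S" for Q'
  proof -
   have d: "dvr Q'" using insert Q' by auto
   have u': "val Q' u < 0" using u Q' by auto
   have "\<bar>val Q' u\<bar> <= (\<Sum>Q\<in>S. \<bar>val Q u\<bar>)" using insert(1) Q' by (intro member_le_sum) auto
   then have rb: "int r > \<bar>val Q' u\<bar>" unfolding r_def by simp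
   have vw: "val Q' (w ^ r) = int r * val Q' w" using dvr.val_power[OF d] w by simp
   consider "val Q' w \<ge> 0" | "val Q' w < 0" by linarith
   then show ?thesis
   proof cases
    case 1
    then have "0 <= int r * val Q' w" by simp
    then have "val Q' u < val Q' (w ^ r)" unfolding vw using u' by linarith
    then show ?thesis using dvr.val_add_less[OF d, of u "w ^ r"] u w u' by (simp add: z_def)
   next
    case 2
    then have "int r * val Q' w <= - int r"
     using mult_left_mono[of "val Q' w" "-1" "int r"] by simp
    then have "val Q' (w ^ r) < val Q' u" "val Q' (w ^ r) < 0" unfolding vw using rb u' by auto
    then show ?thesis using dvr.val_add_less[OF d, of "w ^ r" u] u w by (simp add: z_def add.commute)
   qed
  qed
  ultimately show ?thesis using z by auto
 qed
qed

text \<open>\<open>1 / (1 + u ^ m)\<close> is close to 1 where \<open>u\<close> has a zero and close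
  to 0 where \<open>u\<close> has a pole. The exponent \<open>Suc n\<close> stays positive for
  \<open>n = 0\<close>.\<close>

lemma dvr_approx_idem:
 assumes "finite S" "dvr P" "\<forall>Q\<in>S. dvr Q" "P ~: S"
 shows "\<exists>e. e - 1 : vset P (int n) & (\<forall>Q\<in>S. e : vset Q (int n))"
proof -
 obtain u where u: "u ~= 0" "val P u > 0" "\<forall>Q\<in>S. val Q u < 0"
  using dvr_separate_set[OF assms] by blast
 define m where "m = Suc n"
 have "0 < val P (u ^ m)" using u by (simp add: dvr.val_power[OF assms(2)] m_def del: power_Suc)
 then have P: "1 + u ^ m ~= 0" "val P (1 + u ^ m) = 0"
  using dvr.val_add_less[OF assms(2), of 1 "u ^ m"] u
  by (auto simp: dvr.val_one[OF assms(2)])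
 define e where "e = 1 / (1 + u ^ m)"
 have "e - 1 = - (u ^ m / (1 + u ^ m))" using P by (simp add: e_def field_simps)
 moreover have "int m * 1 <= int m * val P u" using u by (intro mult_left_mono) auto
 then have "int n <= int m * val P u" unfolding m_def by (rule order_trans[rotated]) simp
 then have "val P (u ^ m / (1 + u ^ m)) \<ge> int n"
  using P u by (simp add: dvr.val_divide[OF assms(2)] dvr.val_power[OF assms(2)])
 ultimately have "e - 1 : vset P (int n)"
  by (simp add: vset_def dvr.val_uminus[OF assms(2)])
 moreover have "e : vset Q (int n)" if "Q : S" for Q
 proof -
  have d: "dvr Q" using assms that by auto
  have vu: "val Q u <= -1" using u that by auto
  have "val Q (u ^ m) = int m * val Q u" using u by (simp add: dvr.val_power[OF d])
  also have "\<dots> <= int m * (-1)" using vu by (intro mult_left_mono) auto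
  finally have v: "val Q (u ^ m) <= - int m" by simp
  then have "val Q (u ^ m + 1) = val Q (u ^ m)"
   using u by (intro dvr.val_add_less[OF d]) (auto simp: m_def dvr.val_one[OF d])
  then have "val Q e \<ge> int n" using P v
   by (simp add: e_def dvr.val_divide[OF d] dvr.val_one[OF d] m_def add.commute)
  then show ?thesis by (simp add: vset_def)
 qed
 ultimately show ?thesis by blast
qed

text \<open>The combination of the \<open>f Q\<close> with approximate idempotents as
  coefficients.\<close>

lemma weak_approximation:
 fixes f :: "'f::Fields.field set => 'f" and n :: "'f set => int"
 assumes S: "finite S" "\<forall>P\<in>S. dvr P"
 obtains y where "\<forall>P\<in>S. y - f P : vset P (n P)"
proof -
 \<comment> \<open>Precision for the idempotents: an error of value \<open>m\<close> at
   \<open>P\<close>, multiplied by any \<open>f Q\<close>, still has value at least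
   \<open>n P\<close>.\<close>
 define m where "m = nat ((\<Sum>P\<in>S. \<bar>n P\<bar>) + (\<Sum>P\<in>S. \<Sum>Q\<in>S. \<bar>val P (f Q)\<bar>))"
 have mb: "n P - val P (f Q) <= int m" if "P : S" "Q : S" for P Q
 proof -
  have "\<bar>n P\<bar> <= (\<Sum>P\<in>S. \<bar>n P\<bar>)" using S that by (intro member_le_sum) auto
  moreover have "\<bar>val P (f Q)\<bar> <= (\<Sum>Q\<in>S. \<bar>val P (f Q)\<bar>)" using S that by (intro member_le_sum) auto
  moreover have "(\<Sum>Q\<in>S. \<bar>val P (f Q)\<bar>) <= (\<Sum>P\<in>S. \<Sum>Q\<in>S. \<bar>val P (f Q)\<bar>)"
   using S that by (intro member_le_sum[of P S "%P. \<Sum>Q\<in>S. \<bar>val P (f Q)\<bar>"]) (auto intro: sum_nonneg)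
  ultimately show ?thesis unfolding m_def by linarith
 qed
 have "\<exists>e. e - 1 : vset P (int m) & (\<forall>Q\<in>S - {P}. e : vset Q (int m))" if "P : S" for P
  using S that by (intro dvr_approx_idem) auto
 then obtain e where e: "!!P. P : S ==> e P - 1 : vset P (int m)"
  "!!P Q. P : S ==> Q : S ==> Q ~= P ==> e P : vset Q (int m)"
  by (metis Diff_iff insert_absorb insert_iff singletonD)
 define y where "y = (\<Sum>Q\<in>S. e Q * f Q)"
 have "y - f P : vset P (n P)" if P: "P : S" for P
 proof -
  have d: "dvr P" using S P by auto
  have "y = e P * f P + (\<Sum>Q\<in>S - {P}. e Q * f Q)" unfolding y_def using S P by (simp add: sum.remove)
  then have "y - f P = (e P - 1) * f P + (\<Sum>Q\<in>S - {P}. e Q * f Q)" by (simp add: algebra_simps)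
  moreover have mult: "z * f Q : vset P (n P)" if "z : vset P (int m)" "Q : S" for z Q
  proof (cases "f Q = 0 \<or> z = 0")
   case False
   then show ?thesis using that mb[OF P that(2)] by (auto simp: vset_def dvr.val_mult[OF d])
  qed (use d in \<open>auto simp: dvr.zero_vset\<close>)
  moreover have "(e P - 1) * f P : vset P (n P)" using mult e(1) P by blast
  moreover have "(\<Sum>Q\<in>S - {P}. e Q * f Q) : vset P (n P)"
   using mult e(2) P by (intro dvr.vset_sum[OF d]) auto
  ultimately show ?thesis using dvr.vset_add[OF d] by simp
 qed
 then show ?thesis using that by blast
qed

subsection \<open>Finite vector spaces and counting\<close>

text \<open>Coordinates in a basis are lists of length \<open>n\<close> over \<open>K\<close>. This
  and the converse below replace dimensions by cardinalities.\<close>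

lemma (in ring) card_dimension:
 assumes "subfield K R" "finite K" "dimension n K E"
 shows "finite E" "card E = card K ^ n"
proof -
 obtain Vs where Vs: "set Vs \<subseteq> carrier R" "independent K Vs" "length Vs = n" "Span K Vs = E"
  using exists_base[OF assms(1) assms(3)] by blast
 let ?A = "{Ks. set Ks \<subseteq> K & length Ks = n}"
 have E: "E = (%Ks. combine Ks Vs) ` ?A"
  using Span_eq_combine_set_length_version[OF assms(1) Vs(1)] Vs by auto
 have "inj_on (%Ks. combine Ks Vs) ?A"
 proof (rule inj_onI)
  fix Ks Ls assume K: "Ks : ?A" "Ls : ?A" "combine Ks Vs = combine Ls Vs"
  have "combine Ks Vs : Span K Vs" using K E Vs by auto
  from unique_decomposition[OF assms(1) Vs(2) this] K Vs(3) show "Ks = Ls" by auto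
 qed
 then have "card E = card ?A" unfolding E by (rule card_image)
 then show "card E = card K ^ n" using card_lists_length_eq[OF assms(2)] by simp
 show "finite E" unfolding E using finite_lists_length_eq[OF assms(2)] by auto
qed

lemma (in ring) card_dim_finite:
 assumes "subfield K R" "finite K" "subalgebra K E R" "finite E"
 shows "finite_dimension K E" "card E = card K ^ dim K E"
proof -
 have Es: "E \<subseteq> carrier R" using subalgebra_in_carrier[OF assms(3)] .
 obtain xs where xs: "set xs = E" using finite_list[OF assms(4)] by blast
 have "Span K xs = E"
  using subalgebra_Span_incl[OF assms(1,3), of xs] Span_base_incl[OF assms(1), of xs] xs Es by blast
 then show fd: "finite_dimension K E" using Span_finite_dimension[OF assms(1), of xs] xs Es by auto
 have "dimension (dim K E) K E" using finite_dimensionE[OF assms(1) fd] by (simp add: over_def)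
 then show "card E = card K ^ dim K E" using card_dimension(2)[OF assms(1,2)] by blast
qed

lemma combine_rota:
 "length Ks = length Us ==> ring.combine ring_of_type_algebra Ks Us = (\<Sum>i<length Us. Ks ! i * (Us ! i :: 'a::Fields.field))"
proof (induction Ks Us rule: list_induct2)
 case (Cons k Ks u Us)
 then show ?case by (simp add: sum.lessThan_Suc_shift del: sum.lessThan_Suc)
qed simp

lemma eval_rota:
 "ring.eval ring_of_type_algebra (map f (rev [0..<n])) x = (\<Sum>i<n. f i * (x :: 'a::Fields.field) ^ i)"
proof (induction n)
 case (Suc n)
 have "x [^]\<^bsub>ring_of_type_algebra\<^esub> m = x ^ m" for m :: nat
  by (induction m) (auto simp: nat_pow_def)
 with Suc show ?case by simp
qed simp

section \<open>Subspaces of the function field over the constants, and polynomials in one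
  element\<close>

locale constants =
 fixes \<iota> :: "'k::{Fields.field,finite} => 'f::Fields.field"
 assumes \<iota>_hom: "\<iota> : ring_hom ring_of_type_algebra ring_of_type_algebra"
begin

lemma \<iota>_add [simp]: "\<iota> (x + y) = \<iota> x + \<iota> y" and \<iota>_mult [simp]: "\<iota> (x * y) = \<iota> x * \<iota> y"
 and \<iota>_1 [simp]: "\<iota> 1 = 1"
 using \<iota>_hom by (auto simp: ring_hom_rota_iff)

lemma \<iota>_0 [simp]: "\<iota> 0 = 0"
 using \<iota>_add[of 0 0] by (metis add_0 add_cancel_right_left)

lemma \<iota>_uminus [simp]: "\<iota> (- x) = - \<iota> x"
 using \<iota>_add[of x "- x"] by (simp del: \<iota>_add add: eq_neg_iff_add_eq_0 add.commute)

lemma \<iota>_diff [simp]: "\<iota> (x - y) = \<iota> x - \<iota> y"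
 using \<iota>_add[of x "- y"] by (simp del: \<iota>_add)

lemma \<iota>_eq_0_iff [simp]: "\<iota> x = 0 \<longleftrightarrow> x = 0"
proof
 assume "\<iota> x = 0"
 show "x = 0"
 proof (rule ccontr)
  assume "x ~= 0"
  then have "\<iota> (x * inverse x) = 1" by simp
  then show False using \<open>\<iota> x = 0\<close> by (simp only: \<iota>_mult) simp
 qed
qed simp

lemma inj_\<iota>: "inj \<iota>"
 by (rule injI) (metis \<iota>_diff \<iota>_eq_0_iff eq_iff_diff_eq_0)

lemma \<iota>_eq_iff [simp]: "\<iota> x = \<iota> y \<longleftrightarrow> x = y"
 using inj_\<iota> by (auto dest: injD)

lemma \<iota>_inverse [simp]: "\<iota> (inverse x) = inverse (\<iota> x)"
proof (cases "x = 0")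
 case False
 then have "\<iota> x * \<iota> (inverse x) = 1" using \<iota>_mult[of x "inverse x"] by (simp del: \<iota>_mult)
 then show ?thesis using inverse_unique by metis
qed simp

lemma \<iota>_divide [simp]: "\<iota> (x / y) = \<iota> x / \<iota> y"
 by (simp add: divide_inverse)

lemma \<iota>_power [simp]: "\<iota> (x ^ n) = \<iota> x ^ n"
 by (induction n) auto

lemma \<iota>_sum [simp]: "\<iota> (sum f I) = (\<Sum>i\<in>I. \<iota> (f i))"
 by (induction I rule: infinite_finite_induct) auto

lemma subfield_\<iota>: "subfield (range \<iota>) ring_of_type_algebra"
proof (rule field.subfieldI'[OF field_from_type_algebra])
 show "subring (range \<iota>) ring_of_type_algebra"
  unfolding subring_rota_iff by (auto simp: image_iff) (metis \<iota>_1 \<iota>_diff \<iota>_mult)+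
 show "inv\<^bsub>ring_of_type_algebra\<^esub> k : range \<iota>"
  if "k : range \<iota> - {\<zero>\<^bsub>ring_of_type_algebra\<^esub>}" for k
  using that by (auto simp flip: \<iota>_inverse)
qed

lemma card_range_\<iota>: "finite (range \<iota>)" "card (range \<iota>) = CARD('k)"
 using card_image[OF inj_\<iota>] by auto

lemma card_K_gt_1: "CARD('k) > 1"
 using card_mono[of "UNIV::'k set" "{0,1}"] by simp

definition ksub :: "'f set => bool" where
 "ksub V \<longleftrightarrow> 0 : V & (\<forall>x\<in>V. \<forall>y\<in>V. x + y : V) & (\<forall>a. \<forall>x\<in>V. \<iota> a * x : V)"

lemma ksubD:
 assumes "ksub V"
 shows "0 : V" "!!x y. x : V ==> y : V ==> x + y : V" "!!a x. x : V ==> \<iota> a * x : V"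
  "!!x. x : V ==> - x : V" "!!x y. x : V ==> y : V ==> x - y : V"
  "!!I f. (!!i. i : I ==> f i : V) ==> sum f I : V"
proof -
 show *: "0 : V" "!!x y. x : V ==> y : V ==> x + y : V" "!!a x. x : V ==> \<iota> a * x : V"
  using assms by (auto simp: ksub_def)
 show m: "- x : V" if "x : V" for x using *(3)[OF that, of "-1"] by simp
 show "x - y : V" if "x : V" "y : V" for x y using *(2)[OF that(1) m[OF that(2)]] by simp
 show "sum f I : V" if "!!i. i : I ==> f i : V" for I f
  using that by (induction I rule: infinite_finite_induct) (auto intro: *)
qed

lemma ksub_subalgebra: "ksub V ==> subalgebra (range \<iota>) V ring_of_type_algebra"
 unfolding subalgebra_def subalgebra_axioms_def
proof
 assume V: "ksub V"
 show "subgroup V (add_monoid ring_of_type_algebra)"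
  by (rule rota.add.subgroupI) (use V ksubD[OF V] in auto)
qed (auto simp: ksub_def)

lemma card_ksub: "ksub V ==> finite V ==> card V = CARD('k) ^ ring.dim ring_of_type_algebra (range \<iota>) V"
 using rota.card_dim_finite(2)[OF subfield_\<iota> card_range_\<iota>(1) ksub_subalgebra] card_range_\<iota>(2) by simp

text \<open>A family in \<open>W\<close> that is independent modulo \<open>I\<close> and of maximal
  length generates \<open>W\<close> modulo \<open>I\<close>. This bounds the dimension of
  \<open>W / I\<close> without forming the quotient.\<close>

lemma spanning_mod_exists:
 fixes N :: nat
 assumes I: "ksub I" and W: "ksub W"
  and dep: "!!y. (!!i. i <= N ==> y i : W) ==> \<exists>c. (\<exists>i\<le>N. c i ~= 0) & (\<Sum>i\<le>N. \<iota> (c i) * y i) : I"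
 obtains d y where "d <= N" "!!i. i < d ==> y i : W" "!!w. w : W ==> \<exists>c. w - (\<Sum>i<d. \<iota> (c i) * y i) : I"
proof -
 define Q where "Q d y \<longleftrightarrow> (\<forall>i<d. y i : W) & (\<forall>c. (\<exists>i<d. c i ~= 0) --> (\<Sum>i<d. \<iota> (c i) * y i) ~: I)" for d :: nat and y
 have nQ: "\<not> (\<exists>y. Q (Suc N) y)"
  using dep unfolding Q_def lessThan_Suc_atMost less_Suc_eq_le by metis
 have Q0: "Q 0 y" for y by (simp add: Q_def)
 obtain d where d: "d <= N" "\<exists>y. Q d y" "\<not> (\<exists>y. Q (Suc d) y)"
 proof -
  have "\<exists>d\<le>N. (\<exists>y. Q d y) & \<not> (\<exists>y. Q (Suc d) y)"
  proof (rule ccontr)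
   assume *: "\<not> ?thesis"
   have "d <= Suc N ==> \<exists>y. Q d y" for d
    by (induction d) (use * Q0 in auto)
   then show False using nQ by blast
  qed
  then show ?thesis using that by blast
 qed
 then obtain y where y: "Q d y" by blast
 show ?thesis
 proof (rule that[OF d(1)])
  show "y i : W" if "i < d" for i using y that by (auto simp: Q_def)
  show "\<exists>c. w - (\<Sum>i<d. \<iota> (c i) * y i) : I" if w: "w : W" for w
  proof -
   have "\<not> Q (Suc d) (y(d := w))" using d(3) by blast
   then obtain c where c: "\<exists>i<Suc d. c i ~= 0" "(\<Sum>i<Suc d. \<iota> (c i) * (y(d := w)) i) : I"
    using y w unfolding Q_def by (auto simp: less_Suc_eq)
   then have c2: "(\<Sum>i<d. \<iota> (c i) * y i) + \<iota> (c d) * w : I" by simp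
   have cd: "c d ~= 0"
   proof
    assume "c d = 0"
    then have "(\<Sum>i<d. \<iota> (c i) * y i) : I" "\<exists>i<d. c i ~= 0" using c c2 less_Suc_eq by auto
    then show False using y unfolding Q_def by blast
   qed
   have "\<iota> (inverse (c d)) * ((\<Sum>i<d. \<iota> (c i) * y i) + \<iota> (c d) * w) : I" using ksubD(3)[OF I c2] .
   also have "\<iota> (inverse (c d)) * ((\<Sum>i<d. \<iota> (c i) * y i) + \<iota> (c d) * w) =
     w - (\<Sum>i<d. \<iota> (- inverse (c d) * c i) * y i)"
    using cd by (simp add: distrib_left sum_distrib_left sum_negf mult.assoc)
   finally show ?thesis by (intro exI[of _ "%i. - inverse (c d) * c i"])
  qed
 qed
qed

text \<open>Elements with the same coordinates are congruent modulo \<open>I\<close>, so choosing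
  coordinates is injective on \<open>S\<close>.\<close>

lemma finite_incongruent:
 assumes I: "ksub I"
  and span: "!!w. w : S ==> \<exists>c. w - (\<Sum>i<d. \<iota> (c i) * y i) : I"
  and inc: "!!s t. s : S ==> t : S ==> s - t : I ==> s = t"
 shows "finite S" "card S <= CARD('k) ^ d"
proof -
 obtain c where c: "!!w. w : S ==> w - (\<Sum>i<d. \<iota> (c w i) * y i) : I" using span by metis
 define g where "g w = restrict (c w) {..<d}" for w
 have "inj_on g S"
 proof (rule inj_onI)
  fix s t assume st: "s : S" "t : S" "g s = g t"
  have "c s i = c t i" if "i < d" for i using st(3) that unfolding g_def by (metis lessThan_iff restrict_apply')
  then have "(\<Sum>i<d. \<iota> (c s i) * y i) = (\<Sum>i<d. \<iota> (c t i) * y i)" by simp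
  then have "s - t = (s - (\<Sum>i<d. \<iota> (c s i) * y i)) - (t - (\<Sum>i<d. \<iota> (c t i) * y i))" by simp
  then have "s - t : I" using ksubD(5)[OF I c[OF st(1)] c[OF st(2)]] by simp
  then show "s = t" using inc st by blast
 qed
 moreover have "g ` S \<subseteq> PiE {..<d} (%_. UNIV)"
  unfolding g_def by (intro image_subsetI) (simp only: restrict_PiE_iff UNIV_I Ball_def simp_thms)
 moreover have "finite (PiE {..<d} (%_. UNIV :: 'k set))" by (simp add: finite_PiE)
 moreover have "card (PiE {..<d} (%_. UNIV :: 'k set)) = CARD('k) ^ d" by (simp add: card_PiE)
 ultimately show "finite S" "card S <= CARD('k) ^ d"
  using inj_on_finite card_inj_on_le by metis+
qed

definition ev :: "'f => 'k poly => 'f" where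
 "ev x p = poly (map_poly \<iota> p) x"

lemma ev_0 [simp]: "ev x 0 = 0" by (simp add: ev_def)
lemma ev_pCons [simp]: "ev x (pCons a p) = \<iota> a + x * ev x p"
 by (simp add: ev_def map_poly_pCons)
lemma ev_1 [simp]: "ev x 1 = 1" by (simp add: one_pCons)
lemma ev_add [simp]: "ev x (p + q) = ev x p + ev x q"
proof (induction p arbitrary: q)
 case (pCons a p)
 then show ?case by (cases q) (simp add: algebra_simps)
qed simp
lemma ev_smult [simp]: "ev x (smult a p) = \<iota> a * ev x p"
 by (induction p) (auto simp: algebra_simps)
lemma ev_mult [simp]: "ev x (p * q) = ev x p * ev x q"
 by (induction p) (auto simp: algebra_simps)
lemma ev_uminus [simp]: "ev x (- p) = - ev x p"
 using ev_smult[of x "-1" p] by simp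
lemma ev_diff [simp]: "ev x (p - q) = ev x p - ev x q"
 using ev_add[of x p "- q"] by simp
lemma ev_sum [simp]: "ev x (sum f I) = (\<Sum>i\<in>I. ev x (f i))"
 by (induction I rule: infinite_finite_induct) auto
lemma ev_prod [simp]: "ev x (prod f I) = (\<Prod>i\<in>I. ev x (f i))"
 by (induction I rule: infinite_finite_induct) auto

lemma ev_eq_sum: "degree p < n ==> ev x p = (\<Sum>j<n. \<iota> (coeff p j) * x ^ j)"
proof (induction p arbitrary: n)
 case (pCons a p)
 obtain m where n: "n = Suc m" using pCons.prems by (cases n) auto
 show ?case
 proof (cases "p = 0")
  case True
  then show ?thesis by (simp add: n sum.lessThan_Suc_shift coeff_pCons del: sum.lessThan_Suc)
 next
  case False
  then have "degree p < m" using pCons.prems n by simp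
  then show ?thesis using pCons.IH[of m]
   by (simp add: n sum.lessThan_Suc_shift coeff_pCons sum_distrib_left mult_ac del: sum.lessThan_Suc)
 qed
qed simp

lemma ev_mem_subring: "subring W ring_of_type_algebra ==> range \<iota> \<subseteq> W ==> x : W ==> ev x p : W"
 by (induction p) (auto intro!: subring_rotaD[of W])

lemma generate_field_ev:
 assumes "z : generate_field ring_of_type_algebra (range \<iota> \<union> {x})"
 shows "\<exists>p q. ev x q ~= 0 & z = ev x p / ev x q"
 using assms
proof (induction rule: generate_field.induct)
 case one
 have "ev x 1 ~= 0 & 1 = ev x 1 / ev x 1" by simp
 then show ?case unfolding rota_simps by blast
next
 case (incl h)
 then consider a where "h = \<iota> a" | "h = x" by auto
 then show ?case
 proof cases
  case 1
  then have "ev x 1 ~= 0 & h = ev x [:a:] / ev x 1" by simp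
  then show ?thesis by blast
 next
  case 2
  then have "ev x 1 ~= 0 & h = ev x [:0,1:] / ev x 1" by simp
  then show ?thesis by blast
 qed
next
 case (a_inv h)
 then obtain p q where "ev x q ~= 0 & h = ev x p / ev x q" by blast
 then have "ev x q ~= 0 & - h = ev x (- p) / ev x q" by simp
 then show ?case unfolding rota_uminus by blast
next
 case (m_inv h)
 then obtain p q where "ev x q ~= 0 & h = ev x p / ev x q" by blast
 then have "ev x p ~= 0 & inverse h = ev x q / ev x p" using m_inv by auto
 then show ?case using m_inv by (auto simp del: ev_pCons)
next
 case (eng_add g h)
 then obtain p q r s where "ev x q ~= 0 & g = ev x p / ev x q" "ev x s ~= 0 & h = ev x r / ev x s" by blast
 then have "ev x (q * s) ~= 0 & g + h = ev x (p * s + r * q) / ev x (q * s)" by (simp add: field_simps)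
 then show ?case unfolding rota_simps by blast
next
 case (eng_mult g h)
 then obtain p q r s where "ev x q ~= 0 & g = ev x p / ev x q" "ev x s ~= 0 & h = ev x r / ev x s" by blast
 then have "ev x (q * s) ~= 0 & g * h = ev x (p * r) / ev x (q * s)" by simp
 then show ?case unfolding rota_simps by blast
qed

lemma relation_clear_denominators:
 fixes n :: nat
 assumes "!!i. i < n ==> c i : generate_field ring_of_type_algebra (range \<iota> \<union> {x})"
  "\<exists>i<n. c i ~= 0" "(\<Sum>i<n. c i * y i) = 0"
 shows "\<exists>p. (\<exists>i<n. p i ~= 0) & (\<Sum>i<n. ev x (p i) * y i) = 0"
proof -
 obtain p q where pq: "!!i. i < n ==> ev x (q i) ~= 0 & c i = ev x (p i) / ev x (q i)"
  using generate_field_ev[OF assms(1)] by metis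
 define r where "r i = p i * (\<Prod>j\<in>{..<n} - {i}. q j)" for i
 define Q where "Q = (\<Prod>j<n. ev x (q j))"
 have Q: "Q ~= 0" unfolding Q_def by (subst prod_zero_iff) (use pq in auto)
 have r: "ev x (r i) = Q * c i" if "i < n" for i
  using pq[OF that] that by (simp add: r_def Q_def prod.remove[of "{..<n}" i])
 have "(\<Sum>i<n. ev x (r i) * y i) = Q * (\<Sum>i<n. c i * y i)"
  by (simp add: sum_distrib_left r mult.assoc)
 moreover obtain i where "i < n" "c i ~= 0" using assms(2) by blast
 then have "r i ~= 0" using r[of i] Q by auto
 ultimately show ?thesis using assms(3) \<open>i < n\<close> by auto
qed

lemma subfield_generate: "subfield (generate_field ring_of_type_algebra H) (ring_of_type_algebra :: 'f ring)"
 by (rule field.generate_field_is_subfield[OF field_from_type_algebra]) simp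

text \<open>More elements than the dimension are dependent over \<open>K(t)\<close>; clearing
  denominators moves the coefficients into \<open>K[t]\<close>, where they can be reduced and
  compared by degree.\<close>

lemma relation_exists:
 assumes N: "ring.dimension ring_of_type_algebra N (generate_field ring_of_type_algebra (range \<iota> \<union> {t})) E"
  and y: "!!i. y i : E"
 shows "\<exists>p. (\<exists>i<Suc N. p i ~= 0) & (\<Sum>i<Suc N. ev t (p i) * y i) = 0"
proof -
 let ?K = "generate_field ring_of_type_algebra (range \<iota> \<union> {t})"
 define Us where "Us = map y [0..<Suc N]"
 have "\<not> ring.independent ring_of_type_algebra ?K Us"
 proof
  assume "ring.independent ring_of_type_algebra ?K Us"
  from rota.independent_length_le_dimension[OF subfield_generate N this]
  have "length Us <= N" using y by (auto simp: Us_def)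
  then show False by (simp add: Us_def)
 qed
 from rota.dependent_imp_non_trivial_combine[OF subfield_generate _ this]
 obtain Ks where Ks: "length Ks = length Us" "ring.combine ring_of_type_algebra Ks Us = 0"
  "set Ks \<subseteq> ?K" "set Ks ~= {0}" by auto
 have len: "length Us = Suc N" by (simp add: Us_def)
 have "(\<Sum>i<Suc N. Ks ! i * y i) = 0"
  using Ks(2) combine_rota[OF Ks(1)] by (simp add: len Us_def nth_append del: upt_Suc sum.lessThan_Suc)
 moreover have "\<exists>i<Suc N. Ks ! i ~= 0"
 proof (rule ccontr)
  assume "\<not> ?thesis"
  then have "set Ks \<subseteq> {0}" using Ks(1) len by (auto simp: in_set_conv_nth)
  then show False using Ks len by (cases Ks) auto
 qed
 moreover have "Ks ! i : ?K" if "i < Suc N" for i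
  using Ks(1,3) that len nth_mem[of i Ks] by (metis subsetD)
 ultimately show ?thesis
  using relation_clear_denominators[of "Suc N" "(!) Ks" t y] by blast
qed

text \<open>The exchange property of transcendence bases in degree one: a polynomial relation
  between \<open>t\<close> and \<open>x\<close> is read as an equation for \<open>t\<close> instead
  of \<open>x\<close>.\<close>

lemma algebraic_swap:
 assumes t: "!!p. ev t p = 0 ==> p = 0" and x: "!!p. ev x p = 0 ==> p = 0"
  and alg: "ring.algebraic ring_of_type_algebra (generate_field ring_of_type_algebra (range \<iota> \<union> {t})) x"
 shows "ring.algebraic ring_of_type_algebra (generate_field ring_of_type_algebra (range \<iota> \<union> {x})) t"
proof -
 let ?K = "%t. generate_field ring_of_type_algebra (range \<iota> \<union> {t})"
 have sf: "subfield (?K t) ring_of_type_algebra" for t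
  by (rule field.generate_field_is_subfield[OF field_from_type_algebra]) simp
 have dom: "domain (ring_of_type_algebra :: 'f ring)"
  using field.axioms(1)[OF field_from_type_algebra] .

 have fd: "ring.finite_dimension ring_of_type_algebra (?K t) (ring.simple_extension ring_of_type_algebra (?K t) x)"
  using domain.finite_dimension_simple_extension[OF dom sf, of x t] alg by (simp add: over_def)
 obtain N where N: "ring.dimension ring_of_type_algebra N (?K t) (ring.simple_extension ring_of_type_algebra (?K t) x)"
  using rota.finite_dimensionE'[OF fd] by blast
 let ?S = "ring.simple_extension ring_of_type_algebra (?K t) x"
 have sub: "subring ?S ring_of_type_algebra"
  using domain.simple_extension_is_subring[OF dom subfieldE(1)[OF sf]] by simp
 have xS: "x : ?S" using rota.simple_extension_mem[OF subfieldE(1)[OF sf]] by simp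
 have "x ^ i : ?S" for i using subring_rotaD(7)[OF sub xS] .
 from relation_exists[OF N, of "%i. x ^ i", OF this]
 obtain p where p: "\<exists>i<Suc N. p i ~= 0" "(\<Sum>i<Suc N. ev t (p i) * x ^ i) = 0" by blast
 define D where "D = Suc (\<Sum>i<Suc N. degree (p i))"
 have deg: "degree (p i) < D" if "i < Suc N" for i
  using member_le_sum[of i "{..<Suc N}" "%i. degree (p i)"] that by (simp add: D_def del: sum.lessThan_Suc)
 \<comment> \<open>\<open>r j\<close> collects the coefficients of \<open>t ^ j\<close> as a
   polynomial in \<open>x\<close>.\<close>
 define r where "r j = (\<Sum>i<Suc N. Polynomial.monom (coeff (p i) j) i)" for j
 have cr: "coeff (r j) i = (if i < Suc N then coeff (p i) j else 0)" for i j
  by (simp add: r_def coeff_sum del: sum.lessThan_Suc)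
 have evr: "ev x (r j) = (\<Sum>i<Suc N. \<iota> (coeff (p i) j) * x ^ i)" for j
 proof -
  have "ev x (Polynomial.monom a i) = \<iota> a * x ^ i" for a i
   by (induction i) (auto simp: monom_0 monom_Suc)
  then show ?thesis by (simp add: r_def del: sum.lessThan_Suc)
 qed
 have "(\<Sum>j<D. ev x (r j) * t ^ j) = (\<Sum>j<D. \<Sum>i<Suc N. \<iota> (coeff (p i) j) * x ^ i * t ^ j)"
  by (simp add: evr sum_distrib_right del: sum.lessThan_Suc)
 also have "\<dots> = (\<Sum>i<Suc N. \<Sum>j<D. \<iota> (coeff (p i) j) * x ^ i * t ^ j)" by (rule sum.swap)
 also have "\<dots> = (\<Sum>i<Suc N. ev t (p i) * x ^ i)"
  by (rule sum.cong) (auto simp: ev_eq_sum[OF deg] sum_distrib_left sum_distrib_right mult_ac simp del: sum.lessThan_Suc)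
 finally have rel: "(\<Sum>j<D. ev x (r j) * t ^ j) = 0" using p(2) by simp
 obtain i where i: "i < Suc N" "p i ~= 0" using p(1) by blast
 have nz: "ev x (r (degree (p i))) ~= 0"
 proof
  assume "ev x (r (degree (p i))) = 0"
  then have "r (degree (p i)) = 0" by (rule x)
  then have "coeff (r (degree (p i))) i = 0" by simp
  then show False using i by (simp add: cr)
 qed
 \<comment> \<open>List polynomials must have a nonzero leading coefficient, so the equation is cut
   at the last index where \<open>ev x (r j)\<close> does not vanish.\<close>
 define m where "m = Max {j. j < D & ev x (r j) ~= 0}"
 have fin: "finite {j. j < D & ev x (r j) ~= 0}" "{j. j < D & ev x (r j) ~= 0} ~= {}"
  using nz deg[OF i(1)] by auto
 have m: "m < D" "ev x (r m) ~= 0" using Max_in[OF fin] by (auto simp: m_def)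
 have m0: "ev x (r j) = 0" if "j < D" "j > m" for j
  using Max_ge[OF fin(1), of j] that unfolding m_def by (metis (mono_tags, lifting) leD mem_Collect_eq)
 have rel2: "(\<Sum>j<Suc m. ev x (r j) * t ^ j) = 0"
 proof -
  have "(\<Sum>j<Suc m. ev x (r j) * t ^ j) = (\<Sum>j<D. ev x (r j) * t ^ j)"
   by (rule sum.mono_neutral_left) (use m m0 in auto)
  then show ?thesis using rel by simp
 qed
 define L where "L = map (%j. ev x (r j)) (rev [0..<Suc m])"
 have gen: "ev x w : ?K x" for w
 proof (rule ev_mem_subring[OF subfieldE(1)[OF sf]])
  show "range \<iota> \<subseteq> ?K x" "x : ?K x" using generate_field.incl[of _ "range \<iota> \<union> {x}"] by blast+
 qed
 have "L : carrier (univ_poly ring_of_type_algebra (?K x))"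
  using gen m by (auto simp: univ_poly_def polynomial_def L_def)
 moreover have "L ~= []" by (simp add: L_def)
 moreover have "ring.eval ring_of_type_algebra L t = 0"
  unfolding L_def eval_rota by (rule rel2)
 ultimately show ?thesis using rota.algebraicI[of L "?K x" t] by (simp add: over_def)
qed

end

subsection \<open>The places of a curve\<close>

lemma coset_eq_image: "I +[P] y = (%h. h + y) ` I"
 by (auto simp: a_r_coset_def r_coset_def)

lemma coset_eq_iff:
 assumes "0 : I" "!!x y. x : I ==> y : I ==> x - y : I"
 shows "I +[P] y = I +[P] z \<longleftrightarrow> y - z : I"
proof
 assume "I +[P] y = I +[P] z"
 then have "y : (%h. h + z) ` I" unfolding coset_eq_image using assms(1) by (metis add_0 image_eqI)
 then show "y - z : I" by auto
next
 assume *: "y - z : I"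
 have neg: "- x : I" if "x : I" for x using assms(2)[OF assms(1) that] by simp
 have add: "x + y : I" if "x : I" "y : I" for x y using assms(2)[OF that(1) neg[OF that(2)]] by simp
 have "h + y : (%h. h + z) ` I" if "h : I" for h
  using add[OF that *] by (intro image_eqI[of _ _ "h + (y - z)"]) auto
 moreover have "h + z : (%h. h + y) ` I" if "h : I" for h
  using assms(2)[OF that *] by (intro image_eqI[of _ _ "h - (y - z)"]) auto
 ultimately show "I +[P] y = I +[P] z" unfolding coset_eq_image by blast
qed

locale curve =
 fixes \<iota> :: "'k::{Fields.field,finite} => 'f::Fields.field" and PX :: "'f set set"
 assumes curve: "smooth_projective_curve \<iota> PX"
begin

sublocale constants \<iota>
 by unfold_locales (use curve in \<open>simp add: smooth_projective_curve_def\<close>)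

abbreviation KX :: "'f => 'f set" where
 "KX x \<equiv> generate_field ring_of_type_algebra (range \<iota> \<union> {x})"

lemma place_dvr: "P : closed_points PX ==> dvr P"
 using curve by unfold_locales (simp add: smooth_projective_curve_def)

text \<open>Absolute integrality enters here: the minimal polynomial of \<open>x\<close> stays
  irreducible over the function field, but has the root \<open>x\<close> there, so it is
  linear.\<close>

lemma algebraic_constant:
 assumes "ev x p = 0" "p ~= 0" shows "x : range \<iota>"
proof -
 obtain r where r: "ev x r = 0" "r ~= 0" and min: "!!s. ev x s = 0 ==> s ~= 0 ==> degree r <= degree s"
  using ex_has_least_nat[of "%r. ev x r = 0 & r ~= 0" p degree] assms by blast
 have deg: "degree r ~= 0"
 proof
  assume "degree r = 0"
  then obtain a where "r = [:a:]" by (metis degree_eq_zeroE)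
  then show False using r by simp
 qed
 have "Factorial_Ring.irreducible r"
 proof (rule Factorial_Ring.irreducibleI)
  show "\<not> r dvd 1" using deg by (simp add: is_unit_iff_degree r(2))
 next
  fix a b assume ab: "r = a * b"
  then have nz: "a ~= 0" "b ~= 0" using r(2) by auto
  have d: "degree r = degree a + degree b" using ab nz by (simp add: degree_mult_eq)
  have "ev x a = 0 \<or> ev x b = 0" using r(1) ab by simp
  then have "degree a = 0 \<or> degree b = 0" using min[of a] min[of b] nz d by auto
  then show "a dvd 1 \<or> b dvd 1" using nz by (auto simp: is_unit_iff_degree)
 qed (use r in auto)
 then have irr: "Factorial_Ring.irreducible (map_poly \<iota> r)"
  using curve by (simp add: smooth_projective_curve_def absolutely_integral_def)
 have "poly (map_poly \<iota> r) x = 0" using r(1) by (simp add: ev_def)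
 then obtain g where g: "map_poly \<iota> r = [:-x, 1:] * g" by (metis dvdE poly_eq_0_iff_dvd)
 have nz: "g ~= 0" using irr g by (auto simp: irreducible_def)
 have "\<not> [:-x, 1:] dvd 1" by (simp add: is_unit_iff_degree)
 then have "g dvd 1" using Factorial_Ring.irreducibleD[OF irr g] by blast
 then have "degree g = 0" using nz by (simp add: is_unit_iff_degree)
 then have "degree (map_poly \<iota> r) = 1" using nz unfolding g by (subst degree_mult_eq) auto
 then have "degree r = 1" by (simp add: degree_map_poly)
 then obtain a b where ab: "r = [:a, b:]" "b ~= 0" by (metis degree1_coeffs)
 then have "\<iota> a + x * \<iota> b = 0" using r(1) by simp
 then have "x = \<iota> (- a / b)" using ab(2) by (simp add: field_simps eq_neg_iff_add_eq_0)
 then show ?thesis by blast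
qed

lemma projective: obtains N x where "\<exists>i\<le>N. x i ~= 0"
  "PX = (\<Union>i\<in>{i. i <= N & x i ~= 0}. affine_model (affine_chart \<iota> N x i))" "UNIV : PX"
 using curve unfolding smooth_projective_curve_def projective_model_def by metis

lemma affine_chart_subring: "subring (affine_chart \<iota> N x i) ring_of_type_algebra"
 unfolding affine_chart_def by (rule rota.generate_ring_is_subring) simp

lemma affine_chart_gens: "range \<iota> \<subseteq> affine_chart \<iota> N x i" "j <= N ==> x j / x i : affine_chart \<iota> N x i"
 unfolding affine_chart_def by (auto intro!: generate_ring.incl)

lemma affine_chart_minimal:
 assumes "subring W ring_of_type_algebra" "range \<iota> \<subseteq> W" "!!j. j <= N ==> x j / x i : W"
 shows "affine_chart \<iota> N x i \<subseteq> W"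
 unfolding affine_chart_def by (rule rota.generate_ring_min_subring1) (use assms in auto)

lemma prime_ideal_one: "primeideal p (subring_of A) ==> 1 : A ==> 1 ~: p"
proof
 assume p: "primeideal p (subring_of A)" "1 : p" "1 : A"
 interpret primeideal p "subring_of A" by fact
 have "A \<subseteq> p" using I_l_closed[OF p(2)] by auto
 moreover have "p \<subseteq> A" using a_subset by simp
 ultimately show False using I_notcarr by simp
qed

lemma subset_localization:
 assumes "primeideal p (subring_of A)" "1 : A" shows "A \<subseteq> localization A p"
proof
 fix x assume "x : A"
 then have "x = x / 1 & x : A & 1 : A - p" using prime_ideal_one assms by auto
 then show "x : localization A p" unfolding localization_def by blast
qed

lemma constants_subset: "P : PX ==> range \<iota> \<subseteq> P"
proof -
 assume P: "P : PX"
 obtain N x where x: "PX = (\<Union>i\<in>{i. i <= N & x i ~= 0}. affine_model (affine_chart \<iota> N x i))"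
  by (rule projective)
 then obtain i p where ip: "P = localization (affine_chart \<iota> N x i) p" "primeideal p (subring_of (affine_chart \<iota> N x i))"
  using P by (auto simp: affine_model_def)
 show ?thesis
  using subset_localization[OF ip(2) subring_rotaD(1)[OF affine_chart_subring]] affine_chart_gens(1)[of N x i]
  unfolding ip(1) by (rule order_trans[rotated])
qed

lemma place_constants: "P : closed_points PX ==> \<iota> a : P"
 using constants_subset by (auto simp: closed_points_def)

text \<open>The valuative criterion of properness: a valuation is centred on the chart whose coordinate
  has the least value.\<close>

lemma dvr_is_place:
 assumes "dvr W" "range \<iota> \<subseteq> W" shows "W : closed_points PX"
proof -
 interpret W: dvr W by fact
 obtain N x where x: "\<exists>i\<le>N. x i ~= 0" "PX = (\<Union>i\<in>{i. i <= N & x i ~= 0}. affine_model (affine_chart \<iota> N x i))"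
  by (rule projective)
 obtain i where i: "i <= N" "x i ~= 0" "!!j. j <= N ==> x j ~= 0 ==> val W (x i) <= val W (x j)"
 proof -
  define A where "A = (%j. val W (x j)) ` {j. j <= N & x j ~= 0}"
  have fin: "finite A" "A ~= {}" using x(1) by (auto simp: A_def)
  obtain i where "i <= N" "x i ~= 0" "val W (x i) = Min A" using Min_in[OF fin] by (auto simp: A_def)
  then show ?thesis using that[of i] Min_le[OF fin(1)] by (auto simp: A_def)
 qed
 define A where "A = affine_chart \<iota> N x i"
 define p where "p = max_ideal W \<inter> A"
 have A: "subring A ring_of_type_algebra" unfolding A_def by (rule affine_chart_subring)
 have AW: "A \<subseteq> W" unfolding A_def
 proof (rule affine_chart_minimal[OF W.subring assms(2)])
  fix j assume "j <= N"
  then show "x j / x i : W" using i by (cases "x j = 0") (auto simp: W.mem_iff W.val_divide)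
 qed
 have "primeideal p (subring_of A)"
 proof (rule primeidealI)
  show "ideal p (subring_of A)"
  proof (rule idealI)
   show "ring (subring_of A)" by (rule rota.subring_is_ring[OF A])
   show "subgroup p (add_monoid (subring_of A))"
   proof (unfold_locales, goal_cases)
    case 4
    have "inv\<^bsub>add_monoid (subring_of A)\<^esub> x = - x" if "x : A" for x
    proof -
     interpret A: ring "subring_of A" by (rule rota.subring_is_ring[OF A])
     show ?thesis using A.minus_equality[of "- x" x] that subring_rotaD(6)[OF A] by (simp add: a_inv_def)
    qed
    with 4 show ?case using W.max_ideal_closed(2)[of 0] W.max_ideal_closed(6) subring_rotaD(6)[OF A]
     by (auto simp: p_def)
   qed (use W.max_ideal_closed subring_rotaD[OF A] in \<open>auto simp: p_def\<close>)
  qed (use W.max_ideal_closed subring_rotaD[OF A] AW in \<open>auto simp: p_def\<close>)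
  show "cring (subring_of A)" using rota.subcring_iff[of A] rota.subcringI'[OF A] by simp
  show "carrier (subring_of A) ~= p" using W.max_ideal_closed(7) subring_rotaD(1)[OF A] by (auto simp: p_def)
  show "a : p \<or> b : p" if "a : carrier (subring_of A)" "b : carrier (subring_of A)"
   "a \<otimes>\<^bsub>subring_of A\<^esub> b : p" for a b
   using that W.max_ideal_prime[of a b] AW by (auto simp: p_def)
 qed
 then have L: "localization A p : PX" unfolding x(2) affine_model_def A_def using i by blast
 have LW: "localization A p \<subseteq> W"
 proof
  fix z assume "z : localization A p"
  then obtain a b where z: "z = a / b" "a : A" "b : A" "b ~: p" by (auto simp: localization_def)
  then have "b ~= 0" "inverse b : W" using AW by (auto simp: p_def max_ideal_def)
  then show "z : W" using z AW W.closed(5) by (auto simp: divide_inverse)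
 qed
 then have "localization A p ~= UNIV" using W.not_UNIV by blast
 then have "localization A p : closed_points PX" using L by (simp add: closed_points_def)
 \<comment> \<open>Both rings are discrete valuation rings, hence maximal among proper subrings, so
   the inclusion is an equality.\<close>
 then show ?thesis using dvr.maximal_dvr[OF place_dvr _ LW] W.dvr by metis
qed

lemma transcendental_imp: "x ~: range \<iota> ==> ev x p = 0 ==> p = 0"
 using algebraic_constant by blast

text \<open>Exchanging the transcendence basis makes \<open>t\<close> algebraic over
  \<open>K(x)\<close>. The function field is the fraction field of an affine chart, hence generated
  over \<open>K(x, t)\<close> by finitely many algebraic coordinates.\<close>

lemma finite_dimension_KX:
 assumes x: "x ~: range \<iota>"
 shows "ring.finite_dimension ring_of_type_algebra (KX x) UNIV"
proof -
 have dom: "domain (ring_of_type_algebra :: 'f ring)"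
  using field.axioms(1)[OF field_from_type_algebra] .
 obtain t where t: "ring.transcendental ring_of_type_algebra (range \<iota>) t"
  and alg: "!!y. ring.algebraic ring_of_type_algebra (KX t) y"
  using curve unfolding smooth_projective_curve_def trdeg_one_def by blast
 have tt: "t ~: range \<iota>"
  using domain.algebraic_self[OF dom subfieldE(1)[OF subfield_\<iota>]] t by (auto simp: over_def)
 then have "ring.algebraic ring_of_type_algebra (KX x) t"
  using algebraic_swap[of t x, OF transcendental_imp[OF tt] transcendental_imp[OF x] alg] by blast
 then have tx: "(ring.algebraic ring_of_type_algebra over KX x) t" by (simp add: over_def)
 define E where "E = ring.simple_extension ring_of_type_algebra (KX x) t"
 have fdE: "ring.finite_dimension ring_of_type_algebra (KX x) E"
  unfolding E_def using domain.finite_dimension_simple_extension[OF dom subfield_generate, of t] tx by simp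
 have sfE: "subfield E ring_of_type_algebra"
  using domain.finite_extension_is_subfield[OF dom subfield_generate, of "[t]" "range \<iota> \<union> {x}"] tx
  by (simp add: E_def rota.finite_extension.simps)
 have "KX t \<subseteq> E"
 proof (rule field.generate_field_min_subfield1[OF field_from_type_algebra _ sfE])
  have "KX x \<subseteq> E" unfolding E_def
   using rota.simple_extension_incl[OF subfieldE(3)[OF subfield_generate]] subfield_generate by simp
  moreover have "t : E" unfolding E_def
   using rota.simple_extension_mem[OF subfieldE(1)[OF subfield_generate]] by simp
  ultimately show "range \<iota> \<union> {t} \<subseteq> E" using generate_field.incl[of _ "range \<iota> \<union> {x}"] by blast
 qed simp
 then have algE: "(ring.algebraic ring_of_type_algebra over E) y" for y
  using rota.algebraic_mono[of "KX t" E y] alg by (simp add: over_def)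
 obtain N z where z: "PX = (\<Union>i\<in>{i. i <= N & z i ~= 0}. affine_model (affine_chart \<iota> N z i))" "UNIV : PX"
  by (rule projective)
 then obtain i p where ip: "UNIV = localization (affine_chart \<iota> N z i) p" by (auto simp: affine_model_def)
 define zs where "zs = map (%j. z j / z i) [0..<Suc N]"
 define E2 where "E2 = ring.finite_extension ring_of_type_algebra E zs"
 have sfE2: "subfield E2 ring_of_type_algebra"
  unfolding E2_def by (rule domain.finite_extension_is_subfield[OF dom sfE _ algE]) simp
 have fdE2: "ring.finite_dimension ring_of_type_algebra E E2"
  unfolding E2_def by (rule domain.finite_extension_finite_dimension(1)[OF dom sfE _ algE]) simp
 have EE2: "E \<subseteq> E2" unfolding E2_def
  using rota.finite_extension_incl[OF subfieldE(3)[OF sfE], of zs] by simp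
 have zsE2: "set zs \<subseteq> E2" unfolding E2_def
  using domain.finite_extension_mem[OF dom subfieldE(1)[OF sfE], of zs] by auto
 have "z j / z i : E2" if "j <= N" for j
  using zsE2 that by (auto simp: zs_def subset_eq simp del: upt_Suc)
 moreover have "range \<iota> \<subseteq> KX t" using generate_field.incl[of _ "range \<iota> \<union> {t}"] by blast
 ultimately have "affine_chart \<iota> N z i \<subseteq> E2"
  using \<open>KX t \<subseteq> E\<close> EE2 by (intro affine_chart_minimal[OF subfieldE(1)[OF sfE2]]) auto
 have "E2 = UNIV"
 proof -
  have "w : E2" for w
  proof -
   obtain a b where ab: "w = a / b" "a : E2" "b : E2"
    using ip \<open>affine_chart \<iota> N z i \<subseteq> E2\<close> unfolding localization_def by blast
   show "w : E2"
   proof (cases "b = 0")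
    case True
    then show ?thesis using ab subring_rotaD(2)[OF subfieldE(1)[OF sfE2]] by simp
   next
    case False
    then have "inverse b : E2" using rota.subfield_m_inv(1)[OF sfE2, of b] ab by simp
    then show ?thesis using ab subring_rotaD(5)[OF subfieldE(1)[OF sfE2]] by (simp add: divide_inverse)
   qed
  qed
  then show ?thesis by blast
 qed
 then show ?thesis using rota.telescopic_base_dim(1)[OF subfield_generate sfE fdE fdE2] by simp
qed

text \<open>The degree of \<open>x\<close> as a map to the projective line;
  \<open>deg_pole_divisor\<close> identifies it with the number of poles and of zeros, counted with
  multiplicity.\<close>

definition fdeg :: "'f => nat" where
 "fdeg x = ring.dim ring_of_type_algebra (KX x) UNIV"

lemma dimension_fdeg: "x ~: range \<iota> ==> ring.dimension ring_of_type_algebra (fdeg x) (KX x) UNIV"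
 using rota.finite_dimensionE[OF subfield_generate finite_dimension_KX] by (simp add: over_def fdeg_def)

lemma relation_fdeg:
 assumes "x ~: range \<iota>"
 shows "\<exists>p. (\<exists>i<Suc (fdeg x). p i ~= 0) & (\<Sum>i<Suc (fdeg x). ev x (p i) * y i) = 0"
 using relation_exists[OF dimension_fdeg[OF assms]] by simp

lemma basis_fdeg:
 assumes x: "x ~: range \<iota>"
 obtains u where "!!p. (\<Sum>i<fdeg x. ev x (p i) * u i) = 0 ==> (\<forall>i<fdeg x. p i = 0)"
proof -
 obtain Vs where Vs: "ring.independent ring_of_type_algebra (KX x) Vs" "length Vs = fdeg x"
  using rota.exists_base[OF subfield_generate dimension_fdeg[OF x]] by blast
 have "p i = 0" if p: "(\<Sum>i<fdeg x. ev x (p i) * Vs ! i) = 0" and i: "i < fdeg x" for p i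
 proof -
  define Ks where "Ks = map (%i. ev x (p i)) [0..<fdeg x]"
  have "set Ks \<subseteq> KX x"
  proof -
   have "ev x w : KX x" for w
   proof (rule ev_mem_subring[OF subfieldE(1)[OF subfield_generate]])
    show "range \<iota> \<subseteq> KX x" "x : KX x" using generate_field.incl[of _ "range \<iota> \<union> {x}"] by blast+
   qed
   then show ?thesis by (auto simp: Ks_def)
  qed
  moreover have "ring.combine ring_of_type_algebra Ks Vs = \<zero>\<^bsub>ring_of_type_algebra\<^esub>"
   using p combine_rota[of Ks Vs] Vs by (simp add: Ks_def)
  ultimately have "set (take (length Vs) Ks) \<subseteq> {0}"
   using rota.independent_imp_trivial_combine[OF subfield_generate Vs(1), of Ks] by simp
  then have "ev x (p i) = 0" using i Vs(2) by (auto simp: Ks_def image_subset_iff)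
  then show ?thesis by (rule transcendental_imp[OF x])
 qed
 then show ?thesis using that by blast
qed

text \<open>The \<open>K[x]\<close>-rank of a \<open>K[x]\<close>-submodule \<open>W\<close> of the function field bounds the \<open>K\<close>-dimension of
  \<open>W / x W\<close>: divide a relation by the largest power of \<open>x\<close> and reduce it modulo \<open>x\<close>.\<close>

lemma relation_mod:
 assumes x: "x ~: range \<iota>" and W: "ksub W" "!!w. w : W ==> x * w : W"
  and y: "!!i. i <= fdeg x ==> y i : W"
 shows "\<exists>c. (\<exists>i\<le>fdeg x. c i ~= 0) & (\<Sum>i\<le>fdeg x. \<iota> (c i) * y i) : (*) x ` W"
proof -
 let ?N = "fdeg x"
 have x0: "x ~= 0" using x by (metis \<iota>_0 rangeI)
 have reduce: "\<exists>r. (\<exists>i\<le>?N. coeff (r i) 0 ~= 0) & (\<Sum>i\<le>?N. ev x (r i) * y i) = 0"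
  if "\<exists>i\<le>?N. p i ~= 0" "(\<Sum>i\<le>?N. ev x (p i) * y i) = 0" for p
  using that
 proof (induction "\<Sum>i\<le>?N. degree (p i)" arbitrary: p rule: less_induct)
  case less
  show ?case
  proof (cases "\<exists>i\<le>?N. coeff (p i) 0 ~= 0")
   case True
   then show ?thesis using less.prems by blast
  next
   case False
   have "\<exists>r. p i = pCons 0 r" if "i <= ?N" for i
    using False that by (cases "p i") auto
   then obtain r where r: "!!i. i <= ?N ==> p i = pCons 0 (r i)" by metis
   obtain i where i: "i <= ?N" "p i ~= 0" using less.prems by blast
   then have ri: "r i ~= 0" using r by auto
   have "(\<Sum>i\<le>?N. degree (r i)) < (\<Sum>i\<le>?N. degree (p i))"
    by (rule sum_strict_mono_ex1) (use r i ri in \<open>auto intro!: bexI[of _ i]\<close>)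
   moreover have "x * (\<Sum>i\<le>?N. ev x (r i) * y i) = (\<Sum>i\<le>?N. ev x (p i) * y i)"
    by (auto simp: sum_distrib_left r mult.assoc intro!: sum.cong)
   then have "(\<Sum>i\<le>?N. ev x (r i) * y i) = 0" using less.prems x0 by simp
   ultimately show ?thesis using less.hyps[of r] i ri by blast
  qed
 qed
 obtain p where p: "\<exists>i\<le>?N. p i ~= 0" "(\<Sum>i\<le>?N. ev x (p i) * y i) = 0"
  using relation_fdeg[OF x, of y] unfolding lessThan_Suc_atMost less_Suc_eq_le by blast
 obtain r where r: "\<exists>i\<le>?N. coeff (r i) 0 ~= 0" "(\<Sum>i\<le>?N. ev x (r i) * y i) = 0"
  using reduce[OF p] by blast
 obtain s where s: "!!i. r i = pCons (coeff (r i) 0) (s i)"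
 proof -
  have "\<exists>s. r i = pCons (coeff (r i) 0) s" for i by (cases "r i") auto
  then show ?thesis using that by metis
 qed
 have evW: "ev x p * w : W" if "w : W" for p w
 proof (induction p)
  case (pCons a p)
  have "ev x (pCons a p) * w = \<iota> a * w + x * (ev x p * w)" by (simp add: algebra_simps)
  then show ?case using W ksubD[OF W(1)] that pCons by metis
 qed (use ksubD[OF W(1)] in auto)
 have "ev x (r i) = \<iota> (coeff (r i) 0) + x * ev x (s i)" for i
  by (metis ev_pCons s)
 then have "(\<Sum>i\<le>?N. ev x (r i) * y i) = (\<Sum>i\<le>?N. \<iota> (coeff (r i) 0) * y i) + x * (\<Sum>i\<le>?N. ev x (s i) * y i)"
  by (simp add: sum_distrib_left sum.distrib algebra_simps)
 then have "(\<Sum>i\<le>?N. \<iota> (coeff (r i) 0) * y i) = x * (- (\<Sum>i\<le>?N. ev x (s i) * y i))"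
  using r(2) by (simp add: eq_neg_iff_add_eq_0)
 moreover have "- (\<Sum>i\<le>?N. ev x (s i) * y i) : W" using y evW by (intro ksubD[OF W(1)]) auto
 ultimately have "(\<Sum>i\<le>?N. \<iota> (coeff (r i) 0) * y i) : (*) x ` W" by (rule image_eqI)
 then show ?thesis using r(1) by (intro exI[of _ "%i. coeff (r i) 0"] conjI)
qed

text \<open>The one finiteness principle from which discreteness of valuations, finiteness of
  residue rings and the bound on zeros are all drawn, by different choices of
  \<open>W\<close>.\<close>

lemma incongruent_bound:
 assumes x: "x ~: range \<iota>" and W: "ksub W" "!!w. w : W ==> x * w : W"
  and S: "S \<subseteq> W" "!!s t. s : S ==> t : S ==> s - t : (*) x ` W ==> s = t"
 shows "finite S" "card S <= CARD('k) ^ fdeg x"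
proof -
 have I: "ksub ((*) x ` W)"
  unfolding ksub_def
 proof (intro conjI ballI allI)
  show "0 : (*) x ` W" using ksubD(1)[OF W(1)] by force
  show "a + b : (*) x ` W" if "a : (*) x ` W" "b : (*) x ` W" for a b
   using that ksubD(2)[OF W(1)] by (auto simp: distrib_left[symmetric])
  show "\<iota> a * b : (*) x ` W" if "b : (*) x ` W" for a b
   using that ksubD(3)[OF W(1)] by (auto simp: mult.left_commute)
 qed
 obtain d y where d: "d <= fdeg x" "!!w. w : W ==> \<exists>c. w - (\<Sum>i<d. \<iota> (c i) * y i) : (*) x ` W"
  using spanning_mod_exists[OF I W(1) relation_mod[OF x W]] by metis
 have "finite S & card S <= CARD('k) ^ d"
  using finite_incongruent[OF I, where S = S and d = d and y = y] d(2) S by (metis subsetD)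
 moreover have "CARD('k) ^ d <= CARD('k) ^ fdeg x" using d(1) card_K_gt_1 by simp
 ultimately show "finite S" "card S <= CARD('k) ^ fdeg x" by auto
qed

end

section \<open>Valuation rings that contain the constants are discrete\<close>

context curve
begin

lemma ksubI_subring:
 assumes "subring W ring_of_type_algebra" "range \<iota> \<subseteq> W" shows "ksub W"
proof -
 have "\<iota> a : W" for a using assms(2) by blast
 then show ?thesis unfolding ksub_def by (simp add: subring_rotaD(2,3,5)[OF assms(1)])
qed

lemma dvr_ksub: assumes "dvr P" "range \<iota> \<subseteq> P" shows "ksub (vset P k)"
proof -
 interpret dvr P by fact
 have "\<iota> a : P" for a using assms(2) by blast
 then show ?thesis unfolding ksub_def using vset_add vset_mult_left by simp
qed

text \<open>If the maximal ideal were not principal, or some nonzero element were divisible by all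
  powers of its generator, there would be an infinite chain of proper divisors of one element
  \<open>x\<close>; these are pairwise incongruent modulo \<open>x\<close>, against
  \<open>incongruent_bound\<close>.\<close>

lemma valuation_ring_dvr:
 assumes W: "subring W ring_of_type_algebra" "range \<iota> \<subseteq> W"
  and val: "!!z. z ~= 0 ==> z : W \<or> inverse z : W" and ne: "W ~= UNIV"
 shows "dvr W"
proof -
 note cl = subring_rotaD[OF W(1)]
 define m where "m = {z : W. z = 0 \<or> inverse z ~: W}"
 have m_eq: "m = max_ideal W" by (simp add: m_def max_ideal_def)
 have mmul: "a * z : m" if "a : W" "z : m" for a z
 proof (cases "a * z = 0")
  case True
  then show ?thesis unfolding True using cl(2) by (simp add: m_def)
 next
  case False
  have "inverse (a * z) ~: W"
  proof
   assume "inverse (a * z) : W"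
   then have "a * inverse (a * z) : W" using cl(5) that by blast
   moreover have "a * inverse (a * z) = inverse z" using False by (simp add: field_simps)
   ultimately have "inverse z : W" by (simp only:)
   then show False using False that by (simp add: m_def)
  qed
  then show ?thesis using that cl(5) by (simp add: m_def)
 qed
 have one: "1 ~: m" using cl by (simp add: m_def)
 have unit: "inverse (1 - z) : W" "1 - z ~= 0" if "z : m" for z
 proof -
  show nz: "1 - z ~= 0" using that one by auto
  show "inverse (1 - z) : W"
  proof (rule ccontr)
   assume n: "inverse (1 - z) ~: W"
   have "1 - z : W" using cl that by (simp add: m_def)
   show False
   proof (cases "z = 0")
    case True then show False using n cl by simp
   next
    case False
    have "z / (1 - z) : W \<or> (1 - z) / z : W" using val[of "z / (1 - z)"] nz False by simp
    then show False
    proof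
     assume "z / (1 - z) : W"
     then have "1 + z / (1 - z) : W" using cl by blast
     then show False using n nz by (simp add: field_simps)
    next
     assume "(1 - z) / z : W"
     then have "1 + (1 - z) / z : W" using cl by blast
     then show False using False that by (simp add: field_simps m_def)
    qed
   qed
  qed
 qed
 have chain: False
  if x: "x : m" "x ~= 0" and y: "!!i. y i : W" "!!i. y i ~= 0" "!!i. x / y i : m"
   and lt: "!!i j. i < j ==> y i / y j : m \<or> y j / y i : m" for x and y :: "nat => 'f"
 proof -
  have xr: "x ~: range \<iota>"
  proof
   assume "x : range \<iota>"
   then obtain a where "x = \<iota> a" by blast
   then have "inverse x = \<iota> (inverse a)" by simp
   then have "inverse x : W" using W(2) by blast
   then show False using x by (simp add: m_def)
  qed
  \<comment> \<open>\<open>y i - y j\<close> is \<open>- y j\<close> times the unit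
    \<open>1 - y i / y j\<close>. If it were \<open>x w\<close>, then \<open>x / y j\<close>, which
    lies in \<open>m\<close>, would be invertible.\<close>
  have div: "y i - y j ~: (*) x ` W" if "y i / y j : m" for i j
  proof
   assume "y i - y j : (*) x ` W"
   then obtain w where w: "w : W" "y i - y j = x * w" by blast
   define u where "u = 1 - y i / y j"
   have u: "inverse u : W" "u ~= 0" using unit[OF that] by (auto simp: u_def)
   have "y i - y j = - y j * u" using y(2)[of j] by (simp add: u_def field_simps)
   then have "- y j * u = x * w" using w by simp
   have "x / y j * (w * (- inverse u)) = (x * w) * (- inverse u) / y j" by simp
   also have "\<dots> = (- y j * u) * (- inverse u) / y j" using \<open>- y j * u = x * w\<close> by (simp only:)
   also have "\<dots> = 1" using y(2)[of j] u(2) by simp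
   finally have "x / y j * (w * (- inverse u)) = 1" .
   moreover have "w * (- inverse u) * (x / y j) : m"
    by (rule mmul[OF cl(5)[OF w(1) cl(6)[OF u(1)]] y(3)])
   ultimately show False using one by (simp add: mult.commute)
  qed
  have div2: "y i - y j ~: (*) x ` W" if "i ~= j" for i j
  proof
   assume a: "y i - y j : (*) x ` W"
   then obtain w where "w : W" "y i - y j = x * w" by blast
   then have "y j - y i = x * (- w)" "- w : W" using cl(6) by (auto simp: algebra_simps)
   then have b: "y j - y i : (*) x ` W" by blast
   show False using lt[of i j] lt[of j i] div[of i j] div[of j i] a b that by (metis nat_neq_iff)
  qed
  have "inj y"
  proof (rule injI, rule ccontr)
   fix i j assume ij: "y i = y j" "i ~= j"
   have "0 : (*) x ` W" using cl(2) by force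
   then show False using div2[OF ij(2)] ij(1) by simp
  qed
  moreover have "finite (range y)"
  proof (rule incongruent_bound(1)[OF xr, of W])
   show "ksub W" by (rule ksubI_subring[OF W])
   show "x * w : W" if "w : W" for w using cl(5) that x by (simp add: m_def)
   show "range y \<subseteq> W" using y by blast
   show "s = t" if "s : range y" "t : range y" "s - t : (*) x ` W" for s t
    using that div2 by (metis rangeE)
  qed
  ultimately show False using finite_imageD by blast
 qed
 obtain x where x: "x : m" "x ~= 0"
 proof -
  obtain z where "z ~: W" using ne by blast
  then have "z ~= 0" using cl(2) by auto
  then have "inverse z : W" using val \<open>z ~: W\<close> by blast
  then have "inverse z : m" "inverse z ~= 0" using \<open>z ~: W\<close> \<open>z ~= 0\<close> by (auto simp: m_def)
  then show ?thesis using that by blast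
 qed
 have "\<exists>\<pi>. \<pi> : m & \<pi> ~= 0 & (\<forall>z\<in>m. z / \<pi> : W)"
 proof (rule ccontr)
  assume nn: "\<not> ?thesis"
  \<comment> \<open>If \<open>w\<close> does not generate \<open>m\<close>, some \<open>z\<close> in
    \<open>m\<close> is not a multiple of \<open>w\<close>; in a valuation ring \<open>z\<close>
    then properly divides \<open>w\<close>.\<close>
  have *: "\<exists>z. z : m & w / z : m & z ~= 0" if w: "w : m" "w ~= 0" for w
  proof -
   obtain z where z: "z : m" "z / w ~: W" using w nn by blast
   then have "z ~= 0" using cl(2) by auto
   then have "w / z : W" using val[of "z / w"] z w by simp
   then have "w / z : m" using z by (simp add: m_def)
   then show ?thesis using z \<open>z ~= 0\<close> by blast
  qed
  define nx where "nx w = (SOME z. z : m & w / z : m & z ~= 0)" for w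
  have nx: "nx w : m & w / nx w : m & nx w ~= 0" if "w : m" "w ~= 0" for w
   using someI_ex[OF *[OF that]] by (simp add: nx_def)
  define y where "y i = (nx ^^ i) x" for i
  have y: "y i : m & y i ~= 0" for i by (induction i) (use x nx in \<open>auto simp: y_def\<close>)
  have ys: "y i / y (Suc i) : m" for i using nx[of "y i"] y[of i] by (simp add: y_def)
  have yij: "y i / y (Suc (i + k)) : m" for i k
  proof (induction k)
   case (Suc k)
   have "y i / y (Suc (i + k)) : W" using Suc by (simp add: m_def)
   from mmul[OF this ys[of "Suc (i + k)"]] show ?case using y[of "Suc (i + k)"] by simp
  qed (use ys in simp)
  have lt: "y i / y j : m" if "i < j" for i j
   using yij[of i "j - Suc i"] that by simp
  show False
   \<comment> \<open>The index is shifted because \<open>x / y 0 = 1\<close> is not in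
     \<open>m\<close>.\<close>
   by (rule chain[of x "%i. y (Suc i)"])
    (use x y lt[of 0] lt in \<open>auto simp: m_def y_def[of 0]\<close>)
 qed
 then obtain \<pi> where \<pi>: "\<pi> : m" "\<pi> ~= 0" "!!z. z : m ==> z / \<pi> : W" by blast
 have \<pi>W: "\<pi> : W" using \<pi> by (simp add: m_def)
 have powers: "\<exists>k. z / \<pi> ^ k : W - m" if z: "z : W" "z ~= 0" for z
 proof (rule ccontr)
  assume n: "\<not> ?thesis"
  \<comment> \<open>If no power of \<pi> strips \<open>z\<close> down to a unit, all powers of \<pi>
    properly divide \<open>z\<close> and form the forbidden chain.\<close>
  have zk: "z / \<pi> ^ k : m" for k
  proof (induction k)
   case 0
   then show ?case using n z by (metis DiffI div_by_1 power_0)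
  next
   case (Suc k)
   have "z / \<pi> ^ k / \<pi> : W" by (rule \<pi>(3)[OF Suc])
   moreover have "z / \<pi> ^ k / \<pi> = z / \<pi> ^ Suc k" by (simp add: mult.commute)
   ultimately show ?case using n by (metis DiffI)
  qed
  have "\<pi> ^ j / \<pi> ^ i : m" if "i < j" for i j
  proof -
   have "\<pi> ^ j / \<pi> ^ i = \<pi> ^ (j - i)" using that \<pi>(2) by (simp add: power_diff)
   also have "\<dots> = \<pi> ^ (j - i - 1) * \<pi>" using that by (cases "j - i") auto
   finally show ?thesis using mmul[OF cl(7)[OF \<pi>W] \<pi>(1)] by simp
  qed
  then show False
   by (intro chain[of z "%i. \<pi> ^ i"]) (use zk[of 0] z zk \<pi> \<pi>W cl(7) in auto)
 qed
 have "uniformizer W \<pi>"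
  unfolding uniformizer_def m_eq[symmetric]
 proof (intro conjI allI impI \<pi>(1,2))
  fix z :: 'f assume z: "z ~= 0"
  show "\<exists>k. \<exists>u\<in>W - m. z = u * \<pi> powi k"
  proof (cases "z : W")
   case True
   then obtain k where "z / \<pi> ^ k : W - m" using powers z by blast
   moreover have "z = z / \<pi> ^ k * \<pi> powi int k" using \<pi> by simp
   ultimately show ?thesis by blast
  next
   case False
   then have "inverse z : W" "inverse z ~= 0" using val z by auto
   then obtain k where k: "inverse z / \<pi> ^ k : W - m" using powers by blast
   then have "inverse (inverse z / \<pi> ^ k) : W - m" using z \<pi> by (auto simp: m_def)
   moreover have "z = inverse (inverse z / \<pi> ^ k) * \<pi> powi (- int k)" using \<pi> z
    by (simp add: power_int_minus field_simps)
   ultimately show ?thesis by blast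
  qed
 qed
 then show ?thesis using W(1) by unfold_locales (auto simp: discrete_valuation_ring_def)
qed

end

section \<open>Chevalley's extension theorem\<close>

definition adjoin :: "'f::Fields.field set => 'f => 'f set" where
 "adjoin W z = {poly p z | p. \<forall>i. coeff p i : W}"

lemma adjoin_subring:
 assumes W: "subring W ring_of_type_algebra"
 shows "subring (adjoin W z) ring_of_type_algebra" "W \<subseteq> adjoin W z" "z : adjoin W z"
proof -
 note cl = subring_rotaD[OF W]
 have sum: "(!!i. i : I ==> f i : W) ==> sum f I : W" for I :: "nat set" and f
  by (induction I rule: infinite_finite_induct) (auto intro: cl)
 have c1: "coeff 1 i : W" for i using cl by (cases i) (auto simp: one_pCons coeff_pCons)
 show "subring (adjoin W z) ring_of_type_algebra"
  unfolding subring_rota_iff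
 proof (intro conjI ballI)
  show "1 : adjoin W z" unfolding adjoin_def using c1 by (auto intro!: exI[of _ 1])
  fix a b assume "a : adjoin W z" "b : adjoin W z"
  then obtain p r where pr: "a = poly p z" "\<forall>i. coeff p i : W" "b = poly r z" "\<forall>i. coeff r i : W"
   by (auto simp: adjoin_def)
  show "a - b : adjoin W z" unfolding adjoin_def
   by (rule CollectI, rule exI[of _ "p - r"]) (use pr cl in auto)
  show "a * b : adjoin W z" unfolding adjoin_def
   by (rule CollectI, rule exI[of _ "p * r"]) (use pr cl in \<open>auto simp: coeff_mult intro!: sum\<close>)
 qed
 show "W \<subseteq> adjoin W z"
 proof
  fix a assume "a : W"
  then have "\<forall>i. coeff [:a:] i : W" using cl(2) by (auto simp: coeff_pCons split: nat.split)
  then show "a : adjoin W z" unfolding adjoin_def by (intro CollectI exI[of _ "[:a:]"]) simp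
 qed
 have "\<forall>i. coeff [:0,1:] i : W" using cl(1,2) by (auto simp: coeff_pCons split: nat.split)
 then show "z : adjoin W z" unfolding adjoin_def by (intro CollectI exI[of _ "[:0,1:]"]) simp
qed

text \<open>The descent step in Chevalley's extension theorem.\<close>

lemma adjoin_descent:
 fixes z :: "'f::Fields.field"
 assumes W: "subring W ring_of_type_algebra" and t: "t : W" "inverse t ~: W" "t ~= 0" and z: "z ~= 0"
  and p: "\<forall>i. coeff p i : W" "t * poly p z = 1"
  and r: "\<forall>i. coeff r i : W" "t * poly r (inverse z) = 1" "degree r <= degree p"
 shows "\<exists>p'. (\<forall>i. coeff p' i : W) & t * poly p' z = 1 & degree p' < degree p"
proof -
 note cl = subring_rotaD[OF W]
 define n where "n = degree p"
 have n0: "n > 0"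
 proof (rule ccontr)
  assume "\<not> n > 0"
  then obtain a where "p = [:a:]" unfolding n_def by (metis degree_eq_zeroE not_gr_zero)
  then have "t * a = 1" "a : W" using p by (auto split: nat.splits dest: spec[of _ 0])
  then show False using t inverse_unique by metis
 qed
 define b0 where "b0 = coeff r 0"
 define an where "an = coeff p n"
 define S where "S = (\<Sum>j=1..n. Polynomial.monom (coeff r j) (n - j))"
 \<comment> \<open>\<open>S\<close> at \<open>z\<close> is \<open>z ^ n\<close> times
   \<open>poly r (inverse z) - b0\<close>, so \<open>t * poly S z = (1 - t * b0) * z ^ n\<close>.
   Hence the summand with \<open>S\<close>, of lower degree, replaces exactly the top term of
   \<open>p\<close> after multiplication by \<open>1 - t * b0\<close>.\<close>
 define p' where "p' = [:b0:] + smult (1 - t * b0) (p - Polynomial.monom an n) + smult (t * an) S"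
 have sumW: "(!!i. i : I ==> f i : W) ==> sum f I : W" for I :: "nat set" and f
  by (induction I rule: infinite_finite_induct) (auto intro: cl)
 have bW: "b0 : W" "an : W" using p r by (auto simp: b0_def an_def)
 have "coeff p' i : W" for i
 proof -
  have "coeff [:b0:] i : W" using bW cl(2) by (auto simp: coeff_pCons split: nat.split)
  moreover have "coeff (p - Polynomial.monom an n) i : W" using p bW cl by auto
  moreover have "coeff S i : W" using r cl by (auto simp: S_def coeff_sum intro!: sumW)
  ultimately show ?thesis using bW t cl by (simp add: p'_def)
 qed
 moreover have "degree p' < n"
 proof -
  have "degree (p - Polynomial.monom an n) < n"
  proof (rule degree_lessI)
   show "p - Polynomial.monom an n ~= 0 \<or> 0 < n" using n0 by simp
   show "\<forall>k\<ge>n. coeff (p - Polynomial.monom an n) k = 0"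
    by (auto simp: an_def n_def coeff_eq_0)
  qed
  moreover have "degree S < n"
  proof (rule degree_lessI)
   show "S ~= 0 \<or> 0 < n" using n0 by simp
   show "\<forall>k\<ge>n. coeff S k = 0" unfolding S_def coeff_sum by (auto intro!: sum.neutral)
  qed
  ultimately show ?thesis using n0 unfolding p'_def
   by (intro degree_add_less) (auto intro: le_less_trans[OF degree_smult_le])
 qed
 moreover have "t * poly p' z = 1"
 proof -
  have inv: "inverse z ^ j * z ^ n = z ^ (n - j)" if "j <= n" for j
   using z that by (simp add: power_diff power_inverse divide_inverse mult.commute)
  have rsum: "poly r w = (\<Sum>j\<le>n. coeff r j * w ^ j)" for w
  proof -
   have "poly r w = (\<Sum>j\<le>degree r. coeff r j * w ^ j)" by (rule poly_altdef)
   also have "\<dots> = (\<Sum>j\<le>n. coeff r j * w ^ j)"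
    using r(3) by (intro sum.mono_neutral_left) (auto simp: n_def coeff_eq_0)
   finally show ?thesis .
  qed
  have "{..n} = insert 0 {1..n}" by auto
  then have "poly r (inverse z) = b0 + (\<Sum>j=1..n. coeff r j * inverse z ^ j)"
   unfolding rsum by (simp add: b0_def)
  then have "z ^ n * poly r (inverse z) = b0 * z ^ n + (\<Sum>j=1..n. coeff r j * (inverse z ^ j * z ^ n))"
   by (simp add: algebra_simps sum_distrib_left)
  also have "(\<Sum>j=1..n. coeff r j * (inverse z ^ j * z ^ n)) = poly S z"
   unfolding S_def by (auto simp: poly_sum poly_monom inv intro!: sum.cong)
  finally have "t * (z ^ n * poly r (inverse z)) = t * (b0 * z ^ n + poly S z)" by simp
  moreover have "t * (z ^ n * poly r (inverse z)) = z ^ n * (t * poly r (inverse z))" by (simp add: ac_simps)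
  ultimately have S: "t * poly S z = z ^ n * (1 - t * b0)"
   using r(2) by (simp add: algebra_simps)
  have "t * poly p' z = t * b0 + (1 - t * b0) * (t * poly p z - t * an * z ^ n) + t * an * (t * poly S z)"
   by (simp add: p'_def poly_monom algebra_simps)
  also have "\<dots> = 1" unfolding S p(2) by (simp add: algebra_simps)
  finally show ?thesis .
 qed
 ultimately show ?thesis unfolding n_def by blast
qed

text \<open>Zorn's lemma gives a maximal subring \<open>W\<close> without \<open>inverse t\<close>.
  If neither \<open>z\<close> nor \<open>inverse z\<close> were in \<open>W\<close>, then
  \<open>inverse t\<close> would lie in both \<open>W[z]\<close> and \<open>W[1/z]\<close>, and
  representations of least degree would contradict \<open>adjoin_descent\<close>.\<close>

lemma exists_valuation_ring:
 fixes t :: "'f::Fields.field"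
 assumes R0: "subring R0 ring_of_type_algebra" and t: "t : R0" "t ~= 0" "inverse t ~: R0"
 obtains W where "subring W ring_of_type_algebra" "R0 \<subseteq> W" "inverse t ~: W"
  "!!z. z ~= 0 ==> z : W \<or> inverse z : W"
proof -
 define F where "F = {W. subring W ring_of_type_algebra & R0 \<subseteq> W & inverse t ~: W}"
 have "\<exists>M\<in>F. \<forall>U\<in>F. M \<subseteq> U --> U = M"
 proof (rule subset_Zorn_nonempty)
  show "F ~= {}" using R0 t by (auto simp: F_def)
  fix C assume C: "C ~= {}" "subset.chain F C"
  have "subring (\<Union>C) ring_of_type_algebra"
   unfolding subring_rota_iff
  proof (intro conjI ballI)
   show "1 : \<Union>C" using C by (auto simp: F_def subset.chain_def subring_rota_iff)
   fix x y assume "x : \<Union>C" "y : \<Union>C"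
   then obtain A B where AB: "A : C" "B : C" "x : A" "y : B" by blast
   then obtain Z where Z: "Z : C" "x : Z" "y : Z" using C(2) unfolding subset.chain_def by blast
   then have "subring Z ring_of_type_algebra" using C(2) by (auto simp: F_def subset.chain_def)
   then have "x - y : Z" "x * y : Z" using Z unfolding subring_rota_iff by auto
   then show "x - y : \<Union>C" "x * y : \<Union>C" using Z by auto
  qed
  moreover obtain A where "A : C" using C(1) by blast
  then have "R0 \<subseteq> \<Union>C" using C(2) unfolding F_def subset.chain_def by blast
  moreover have "inverse t ~: \<Union>C" using C by (auto simp: F_def subset.chain_def)
  ultimately show "\<Union>C : F" by (simp add: F_def)
 qed
 then obtain W where W: "W : F" "!!V. V : F ==> W \<subseteq> V ==> V = W" by blast
 then have Wr: "subring W ring_of_type_algebra" "R0 \<subseteq> W" "inverse t ~: W" by (auto simp: F_def)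
 have tW: "t : W" using Wr t by blast
 have adj: "\<exists>p. (\<forall>i. coeff p i : W) & t * poly p z = 1" if "z ~: W" for z
 proof -
  have "adjoin W z ~: F" using W(2)[of "adjoin W z"] adjoin_subring[OF Wr(1), of z] that by blast
  then have "inverse t : adjoin W z" using adjoin_subring[OF Wr(1), of z] Wr(2) by (auto simp: F_def)
  then obtain p where "\<forall>i. coeff p i : W" "inverse t = poly p z" by (auto simp: adjoin_def)
  then show ?thesis using t by (intro exI[of _ p]) (auto simp flip: \<open>inverse t = poly p z\<close>)
 qed
 have "z : W \<or> inverse z : W" if z: "z ~= 0" for z
 proof (rule ccontr)
  assume "\<not> ?thesis"
  then have nz: "z ~: W" "inverse z ~: W" by auto
  let ?P = "%w p. (\<forall>i. coeff p i : W) & t * poly p w = 1"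
  obtain p where p: "?P z p" "!!p'. ?P z p' ==> degree p <= degree p'"
   using ex_has_least_nat[of "?P z" _ degree] adj[OF nz(1)] by blast
  obtain r where r: "?P (inverse z) r" "!!p'. ?P (inverse z) p' ==> degree r <= degree p'"
   using ex_has_least_nat[of "?P (inverse z)" _ degree] adj[OF nz(2)] by blast
  show False
  proof (cases "degree r <= degree p")
   case True
   from adjoin_descent[OF Wr(1) tW Wr(3) t(2) z _ _ _ _ True] p(1) r(1)
   obtain p' where "?P z p'" "degree p' < degree p" by blast
   then show False using p(2) by fastforce
  next
   case False
   then have le: "degree p <= degree r" by simp
   have "inverse z ~= 0" using z by simp
   from adjoin_descent[OF Wr(1) tW Wr(3) t(2) this _ _ _ _ le] p(1) r(1)
   obtain p' where "?P (inverse z) p'" "degree p' < degree r" by auto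
   then show False using r(2) by fastforce
  qed
 qed
 then show ?thesis using that Wr by blast
qed

section \<open>Existence of places and finiteness of residue fields\<close>

context curve
begin

text \<open>The valuation ring of Chevalley's theorem is discrete by
  \<open>valuation_ring_dvr\<close> and is a local ring of the curve by properness.\<close>

lemma exists_place:
 assumes R0: "subring R0 ring_of_type_algebra" "range \<iota> \<subseteq> R0" and t: "t : R0" "t ~= 0" "inverse t ~: R0"
 obtains P where "P : closed_points PX" "R0 \<subseteq> P" "t : max_ideal P"
proof -
 obtain W where W: "subring W ring_of_type_algebra" "R0 \<subseteq> W" "inverse t ~: W"
  "!!z. z ~= 0 ==> z : W \<or> inverse z : W" by (rule exists_valuation_ring[OF R0(1) t]) blast
 then have d: "dvr W" using valuation_ring_dvr[OF W(1)] R0(2) by auto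
 then have "W : closed_points PX" using dvr_is_place W(2) R0(2) by blast
 then show ?thesis using that W t by (auto simp: max_ideal_def)
qed

text \<open>Apply \<open>exists_place\<close> to \<open>K[x]\<close>: if \<open>inverse x\<close>
  were a polynomial in \<open>x\<close>, then \<open>x\<close> would be algebraic.\<close>

lemma exists_zero:
 assumes x: "x ~: range \<iota>"
 obtains P where "P : closed_points PX" "x : max_ideal P"
proof -
 have x0: "x ~= 0" using x by (metis \<iota>_0 rangeI)
 have R: "subring (adjoin (range \<iota>) x) ring_of_type_algebra" "range \<iota> \<subseteq> adjoin (range \<iota>) x" "x : adjoin (range \<iota>) x"
  using adjoin_subring[OF subfieldE(1)[OF subfield_\<iota>]] by auto
 have "inverse x ~: adjoin (range \<iota>) x"
 proof
  assume "inverse x : adjoin (range \<iota>) x"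
  then obtain p where p: "\<forall>i. coeff p i : range \<iota>" "inverse x = poly p x" by (auto simp: adjoin_def)
  define r where "r = map_poly (inv_into UNIV \<iota>) p"
  have "map_poly \<iota> r = p"
  proof (rule poly_eqI)
   fix n
   have "inv_into UNIV \<iota> 0 = 0" by (metis \<iota>_0 inj_\<iota> inv_f_f)
   then show "coeff (map_poly \<iota> r) n = coeff p n"
    using p(1) by (simp add: r_def coeff_map_poly f_inv_into_f)
  qed
  then have "ev x (pCons (-1) r) = 0" using p(2) x0 by (simp add: ev_def[of x r] flip: p(2))
  then have "pCons (-1) r = 0" by (rule transcendental_imp[OF x])
  then show False by simp
 qed
 from exists_place[OF R(1,2,3) x0 this] show ?thesis using that by blast
qed

lemma residue_ring_ideal:
 assumes "dvr P" "range \<iota> \<subseteq> P" "0 <= k" shows "ideal (vset P k) (subring_of P)"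
proof -
 interpret dvr P by fact
 have sub: "vset P k \<subseteq> P" using vset_mono[OF assms(3)] by simp
 interpret A: ring "subring_of P" by (rule rota.subring_is_ring[OF subring])
 have ne: "vset P k ~= {}" using zero_vset[of k] by blast
 show ?thesis
 proof (rule idealI[OF A.ring_axioms])
  show "subgroup (vset P k) (add_monoid (subring_of P))"
  proof (rule A.add.subgroupI)
   show "\<ominus>\<^bsub>subring_of P\<^esub> a : vset P k" if "a : vset P k" for a
   proof -
    have "a : P" using that sub by blast
    then have "\<ominus>\<^bsub>subring_of P\<^esub> a = - a" using A.minus_equality[of "- a" a] closed(6) by simp
    then show ?thesis using vset_uminus that by simp
   qed
  qed (use sub vset_add ne in auto)
 next
  fix a y assume "a : vset P k" "y : carrier (subring_of P)"
  then have "y * a : vset P k" using vset_mult_left by simp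
  then show "y \<otimes>\<^bsub>subring_of P\<^esub> a : vset P k" "a \<otimes>\<^bsub>subring_of P\<^esub> y : vset P k"
   by (simp_all add: mult.commute)
 qed
qed

lemma residue_field_field:
 assumes "dvr P" "range \<iota> \<subseteq> P" shows "field (residue_field P)"
proof -
 interpret dvr P by fact
 have id: "ideal (max_ideal P) (subring_of P)" using residue_ring_ideal[OF assms, of 1] by simp
 have cr: "cring (subring_of P)" using rota.subcring_iff[of P] rota.subcringI'[OF subring] by simp
 have "maximalideal (max_ideal P) (subring_of P)"
 proof (rule maximalidealI[OF id])
  show "carrier (subring_of P) ~= max_ideal P" using max_ideal_closed(7) closed(1) by auto
  show "J = max_ideal P \<or> J = carrier (subring_of P)"
   if J: "ideal J (subring_of P)" "max_ideal P \<subseteq> J" "J \<subseteq> carrier (subring_of P)" for J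
  proof (cases "J \<subseteq> max_ideal P")
   case False
   then obtain u where u: "u : J" "u : P - max_ideal P" using J(3) by auto
   then have "inverse u * u : J" using ideal.I_l_closed[OF J(1) u(1), of "inverse u"] u(2)
    unfolding unit_iff by simp
   then have "1 : J" using u(2) unfolding unit_iff by simp
   then have "P \<subseteq> J" using ideal.I_l_closed[OF J(1), of 1] by auto
   then show ?thesis using J by auto
  qed (use J in auto)
 qed
 then show ?thesis unfolding residue_field_def using maximalideal.quotient_is_field cr by blast
qed

lemma residue_constants_subfield:
 assumes "dvr P" "range \<iota> \<subseteq> P"
 shows "subfield (range (%a. max_ideal P +[P] \<iota> a)) (residue_field P)"
  "card (range (%a. max_ideal P +[P] \<iota> a)) = CARD('k)"
proof -
 interpret dvr P by fact
 let ?h = "%a. max_ideal P +[P] \<iota> a"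
 have id: "ideal (max_ideal P) (subring_of P)" using residue_ring_ideal[OF assms, of 1] by simp
 have hom: "(%y. max_ideal P +[P] y) : ring_hom (subring_of P) (residue_field P)"
  unfolding residue_field_def by (rule ideal.rcos_ring_hom[OF id])
 have \<iota>P: "\<iota> a : P" for a using assms(2) by blast
 have "?h : ring_hom (ring_of_type_algebra :: 'k ring) (residue_field P)"
  using hom \<iota>P by (auto simp: ring_hom_def)
 then interpret h: ring_hom_ring "ring_of_type_algebra :: 'k ring" "residue_field P" ?h
  using residue_field_field[OF assms] field.axioms(1) domain.axioms(1) cring.axioms(1)
  by (intro ring_hom_ringI2) (auto intro: rota.ring_axioms)
 interpret RF: field "residue_field P" by (rule residue_field_field[OF assms])
 have "subfield (UNIV::'k set) ring_of_type_algebra"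
  by (rule field.subfieldI'[OF field_from_type_algebra]) (auto simp: subring_rota_iff)
 from h.img_is_subfield(2)[OF this]
 show "subfield (range ?h) (residue_field P)" using RF.one_not_zero by simp
 have "inj ?h"
 proof (rule injI)
  fix a b assume "?h a = ?h b"
  then have "\<iota> a - \<iota> b : max_ideal P" using coset_eq_iff max_ideal_closed(2,6) by blast
  then have "\<iota> (a - b) : max_ideal P" by simp
  moreover have "inverse (\<iota> (a - b)) : P" using \<iota>P[of "inverse (a - b)"] by (simp del: \<iota>_diff)
  ultimately have "\<iota> (a - b) = 0" by (simp add: max_ideal_def del: \<iota>_diff)
  then show "a = b" by (metis \<iota>_eq_0_iff eq_iff_diff_eq_0)
 qed
 then show "card (range ?h) = CARD('k)" by (rule card_image)
qed

lemma carrier_residue_field: "carrier (residue_field P) = (%y. max_ideal P +[P] y) ` P"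
 by (auto simp: residue_field_def FactRing_def A_RCOSETS_def RCOSETS_def a_r_coset_def)

text \<open>Different residues are incongruent modulo a uniformizer, which is not a constant, so
  \<open>incongruent_bound\<close> applies with \<open>W = P\<close>. From here on the degree of a
  point is accessed through this cardinality.\<close>

lemma residue_field_finite:
 assumes P: "P : closed_points PX"
 shows "finite (carrier (residue_field P))" "card (carrier (residue_field P)) = CARD('k) ^ point_degree \<iota> P"
proof -
 have d: "dvr P" "range \<iota> \<subseteq> P" using P place_dvr place_constants by auto
 interpret dvr P by fact
 obtain x where x: "uniformizer P x" using ex_uniformizer by blast
 then have xm: "x : max_ideal P" "x ~= 0" by (auto simp: uniformizer_def)
 have xr: "x ~: range \<iota>"
 proof
  assume "x : range \<iota>"
  then obtain a where "x = \<iota> a" by blast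
  then have "inverse x : P" using d(2) by (metis \<iota>_inverse rangeI subsetD)
  then show False using xm by (simp add: max_ideal_def)
 qed
 let ?h = "%y. max_ideal P +[P] y"
 have heq: "?h y = ?h z \<longleftrightarrow> y - z : max_ideal P" for y z
  by (rule coset_eq_iff) (use max_ideal_closed in auto)
 obtain S where S: "S \<subseteq> P" "inj_on ?h S" "?h ` S = ?h ` P"
  using subset_image_inj[of "?h ` P" ?h P] by auto
 have "finite S"
 proof (rule incongruent_bound(1)[OF xr])
  show "ksub P" by (rule ksubI_subring[OF subring d(2)])
  show "x * w : P" if "w : P" for w using closed(5)[OF max_ideal_closed(5)[OF xm(1)] that] .
  show "s = t" if st: "s : S" "t : S" "s - t : (*) x ` P" for s t
  proof -
   obtain w where "w : P" "s - t = x * w" using st(3) by blast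
   then have "s - t : max_ideal P" using max_ideal_closed(4)[OF xm(1)] by simp
   then have "?h s = ?h t" unfolding heq .
   from inj_onD[OF S(2) this st(1,2)] show ?thesis .
  qed
 qed (use S in auto)
 then have "finite (?h ` S)" by (rule finite_imageI)
 then show fin: "finite (carrier (residue_field P))" unfolding carrier_residue_field S(3) .
 interpret RF: field "residue_field P" by (rule residue_field_field[OF d])
 let ?K = "range (%a. max_ideal P +[P] \<iota> a)"
 have K: "?K \<subseteq> carrier (residue_field P)" using d(2) by (auto simp: carrier_residue_field)
 have "subalgebra ?K (carrier (residue_field P)) (residue_field P)" by (rule RF.carrier_is_subalgebra[OF K])
 then have "card (carrier (residue_field P)) = card ?K ^ ring.dim (residue_field P) ?K (carrier (residue_field P))"
  using RF.card_dim_finite(2) residue_constants_subfield(1)[OF d] fin by simp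
 then show "card (carrier (residue_field P)) = CARD('k) ^ point_degree \<iota> P"
  unfolding point_degree_def residue_constants_subfield(2)[OF d] by simp
qed

end

subsection \<open>Degrees and Riemann's theorem\<close>

text \<open>Rank and nullity in counting form. \<open>f\<close> need not be a homomorphism, only its
  fibres must be cosets of \<open>B\<close>, so the target needs no structure.\<close>

lemma card_fibres:
 assumes B: "finite B" and im: "finite (f ` A)" and BA: "!!a b. a : A ==> b : B ==> a + b : A"
  and eq: "!!a b. a : A ==> b : A ==> f a = f b \<longleftrightarrow> b - a : B"
 shows "finite A" "card A = card (f ` A) * card (B :: 'a::ab_group_add set)"
proof -
 define s where "s v = (SOME a. a : A & f a = v)" for v
 have s: "s v : A" "f (s v) = v" if "v : f ` A" for v
  using someI_ex[of "%a. a : A & f a = v"] that unfolding s_def by blast+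
 have fsb: "f (s v + b) = v" if "v : f ` A" "b : B" for v b
  using eq[of "s v" "s v + b"] s[OF that(1)] BA that by auto
 have "bij_betw (%(v, b). s v + b) (f ` A \<times> B) A"
 proof (rule bij_betwI')
  fix p q assume pq: "p : f ` A \<times> B" "q : f ` A \<times> B"
  obtain v b w c where e: "p = (v, b)" "q = (w, c)" by (metis surj_pair)
  then have vb: "v : f ` A" "b : B" "w : f ` A" "c : B" using pq by auto
  have "v = w" if "s v + b = s w + c"
   using fsb[OF vb(1,2)] fsb[OF vb(3,4)] that by simp
  then show "((case p of (v, b) => s v + b) = (case q of (v, b) => s v + b)) = (p = q)"
   unfolding e by auto
 next
  fix p assume "p : f ` A \<times> B" then show "(case p of (v, b) => s v + b) : A" using s BA by auto
 next
  fix a assume a: "a : A"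
  then have v: "f a : f ` A" by blast
  have "a - s (f a) : B" using eq[of "s (f a)" a] s[OF v] a by auto
  then show "\<exists>p\<in>f ` A \<times> B. a = (case p of (v, b) => s v + b)"
   using v by (intro bexI[of _ "(f a, a - s (f a))"]) auto
 qed
 then show "finite A" "card A = card (f ` A) * card B"
  using bij_betw_finite bij_betw_same_card[of _ "f ` A \<times> B" A] im B by (fastforce simp: card_cartesian_product)+
qed

lemma sum_keys_superset:
 assumes "finite S" "keys D \<subseteq> S"
 shows "(\<Sum>P\<in>keys D. lookup D P * f P) = (\<Sum>P\<in>S. lookup D P * (f P :: int))"
 using assms by (intro sum.mono_neutral_left) (auto simp: in_keys_iff)

lemma div_degree_superset:
 assumes "finite S" "keys D \<subseteq> S"
 shows "div_degree \<iota> D = (\<Sum>P\<in>S. lookup D P * int (point_degree \<iota> P))"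
 unfolding div_degree_def by (rule sum_keys_superset[OF assms])

lemma div_degree_add: "div_degree \<iota> (D + E) = div_degree \<iota> D + div_degree \<iota> E"
proof -
 let ?S = "keys D \<union> keys E"
 have "keys (D + E) \<subseteq> ?S" by (rule keys_add)
 then show ?thesis
  using div_degree_superset[of ?S "D + E" \<iota>] div_degree_superset[of ?S D \<iota>] div_degree_superset[of ?S E \<iota>]
  by (simp add: lookup_add distrib_right sum.distrib)
qed

lemma div_degree_zero [simp]: "div_degree \<iota> 0 = 0"
 by (simp add: div_degree_def)

lemma div_degree_uminus: "div_degree \<iota> (- D) = - div_degree \<iota> D"
 using div_degree_add[of \<iota> D "- D"] by simp

lemma div_degree_diff: "div_degree \<iota> (D - E) = div_degree \<iota> D - div_degree \<iota> E"
 using div_degree_add[of \<iota> "D - E" E] by simp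

lemma div_degree_single [simp]: "div_degree \<iota> (single P k) = k * int (point_degree \<iota> P)"
 by (cases "k = 0") (auto simp: div_degree_def)

lemma div_degree_sum: "div_degree \<iota> (sum D I) = (\<Sum>i\<in>I. div_degree \<iota> (D i))"
 by (induction I rule: infinite_finite_induct) (auto simp: div_degree_add)

definition dle :: "'f divisor => 'f divisor => bool" where
 "dle D E \<longleftrightarrow> (\<forall>P. lookup D P <= lookup E P)"

lemma div_degree_mono:
 assumes "dle D E" shows "div_degree \<iota> D <= div_degree \<iota> E"
proof -
 let ?S = "keys D \<union> keys E"
 have "(\<Sum>P\<in>?S. lookup D P * int (point_degree \<iota> P)) <= (\<Sum>P\<in>?S. lookup E P * int (point_degree \<iota> P))"
  using assms by (intro sum_mono mult_right_mono) (auto simp: dle_def)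
 then show ?thesis using div_degree_superset[of ?S D \<iota>] div_degree_superset[of ?S E \<iota>] by simp
qed

text \<open>Adding one point at a time keeps each change within a single residue field. The step
  keeps \<open>A\<close> between \<open>D\<close> and \<open>E\<close> so that monotone estimates
  stay available.\<close>

lemma divisor_induct [consumes 3, case_names base step]:
 fixes D E :: "'f::Fields.field divisor"
 assumes D: "D : divisors PX" and E: "E : divisors PX" and le: "dle D E"
  and base: "Q D"
  and step: "!!A P. A : divisors PX ==> dle D A ==> dle (A + single P 1) E ==>
   P : closed_points PX ==> Q A ==> Q (A + single P 1)"
 shows "Q E"
proof -
 define S where "S = keys D \<union> keys E"
 have S: "finite S" by (simp add: S_def)
 have "Q A" if "A : divisors PX" "dle D A" "dle A E" "keys A \<subseteq> S" for A
  using that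
 proof (induction "\<Sum>P\<in>S. nat (lookup A P - lookup D P)" arbitrary: A rule: less_induct)
  case less
  show ?case
  proof (cases "A = D")
   case False
   then obtain P where "lookup A P ~= lookup D P"
    by (meson poly_mapping_eqI)
   then have P: "lookup D P < lookup A P"
    using less.prems(2) unfolding dle_def by (metis order_less_le)
   then have "P : keys D \<or> P : keys A" by (auto simp: in_keys_iff)
   then have PS: "P : S" "P : closed_points PX" using D less.prems by (auto simp: S_def divisors_def)
   define A' where "A' = A - single P 1"
   have lk: "lookup A' R = lookup A R - (if R = P then 1 else 0)" for R
    by (simp add: A'_def lookup_minus lookup_single when_def)
   have keys: "keys A' \<subseteq> insert P (keys A)"
    by (auto simp: in_keys_iff lk split: if_splits)
   have "Q A'"
   proof (rule less.hyps)
    show "(\<Sum>P\<in>S. nat (lookup A' P - lookup D P)) <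
      (\<Sum>P\<in>S. nat (lookup A P - lookup D P))"
     by (rule sum_strict_mono_ex1[OF S]) (use P PS in \<open>auto simp: lk intro!: bexI[of _ P]\<close>)
    show "A' : divisors PX" using keys less.prems(1) PS by (auto simp: divisors_def)
    show "dle D A'" unfolding dle_def lk using less.prems(2) P by (auto simp: dle_def)
    show "dle A' E" unfolding dle_def
    proof
     fix R
     have "lookup A R <= lookup E R" using less.prems(3) by (simp add: dle_def)
     then show "lookup A' R <= lookup E R" unfolding lk by (cases "R = P") auto
    qed
    show "keys A' \<subseteq> S" using keys less.prems PS by auto
   qed
   moreover have "A' + single P 1 = A" by (simp add: A'_def)
   moreover have "A' : divisors PX" using keys less.prems(1) PS by (auto simp: divisors_def)
   moreover have "dle D A'" unfolding dle_def lk using less.prems(2) P by (auto simp: dle_def)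
   ultimately show ?thesis using step[of A' P] PS less.prems(3) by simp
  qed (use base in simp)
 qed
 from this[OF E le] show ?thesis by (simp add: dle_def S_def)
qed

lemma dle_refl [simp]: "dle D D" by (simp add: dle_def)

lemma divisors_add: "D : divisors PX ==> E : divisors PX ==> D + E : divisors PX"
 unfolding divisors_def using keys_add[of D E] by blast
lemma divisors_uminus: "D : divisors PX ==> - D : divisors PX"
 by (simp add: divisors_def)
lemma divisors_diff: "D : divisors PX ==> E : divisors PX ==> D - E : divisors PX"
 using divisors_add[OF _ divisors_uminus, of D PX E] by simp
lemma divisors_zero [simp]: "0 : divisors PX" by (simp add: divisors_def)
lemma divisors_single: "P : closed_points PX ==> single P k : divisors PX"
 by (auto simp: divisors_def)
lemma divisors_sum: "(!!i. i : I ==> D i : divisors PX) ==> sum D I : divisors PX"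
 by (induction I rule: infinite_finite_induct) (auto intro: divisors_add)

lemma divisor_of_function:
 fixes f :: "'f::Fields.field set => int"
 assumes "finite {P. f P ~= 0}" "!!P. P ~: closed_points PX ==> f P = 0"
 shows "lookup (Abs_poly_mapping f) = f" "Abs_poly_mapping f : divisors PX"
proof -
 show l: "lookup (Abs_poly_mapping f) = f" by (rule lookup_Abs_poly_mapping[OF assms(1)])
 have "P : closed_points PX" if "P : keys (Abs_poly_mapping f)" for P
  using that assms(2)[of P] unfolding in_keys_iff l by blast
 then show "Abs_poly_mapping f : divisors PX" by (auto simp: divisors_def)
qed

section \<open>Dimensions of spaces of sections\<close>

context curve
begin

abbreviation deg :: "'f divisor => int" where "deg \<equiv> div_degree \<iota>"
abbreviation ell :: "'f divisor => nat" where "ell \<equiv> dim_H0 \<iota> PX"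

lemma H0_iff: "f : H0 PX D \<longleftrightarrow> (\<forall>P\<in>closed_points PX. f : vset P (- lookup D P))"
proof -
 have "- a <= b \<longleftrightarrow> 0 <= b + a" for a b :: int by linarith
 then show ?thesis by (cases "f = 0") (simp_all add: H0_def vset_def)
qed

lemma ksub_H0: "ksub (H0 PX D)"
proof -
 have k: "ksub (vset P (- lookup D P))" if "P : closed_points PX" for P
  by (rule dvr_ksub[OF place_dvr[OF that]]) (use place_constants[OF that] in auto)
 show ?thesis unfolding ksub_def
  by (intro conjI ballI allI) (simp_all add: H0_iff ksubD(1)[OF k] ksubD(2)[OF k] ksubD(3)[OF k])
qed

lemma H0_mono: "dle D E ==> H0 PX D \<subseteq> H0 PX E"
 unfolding H0_def dle_def by clarsimp (metis add_left_mono order_trans)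

lemma card_H0: "finite (H0 PX D) ==> card (H0 PX D) = CARD('k) ^ ell D"
 unfolding dim_H0_def by (rule card_ksub[OF ksub_H0])

text \<open>The leading coefficient at \<open>P\<close> of a section of \<open>D + P\<close>: such a
  section has value at least \<open>- lookup D P - 1\<close>, so the power of \<pi> makes it
  regular.\<close>

definition lead :: "'f divisor => 'f set => 'f => 'f => 'f set" where
 "lead D P \<pi> f = max_ideal P +[P] (\<pi> powi (lookup D P + 1) * f)"

lemma H0_add_single_iff:
 assumes P: "P : closed_points PX" and \<pi>: "uniformizer P \<pi>" and f: "f : H0 PX (D + single P 1)"
 shows "\<pi> powi (lookup D P + 1) * f : P"
  "f : H0 PX D \<longleftrightarrow> \<pi> powi (lookup D P + 1) * f : max_ideal P"
proof -
 interpret dvr P by (rule place_dvr[OF P])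
 have \<pi>0: "\<pi> ~= 0" "val P \<pi> = 1" using \<pi> by (auto simp: uniformizer_iff)
 have fv: "f : vset Q (- lookup D Q - (if Q = P then 1 else 0))" if "Q : closed_points PX" for Q
  using f that unfolding H0_iff by (auto simp: lookup_add lookup_single when_def)
 have "f : vset P (- lookup D P - 1)" using fv[OF P] by simp
 then show "\<pi> powi (lookup D P + 1) * f : P"
  using vset_mult_iff[of "\<pi> powi (lookup D P + 1)" f 0] \<pi>0 by (simp add: val_powi)
 have "f : H0 PX D \<longleftrightarrow> f : vset P (- lookup D P)"
 proof
  assume "f : vset P (- lookup D P)"
  then show "f : H0 PX D" unfolding H0_iff using fv by (metis diff_zero)
 qed (use P in \<open>simp add: H0_iff\<close>)
 then show "f : H0 PX D \<longleftrightarrow> \<pi> powi (lookup D P + 1) * f : max_ideal P"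
  using vset_mult_iff[of "\<pi> powi (lookup D P + 1)" f 1] \<pi>0 by (simp add: val_powi)
qed

lemma dle_add_single: "0 <= k ==> dle D (D + single P k)"
 by (simp add: dle_def lookup_add lookup_single when_def)

text \<open>The exact sequence from \<open>H0 D\<close> to \<open>H0 (D + P)\<close> to the residue
  field, in counting form. Full growth of the dimension is thereby the same as surjectivity of the
  leading coefficient.\<close>

lemma H0_step:
 assumes P: "P : closed_points PX" and \<pi>: "uniformizer P \<pi>" and fin: "finite (H0 PX D)"
 defines "E \<equiv> D + single P 1"
 shows "finite (H0 PX E)" "ell D <= ell E" "ell E <= ell D + point_degree \<iota> P"
  "lead D P \<pi> ` H0 PX E \<subseteq> carrier (residue_field P)"
  "ell E = ell D + point_degree \<iota> P \<longleftrightarrow> lead D P \<pi> ` H0 PX E = carrier (residue_field P)"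
  "card (lead D P \<pi> ` H0 PX E) = CARD('k) ^ (ell E - ell D)"
  "!!f g. f : H0 PX E ==> g : H0 PX E ==> lead D P \<pi> f = lead D P \<pi> g \<longleftrightarrow> g - f : H0 PX D"
proof -
 interpret dvr P by (rule place_dvr[OF P])
 let ?A = "H0 PX E" and ?c = "\<pi> powi (lookup D P + 1)"
 show sub: "lead D P \<pi> ` ?A \<subseteq> carrier (residue_field P)"
  using H0_add_single_iff(1)[OF P \<pi>] by (auto simp: lead_def carrier_residue_field E_def)
 have DE: "H0 PX D \<subseteq> ?A" unfolding E_def by (rule H0_mono) (simp add: dle_add_single)
 show eq: "lead D P \<pi> f = lead D P \<pi> g \<longleftrightarrow> g - f : H0 PX D" if "f : ?A" "g : ?A" for f g
 proof -
  have gf: "g - f : ?A" using ksubD(5)[OF ksub_H0] that by blast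
  have "lead D P \<pi> f = lead D P \<pi> g \<longleftrightarrow> lead D P \<pi> g = lead D P \<pi> f" by auto
  also have "\<dots> \<longleftrightarrow> ?c * g - ?c * f : max_ideal P"
   unfolding lead_def by (rule coset_eq_iff) (use max_ideal_closed in auto)
  also have "\<dots> \<longleftrightarrow> ?c * (g - f) : max_ideal P" by (simp add: algebra_simps)
  also have "\<dots> \<longleftrightarrow> g - f : H0 PX D" using H0_add_single_iff(2)[OF P \<pi> gf[unfolded E_def]] by simp
  finally show ?thesis .
 qed
 have finl: "finite (lead D P \<pi> ` ?A)" using finite_subset[OF sub residue_field_finite(1)[OF P]] .
 have add: "a + b : ?A" if "a : ?A" "b : H0 PX D" for a b
  using ksubD(2)[OF ksub_H0] that DE by blast
 note cf = card_fibres[OF fin finl add eq]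
 show finE: "finite ?A" by (rule cf(1))
 have c: "CARD('k) ^ ell E = card (lead D P \<pi> ` ?A) * CARD('k) ^ ell D"
  using cf(2) card_H0[OF finE] card_H0[OF fin] by simp
 have q: "CARD('k) > 1" by (rule card_K_gt_1)
 have "card (H0 PX D) <= card ?A" by (rule card_mono[OF finE DE])
 then show le: "ell D <= ell E" using card_H0[OF finE] card_H0[OF fin] q by simp
 have "CARD('k) ^ ell E = CARD('k) ^ (ell E - ell D) * CARD('k) ^ ell D"
  using le by (simp flip: power_add)
 then show cl: "card (lead D P \<pi> ` ?A) = CARD('k) ^ (ell E - ell D)" using c q by simp
 have "card (lead D P \<pi> ` ?A) <= CARD('k) ^ point_degree \<iota> P"
  using card_mono[OF residue_field_finite(1)[OF P] sub] residue_field_finite(2)[OF P] by simp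
 then have "ell E - ell D <= point_degree \<iota> P" unfolding cl using q by simp
 then show "ell E <= ell D + point_degree \<iota> P" by simp
 have "ell E = ell D + point_degree \<iota> P \<longleftrightarrow> card (lead D P \<pi> ` ?A) = card (carrier (residue_field P))"
  unfolding cl residue_field_finite(2)[OF P] using q le by auto
 also have "\<dots> \<longleftrightarrow> lead D P \<pi> ` ?A = carrier (residue_field P)"
  using card_subset_eq[OF residue_field_finite(1)[OF P] sub] by auto
 finally show "ell E = ell D + point_degree \<iota> P \<longleftrightarrow> lead D P \<pi> ` H0 PX E = carrier (residue_field P)" .
qed

text \<open>A function that is not constant has a pole, namely a zero of its inverse.\<close>

lemma H0_zero: "H0 PX 0 = range \<iota>"
proof
 show "range \<iota> \<subseteq> H0 PX 0"
  unfolding H0_iff using place_constants dvr.vset_0[OF place_dvr] by (auto simp: H0_iff)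
 show "H0 PX 0 \<subseteq> range \<iota>"
 proof
  fix f assume f: "f : H0 PX 0"
  show "f : range \<iota>"
  proof (rule ccontr)
   assume n: "f ~: range \<iota>"
   then have f0: "f ~= 0" by (metis \<iota>_0 rangeI)
   have "inverse f ~: range \<iota>"
   proof
    assume "inverse f : range \<iota>"
    then obtain a where "inverse f = \<iota> a" by blast
    then have "f = \<iota> (inverse a)" by (metis \<iota>_inverse inverse_inverse_eq)
    then show False using n by blast
   qed
   then obtain P where P: "P : closed_points PX" "inverse f : max_ideal P" using exists_zero by blast
   then have "f ~: P" using f0 by (simp add: max_ideal_def)
   then show False using f P(1) dvr.vset_0[OF place_dvr[OF P(1)]] by (auto simp: H0_iff)
  qed
 qed
qed

lemma ell_zero: "ell 0 = 1"
proof -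
 have "CARD('k) ^ ell 0 = CARD('k) ^ 1" using card_H0[of 0] H0_zero card_range_\<iota> by simp
 then show ?thesis using card_K_gt_1 power_inject_exp by blast
qed

definition pos_part :: "'f divisor => 'f divisor" where
 "pos_part D = Abs_poly_mapping (%P. max 0 (lookup D P))"

lemma pos_part:
 assumes "D : divisors PX"
 shows "lookup (pos_part D) P = max 0 (lookup D P)" "pos_part D : divisors PX"
  "dle 0 (pos_part D)" "dle D (pos_part D)"
proof -
 have "{P. max 0 (lookup D P) ~= 0} \<subseteq> keys D" by (auto simp: in_keys_iff)
 then have fin: "finite {P. max 0 (lookup D P) ~= 0}" using finite_subset finite_keys by blast
 have z: "max 0 (lookup D P) = 0" if "P ~: closed_points PX" for P
 proof -
  have "P ~: keys D" using assms that by (auto simp: divisors_def)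
  then show ?thesis by (simp add: in_keys_iff)
 qed
 note dd = divisor_of_function[OF fin z]
 have lk: "lookup (pos_part D) Q = max 0 (lookup D Q)" for Q
  by (simp add: pos_part_def dd(1))
 then show "lookup (pos_part D) P = max 0 (lookup D P)" .
 show "dle 0 (pos_part D)" "dle D (pos_part D)" by (auto simp: dle_def lk)
 show "pos_part D : divisors PX" unfolding pos_part_def by (rule dd(2))
qed

text \<open>Finiteness is needed before \<open>card_H0\<close> can read off a dimension; it spreads
  from \<open>H0 0 = K\<close> one point at a time.\<close>

lemma finite_H0: assumes "D : divisors PX" shows "finite (H0 PX D)"
proof -
 have "finite (H0 PX (pos_part D))"
  using divisors_zero pos_part(2)[OF assms] pos_part(3)[OF assms]
 proof (induction rule: divisor_induct)
  case base
  then show ?case unfolding H0_zero by (rule card_range_\<iota>)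
 next
  case (step A P)
  obtain \<pi> where "uniformizer P \<pi>" using dvr.ex_uniformizer[OF place_dvr[OF step(4)]] by blast
  from H0_step(1)[OF step(4) this step(5)] show ?case .
 qed
 then show ?thesis using H0_mono[OF pos_part(4)[OF assms]] finite_subset by blast
qed

lemma ell_step:
 assumes "D : divisors PX" "P : closed_points PX"
 shows "ell D <= ell (D + single P 1)" "ell (D + single P 1) <= ell D + point_degree \<iota> P"
proof -
 obtain \<pi> where "uniformizer P \<pi>" using dvr.ex_uniformizer[OF place_dvr[OF assms(2)]] by blast
 from H0_step(2,3)[OF assms(2) this finite_H0[OF assms(1)]]
 show "ell D <= ell (D + single P 1)" "ell (D + single P 1) <= ell D + point_degree \<iota> P" by auto
qed

lemma ell_diff:
 assumes "D : divisors PX" "E : divisors PX" "dle D E"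
 shows "ell D <= ell E" "int (ell E) - int (ell D) <= deg E - deg D"
proof -
 have "ell D <= ell E & int (ell E) - int (ell D) <= deg E - deg D"
  using assms
 proof (induction rule: divisor_induct)
  case (step A P)
  then show ?case using ell_step[OF step(1,4)] by (auto simp: div_degree_add)
 qed simp
 then show "ell D <= ell E" "int (ell E) - int (ell D) <= deg E - deg D" by auto
qed

text \<open>Truncated \<pi>-adic expansions with digits in a set of representatives of the residue
  field.\<close>

lemma incongruent_reps:
 assumes P: "P : closed_points PX"
 shows "\<exists>S. S \<subseteq> P & finite S & card S = CARD('k) ^ (point_degree \<iota> P * v) &
  (\<forall>s\<in>S. \<forall>t\<in>S. s - t : vset P (int v) --> s = t)"
proof -
 interpret dvr P by (rule place_dvr[OF P])
 let ?h = "%y. max_ideal P +[P] y"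
 have heq: "?h y = ?h z \<longleftrightarrow> y - z : max_ideal P" for y z
  by (rule coset_eq_iff) (use max_ideal_closed in auto)
 obtain S0 where S0: "S0 \<subseteq> P" "inj_on ?h S0" "?h ` S0 = ?h ` P"
  using subset_image_inj[of "?h ` P" ?h P] by auto
 have fin0: "finite S0" using S0 residue_field_finite(1)[OF P] unfolding carrier_residue_field by (metis finite_image_iff)
 have card0: "card S0 = CARD('k) ^ point_degree \<iota> P"
  using card_image[OF S0(2)] residue_field_finite(2)[OF P] unfolding carrier_residue_field S0(3) by simp
 obtain \<pi> where \<pi>: "uniformizer P \<pi>" using ex_uniformizer by blast
 then have \<pi>0: "\<pi> ~= 0" "val P \<pi> = 1" by (auto simp: uniformizer_iff)
 then have \<pi>m: "\<pi> : max_ideal P" by (simp add: max_ideal_iff)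
 show ?thesis
 proof (induction v)
  case 0
  show ?case by (rule exI[of _ "{0}"]) (auto simp: closed)
 next
  case (Suc v)
  then obtain S where S: "S \<subseteq> P" "finite S" "card S = CARD('k) ^ (point_degree \<iota> P * v)"
   "!!s t. s : S ==> t : S ==> s - t : vset P (int v) ==> s = t" by blast
  let ?g = "%(a, b). a + \<pi> * b"
  have key: "a = a' & b = b'" if ab: "a : S0" "a' : S0" "b : S" "b' : S"
   and c: "(a + \<pi> * b) - (a' + \<pi> * b') : vset P (int (Suc v))" for a a' b b'
  proof -
   have "vset P (int (Suc v)) \<subseteq> vset P 1" by (rule vset_mono) simp
   then have c1: "(a + \<pi> * b) - (a' + \<pi> * b') : max_ideal P" using c by auto
   have "b - b' : P" using ab S(1) by (intro closed(4)) auto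
   then have "\<pi> * (b - b') : max_ideal P" by (rule max_ideal_closed(4)[OF \<pi>m])
   from max_ideal_closed(2)[OF c1 this] have "a - a' : max_ideal P" by (simp add: algebra_simps)
   then have "?h a = ?h a'" unfolding heq .
   then have aa: "a = a'" using inj_onD[OF S0(2) _ ab(1,2)] by blast
   then have "\<pi> * (b - b') : vset P (int (Suc v))" using c by (simp add: algebra_simps)
   then have "b - b' : vset P (int v)" using vset_mult_iff[of \<pi> "b - b'" "int (Suc v)"] \<pi>0 by simp
   then show ?thesis using aa S(4) ab by blast
  qed
  have inj: "inj_on ?g (S0 \<times> S)"
  proof (rule inj_onI)
   fix p p' assume p: "p : S0 \<times> S" "p' : S0 \<times> S" "?g p = ?g p'"
   obtain a b a' b' where e: "p = (a, b)" "p' = (a', b')" by (metis surj_pair)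
   then have "(a + \<pi> * b) - (a' + \<pi> * b') : vset P (int (Suc v))" using p(3) by simp
   then show "p = p'" using key[of a a' b b'] p e by auto
  qed
  show ?case
  proof (intro exI[of _ "?g ` (S0 \<times> S)"] conjI)
   show "?g ` (S0 \<times> S) \<subseteq> P"
   proof clarify
    fix a b assume "a : S0" "b : S"
    then have "a : P" "b : P" using S0 S by auto
    then show "a + \<pi> * b : P" using closed(3,5) max_ideal_closed(5)[OF \<pi>m] by simp
   qed
   show "finite (?g ` (S0 \<times> S))" using fin0 S by auto
   show "card (?g ` (S0 \<times> S)) = CARD('k) ^ (point_degree \<iota> P * Suc v)"
    using card_image[OF inj] by (simp add: card_cartesian_product card0 S power_add)
   show "\<forall>s\<in>?g ` (S0 \<times> S). \<forall>t\<in>?g ` (S0 \<times> S). s - t : vset P (int (Suc v)) --> s = t"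
    using key by fastforce
  qed
 qed
qed

text \<open>Weak approximation combines representatives modulo \<open>P ^ val P x\<close> at all
  zeros in \<open>Z\<close>. The resulting functions are regular on \<open>Z\<close> and incongruent
  modulo \<open>x\<close> in the ring of such functions, so \<open>incongruent_bound\<close> limits
  their number.\<close>

lemma zeros_degree_le:
 assumes x: "x ~: range \<iota>" and Z: "finite Z" "Z \<subseteq> {P : closed_points PX. 0 < val P x}"
 shows "(\<Sum>P\<in>Z. nat (val P x) * point_degree \<iota> P) <= fdeg x"
proof -
 have x0: "x ~= 0" using x by (metis \<iota>_0 rangeI)
 have dv: "!!P. P : Z ==> dvr P" using Z place_dvr by blast
 have ZP: "!!P. P : Z ==> P : closed_points PX" "!!P. P : Z ==> 0 < val P x" using Z by auto
 have "\<exists>S. P : Z --> S \<subseteq> P & finite S & card S = CARD('k) ^ (point_degree \<iota> P * nat (val P x)) &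
  (\<forall>s\<in>S. \<forall>t\<in>S. s - t : vset P (val P x) --> s = t)" for P
  using incongruent_reps[of P "nat (val P x)"] ZP[of P] by (cases "P : Z") auto
 then obtain S where S: "!!P. P : Z ==> S P \<subseteq> P" "!!P. P : Z ==> finite (S P)"
  "!!P. P : Z ==> card (S P) = CARD('k) ^ (point_degree \<iota> P * nat (val P x))"
  "!!P s t. P : Z ==> s : S P ==> t : S P ==> s - t : vset P (val P x) ==> s = t" by metis
 have "\<exists>y. \<forall>P\<in>Z. y - g P : vset P (val P x)" for g
  using weak_approximation[OF Z(1), of g "%P. val P x"] dv by metis
 then obtain Y where Y: "!!g P. P : Z ==> Y g - g P : vset P (val P x)" by metis
 define W where "W = {w. \<forall>P\<in>Z. w : P}"
 have Wr: "subring W ring_of_type_algebra"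
  unfolding subring_rota_iff W_def using dvr.closed(1)[OF dv] dvr.closed(4)[OF dv] dvr.closed(5)[OF dv] by auto
 have WK: "range \<iota> \<subseteq> W" using ZP place_constants by (auto simp: W_def)
 have xW: "x : W" using ZP dvr.mem_iff[OF dv] by (force simp: W_def)
 have inj: "inj_on Y (PiE Z S)" and inc: "!!g h. g : PiE Z S ==> h : PiE Z S ==> Y g - Y h : (*) x ` W ==> g = h"
 proof -
  show inc: "g = h" if gh: "g : PiE Z S" "h : PiE Z S" "Y g - Y h : (*) x ` W" for g h
  proof (rule PiE_ext[OF gh(1,2)])
   fix P assume P: "P : Z"
   interpret dvr P by (rule dv[OF P])
   obtain w where w: "w : W" "Y g - Y h = x * w" using gh(3) by blast
   have "x : vset P (val P x)" by (simp add: vset_def)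
   moreover have "w : vset P 0" using w(1) P by (simp add: W_def)
   ultimately have "Y g - Y h : vset P (val P x)" using vset_mult[of x "val P x" w 0] w(2) by simp
   from vset_diff[OF vset_add[OF this Y[OF P, of h]] Y[OF P, of g]]
   have "g P - h P : vset P (val P x)" by simp
   then show "g P = h P" using S(4)[OF P] gh P by blast
  qed
  show "inj_on Y (PiE Z S)"
  proof (rule inj_onI)
   fix g h assume "g : PiE Z S" "h : PiE Z S" "Y g = Y h"
   moreover have "0 : (*) x ` W" using subring_rotaD(2)[OF Wr] by force
   ultimately show "g = h" using inc by simp
  qed
 qed
 have "card (Y ` PiE Z S) <= CARD('k) ^ fdeg x"
 proof (rule incongruent_bound(2)[OF x, of W])
  show "ksub W" by (rule ksubI_subring[OF Wr WK])
  show "x * w : W" if "w : W" for w using subring_rotaD(5)[OF Wr xW that] .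
  show "Y ` PiE Z S \<subseteq> W"
  proof clarify
   fix g assume g: "g : PiE Z S"
   have "Y g : P" if P: "P : Z" for P
   proof -
    interpret dvr P by (rule dv[OF P])
    have "vset P (val P x) \<subseteq> vset P 0" by (rule vset_mono) (use ZP(2)[OF P] in simp)
    then have "Y g - g P : P" using Y[OF P] by auto
    moreover have "g P : P" using g S(1)[OF P] P by blast
    ultimately show ?thesis using closed(3) by fastforce
   qed
   then show "Y g : W" by (simp add: W_def)
  qed
  show "s = t" if "s : Y ` PiE Z S" "t : Y ` PiE Z S" "s - t : (*) x ` W" for s t
   using that inc by blast
 qed
 then have "CARD('k) ^ (\<Sum>P\<in>Z. nat (val P x) * point_degree \<iota> P) <= CARD('k) ^ fdeg x"
  using card_image[OF inj] card_PiE[OF Z(1), of S] S(3) by (simp add: power_sum mult.commute)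
 then show ?thesis using card_K_gt_1 by simp
qed

lemma point_degree_pos: "P : closed_points PX ==> 0 < point_degree \<iota> P"
proof (rule ccontr)
 assume P: "P : closed_points PX" and "\<not> 0 < point_degree \<iota> P"
 then have c: "card (carrier (residue_field P)) = 1" using residue_field_finite(2)[OF P] by simp
 interpret RF: field "residue_field P"
  by (rule residue_field_field[OF place_dvr[OF P]]) (use place_constants[OF P] in auto)
 have "\<zero>\<^bsub>residue_field P\<^esub> = \<one>\<^bsub>residue_field P\<^esub>" using c RF.zero_closed RF.one_closed by (metis card_1_singletonE singletonD)
 then show False using RF.one_not_zero by simp
qed

lemma finite_zeros: 
 assumes "x ~: range \<iota>" shows "finite {P : closed_points PX. 0 < val P x}"
proof (rule ccontr)
 assume "infinite {P : closed_points PX. 0 < val P x}"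
 then obtain Z where Z: "finite Z" "card Z = Suc (fdeg x)" "Z \<subseteq> {P : closed_points PX. 0 < val P x}"
  using infinite_arbitrarily_large by blast
 have "(\<Sum>P\<in>Z. 1) <= (\<Sum>P\<in>Z. nat (val P x) * point_degree \<iota> P)"
 proof (rule sum_mono)
  fix P assume "P : Z"
  then have "0 < val P x" "0 < point_degree \<iota> P" using Z(3) point_degree_pos by auto
  then have "0 < nat (val P x) * point_degree \<iota> P" by simp
  then show "1 <= nat (val P x) * point_degree \<iota> P" by linarith
 qed
 then show False using zeros_degree_le[OF assms Z(1,3)] Z(2) by simp
qed

end

section \<open>Principal divisors have degree zero\<close>

context curve
begin

lemma inverse_not_constant: "x ~: range \<iota> ==> inverse x ~: range \<iota>"
proof
 assume "x ~: range \<iota>" "inverse x : range \<iota>"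
 then obtain a where "inverse x = \<iota> a" by blast
 then have "x = \<iota> (inverse a)" by (metis \<iota>_inverse inverse_inverse_eq)
 then show False using \<open>x ~: range \<iota>\<close> by blast
qed

lemma val_constant: "P : closed_points PX ==> a ~= 0 ==> val P (\<iota> a) = 0"
proof -
 assume P: "P : closed_points PX" and a: "a ~= 0"
 have "\<iota> a : P" "inverse (\<iota> a) : P" using place_constants[OF P, of a] place_constants[OF P, of "inverse a"] by simp_all
 then have "\<iota> a : P - max_ideal P" using a unfolding dvr.unit_iff[OF place_dvr[OF P]] by simp
 then show ?thesis by (rule dvr.val_unit[OF place_dvr[OF P]])
qed

lemma finite_val_support:
 assumes "x ~= 0" shows "finite {P : closed_points PX. val P x ~= 0}"
proof (cases "x : range \<iota>")
 case True
 then obtain a where a: "x = \<iota> a" "a ~= 0" using assms by auto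
 have "{P : closed_points PX. val P x ~= 0} = {}" using val_constant a by auto
 then show ?thesis by (simp only: finite.emptyI)
next
 case False
 have "val P (inverse x) = - val P x" if "P : closed_points PX" for P
  using dvr.val_inverse[OF place_dvr[OF that] assms] .
 then have "{P : closed_points PX. val P x ~= 0} =
   {P : closed_points PX. 0 < val P x} \<union> {P : closed_points PX. 0 < val P (inverse x)}" by fastforce
 then show ?thesis using finite_zeros[OF False] finite_zeros[OF inverse_not_constant[OF False]] by simp
qed

text \<open>\<open>val\<close> carries no information off the closed points, so these get
  multiplicity zero.\<close>

definition prin :: "'f => 'f divisor" where
 "prin x = Abs_poly_mapping (%P. if P : closed_points PX then val P x else 0)"

lemma prin:
 assumes "x ~= 0"
 shows "P : closed_points PX ==> lookup (prin x) P = val P x" "prin x : divisors PX"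
proof -
 let ?f = "%P. if P : closed_points PX then val P x else 0"
 have "{P. ?f P ~= 0} = {P : closed_points PX. val P x ~= 0}" by auto
 then have fin: "finite {P. ?f P ~= 0}" using finite_val_support[OF assms] by simp
 have z: "?f P = 0" if "P ~: closed_points PX" for P using that by simp
 note d = divisor_of_function[OF fin z]
 show "lookup (prin x) P = val P x" if "P : closed_points PX"
  using that by (simp add: prin_def d(1))
 show "prin x : divisors PX" unfolding prin_def by (rule d(2))
qed

lemma lookup_outside: "D : divisors PX ==> P ~: closed_points PX ==> lookup D P = 0"
 by (metis (no_types, lifting) divisors_def in_keys_iff mem_Collect_eq subsetD)

lemma dleI:
 assumes "D : divisors PX" "E : divisors PX"
  "!!P. P : closed_points PX ==> lookup D P <= lookup E P"
 shows "dle D E"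
 unfolding dle_def
proof
 fix P show "lookup D P <= lookup E P"
  using assms lookup_outside[OF assms(1), of P] lookup_outside[OF assms(2), of P]
  by (cases "P : closed_points PX") auto
qed

lemma divisor_eqI:
 assumes "D : divisors PX" "E : divisors PX"
  "!!P. P : closed_points PX ==> lookup D P = lookup E P"
 shows "D = E"
proof (rule poly_mapping_eqI)
 fix P show "lookup D P = lookup E P"
  using assms lookup_outside[OF assms(1), of P] lookup_outside[OF assms(2), of P]
  by (cases "P : closed_points PX") auto
qed

lemma H0_mult_iff:
 assumes "x ~= 0" shows "f : H0 PX (D + prin x) \<longleftrightarrow> x * f : H0 PX D"
proof -
 have "f : vset P (- lookup (D + prin x) P) \<longleftrightarrow> x * f : vset P (- lookup D P)"
  if "P : closed_points PX" for P
 proof -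
  have "- lookup (D + prin x) P = - lookup D P - val P x"
   using prin(1)[OF assms that] by (simp add: lookup_add)
  then show ?thesis using dvr.vset_mult_iff[OF place_dvr[OF that] assms] by simp
 qed
 then show ?thesis by (auto simp: H0_iff)
qed

lemma ell_prin:
 assumes D: "D : divisors PX" and x: "x ~= 0" shows "ell (D + prin x) = ell D"
proof -
 have "bij_betw ((*) x) (H0 PX (D + prin x)) (H0 PX D)"
 proof (rule bij_betwI[of _ _ _ "%f. f / x"])
  show "(%f. f / x) : H0 PX D \<rightarrow> H0 PX (D + prin x)" using H0_mult_iff[OF x] x by auto
 qed (use H0_mult_iff[OF x] x in auto)
 then have "card (H0 PX (D + prin x)) = card (H0 PX D)" by (rule bij_betw_same_card)
 then have "CARD('k) ^ ell (D + prin x) = CARD('k) ^ ell D"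
  using card_H0[OF finite_H0[OF D]] card_H0[OF finite_H0[OF divisors_add[OF D prin(2)[OF x]]]] by simp
 then show ?thesis using card_K_gt_1 power_inject_exp by blast
qed

definition pole_divisor :: "'f => 'f divisor" where
 "pole_divisor x = (if x = 0 then 0 else pos_part (- prin x))"

lemma pole_divisor:
 shows "x ~= 0 ==> P : closed_points PX ==> lookup (pole_divisor x) P = max 0 (- val P x)"
  "pole_divisor x : divisors PX" "dle 0 (pole_divisor x)" "x : H0 PX (pole_divisor x)"
proof -
 have d: "- prin x : divisors PX" if "x ~= 0" using divisors_uminus prin(2)[OF that] by blast
 have lk: "lookup (pole_divisor x) P = max 0 (- val P x)" if "x ~= 0" "P : closed_points PX" for P
  using pos_part(1)[OF d[OF that(1)], of P] prin(1)[OF that] that(1) by (simp add: pole_divisor_def lookup_uminus)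
 then show "x ~= 0 ==> P : closed_points PX ==> lookup (pole_divisor x) P = max 0 (- val P x)" .
 show "pole_divisor x : divisors PX" "dle 0 (pole_divisor x)"
  using pos_part(2,3)[OF d] by (auto simp: pole_divisor_def)
 show "x : H0 PX (pole_divisor x)" unfolding H0_def using lk by auto
qed

lemma pole_degree:
 assumes "x ~= 0"
 shows "deg (pole_divisor x) = (\<Sum>P\<in>{P : closed_points PX. 0 < val P (inverse x)}. int (nat (val P (inverse x)) * point_degree \<iota> P))"
proof -
 let ?Z = "{P : closed_points PX. 0 < val P (inverse x)}"
 have vi: "val P (inverse x) = - val P x" if "P : closed_points PX" for P
  using dvr.val_inverse[OF place_dvr[OF that] assms] .
 have sub: "?Z \<subseteq> {P : closed_points PX. val P x ~= 0}" using vi by auto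
 have fin: "finite ?Z" using finite_subset[OF sub finite_val_support[OF assms]] .
 have keys: "keys (pole_divisor x) \<subseteq> ?Z"
 proof
  fix P assume P: "P : keys (pole_divisor x)"
  then have "P : closed_points PX" using pole_divisor(2)[of x] by (auto simp: divisors_def)
  then show "P : ?Z" using P pole_divisor(1)[OF assms, of P] vi[of P] by (auto simp: in_keys_iff)
 qed
 show ?thesis unfolding div_degree_superset[OF fin keys]
  by (rule sum.cong) (auto simp: pole_divisor(1)[OF assms] vi)
qed

lemma lookup_scale: "lookup (\<Sum>i<(l::nat). D) P = int l * lookup D P"
 by (induction l) (auto simp: lookup_add distrib_right)

text \<open>With \<open>u\<close> a basis over \<open>K(x)\<close>, the products
  \<open>x ^ j * u i\<close> for \<open>j\<close> up to \<open>l\<close> are independent over K;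
  \<open>C\<close> absorbs the poles of the \<open>u i\<close>.\<close>

lemma ell_multiple_pole:
 assumes x: "x ~: range \<iota>"
 obtains C where "C : divisors PX" "dle 0 C"
  "!!l. (l + 1) * fdeg x <= ell ((\<Sum>i<l. pole_divisor x) + C)"
proof -
 let ?N = "fdeg x" and ?B = "pole_divisor x"
 have x0: "x ~= 0" using x by (metis \<iota>_0 rangeI)
 obtain u where u: "!!p. (\<Sum>i<?N. ev x (p i) * u i) = 0 ==> (\<forall>i<?N. p i = 0)"
  by (rule basis_fdeg[OF x]) (erule that)
 define C where "C = (\<Sum>i<?N. pole_divisor (u i))"
 have C: "C : divisors PX" unfolding C_def by (intro divisors_sum pole_divisor)
 have lkC: "lookup C P = (\<Sum>i<?N. lookup (pole_divisor (u i)) P)" for P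
  by (simp add: C_def lookup_sum)
 have nn: "0 <= lookup (pole_divisor y) P" for y P
  using pole_divisor(3)[of y] by (simp add: dle_def)
 have C0: "dle 0 C" unfolding dle_def lkC using nn by (auto intro: sum_nonneg)
 have uC: "u i : H0 PX C" if "i < ?N" for i
 proof -
  have "dle (pole_divisor (u i)) C" unfolding dle_def lkC
  proof
   fix P show "lookup (pole_divisor (u i)) P <= (\<Sum>i<?N. lookup (pole_divisor (u i)) P)"
    using that nn by (intro member_le_sum) auto
  qed
  then show ?thesis using H0_mono pole_divisor(4) by blast
 qed
 have "(l + 1) * ?N <= ell ((\<Sum>i<l. ?B) + C)" for l
 proof -
  let ?E = "(\<Sum>i<l. ?B) + C"
  have E: "?E : divisors PX" by (intro divisors_add divisors_sum pole_divisor C)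
  have xj: "x ^ j * u i : H0 PX ?E" if j: "j <= l" and i: "i < ?N" for i j
   unfolding H0_iff
  proof
   fix P assume P: "P : closed_points PX"
   interpret dvr P by (rule place_dvr[OF P])
   have "int j * - val P x <= int j * max 0 (- val P x)" by (intro mult_left_mono) auto
   moreover have "int j * max 0 (- val P x) <= int l * max 0 (- val P x)" using j by (intro mult_right_mono) auto
   ultimately have "int j * - val P x <= int l * max 0 (- val P x)" by linarith
   then have "- (int l * max 0 (- val P x)) <= int j * val P x" by simp
   then have "x ^ j : vset P (- (int l * max 0 (- val P x)))" using x0 by (simp add: vset_def val_power)
   moreover have "u i : vset P (- lookup C P)" using uC[OF i] P by (auto simp: H0_iff)
   ultimately have "x ^ j * u i : vset P (- (int l * max 0 (- val P x)) + - lookup C P)"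
    by (rule vset_mult)
   then show "x ^ j * u i : vset P (- lookup ?E P)"
    by (simp only: lookup_add lookup_scale pole_divisor(1)[OF x0 P] minus_add_distrib)
  qed
  let ?I = "{..<?N} \<times> {..l}"
  define g where "g c = (\<Sum>(i, j)\<in>?I. \<iota> (c (i, j)) * (x ^ j * u i))" for c :: "nat \<times> nat => 'k"
  have evm: "ev x (Polynomial.monom a j) = \<iota> a * x ^ j" for a j
   by (induction j) (auto simp: monom_0 monom_Suc)
  have gev: "g c = (\<Sum>i<?N. ev x (\<Sum>j\<le>l. Polynomial.monom (c (i, j)) j) * u i)" for c
   unfolding g_def by (simp add: sum.cartesian_product[symmetric] evm sum_distrib_right mult.assoc)
  have "inj_on g (PiE ?I (%_. UNIV))"
  proof (rule inj_onI)
   fix c d assume cd: "c : PiE ?I (%_. UNIV)" "d : PiE ?I (%_. UNIV)" "g c = g d"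
   have "(\<Sum>i<?N. ev x ((\<Sum>j\<le>l. Polynomial.monom (c (i, j)) j) - (\<Sum>j\<le>l. Polynomial.monom (d (i, j)) j)) * u i) = 0"
    using cd(3) unfolding gev by (simp add: left_diff_distrib sum_subtractf)
   from u[OF this] have eq: "(\<Sum>j\<le>l. Polynomial.monom (c (i, j)) j) = (\<Sum>j\<le>l. Polynomial.monom (d (i, j)) j)"
    if "i < ?N" for i using that by simp
   have co: "coeff (\<Sum>j\<le>l. Polynomial.monom (e (i, j)) j) m = e (i, m)" if "m <= l" for e :: "nat \<times> nat => 'k" and i m
    using that by (simp add: coeff_sum)
   show "c = d"
   proof (rule PiE_ext[OF cd(1,2)])
    fix p assume "p : ?I"
    then obtain i m where p: "p = (i, m)" "i < ?N" "m <= l" by auto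
    then show "c p = d p" using co[of m c i] co[of m d i] eq[of i] by simp
   qed
  qed
  moreover have "g ` PiE ?I (%_. UNIV) \<subseteq> H0 PX ?E"
  proof clarify
   fix c show "g c : H0 PX ?E" unfolding g_def
    by (rule ksubD(6)[OF ksub_H0]) (use xj ksubD(3)[OF ksub_H0] in auto)
  qed
  ultimately have "card (PiE ?I (%_. UNIV :: 'k set)) <= card (H0 PX ?E)"
   using card_inj_on_le finite_H0[OF E] by blast
  then have "CARD('k) ^ (?N * (l + 1)) <= CARD('k) ^ ell ?E"
   using card_H0[OF finite_H0[OF E]] by (simp add: card_PiE)
  then have "?N * (l + 1) <= ell ?E" using card_K_gt_1 power_le_imp_le_exp by blast
  then show ?thesis by (simp add: mult.commute)
 qed
 then show ?thesis using that C C0 by blast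
qed

lemma deg_scale: "deg (\<Sum>i<(l::nat). D) = int l * deg D"
 by (simp add: div_degree_sum)

lemma ell_le_deg: "D : divisors PX ==> dle 0 D ==> int (ell D) <= deg D + 1"
 using ell_diff(2)[OF divisors_zero, of D] ell_zero by simp

text \<open>Compare growth in \<open>l\<close>: the sections of \<open>l B + C\<close> have
  dimension at least \<open>(l + 1) * fdeg x\<close> and at most
  \<open>l deg B + deg C + 1\<close>.\<close>

lemma fdeg_le_pole_degree:
 assumes x: "x ~: range \<iota>" shows "int (fdeg x) <= deg (pole_divisor x)"
proof (rule ccontr)
 assume "\<not> ?thesis"
 then have lt: "deg (pole_divisor x) + 1 <= int (fdeg x)" by simp
 obtain C where C: "C : divisors PX" "dle 0 C" "!!l. (l + 1) * fdeg x <= ell ((\<Sum>i<l. pole_divisor x) + C)"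
  by (rule ell_multiple_pole[OF x]) blast
 define l where "l = nat (deg C + 1)"
 let ?E = "(\<Sum>i<l. pole_divisor x) + C"
 have B: "pole_divisor x : divisors PX" "dle 0 (pole_divisor x)" by (rule pole_divisor)+
 have E: "?E : divisors PX" by (intro divisors_add divisors_sum B C)
 have "dle 0 ?E" using B(2) C(2) unfolding dle_def lookup_add lookup_scale by simp
 then have "int (ell ?E) <= int l * deg (pole_divisor x) + deg C + 1"
  using ell_le_deg[OF E] by (simp add: div_degree_add deg_scale)
 moreover have "int ((l + 1) * fdeg x) <= int (ell ?E)" using C(3)[of l] by linarith
 moreover have "(int l + 1) * (deg (pole_divisor x) + 1) <= (int l + 1) * int (fdeg x)"
  using lt by (intro mult_left_mono) auto
 moreover have "0 <= deg (pole_divisor x)" using div_degree_mono[OF B(2), of \<iota>] by simp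
 moreover have "deg C + 1 <= int l" by (simp add: l_def)
 ultimately show False by (simp add: algebra_simps)
qed

text \<open>The two bounds, applied to \<open>x\<close> and to \<open>inverse x\<close>, form a
  closed chain of inequalities.\<close>

lemma deg_pole_divisor:
 assumes x: "x ~: range \<iota>" shows "deg (pole_divisor x) = int (fdeg x)" "deg (pole_divisor (inverse x)) = int (fdeg x)"
proof -
 have x0: "x ~= 0" using x by (metis \<iota>_0 rangeI)
 have up: "deg (pole_divisor (inverse y)) <= int (fdeg y)" if y: "y ~: range \<iota>" for y
 proof -
  have y0: "inverse y ~= 0" using y by (metis \<iota>_0 rangeI inverse_nonzero_iff_nonzero)
  show ?thesis using zeros_degree_le[OF y finite_zeros[OF y] order_refl]
   unfolding pole_degree[OF y0] inverse_inverse_eq of_nat_sum[symmetric] by (simp only: of_nat_le_iff)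
 qed
 have "deg (pole_divisor x) <= int (fdeg (inverse x))" using up[OF inverse_not_constant[OF x]] by simp
 moreover have "int (fdeg (inverse x)) <= deg (pole_divisor (inverse x))"
  by (rule fdeg_le_pole_degree[OF inverse_not_constant[OF x]])
 moreover have "deg (pole_divisor (inverse x)) <= int (fdeg x)" by (rule up[OF x])
 moreover have "int (fdeg x) <= deg (pole_divisor x)" by (rule fdeg_le_pole_degree[OF x])
 ultimately show "deg (pole_divisor x) = int (fdeg x)" "deg (pole_divisor (inverse x)) = int (fdeg x)" by auto
qed

lemma deg_prin: assumes x: "x ~= 0" shows "deg (prin x) = 0"
proof (cases "x : range \<iota>")
 case True
 then obtain a where a: "x = \<iota> a" "a ~= 0" using x by auto
 have v: "val P x = 0" if "P : closed_points PX" for P using val_constant a that by simp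
 have "prin x = 0" by (rule divisor_eqI) (simp_all add: prin(2)[OF x] prin(1)[OF x] v)
 then show ?thesis by simp
next
 case False
 have x': "inverse x ~= 0" using x by simp
 have "prin x = pole_divisor (inverse x) - pole_divisor x"
 proof (rule divisor_eqI)
  fix P assume P: "P : closed_points PX"
  show "lookup (prin x) P = lookup (pole_divisor (inverse x) - pole_divisor x) P"
   using dvr.val_inverse[OF place_dvr[OF P] x] by (simp add: lookup_minus pole_divisor(1)[OF x P] pole_divisor(1)[OF x' P] prin(1)[OF x P])
 qed (intro prin x divisors_diff pole_divisor)+
 then show ?thesis using deg_pole_divisor[OF False] by (simp add: div_degree_diff)
qed

lemma H0_deg_neg:
 assumes D: "D : divisors PX" and neg: "deg D < 0" shows "H0 PX D = {0}"
proof -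
 have "f = 0" if f: "f : H0 PX D" for f
 proof (rule ccontr)
  assume f0: "f ~= 0"
  have "dle 0 (D + prin f)"
  proof (rule dleI)
   show "D + prin f : divisors PX" by (intro divisors_add D prin f0)
   fix P assume "P : closed_points PX"
   then show "lookup 0 P <= lookup (D + prin f) P"
    using f f0 by (simp add: lookup_add prin(1)[OF f0] H0_def add.commute)
  qed simp
  then show False using div_degree_mono[of 0 "D + prin f" \<iota>] neg by (simp add: div_degree_add deg_prin[OF f0])
 qed
 then show ?thesis using ksubD(1)[OF ksub_H0] by blast
qed

section \<open>Riemann's theorem and the genus\<close>

lemma exists_transcendental: obtains x where "x ~: range \<iota>"
proof -
 have dom: "domain (ring_of_type_algebra :: 'f ring)"
  using field.axioms(1)[OF field_from_type_algebra] .
 obtain t where t: "ring.transcendental ring_of_type_algebra (range \<iota>) t"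
  using curve unfolding smooth_projective_curve_def trdeg_one_def by blast
 have "t ~: range \<iota>"
  using domain.algebraic_self[OF dom subfieldE(1)[OF subfield_\<iota>]] t by (auto simp: over_def)
 then show ?thesis using that by blast
qed

text \<open>The excess \<open>deg - ell\<close> is bounded on multiples of a pole divisor
  \<open>B\<close>. It grows with the divisor and is invariant under linear equivalence, and every
  divisor is linearly equivalent to one whose positive part lies below some
  \<open>l B\<close>.\<close>

lemma Riemann: "\<exists>\<gamma>. \<forall>D\<in>divisors PX. deg D - int (ell D) <= \<gamma>"
proof -
 obtain x where x: "x ~: range \<iota>" by (rule exists_transcendental)
 let ?B = "pole_divisor x"
 have B: "?B : divisors PX" "dle 0 ?B" by (rule pole_divisor)+
 have lB: "(\<Sum>i<l. ?B) : divisors PX" for l :: nat by (intro divisors_sum B)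
 obtain C where C: "C : divisors PX" "dle 0 C" "!!l. (l + 1) * fdeg x <= ell ((\<Sum>i<l. ?B) + C)"
  by (rule ell_multiple_pole[OF x]) blast
 define \<gamma> where "\<gamma> = deg C"
 have bl: "deg (\<Sum>i<l. ?B) - int (ell (\<Sum>i<l. ?B)) <= \<gamma>" for l :: nat
 proof -
  have le: "dle (\<Sum>i<l. ?B) ((\<Sum>i<l. ?B) + C)" using C(2) by (simp add: dle_def lookup_add)
  have "int (ell ((\<Sum>i<l. ?B) + C)) - int (ell (\<Sum>i<l. ?B)) <= deg C"
   using ell_diff(2)[OF lB divisors_add[OF lB C(1)] le] by (simp add: div_degree_add)
  moreover have "int ((l + 1) * fdeg x) <= int (ell ((\<Sum>i<l. ?B) + C))" using C(3)[of l] by linarith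
  moreover have "int ((l + 1) * fdeg x) = int l * int (fdeg x) + int (fdeg x)" by (simp add: algebra_simps)
  ultimately show ?thesis unfolding deg_scale \<gamma>_def deg_pole_divisor(1)[OF x] by linarith
 qed
 have Bpos: "1 <= deg ?B"
 proof -
  have x0: "inverse x ~= 0" using x by (metis \<iota>_0 rangeI inverse_nonzero_iff_nonzero)
  obtain P where P: "P : closed_points PX" "x : max_ideal P" by (rule exists_zero[OF x])
  interpret dvr P by (rule place_dvr[OF P(1)])
  have v: "0 < val P x" using P(2) x0 by (auto simp: max_ideal_iff)
  have "single P 1 : divisors PX" using P(1) by (rule divisors_single)
  have "dle (single P 1) (pole_divisor (inverse x))"
  proof (rule dleI)
   fix Q assume Q: "Q : closed_points PX"
   have "val P (inverse x) = - val P x" using val_inverse x0 by simp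
   then show "lookup (single P 1) Q <= lookup (pole_divisor (inverse x)) Q"
    unfolding pole_divisor(1)[OF x0 Q] using v by (auto simp: lookup_single when_def)
  qed (intro pole_divisor divisors_single P)+
  from div_degree_mono[OF this, of \<iota>] have "int (point_degree \<iota> P) <= int (fdeg x)" by (simp add: deg_pole_divisor[OF x])
  then show ?thesis using point_degree_pos[OF P(1)] by (simp add: deg_pole_divisor[OF x])
 qed
 have "deg D - int (ell D) <= \<gamma>" if D: "D : divisors PX" for D
 proof -
  let ?D = "pos_part D"
  have D': "?D : divisors PX" "dle 0 ?D" "dle D ?D" by (rule pos_part[OF D])+
  \<comment> \<open>By \<open>bl\<close>, \<open>ell (l B)\<close> is then larger than
    \<open>deg ?D\<close>, which is the most that subtracting \<open>?D\<close> can cost. So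
    \<open>l B - ?D\<close> has a nonzero section.\<close>
  define l where "l = nat (\<gamma> + deg ?D + 1)"
  let ?L = "\<Sum>i<l. ?B"
  have dL: "?L - ?D : divisors PX" by (rule divisors_diff[OF lB D'(1)])
  have le: "dle (?L - ?D) ?L" using D'(2) by (simp add: dle_def lookup_minus)
  have "int (ell ?L) - int (ell (?L - ?D)) <= deg ?D"
   using ell_diff(2)[OF dL lB le] by (simp add: div_degree_diff)
  moreover have "int l * 1 <= int l * deg ?B" using Bpos by (intro mult_left_mono) auto
  moreover have "int l * deg ?B - int (ell ?L) <= \<gamma>" using bl[of l] by (simp add: deg_scale)
  moreover have "\<gamma> + deg ?D + 1 <= int l" by (simp add: l_def)
  ultimately have "0 < ell (?L - ?D)" by linarith
  then have "card (H0 PX (?L - ?D)) ~= 1"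
   using card_H0[OF finite_H0[OF dL]] card_K_gt_1 by simp
  then have "H0 PX (?L - ?D) ~= {0}" by auto
  then obtain z where z: "z : H0 PX (?L - ?D)" "z ~= 0" using ksubD(1)[OF ksub_H0] by blast
  have Dz: "?D + prin (inverse z) : divisors PX" using z by (intro divisors_add D' prin) auto
  have "dle (?D + prin (inverse z)) ?L"
  proof (rule dleI[OF Dz lB])
   fix P assume P: "P : closed_points PX"
   have z': "inverse z ~= 0" using z by simp
   have "0 <= val P z + lookup (?L - ?D) P" using z P by (auto simp: H0_def)
   then show "lookup (?D + prin (inverse z)) P <= lookup ?L P"
    unfolding lookup_add prin(1)[OF z' P] dvr.val_inverse[OF place_dvr[OF P] z(2)] lookup_minus by linarith
  qed
  from ell_diff(2)[OF Dz lB this] have "deg ?D - int (ell ?D) <= deg ?L - int (ell ?L)"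
   using z(2) ell_prin[OF D'(1), of "inverse z"] by (simp add: div_degree_add deg_prin)
  moreover have "deg D - int (ell D) <= deg ?D - int (ell ?D)" using ell_diff(2)[OF D D'(1,3)] by simp
  ultimately show ?thesis using bl[of l] by linarith
 qed
 then show ?thesis by blast
qed

abbreviation gen :: nat where "gen \<equiv> genus \<iota> PX"

text \<open>\<open>Riemann\<close> bounds the set whose greatest element defines the genus, and the
  zero divisor shows that it contains 0.\<close>

lemma genus_bound: "D : divisors PX ==> deg D - int (ell D) + 1 <= int gen"
 and genus_attained: "\<exists>D\<in>divisors PX. int gen = deg D - int (ell D) + 1"
proof -
 let ?Q = "%g. \<exists>D\<in>divisors PX. int g = deg D - int (ell D) + 1"
 obtain \<gamma> where \<gamma>: "!!D. D : divisors PX ==> deg D - int (ell D) <= \<gamma>" using Riemann by blast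
 have b: "\<forall>g. ?Q g --> g <= nat (\<gamma> + 1)" using \<gamma> by fastforce
 have Q0: "?Q 0" by (rule bexI[of _ 0]) (auto simp: ell_zero)
 show "?Q gen" unfolding genus_def by (rule GreatestI_nat[of ?Q 0 "nat (\<gamma> + 1)"]) (use Q0 b in blast)+
 show "deg D - int (ell D) + 1 <= int gen" if D: "D : divisors PX"
 proof (cases "deg D - int (ell D) + 1 \<ge> 0")
  case True
  then have "?Q (nat (deg D - int (ell D) + 1))" using D by (intro bexI[of _ D]) auto
  then have "nat (deg D - int (ell D) + 1) <= gen" unfolding genus_def
   by (rule Greatest_le_nat[of ?Q _ "nat (\<gamma> + 1)"]) (use b in blast)
  then show ?thesis by linarith
 qed simp
qed

end

subsection \<open>Repartitions and Weil differentials\<close>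

context curve
begin

text \<open>Repartitions take values in the function field itself; no completions are needed.\<close>

definition reps :: "'f divisor => ('f set => 'f) set" where
 "reps D = {\<alpha>. \<forall>P\<in>closed_points PX. \<alpha> P : vset P (- lookup D P)}"

text \<open>Values at sets that are not closed points are left free. As \<open>reps\<close> ignores
  them too, a Weil differential does not depend on them.\<close>

definition adeles :: "('f set => 'f) set" where
 "adeles = (\<Union>D\<in>divisors PX. reps D)"

lemma reps_mono: "dle D E ==> reps D \<subseteq> reps E"
proof
 fix \<alpha> assume *: "dle D E" "\<alpha> : reps D"
 have "\<alpha> P : vset P (- lookup E P)" if P: "P : closed_points PX" for P
 proof -
  have "vset P (- lookup D P) \<subseteq> vset P (- lookup E P)"
   by (rule dvr.vset_mono[OF place_dvr[OF P]]) (use * in \<open>simp add: dle_def\<close>)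
  then show ?thesis using * P unfolding reps_def by blast
 qed
 then show "\<alpha> : reps E" by (simp add: reps_def)
qed

lemma reps_add: "\<alpha> : reps D ==> \<beta> : reps D ==> (%P. \<alpha> P + \<beta> P) : reps D"
 unfolding reps_def using dvr.vset_add[OF place_dvr] by simp

lemma reps_diff: "\<alpha> : reps D ==> \<beta> : reps D ==> (%P. \<alpha> P - \<beta> P) : reps D"
 unfolding reps_def using dvr.vset_diff[OF place_dvr] by simp

lemma reps_const_iff: "(%_. f) : reps D \<longleftrightarrow> f : H0 PX D"
 by (simp add: reps_def H0_iff)

lemma reps_zero: "(%_. 0) : reps D"
 unfolding reps_const_iff by (rule ksubD(1)[OF ksub_H0])

lemma H0_mult: "f : H0 PX D ==> g : H0 PX E ==> f * g : H0 PX (D + E)"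
 unfolding H0_iff lookup_add using dvr.vset_mult[OF place_dvr] by (simp, fastforce)

lemma reps_mult: "f : H0 PX D ==> \<alpha> : reps E ==> (%P. f * \<alpha> P) : reps (D + E)"
 unfolding reps_def H0_iff lookup_add using dvr.vset_mult[OF place_dvr] by (simp, fastforce)

definition dsup :: "'f divisor => 'f divisor => 'f divisor" where
 "dsup D E = D + pos_part (E - D)"

lemma dsup:
 assumes "D : divisors PX" "E : divisors PX"
 shows "dsup D E : divisors PX" "lookup (dsup D E) P = max (lookup D P) (lookup E P)"
  "dle D (dsup D E)" "dle E (dsup D E)"
proof -
 note pp = pos_part[OF divisors_diff[OF assms(2,1)]]
 show "dsup D E : divisors PX" unfolding dsup_def by (intro divisors_add assms pp)
 have lk: "lookup (dsup D E) P = max (lookup D P) (lookup E P)" for P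
  by (simp add: dsup_def lookup_add pp(1) lookup_minus)
 then show "lookup (dsup D E) P = max (lookup D P) (lookup E P)" .
 show "dle D (dsup D E)" "dle E (dsup D E)" by (auto simp: dle_def lk)
qed

lemma adeles_common:
 assumes "\<alpha> : adeles" "\<beta> : adeles"
 obtains D where "D : divisors PX" "\<alpha> : reps D" "\<beta> : reps D"
proof -
 obtain D E where DE: "D : divisors PX" "E : divisors PX" "\<alpha> : reps D" "\<beta> : reps E"
  using assms by (auto simp: adeles_def)
 note s = dsup[OF DE(1,2)]
 have "\<alpha> : reps (dsup D E)" "\<beta> : reps (dsup D E)"
  using DE reps_mono[OF s(3)] reps_mono[OF s(4)] by auto
 then show ?thesis using that s(1) by blast
qed

lemma adelesI: "D : divisors PX ==> \<alpha> : reps D ==> \<alpha> : adeles"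
 by (auto simp: adeles_def)

lemma adeles_add: "\<alpha> : adeles ==> \<beta> : adeles ==> (%P. \<alpha> P + \<beta> P) : adeles"
 by (rule adeles_common[of \<alpha> \<beta>]) (auto intro: adelesI reps_add)

lemma adeles_diff: "\<alpha> : adeles ==> \<beta> : adeles ==> (%P. \<alpha> P - \<beta> P) : adeles"
 by (rule adeles_common[of \<alpha> \<beta>]) (auto intro: adelesI reps_diff)

lemma adeles_mult: "\<alpha> : adeles ==> (%P. f * \<alpha> P) : adeles"
proof -
 assume "\<alpha> : adeles"
 then obtain D where "D : divisors PX" "\<alpha> : reps D" by (auto simp: adeles_def)
 then show ?thesis using reps_mult[OF pole_divisor(4)] adelesI[OF divisors_add[OF pole_divisor(2)]] by blast
qed

lemma adeles_const: "(%_. f) : adeles"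
 using adelesI[OF pole_divisor(2)] reps_const_iff pole_divisor(4) by blast

lemma adeles_sum: "(!!i. i : I ==> h i : adeles) ==> (%P. \<Sum>i\<in>I. h i P) : adeles"
 by (induction I rule: infinite_finite_induct) (auto intro: adeles_add adeles_const)

lemma adeles_local: "P : closed_points PX ==> (%Q. if Q = P then f else 0) : adeles"
proof -
 assume P: "P : closed_points PX"
 have "(%Q. if Q = P then f else 0) : reps (pole_divisor f)"
  using pole_divisor(4)[of f] dvr.zero_vset[OF place_dvr] by (auto simp: reps_def H0_iff)
 then show ?thesis using adelesI pole_divisor(2) by blast
qed

text \<open>The vanishing of \<open>H^1(D)\<close>, read as the quotient of all repartitions by
  those in \<open>reps D\<close> and the constant ones.\<close>

definition covers :: "'f divisor => bool" where
 "covers D \<longleftrightarrow> (\<forall>\<alpha>\<in>adeles. \<exists>f. (%P. \<alpha> P - f) : reps D)"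

definition leadv :: "'f divisor => 'f set => 'f => 'f => 'f" where
 "leadv D P \<pi> f = \<pi> powi (lookup D P + 1) * f"

lemma lead_mod:
 assumes P: "P : closed_points PX" and \<pi>: "uniformizer P \<pi>"
 shows "lead D P \<pi> f = lead D P \<pi> g \<longleftrightarrow> f - g : vset P (- lookup D P)"
  "f : vset P (- lookup D P - 1) ==> lead D P \<pi> f : carrier (residue_field P)"
proof -
 interpret dvr P by (rule place_dvr[OF P])
 let ?c = "\<pi> powi (lookup D P + 1)"
 have c: "?c ~= 0" "val P ?c = lookup D P + 1"
  using \<pi> by (auto simp: uniformizer_iff val_powi)
 have "lead D P \<pi> f = lead D P \<pi> g \<longleftrightarrow> ?c * f - ?c * g : max_ideal P"
  unfolding lead_def by (rule coset_eq_iff) (use max_ideal_closed in auto)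
 also have "\<dots> \<longleftrightarrow> ?c * (f - g) : vset P 1" by (simp add: algebra_simps)
 also have "\<dots> \<longleftrightarrow> f - g : vset P (- lookup D P)" by (subst vset_mult_iff) (use c in auto)
 finally show "lead D P \<pi> f = lead D P \<pi> g \<longleftrightarrow> f - g : vset P (- lookup D P)" .
 assume f: "f : vset P (- lookup D P - 1)"
 have "?c * f : vset P 0" by (subst vset_mult_iff) (use c f in auto)
 then show "lead D P \<pi> f : carrier (residue_field P)" by (simp add: lead_def carrier_residue_field)
qed

lemma H0_single_local:
 assumes "P : closed_points PX" "f : H0 PX (D + single P 1)"
 shows "f : vset P (- lookup D P - 1)"
 using assms by (auto simp: H0_iff lookup_add)

lemma reps_single:
 assumes P: "P : closed_points PX" and \<alpha>: "\<alpha> : reps (D + single P 1)"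
 shows "\<alpha> P : vset P (- lookup D P - 1)"
  "\<alpha> P : vset P (- lookup D P) ==> \<alpha> : reps D"
proof -
 have v: "\<alpha> Q : vset Q (- lookup D Q - (if Q = P then 1 else 0))" if "Q : closed_points PX" for Q
  using \<alpha> that unfolding reps_def by (auto simp: lookup_add lookup_single when_def)
 show "\<alpha> P : vset P (- lookup D P - 1)" using v[OF P] by simp
 assume "\<alpha> P : vset P (- lookup D P)"
 then show "\<alpha> : reps D" unfolding reps_def using v by (auto split: if_splits) (metis diff_zero)
qed

lemma excess_mono:
 assumes "D : divisors PX" "E : divisors PX" "dle D E"
 shows "deg D - int (ell D) <= deg E - int (ell E)"
 using ell_diff(2)[OF assms] by simp

text \<open>At the maximal excess every further point raises \<open>ell\<close> by its full degree.
  So all leading coefficients occur, and the poles of a repartition can be removed one at a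
  time.\<close>

lemma covers_of_nonspecial:
 assumes D: "D : divisors PX" and g: "deg D - int (ell D) + 1 = int gen"
 shows "covers D"
 unfolding covers_def
proof
 fix \<alpha> assume "\<alpha> : adeles"
 then obtain E0 where E0: "E0 : divisors PX" "\<alpha> : reps E0" by (auto simp: adeles_def)
 note s = dsup[OF D E0(1)]
 have "\<forall>\<alpha>\<in>reps (dsup D E0). \<exists>f. (%P. \<alpha> P - f) : reps D"
  using D s(1) s(3)
 proof (induction rule: divisor_induct)
  case base
  show ?case by (intro ballI exI[of _ 0]) simp
 next
  case (step A P)
  show ?case
  proof
   fix \<alpha> assume \<alpha>: "\<alpha> : reps (A + single P 1)"
   obtain \<pi> where \<pi>: "uniformizer P \<pi>" using dvr.ex_uniformizer[OF place_dvr[OF step(4)]] by blast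
   have A1: "A + single P 1 : divisors PX" by (intro divisors_add step divisors_single)
   have "deg D - int (ell D) <= deg A - int (ell A)" by (rule excess_mono[OF D step(1,2)])
   moreover have "deg (A + single P 1) - int (ell (A + single P 1)) + 1 <= int gen"
    by (rule genus_bound[OF A1])
   ultimately have "ell (A + single P 1) = ell A + point_degree \<iota> P"
    using ell_step(2)[OF step(1,4)] g by (simp add: div_degree_add)
   then have surj: "lead A P \<pi> ` H0 PX (A + single P 1) = carrier (residue_field P)"
    using H0_step(5)[OF step(4) \<pi> finite_H0[OF step(1)]] by blast
   have "lead A P \<pi> (\<alpha> P) : carrier (residue_field P)"
    by (rule lead_mod(2)[OF step(4) \<pi> reps_single(1)[OF step(4) \<alpha>]])
   then obtain f where f: "f : H0 PX (A + single P 1)" "lead A P \<pi> (\<alpha> P) = lead A P \<pi> f"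
    unfolding surj[symmetric] by blast
   have "(%Q. \<alpha> Q - f) : reps (A + single P 1)"
    using reps_diff[OF \<alpha>] f(1) reps_const_iff by blast
   moreover have "\<alpha> P - f : vset P (- lookup A P)"
    using f(2) unfolding lead_mod(1)[OF step(4) \<pi>] .
   ultimately have "(%Q. \<alpha> Q - f) : reps A" by (rule reps_single(2)[OF step(4)])
   from step(5)[rule_format, OF this] obtain g where "(%Q. \<alpha> Q - f - g) : reps D" ..
   then show "\<exists>f. (%P. \<alpha> P - f) : reps D" by (intro exI[of _ "f + g"]) (simp add: algebra_simps)
  qed
 qed
 then show "\<exists>f. (%P. \<alpha> P - f) : reps D" using E0(2) reps_mono[OF s(4)] by blast
qed

text \<open>An upper bound \<open>d\<close> for the dimension of \<open>H^1(D)\<close>, expressed by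
  generators.\<close>

definition genby :: "'f divisor => nat => bool" where
 "genby D d \<longleftrightarrow> (\<exists>h. (\<forall>i. h i : adeles) &
  (\<forall>\<alpha>\<in>adeles. \<exists>f c. (%P. \<alpha> P - f - (\<Sum>i<d. \<iota> (c i) * h i P)) : reps D))"

text \<open>The kernel of \<open>H^1(D) -> H^1(D + P)\<close> is the cokernel of the leading
  coefficient map, of dimension \<open>point_degree P - (ell E - ell D)\<close>; so many generators
  are added.\<close>

lemma genby_step:
 assumes D: "D : divisors PX" and P: "P : closed_points PX"
 defines "E \<equiv> D + single P 1"
 assumes e: "genby E e"
 shows "genby D (e + (point_degree \<iota> P - (ell E - ell D)))"
proof -
 interpret dvr P by (rule place_dvr[OF P])
 obtain \<pi> where \<pi>: "uniformizer P \<pi>" using ex_uniformizer by blast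
 note st = H0_step[OF P \<pi> finite_H0[OF D], folded E_def]
 define k where "k = point_degree \<iota> P - (ell E - ell D)"
 let ?m = "- lookup D P"
 define W where "W = vset P (?m - 1)"
 \<comment> \<open>\<open>W / I\<close> is the cokernel of the leading coefficient map.\<close>
 define I where "I = {a + g | a g. a : vset P ?m & g : H0 PX E}"
 have K: "range \<iota> \<subseteq> P" using place_constants[OF P] by blast
 have kW: "ksub W" "ksub (vset P ?m)" unfolding W_def by (rule dvr_ksub[OF dvr_axioms K])+
 have kI: "ksub I" unfolding ksub_def
 proof (intro conjI ballI allI)
  have "(0::'f) = 0 + 0" by simp
  then show "0 : I" unfolding I_def using ksubD(1)[OF kW(2)] ksubD(1)[OF ksub_H0] by blast
  fix x assume "x : I"
  then obtain a g where x: "x = a + g" "a : vset P ?m" "g : H0 PX E" by (auto simp: I_def)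
  show "\<iota> c * x : I" for c
   unfolding I_def using x ksubD(3)[OF kW(2) x(2), of c] ksubD(3)[OF ksub_H0 x(3), of c]
   by (intro CollectI exI[of _ "\<iota> c * a"] exI[of _ "\<iota> c * g"]) (simp add: distrib_left)
  fix y assume "y : I"
  then obtain b l where y: "y = b + l" "b : vset P ?m" "l : H0 PX E" by (auto simp: I_def)
  show "x + y : I"
   unfolding I_def using x y ksubD(2)[OF kW(2) x(2) y(2)] ksubD(2)[OF ksub_H0 x(3) y(3)]
   by (intro CollectI exI[of _ "a + b"] exI[of _ "g + l"]) simp
 qed
 have EW: "H0 PX E \<subseteq> W" using H0_single_local[OF P] by (auto simp: W_def E_def)
 have q: "CARD('k) > 1" by (rule card_K_gt_1)
 \<comment> \<open>Sums of elements of \<open>T\<close> and of representatives \<open>G\<close> of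
   the leading coefficients have distinct residues, so \<open>card T * card G\<close> is at most the
   size of the residue field.\<close>
 have bound: "card T <= CARD('k) ^ k"
  if T: "finite T" "T \<subseteq> W" "!!s t. s : T ==> t : T ==> s - t : I ==> s = t" for T
 proof -
  obtain G where G: "G \<subseteq> H0 PX E" "inj_on (lead D P \<pi>) G" "lead D P \<pi> ` G = lead D P \<pi> ` H0 PX E"
   using subset_image_inj[of "lead D P \<pi> ` H0 PX E" "lead D P \<pi>" "H0 PX E"] by auto
  have cG: "card G = CARD('k) ^ (ell E - ell D)" using card_image[OF G(2)] st(6) G(3) by simp
  have inj: "inj_on (%(t, g). lead D P \<pi> (t + g)) (T \<times> G)"
  proof (rule inj_onI)
   fix p p' assume p: "p : T \<times> G" "p' : T \<times> G"
    "(case p of (t, g) => lead D P \<pi> (t + g)) = (case p' of (t, g) => lead D P \<pi> (t + g))"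
   obtain t g t' g' where e: "p = (t, g)" "p' = (t', g')" by (metis surj_pair)
   have tg: "t : T" "t' : T" "g : G" "g' : G" using p e by auto
   have d: "(t + g) - (t' + g') : vset P ?m" using p(3) unfolding e lead_mod(1)[OF P \<pi>, symmetric] by simp
   have "g' - g : H0 PX E" using ksubD(5)[OF ksub_H0] tg G(1) by blast
   then have "t - t' : I" unfolding I_def using d
    by (intro CollectI exI[of _ "(t + g) - (t' + g')"] exI[of _ "g' - g"]) simp
   then have tt: "t = t'" using T(3) tg by blast
   then have "g - g' : vset P ?m" using d by simp
   then have "lead D P \<pi> g = lead D P \<pi> g'" unfolding lead_mod(1)[OF P \<pi>] .
   then have "g = g'" using inj_onD[OF G(2)] tg by blast
   then show "p = p'" using tt e by simp
  qed
  have "(%(t, g). lead D P \<pi> (t + g)) ` (T \<times> G) \<subseteq> carrier (residue_field P)"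
  proof clarify
   fix t g assume "t : T" "g : G"
   then have "t + g : W" using ksubD(2)[OF kW(1)] T(2) G(1) EW by blast
   then show "lead D P \<pi> (t + g) : carrier (residue_field P)" unfolding W_def by (rule lead_mod(2)[OF P \<pi>])
  qed
  from card_inj_on_le[OF inj this residue_field_finite(1)[OF P]]
  have le: "card T * CARD('k) ^ (ell E - ell D) <= CARD('k) ^ point_degree \<iota> P"
   by (simp add: card_cartesian_product cG residue_field_finite(2)[OF P])
  have "CARD('k) ^ point_degree \<iota> P = CARD('k) ^ k * CARD('k) ^ (ell E - ell D)"
   unfolding k_def using st(3) by (simp flip: power_add)
  then show ?thesis using q le by simp
 qed
 \<comment> \<open>Without a relation, \<open>k + 1\<close> elements would have
   \<open>q ^ (k + 1)\<close> combinations incongruent modulo \<open>I\<close>.\<close>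
 have dep: "\<exists>c. (\<exists>i\<le>k. c i ~= 0) & (\<Sum>i\<le>k. \<iota> (c i) * y i) : I" if y: "!!i. i <= k ==> y i : W" for y
 proof (rule ccontr)
  assume n: "\<not> ?thesis"
  let ?F = "PiE {..k} (%_. UNIV :: 'k set)"
  define s where "s c = (\<Sum>i\<le>k. \<iota> (c i) * y i)" for c
  have eqI: "c = c'" if "c : ?F" "c' : ?F" "s c - s c' : I" for c c'
  proof (rule PiE_ext[OF that(1,2)])
   fix i assume i: "i : {..k}"
   have "s c - s c' = (\<Sum>i\<le>k. \<iota> (c i - c' i) * y i)"
    by (simp add: s_def left_diff_distrib sum_subtractf)
   then have "(\<Sum>i\<le>k. \<iota> (c i - c' i) * y i) : I" using that(3) by simp
   then have "\<not> (\<exists>i\<le>k. c i - c' i ~= 0)" using n[unfolded not_ex, rule_format, of "%i. c i - c' i"] by simp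
   then show "c i = c' i" using i by auto
  qed
  have "inj_on s ?F" by (rule inj_onI) (use eqI ksubD(1)[OF kI] in auto)
  then have "card (s ` ?F) = CARD('k) ^ Suc k" by (simp add: card_image card_PiE)
  moreover have "card (s ` ?F) <= CARD('k) ^ k"
  proof (rule bound)
   show "finite (s ` ?F)" by (simp add: finite_PiE)
   show "s ` ?F \<subseteq> W" unfolding s_def using y by (auto intro!: ksubD(6)[OF kW(1)] ksubD(3)[OF kW(1)])
   show "a = b" if "a : s ` ?F" "b : s ` ?F" "a - b : I" for a b using that eqI by blast
  qed
  ultimately show False using q by simp
 qed
 obtain d y where d: "d <= k" "!!i. i < d ==> y i : W" "!!w. w : W ==> \<exists>c. w - (\<Sum>i<d. \<iota> (c i) * y i) : I"
  by (rule spanning_mod_exists[OF kI kW(1) dep]) blast+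
 obtain h where h: "!!i. h i : adeles"
  "!!\<alpha>. \<alpha> : adeles ==> \<exists>f c. (%P. \<alpha> P - f - (\<Sum>i<e. \<iota> (c i) * h i P)) : reps E"
  using e unfolding genby_def by blast
 \<comment> \<open>The generators for \<open>E\<close>, then the \<open>y i\<close> placed at
   \<open>P\<close> alone, then zeros, since \<open>d\<close> may be smaller than
   \<open>k\<close>.\<close>
 define h' where "h' i = (if i < e then h i else if i < e + d then (%Q. if Q = P then y (i - e) else 0) else (%_. 0))" for i
 have h': "h' i : adeles" for i unfolding h'_def using h(1) adeles_local[OF P] adeles_const by simp
 have "\<exists>f c. (%Q. \<alpha> Q - f - (\<Sum>i<e + k. \<iota> (c i) * h' i Q)) : reps D" if \<alpha>: "\<alpha> : adeles" for \<alpha>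
 proof -
  obtain f c where fc: "(%P. \<alpha> P - f - (\<Sum>i<e. \<iota> (c i) * h i P)) : reps E" using h(2)[OF \<alpha>] by blast
  define \<beta> where "\<beta> Q = \<alpha> Q - f - (\<Sum>i<e. \<iota> (c i) * h i Q)" for Q
  have \<beta>: "\<beta> : reps E" using fc by (simp add: \<beta>_def[abs_def])
  have "\<beta> P : W" unfolding W_def by (rule reps_single(1)[OF P \<beta>[unfolded E_def]])
  from d(3)[OF this] obtain b a g where b: "\<beta> P - (\<Sum>i<d. \<iota> (b i) * y i) = a + g" "a : vset P ?m" "g : H0 PX E"
   unfolding I_def by blast
  define \<gamma> where "\<gamma> Q = \<beta> Q - g - (if Q = P then (\<Sum>i<d. \<iota> (b i) * y i) else 0)" for Q
  have loc: "(%Q. if Q = P then (\<Sum>i<d. \<iota> (b i) * y i) else 0) : reps E"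
  proof -
   have "(\<Sum>i<d. \<iota> (b i) * y i) : W" using d(2) by (intro ksubD(6)[OF kW(1)] ksubD(3)[OF kW(1)]) auto
   then show ?thesis unfolding reps_def W_def
    using dvr.zero_vset[OF place_dvr] by (auto simp: E_def lookup_add)
  qed
  have "\<gamma> : reps E" unfolding \<gamma>_def
   using reps_diff[OF reps_diff[OF \<beta> reps_const_iff[THEN iffD2, OF b(3)]] loc] .
  moreover have "\<gamma> P : vset P ?m" using b by (simp add: \<gamma>_def algebra_simps)
  ultimately have \<gamma>D: "\<gamma> : reps D" unfolding E_def by (rule reps_single(2)[OF P])
  define c' where "c' i = (if i < e then c i else if i < e + d then b (i - e) else 0)" for i
  have sum: "(\<Sum>i<e + k. \<iota> (c' i) * h' i Q) = (\<Sum>i<e. \<iota> (c i) * h i Q) + (if Q = P then (\<Sum>i<d. \<iota> (b i) * y i) else 0)" for Q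
  proof -
   have "(\<Sum>i<e + k. \<iota> (c' i) * h' i Q) = (\<Sum>i<e + d. \<iota> (c' i) * h' i Q)"
    using d(1) by (intro sum.mono_neutral_right) (auto simp: c'_def)
   also have "\<dots> = (\<Sum>i<e. \<iota> (c' i) * h' i Q) + (\<Sum>i\<in>{e..<e + d}. \<iota> (c' i) * h' i Q)"
    by (subst sum.union_disjoint[symmetric]) (auto intro: sum.cong)
   also have "(\<Sum>i\<in>{e..<e + d}. \<iota> (c' i) * h' i Q) = (\<Sum>i<d. \<iota> (c' (e + i)) * h' (e + i) Q)"
    by (rule sum.reindex_bij_witness[of _ "%i. e + i" "%i. i - e"]) auto
   also have "\<dots> = (if Q = P then (\<Sum>i<d. \<iota> (b i) * y i) else 0)"
    by (auto simp: c'_def h'_def)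
   also have "(\<Sum>i<e. \<iota> (c' i) * h' i Q) = (\<Sum>i<e. \<iota> (c i) * h i Q)"
    by (rule sum.cong) (auto simp: c'_def h'_def)
   finally show ?thesis .
  qed
  have "(%Q. \<alpha> Q - (f + g) - (\<Sum>i<e + k. \<iota> (c' i) * h' i Q)) = \<gamma>"
   unfolding sum by (rule ext) (simp add: \<gamma>_def \<beta>_def algebra_simps)
  then have "(%Q. \<alpha> Q - (f + g) - (\<Sum>i<e + k. \<iota> (c' i) * h' i Q)) : reps D" using \<gamma>D by simp
  then show ?thesis by blast
 qed
 then show ?thesis unfolding genby_def k_def[symmetric] using h' by blast
qed

text \<open>Descend to \<open>D\<close> from a divisor above it of maximal excess, where
  \<open>H^1\<close> vanishes; the generators added on the way count the loss of excess.\<close>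

lemma genby_index:
 assumes D: "D : divisors PX"
 shows "genby D (nat (int gen - 1 - deg D + int (ell D)))"
proof -
 obtain D0 where D0: "D0 : divisors PX" "int gen = deg D0 - int (ell D0) + 1" using genus_attained by blast
 note s = dsup[OF D D0(1)]
 define E where "E = dsup D D0"
 have E: "E : divisors PX" "dle D E" "dle D0 E" using s by (auto simp: E_def)
 have gE: "deg E - int (ell E) + 1 = int gen"
  using excess_mono[OF D0(1) E(1,3)] genus_bound[OF E(1)] D0(2) by simp
 have "covers E" by (rule covers_of_nonspecial[OF E(1) gE])
 then have "genby E 0" unfolding covers_def genby_def using adeles_const by (intro exI[of _ "%_ _. 0"]) auto
 moreover have "\<forall>e. genby E e --> genby D (e + nat ((deg E - int (ell E)) - (deg D - int (ell D))))"
  using D E(1) E(2)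
 proof (induction rule: divisor_induct)
  case (step A P)
  show ?case
  proof (intro allI impI)
   fix e let ?A = "A + single P 1"
   assume "genby ?A e"
   from genby_step[OF step(1,4) this] step(5)
   have "genby D (e + (point_degree \<iota> P - (ell ?A - ell A)) + nat ((deg A - int (ell A)) - (deg D - int (ell D))))"
    by blast
   moreover have "e + (point_degree \<iota> P - (ell ?A - ell A)) + nat ((deg A - int (ell A)) - (deg D - int (ell D)))
     = e + nat ((deg ?A - int (ell ?A)) - (deg D - int (ell D)))"
    using ell_step[OF step(1,4)] excess_mono[OF D step(1,2)] by (simp add: div_degree_add nat_diff_distrib)
   ultimately show "genby D (e + nat ((deg ?A - int (ell ?A)) - (deg D - int (ell D))))" by simp
  qed
 qed simp
 ultimately have "genby D (0 + nat ((deg E - int (ell E)) - (deg D - int (ell D))))" by blast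
 moreover have "(deg E - int (ell E)) - (deg D - int (ell D)) = int gen - 1 - deg D + int (ell D)" using gE by simp
 ultimately show ?thesis by simp
qed

definition weil :: "'f divisor => (('f set => 'f) => 'k) => bool" where
 "weil D \<omega> \<longleftrightarrow> (\<forall>\<alpha>\<in>adeles. \<forall>\<beta>\<in>adeles. \<omega> (%P. \<alpha> P + \<beta> P) = \<omega> \<alpha> + \<omega> \<beta>) &
  (\<forall>a. \<forall>\<alpha>\<in>adeles. \<omega> (%P. \<iota> a * \<alpha> P) = a * \<omega> \<alpha>) &
  (\<forall>\<alpha>\<in>reps D. \<omega> \<alpha> = 0) & (\<forall>f. \<omega> (%_. f) = 0)"

lemma weilD:
 assumes "weil D \<omega>"
 shows "\<alpha> : adeles ==> \<beta> : adeles ==> \<omega> (%P. \<alpha> P + \<beta> P) = \<omega> \<alpha> + \<omega> \<beta>"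
  "\<alpha> : adeles ==> \<omega> (%P. \<iota> a * \<alpha> P) = a * \<omega> \<alpha>"
  "\<alpha> : reps D ==> \<omega> \<alpha> = 0" "\<omega> (%_. f) = 0"
  "\<alpha> : adeles ==> \<beta> : adeles ==> \<omega> (%P. \<alpha> P - \<beta> P) = \<omega> \<alpha> - \<omega> \<beta>"
  "(!!i. i : I ==> h i : adeles) ==> \<omega> (%P. \<Sum>i\<in>I. \<iota> (c i) * h i P) = (\<Sum>i\<in>I. c i * \<omega> (h i))"
proof -
 show add: "\<omega> (%P. \<alpha> P + \<beta> P) = \<omega> \<alpha> + \<omega> \<beta>" if "\<alpha> : adeles" "\<beta> : adeles" for \<alpha> \<beta>
  using assms that by (simp add: weil_def)
 show sm: "\<omega> (%P. \<iota> a * \<alpha> P) = a * \<omega> \<alpha>" if "\<alpha> : adeles" for a \<alpha> using assms that by (simp add: weil_def)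
 show "\<alpha> : reps D ==> \<omega> \<alpha> = 0" and c: "\<omega> (%_. f) = 0" for f using assms by (auto simp: weil_def)
 show "\<omega> (%P. \<alpha> P - \<beta> P) = \<omega> \<alpha> - \<omega> \<beta>" if "\<alpha> : adeles" "\<beta> : adeles"
  using add[OF adeles_diff[OF that] that(2)] by simp
 show "\<omega> (%P. \<Sum>i\<in>I. \<iota> (c i) * h i P) = (\<Sum>i\<in>I. c i * \<omega> (h i))" if "!!i. i : I ==> h i : adeles"
  using that
 proof (induction I rule: infinite_finite_induct)
  case (insert i I)
  have "\<omega> (%P. \<Sum>i\<in>insert i I. \<iota> (c i) * h i P) = \<omega> (%P. \<iota> (c i) * h i P + (\<Sum>i\<in>I. \<iota> (c i) * h i P))"
   using insert by simp
  also have "\<dots> = \<omega> (%P. \<iota> (c i) * h i P) + \<omega> (%P. \<Sum>i\<in>I. \<iota> (c i) * h i P)"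
   using insert by (intro add adeles_mult adeles_sum) auto
  finally show ?case using insert sm by simp
 qed (simp_all add: c)
qed

text \<open>\<open>S\<close> is the space of all functions congruent to a constant one modulo
  \<open>reps D\<close>. A basis of it remains independent together with an \<alpha> outside, so a
  linear form on all functions can vanish on \<open>S\<close> and be 1 at \<alpha>.\<close>

lemma weil_exists:
 assumes D: "D : divisors PX" and n: "\<not> covers D"
 obtains \<omega> \<alpha> where "weil D \<omega>" "\<alpha> : adeles" "\<omega> \<alpha> ~= 0"
proof -
 obtain \<alpha> where \<alpha>: "\<alpha> : adeles" "!!f. (%P. \<alpha> P - f) ~: reps D" using n by (auto simp: covers_def)
 let ?s1 = "%a (\<beta> :: 'f set => 'f) P. \<iota> a * \<beta> P"
 interpret vs: vector_space_pair ?s1 "(*) :: 'k => 'k => 'k"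
  by unfold_locales (auto simp: algebra_simps fun_eq_iff)
 define S where "S = {\<beta>. \<exists>f. (%P. \<beta> P - f) : reps D}"
 have smul: "(%P. \<iota> a * \<beta> P) : reps D" if "\<beta> : reps D" for a \<beta>
  using reps_mult[of "\<iota> a" 0 \<beta> D] that H0_zero by auto
 have S: "vs.vs1.subspace S"
 proof (rule vs.vs1.subspaceI)
  have "(%P. (0 :: 'f set => 'f) P - 0) : reps D" using reps_zero by simp
  then show "0 : S" unfolding S_def by blast
  fix \<beta> \<gamma> assume "\<beta> : S" "\<gamma> : S"
  then obtain f g where fg: "(%P. \<beta> P - f) : reps D" "(%P. \<gamma> P - g) : reps D" by (auto simp: S_def)
  have "(%P. (\<beta> + \<gamma>) P - (f + g)) : reps D" using reps_add[OF fg] by (simp add: algebra_simps)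
  then show "\<beta> + \<gamma> : S" unfolding S_def by blast
  show "?s1 a \<beta> : S" for a
  proof -
   have "(%P. \<iota> a * \<beta> P - \<iota> a * f) : reps D" using smul[OF fg(1), of a] by (simp add: algebra_simps)
   then show ?thesis unfolding S_def by blast
  qed
 qed
 obtain B where B: "B \<subseteq> S" "vs.vs1.independent B" "S \<subseteq> vs.vs1.span B" using vs.vs1.basis_exists[of S] by metis
 have "\<alpha> ~: S" using \<alpha>(2) by (auto simp: S_def)
 moreover have "vs.vs1.span B \<subseteq> S" using vs.vs1.span_minimal[OF B(1) S] .
 ultimately have ind: "vs.vs1.independent (insert \<alpha> B)" using vs.vs1.independent_insertI[of \<alpha> B] B(2) by blast
 have aB: "\<alpha> ~: B" using B(1) \<open>\<alpha> ~: S\<close> by blast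
 obtain \<omega> where \<omega>: "Vector_Spaces.linear ?s1 (*) \<omega>" "!!x. x : insert \<alpha> B ==> \<omega> x = (if x = \<alpha> then 1 else 0)"
  using vs.linear_independent_extend[OF ind, of "%x. if x = \<alpha> then 1 else 0"] by blast
 have add: "\<omega> (%P. \<beta> P + \<gamma> P) = \<omega> \<beta> + \<omega> \<gamma>" for \<beta> \<gamma>
  using vs.linear_add[OF \<omega>(1), of \<beta> \<gamma>] by (simp add: plus_fun_def)
 have sm: "\<omega> (%P. \<iota> a * \<beta> P) = a * \<omega> \<beta>" for a \<beta> using vs.linear_scale[OF \<omega>(1), of a \<beta>] by simp
 have zero: "\<omega> \<beta> = 0" if "\<beta> : S" for \<beta>
 proof -
  have "\<beta> : vs.vs1.span B" using B(3) that by blast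
  moreover have "\<omega> x = 0" if "x : B" for x using \<omega>(2)[of x] that aB by auto
  ultimately show ?thesis using vs.linear_eq_0_on_span[OF \<omega>(1)] by blast
 qed
 have "weil D \<omega>" unfolding weil_def
 proof (intro conjI ballI allI)
  show "\<omega> \<beta> = 0" if "\<beta> : reps D" for \<beta>
   by (rule zero) (use that in \<open>auto simp: S_def intro!: exI[of _ 0]\<close>)
  show "\<omega> (%_. f) = 0" for f
   by (rule zero) (use reps_zero in \<open>auto simp: S_def intro!: exI[of _ f]\<close>)
 qed (auto simp: add sm)
 moreover have "\<omega> \<alpha> ~= 0" using \<omega>(2)[of \<alpha>] by simp
 ultimately show ?thesis using that \<alpha>(1) by blast
qed

text \<open>Solves \<open>d\<close> homogeneous linear equations by counting: the difference of the
  two elements found is a nontrivial solution.\<close>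

lemma pigeonhole_values:
 fixes T :: "'a => nat => 'k"
 assumes "finite V" "card V > CARD('k) ^ d"
 obtains v w where "v : V" "w : V" "v ~= w" "!!i. i < d ==> T v i = T w i"
proof -
 have "\<not> inj_on (%v. restrict (T v) {..<d}) V"
 proof
  assume inj: "inj_on (%v. restrict (T v) {..<d}) V"
  have "(%v. restrict (T v) {..<d}) ` V \<subseteq> PiE {..<d} (%_. UNIV)"
   by (intro image_subsetI) (simp only: restrict_PiE_iff UNIV_I Ball_def simp_thms)
  from card_inj_on_le[OF inj this] have "card V <= CARD('k) ^ d" by (simp add: finite_PiE card_PiE)
  then show False using assms by simp
 qed
 then obtain v w where vw: "v : V" "w : V" "restrict (T v) {..<d} = restrict (T w) {..<d}" "v ~= w"
  unfolding inj_on_def by blast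
 have "T v i = T w i" if "i < d" for i using fun_cong[OF vw(3), of i] that by simp
 then show ?thesis using that vw by blast
qed

text \<open>A weak form of Clifford's theorem: multiplication by \<open>f \<in> H\<^sup>0(D)\<close> carries a differential vanishing on
  \<open>D\<close> to one vanishing on \<open>0\<close>, so that \<open>dim H\<^sup>0(D) \<le> g\<close> if there is a nonzero one.\<close>

lemma special_degree:
 assumes D: "D : divisors PX" and w: "weil D \<omega>" and \<alpha>: "\<alpha> : adeles" "\<omega> \<alpha> ~= 0"
 shows "deg D <= 2 * int gen - 2"
proof -
 have "deg D - int (ell D) + 1 ~= int gen"
 proof
  assume "deg D - int (ell D) + 1 = int gen"
  then obtain f where f: "(%P. \<alpha> P - f) : reps D" using covers_of_nonspecial[OF D] \<alpha>(1) by (auto simp: covers_def)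
  have "\<omega> \<alpha> = 0" using weilD(5)[OF w \<alpha>(1) adeles_const, of f] weilD(3)[OF w f] weilD(4)[OF w] by simp
  then show False using \<alpha> by simp
 qed
 then have 1: "deg D - int (ell D) + 1 < int gen" using genus_bound[OF D] by simp
 have "ell D <= gen"
 proof (rule ccontr)
  assume "\<not> ell D <= gen"
  then have c: "card (H0 PX D) > CARD('k) ^ gen"
   using card_H0[OF finite_H0[OF D]] card_K_gt_1 by simp
  \<comment> \<open>Among more than \<open>q ^ g\<close> sections, two give equal values on all
    products with the \<open>g\<close> generators of \<open>H^1(0)\<close>. Their difference
    \<open>z\<close> satisfies \<open>z \<omega> = 0\<close>, which is impossible for
    \<open>z\<close> and \<omega> nonzero.\<close>
  have "genby 0 gen" using genby_index[OF divisors_zero] by (simp add: ell_zero)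
  then obtain h where h: "!!i. h i : adeles"
   "!!\<alpha>. \<alpha> : adeles ==> \<exists>f c. (%P. \<alpha> P - f - (\<Sum>i<gen. \<iota> (c i) * h i P)) : reps 0"
   unfolding genby_def by blast
  obtain v w' where vw: "v : H0 PX D" "w' : H0 PX D" "v ~= w'"
   "!!i. i < gen ==> \<omega> (%P. v * h i P) = \<omega> (%P. w' * h i P)"
   by (rule pigeonhole_values[OF finite_H0[OF D] c, of "%v i. \<omega> (%P. v * h i P)"]) blast
  define z where "z = v - w'"
  have z: "z ~= 0" "z : H0 PX D" using vw ksubD(5)[OF ksub_H0] by (auto simp: z_def)
  have zh: "\<omega> (%P. z * h i P) = 0" if "i < gen" for i
   using weilD(5)[OF w adeles_mult[OF h(1)] adeles_mult[OF h(1)], of v i w' i] vw(4)[OF that]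
   by (simp add: z_def left_diff_distrib)
  have "\<omega> (%P. z * \<beta> P) = 0" if \<beta>: "\<beta> : adeles" for \<beta>
  proof -
   obtain f c where fc: "(%P. \<beta> P - f - (\<Sum>i<gen. \<iota> (c i) * h i P)) : reps 0" using h(2)[OF \<beta>] by blast
   define \<gamma> where "\<gamma> P = \<beta> P - f - (\<Sum>i<gen. \<iota> (c i) * h i P)" for P
   have "(%P. z * \<gamma> P) : reps D" using reps_mult[OF z(2) fc] by (simp add: \<gamma>_def)
   then have g0: "\<omega> (%P. z * \<gamma> P) = 0" "(%P. z * \<gamma> P) : adeles" using weilD(3)[OF w] adelesI[OF D] by auto
   have zha: "(%P. z * h i P) : adeles" for i by (rule adeles_mult[OF h(1)])
   have s0: "\<omega> (%P. \<Sum>i<gen. \<iota> (c i) * (z * h i P)) = 0"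
    using weilD(6)[OF w, of "{..<gen}" "%i P. z * h i P" c] zha zh by simp
   have sa: "(%P. \<Sum>i<gen. \<iota> (c i) * (z * h i P)) : adeles"
    by (rule adeles_sum) (rule adeles_mult[OF zha])
   have "(%P. z * \<beta> P) = (%P. (z * \<gamma> P + (\<Sum>i<gen. \<iota> (c i) * (z * h i P))) + z * f)"
    by (rule ext) (simp add: \<gamma>_def algebra_simps sum_distrib_left)
   then have "\<omega> (%P. z * \<beta> P) = \<omega> (%P. z * \<gamma> P + (\<Sum>i<gen. \<iota> (c i) * (z * h i P))) + \<omega> (%_. z * f)"
    using weilD(1)[OF w adeles_add[OF g0(2) sa] adeles_const] by simp
   then show ?thesis using weilD(1)[OF w g0(2) sa] g0(1) s0 weilD(4)[OF w] by simp
  qed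
  from this[OF adeles_mult[OF \<alpha>(1), of "inverse z"]] have "\<omega> \<alpha> = 0" using z(1) by (simp add: mult.assoc[symmetric])
  then show False using \<alpha>(2) by simp
 qed
 then show ?thesis using 1 by linarith
qed

text \<open>For large \<open>N\<close>, the pairs \<open>(a, b)\<close> of sections of
  \<open>D1 + N\<close> and \<open>D2 + N\<close> outnumber the conditions for
  \<open>a \<omega>1 + b \<omega>2\<close> to vanish on generators of \<open>H^1(-N)\<close>, so the
  differentials are proportional.\<close>

lemma weil_one_dimensional:
 assumes D1: "D1 : divisors PX" "weil D1 \<omega>1" and \<alpha>: "\<alpha> : adeles" "\<omega>1 \<alpha> ~= 0"
  and D2: "D2 : divisors PX" "weil D2 \<omega>2"
 obtains f where "!!\<beta>. \<beta> : adeles ==> \<omega>2 \<beta> = \<omega>1 (%P. f * \<beta> P)"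
proof -
 obtain x where x: "x ~: range \<iota>" by (rule exists_transcendental)
 let ?B = "pole_divisor x"
 have B: "?B : divisors PX" "dle 0 ?B" by (rule pole_divisor)+
 have Bpos: "1 <= deg ?B"
 proof -
  obtain P where P: "P : closed_points PX" "inverse x : max_ideal P" by (rule exists_zero[OF inverse_not_constant[OF x]])
  interpret dvr P by (rule place_dvr[OF P(1)])
  have x0: "x ~= 0" using x by (metis \<iota>_0 rangeI)
  have v: "0 < val P (inverse x)" using P(2) x0 by (auto simp: max_ideal_iff)
  have "dle (single P 1) ?B"
  proof (rule dleI)
   fix Q assume Q: "Q : closed_points PX"
   then show "lookup (single P 1) Q <= lookup ?B Q"
    unfolding pole_divisor(1)[OF x0 Q] using v val_inverse[OF x0] by (auto simp: lookup_single when_def)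
  qed (intro pole_divisor divisors_single P)+
  from div_degree_mono[OF this, of \<iota>] show ?thesis using point_degree_pos[OF P(1)] by simp
 qed
 \<comment> \<open>The pairs have dimension at least
   \<open>2 deg N + deg D1 + deg D2 + 2 - 2 g\<close>, and \<open>H^1(-N)\<close> needs
   \<open>g - 1 + deg N\<close> generators. \<open>3 g\<close> plus both absolute degrees suffices;
   the extra 1 makes \<open>deg N\<close> positive, so that \<open>-N\<close> has no
   sections.\<close>
 define l where "l = nat (3 * int gen + \<bar>deg D1\<bar> + \<bar>deg D2\<bar> + 1)"
 define N where "N = (\<Sum>i<l. ?B)"
 have N: "N : divisors PX" unfolding N_def by (intro divisors_sum B)
 have "int l * 1 <= int l * deg ?B" using Bpos by (intro mult_left_mono) auto
 then have degN: "3 * int gen + \<bar>deg D1\<bar> + \<bar>deg D2\<bar> + 1 <= deg N" unfolding N_def deg_scale by (simp add: l_def)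
 have mN: "- N : divisors PX" by (rule divisors_uminus[OF N])
 have "H0 PX (- N) = {0}" by (rule H0_deg_neg[OF mN]) (use degN in \<open>simp add: div_degree_uminus\<close>)
 then have "CARD('k) ^ ell (- N) = CARD('k) ^ 0" using card_H0[OF finite_H0[OF mN]] by simp
 then have lN: "ell (- N) = 0" using card_K_gt_1 power_inject_exp by blast
 define d where "d = nat (int gen - 1 + deg N)"
 have "genby (- N) d" using genby_index[OF mN] by (simp add: lN div_degree_uminus d_def)
 then obtain h where h: "!!i. h i : adeles"
  "!!\<alpha>. \<alpha> : adeles ==> \<exists>f c. (%P. \<alpha> P - f - (\<Sum>i<d. \<iota> (c i) * h i P)) : reps (- N)"
  unfolding genby_def by blast
 have DN: "D1 + N : divisors PX" "D2 + N : divisors PX"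
  using divisors_add[OF D1(1) N] divisors_add[OF D2(1) N] by auto
 let ?V = "H0 PX (D1 + N) \<times> H0 PX (D2 + N)"
 have "d < ell (D1 + N) + ell (D2 + N)"
  using genus_bound[OF DN(1)] genus_bound[OF DN(2)] degN by (simp add: d_def div_degree_add)
 then have "card ?V > CARD('k) ^ d"
  using card_H0[OF finite_H0[OF DN(1)]] card_H0[OF finite_H0[OF DN(2)]] card_K_gt_1
  by (simp add: card_cartesian_product flip: power_add)
 moreover have "finite ?V" using finite_H0 DN by blast
 ultimately obtain v w where vw: "v : ?V" "w : ?V" "v ~= w"
  "!!i. i < d ==> \<omega>1 (%P. fst v * h i P) + \<omega>2 (%P. snd v * h i P) = \<omega>1 (%P. fst w * h i P) + \<omega>2 (%P. snd w * h i P)"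
  using pigeonhole_values[of ?V d "%v i. \<omega>1 (%P. fst v * h i P) + \<omega>2 (%P. snd v * h i P)"] by blast
 define a b where "a = fst v - fst w" and "b = snd v - snd w"
 have ab: "a : H0 PX (D1 + N)" "b : H0 PX (D2 + N)" "a ~= 0 \<or> b ~= 0"
  using vw ksubD(5)[OF ksub_H0] by (auto simp: a_def b_def prod_eq_iff)
 have ha: "(%P. u * h i P) : adeles" for u i by (rule adeles_mult[OF h(1)])
 have abh: "\<omega>1 (%P. a * h i P) + \<omega>2 (%P. b * h i P) = 0" if "i < d" for i
  using weilD(5)[OF D1(2) ha ha, of "fst v" i "fst w" i] weilD(5)[OF D2(2) ha ha, of "snd v" i "snd w" i] vw(4)[OF that]
  by (simp add: a_def b_def left_diff_distrib add_diff_add[symmetric])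
 have split: "\<omega> (%P. u * \<beta> P) = (\<Sum>i<d. c i * \<omega> (%P. u * h i P))"
  if \<omega>: "weil D \<omega>" "D : divisors PX" "u : H0 PX (D + N)" and \<beta>: "(%P. \<beta> P - f - (\<Sum>i<d. \<iota> (c i) * h i P)) : reps (- N)"
  for \<omega> D u \<beta> f c
 proof -
  define \<gamma> where "\<gamma> P = \<beta> P - f - (\<Sum>i<d. \<iota> (c i) * h i P)" for P
  have "(%P. u * \<gamma> P) : reps (D + N + - N)" using reps_mult[OF that(3) \<beta>] by (simp add: \<gamma>_def)
  then have "(%P. u * \<gamma> P) : reps D" by simp
  then have g0: "\<omega> (%P. u * \<gamma> P) = 0" "(%P. u * \<gamma> P) : adeles" using weilD(3)[OF \<omega>(1)] adelesI[OF \<omega>(2)] by auto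
  have sa: "(%P. \<Sum>i<d. \<iota> (c i) * (u * h i P)) : adeles"
   by (rule adeles_sum) (rule adeles_mult[OF ha])
  have "(%P. u * \<beta> P) = (%P. (u * \<gamma> P + (\<Sum>i<d. \<iota> (c i) * (u * h i P))) + u * f)"
   by (rule ext) (simp add: \<gamma>_def algebra_simps sum_distrib_left)
  then have "\<omega> (%P. u * \<beta> P) = \<omega> (%P. u * \<gamma> P + (\<Sum>i<d. \<iota> (c i) * (u * h i P))) + \<omega> (%_. u * f)"
   using weilD(1)[OF \<omega>(1) adeles_add[OF g0(2) sa] adeles_const] by simp
  then show ?thesis using weilD(1)[OF \<omega>(1) g0(2) sa] g0(1) weilD(4)[OF \<omega>(1)]
    weilD(6)[OF \<omega>(1), of "{..<d}" "%i P. u * h i P" c] ha by simp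
 qed
 have rel: "\<omega>1 (%P. a * \<beta> P) + \<omega>2 (%P. b * \<beta> P) = 0" if \<beta>: "\<beta> : adeles" for \<beta>
 proof -
  obtain f c where fc: "(%P. \<beta> P - f - (\<Sum>i<d. \<iota> (c i) * h i P)) : reps (- N)" using h(2)[OF \<beta>] by blast
  have "\<omega>1 (%P. a * \<beta> P) + \<omega>2 (%P. b * \<beta> P) = (\<Sum>i<d. c i * (\<omega>1 (%P. a * h i P) + \<omega>2 (%P. b * h i P)))"
   using split[OF D1(2,1) ab(1) fc] split[OF D2(2,1) ab(2) fc] by (simp add: sum.distrib distrib_left)
  then show ?thesis using abh by simp
 qed
 \<comment> \<open>Otherwise \<open>a \<omega>1 = 0\<close> with \<open>a\<close> nonzero, against
   \<open>\<omega>1 \<alpha> ~= 0\<close>.\<close>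
 have b0: "b ~= 0"
 proof
  assume b: "b = 0"
  then have a: "a ~= 0" using ab(3) by simp
  have "\<omega>1 (%P. a * (inverse a * \<alpha> P)) + \<omega>2 (%P. b * (inverse a * \<alpha> P)) = 0"
   by (rule rel[OF adeles_mult[OF \<alpha>(1)]])
  then show False using \<alpha>(2) a b weilD(4)[OF D2(2), of 0] by (simp add: mult.assoc[symmetric])
 qed
 have "\<omega>2 \<beta> = \<omega>1 (%P. (- a / b) * \<beta> P)" if \<beta>: "\<beta> : adeles" for \<beta>
 proof -
  have "\<omega>1 (%P. a * (inverse b * \<beta> P)) + \<omega>2 (%P. b * (inverse b * \<beta> P)) = 0"
   by (rule rel[OF adeles_mult[OF \<beta>]])
  then have "\<omega>2 \<beta> = - \<omega>1 (%P. a * (inverse b * \<beta> P))" using b0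
   by (simp add: mult.assoc[symmetric] eq_neg_iff_add_eq_0 add.commute)
  also have "\<dots> = \<omega>1 (%P. \<iota> (-1) * (a * (inverse b * \<beta> P)))"
   using weilD(2)[OF D1(2) adeles_mult[OF adeles_mult[OF \<beta>]], of "-1" a "inverse b"] by simp
  also have "(%P. \<iota> (-1) * (a * (inverse b * \<beta> P))) = (%P. (- a / b) * \<beta> P)" by (auto simp: divide_inverse)
  finally show ?thesis .
 qed
 then show ?thesis using that by blast
qed

end

subsection \<open>Residue fields and Frobenius powers\<close>

text \<open>Multiplication by a nonzero \<open>x\<close> permutes the nonzero elements; compare
  their products. Finiteness is a hypothesis, not a class constraint, because the type of
  \<open>L\<close> is not of class \<open>finite\<close>.\<close>

lemma finite_field_power_card:
 fixes x :: "'l::Fields.field"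
 assumes "finite (UNIV :: 'l set)"
 shows "x ^ CARD('l) = x"
proof (cases "x = 0")
 case False
 have "x * (\<Prod>y\<in>UNIV-{0}. x * y) = x * x ^ (CARD('l) - 1) * \<Prod>(UNIV-{0})"
  using assms by (simp add: prod.distrib mult_ac)
 also have "x * x ^ (CARD('l) - 1) = x ^ Suc (CARD('l) - 1)" by (rule power_Suc[symmetric])
 also have "Suc (CARD('l) - 1) = CARD('l)" using assms finite_UNIV_card_ge_0 by fastforce
 also have "(\<Prod>y\<in>UNIV-{0}. x * y) = (\<Prod>y\<in>UNIV-{0}. y)"
  by (rule prod.reindex_bij_witness[of _ "%y. y / x" "%y. x * y"]) (use False in auto)
 finally show ?thesis using assms by simp
qed (use assms finite_UNIV_card_ge_0 in simp)

context constants
begin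

lemma \<iota>_power_card: "\<iota> a ^ (CARD('k) ^ e) = \<iota> a"
 by (induction e) (simp_all add: power_mult flip: \<iota>_power, simp add: finite_field_power_card power_mult)

text \<open>The polynomial \<open>(T+1)\<^sup>q - T\<^sup>q - 1\<close> has degree less than \<open>q\<close> and vanishes on all of \<open>K\<close>.\<close>

lemma frobenius_add_one: "(x + 1) ^ CARD('k) = x ^ CARD('k) + (1 :: 'f)"
proof -
 let ?q = "CARD('k)"
 define p :: "'k poly" where "p = [:1, 1:] ^ ?q - Polynomial.monom 1 ?q - 1"
 have q: "?q > 1" by (rule card_K_gt_1)
 have "p = 0"
 proof (rule ccontr)
  assume p: "p ~= 0"
  have "degree p < ?q"
  proof (rule degree_lessI)
   show "p ~= 0 \<or> 0 < ?q" using p by simp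
   have d: "degree ([:1, 1:] ^ ?q :: 'k poly) = ?q" by (simp add: degree_power_eq)
   have "lead_coeff ([:1, 1:] ^ ?q :: 'k poly) = 1" by (simp add: lead_coeff_power)
   then have l: "coeff ([:1, 1:] ^ ?q :: 'k poly) ?q = 1" using d by simp
   show "\<forall>k\<ge>?q. coeff p k = 0"
   proof (intro allI impI)
    fix k assume k: "k \<ge> ?q"
    have "coeff (1 :: 'k poly) k = 0" using k q by (intro coeff_eq_0) simp
    then show "coeff p k = 0"
     using k l d by (cases "k = ?q") (auto simp: p_def coeff_eq_0)
   qed
  qed
  moreover have "card {x. poly p x = 0} <= degree p" by (rule card_poly_roots_bound[OF p])
  moreover have "{x. poly p x = 0} = UNIV"
   by (auto simp: p_def poly_monom poly_power finite_field_power_card)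
  ultimately show False by simp
 qed
 then have "ev x p = 0" by simp
 have pw: "ev x (r ^ i) = ev x r ^ i" for r i by (induction i) auto
 have mo: "ev x (Polynomial.monom 1 i) = x ^ i" for i by (induction i) (auto simp: monom_0 monom_Suc)
 have "ev x p = (x + 1) ^ ?q - x ^ ?q - 1" by (simp add: p_def pw mo add.commute)
 then show ?thesis using \<open>ev x p = 0\<close> by (simp add: algebra_simps)
qed

lemma frobenius_add: "(x + y) ^ CARD('k) = x ^ CARD('k) + (y :: 'f) ^ CARD('k)"
proof (cases "y = 0")
 case False
 have "(x + y) ^ CARD('k) = (y * (x / y + 1)) ^ CARD('k)" using False by (simp add: distrib_left)
 also have "\<dots> = y ^ CARD('k) * ((x / y) ^ CARD('k) + 1)" by (simp only: power_mult_distrib frobenius_add_one)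
 also have "\<dots> = x ^ CARD('k) + y ^ CARD('k)" using False by (simp add: power_divide distrib_left)
 finally show ?thesis .
qed (simp add: power_0_left)

lemma frobenius_power_add: "(x + y) ^ (CARD('k) ^ e) = x ^ (CARD('k) ^ e) + (y :: 'f) ^ (CARD('k) ^ e)"
proof (induction e)
 case (Suc e)
 have "z ^ (CARD('k) ^ Suc e) = (z ^ (CARD('k) ^ e)) ^ CARD('k)" for z :: 'f by (simp add: mult.commute flip: power_mult)
 then show ?case by (simp only: Suc frobenius_add)
qed simp

lemma frobenius_power_uminus: "(- x) ^ (CARD('k) ^ e) = - ((x :: 'f) ^ (CARD('k) ^ e))"
proof -
 have "(x + - x) ^ (CARD('k) ^ e) = x ^ (CARD('k) ^ e) + (- x) ^ (CARD('k) ^ e)" by (rule frobenius_power_add)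
 then show ?thesis by (simp add: power_0_left eq_neg_iff_add_eq_0 add.commute)
qed

lemma frobenius_power_diff: "(x - y) ^ (CARD('k) ^ e) = x ^ (CARD('k) ^ e) - (y :: 'f) ^ (CARD('k) ^ e)"
 using frobenius_power_add[of x "- y" e] by (simp add: frobenius_power_uminus)

lemma frobenius_power_sum: "(\<Sum>i\<in>I. g i) ^ (CARD('k) ^ e) = (\<Sum>i\<in>I. (g i :: 'f) ^ (CARD('k) ^ e))"
 by (induction I rule: infinite_finite_induct) (simp_all add: power_0_left frobenius_power_add)

end

context dvr
begin

lemma poly_closed: "(!!i. coeff p i : P) ==> x : P ==> poly p x : P"
proof (induction p)
 case (pCons a p)
 have "coeff p i : P" for i using pCons.prems(1)[of "Suc i"] by simp
 then have "poly p x : P" using pCons by blast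
 moreover have "a : P" using pCons.prems(1)[of 0] by simp
 ultimately show ?case using closed(3,5) pCons.prems(2) by simp
qed (simp add: closed)

lemma synthetic_div_closed: "(!!i. coeff p i : P) ==> x : P ==> coeff (synthetic_div p x) i : P"
proof (induction p arbitrary: i)
 case (pCons a p)
 have c: "coeff p i : P" for i using pCons.prems(1)[of "Suc i"] by simp
 show ?case using pCons.IH[OF c pCons.prems(2)] poly_closed[OF c pCons.prems(2)]
  by (cases i) (auto simp: synthetic_div_pCons)
qed (simp add: closed)

text \<open>The bound on roots over the residue field, proved for lifted coefficients and roots.
  Synthetic division by a root leaves a quotient that is still nonzero modulo the maximal
  ideal.\<close>

lemma roots_mod_max_ideal:
 assumes "finite S" "S \<subseteq> P" "!!s t. s : S ==> t : S ==> s - t : max_ideal P ==> s = t"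
  and "!!i. coeff h i : P" "\<exists>i. coeff h i ~: max_ideal P" "!!s. s : S ==> poly h s : max_ideal P"
 shows "card S <= degree h"
 using assms
proof (induction "card S" arbitrary: S h)
 case (Suc k)
 obtain s where s: "s : S" using Suc.hyps(2) by fastforce
 have sP: "s : P" using s Suc.prems(2) by blast
 define g where "g = synthetic_div h s"
 have eq: "[:- s, 1:] * g + [:poly h s:] = h" unfolding g_def by (rule synthetic_div_correct'[symmetric, THEN sym])
 have gP: "coeff g i : P" for i unfolding g_def by (rule synthetic_div_closed[OF Suc.prems(4) sP])
 have ph: "poly h s : max_ideal P" by (rule Suc.prems(6)[OF s])
 have dh: "degree h ~= 0"
 proof
  assume "degree h = 0"
  then obtain a where "h = [:a:]" by (metis degree_eq_zeroE)
  then have "a : max_ideal P" using ph by simp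
  then have "coeff h i : max_ideal P" for i using \<open>h = [:a:]\<close> max_ideal_closed(6) by (cases i) auto
  then show False using Suc.prems(5) by blast
 qed
 have gn: "\<exists>i. coeff g i ~: max_ideal P"
 proof (rule ccontr)
  assume "\<not> ?thesis"
  then have g: "coeff g i : max_ideal P" for i by blast
  have "coeff h i : max_ideal P" for i
  proof -
   have "coeff h i = - s * coeff g i + (case i of 0 => 0 | Suc j => coeff g j) + (case i of 0 => poly h s | Suc j => 0)"
    by (subst eq[symmetric]) (simp add: coeff_pCons split: nat.split)
   moreover have "- s * coeff g i : max_ideal P" by (rule max_ideal_closed(3)[OF closed(6)[OF sP] g])
   moreover have "(case i of 0 => 0 | Suc j => coeff g j) : max_ideal P" using g max_ideal_closed(6) by (cases i) auto
   moreover have "(case i of 0 => poly h s | Suc j => 0) : max_ideal P" using ph max_ideal_closed(6) by (cases i) auto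
   ultimately show ?thesis by (simp only: max_ideal_closed(1))
  qed
  then show False using Suc.prems(5) by blast
 qed
 have "card (S - {s}) <= degree g"
 proof (rule Suc.hyps(1))
  show "k = card (S - {s})" using Suc.hyps(2) s by simp
  show "finite (S - {s})" "S - {s} \<subseteq> P" using Suc.prems by auto
  show "a = b" if "a : S - {s}" "b : S - {s}" "a - b : max_ideal P" for a b using Suc.prems(3) that by blast
  show "coeff g i : P" for i by (rule gP)
  show "\<exists>i. coeff g i ~: max_ideal P" by (rule gn)
  fix t assume t: "t : S - {s}"
  then have tP: "t : P" using Suc.prems(2) by blast
  have "poly h t = (t - s) * poly g t + poly h s" by (subst eq[symmetric]) (simp add: algebra_simps)
  then have "(t - s) * poly g t = poly h t - poly h s" by simp
  then have "(t - s) * poly g t : max_ideal P" using max_ideal_closed(2) Suc.prems(6) t ph by simp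
  moreover have "t - s ~: max_ideal P" using Suc.prems(3) s t by blast
  moreover have "t - s : P" "poly g t : P" using closed(4) sP tP poly_closed[OF gP tP] by auto
  ultimately show "poly g t : max_ideal P" using max_ideal_prime by blast
 qed
 moreover have "degree g = degree h - 1" by (simp add: g_def degree_synthetic_div)
 ultimately show ?case using dh Suc.hyps(2) s Suc.prems(1) by simp
qed simp

end

context curve
begin

lemma residue_hom:
 assumes P: "P : closed_points PX"
 shows "(%y. max_ideal P +[P] y) : ring_hom (subring_of P) (residue_field P)"
  "field (residue_field P)"
  "max_ideal P +[P] y = max_ideal P +[P] z \<longleftrightarrow> y - z : max_ideal P"
proof -
 interpret dvr P by (rule place_dvr[OF P])
 have K: "range \<iota> \<subseteq> P" using place_constants[OF P] by blast
 have id: "ideal (max_ideal P) (subring_of P)" using residue_ring_ideal[OF dvr_axioms K, of 1] by simp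
 show "(%y. max_ideal P +[P] y) : ring_hom (subring_of P) (residue_field P)"
  unfolding residue_field_def by (rule ideal.rcos_ring_hom[OF id])
 show "field (residue_field P)" by (rule residue_field_field[OF dvr_axioms K])
 show "max_ideal P +[P] y = max_ideal P +[P] z \<longleftrightarrow> y - z : max_ideal P"
  by (rule coset_eq_iff) (use max_ideal_closed in auto)
qed

lemma residue_power:
 assumes P: "P : closed_points PX" and y: "y : P"
 shows "max_ideal P +[P] (y ^ i) = (max_ideal P +[P] y) [^]\<^bsub>residue_field P\<^esub> i"
proof -
 interpret dvr P by (rule place_dvr[OF P])
 interpret RF: field "residue_field P" by (rule residue_hom(2)[OF P])
 note hom = residue_hom(1)[OF P]
 show ?thesis
 proof (induction i)
  case 0
  then show ?case using ring_hom_one[OF hom] by simp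
 next
  case (Suc i)
  have "max_ideal P +[P] (y ^ i * y) =
    (max_ideal P +[P] (y ^ i)) \<otimes>\<^bsub>residue_field P\<^esub> (max_ideal P +[P] y)"
   using ring_hom_mult[OF hom, of "y ^ i" y] y closed(7) by simp
  then show ?case using Suc by (simp add: mult.commute)
 qed
qed

lemma residue_zero_iff:
 assumes P: "P : closed_points PX"
 shows "max_ideal P +[P] y = \<zero>\<^bsub>residue_field P\<^esub> \<longleftrightarrow> y : max_ideal P"
proof -
 interpret dvr P by (rule place_dvr[OF P])
 interpret RF: field "residue_field P" by (rule residue_hom(2)[OF P])
 have r: "ring (subring_of P)" by (rule rota.subring_is_ring[OF subring])
 have "max_ideal P +[P] (0 :: 'f) = \<zero>\<^bsub>residue_field P\<^esub>"
  using ring_hom_zero[OF residue_hom(1)[OF P] r RF.ring_axioms] by simp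
 then show ?thesis using residue_hom(3)[OF P, of y 0] by simp
qed

lemma residue_power_card:
 assumes P: "P : closed_points PX" and y: "y : P"
 shows "y ^ (CARD('k) ^ point_degree \<iota> P) - y : max_ideal P"
proof -
 interpret dvr P by (rule place_dvr[OF P])
 interpret RF: field "residue_field P" by (rule residue_hom(2)[OF P])
 let ?h = "%y. max_ideal P +[P] y" and ?R = "CARD('k) ^ point_degree \<iota> P"
 have cR: "card (carrier (residue_field P)) = ?R" "finite (carrier (residue_field P))"
  using residue_field_finite[OF P] by auto
 have hy: "?h y : carrier (residue_field P)" using y by (auto simp: carrier_residue_field)
 have R0: "?R > 0" by simp
 have "?h y [^]\<^bsub>residue_field P\<^esub> ?R = ?h y"
 proof (cases "?h y = \<zero>\<^bsub>residue_field P\<^esub>")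
  case True
  then show ?thesis using R0 RF.nat_pow_zero by simp
 next
  case False
  interpret MG: group "Multiplicative_Group.mult_of (residue_field P)" by (rule RF.field_mult_group)
  have "?h y [^]\<^bsub>Multiplicative_Group.mult_of (residue_field P)\<^esub> Coset.order (Multiplicative_Group.mult_of (residue_field P)) = \<one>\<^bsub>Multiplicative_Group.mult_of (residue_field P)\<^esub>"
   by (rule MG.pow_order_eq_1) (use False hy in simp)
  then have "?h y [^]\<^bsub>residue_field P\<^esub> (?R - 1) = \<one>\<^bsub>residue_field P\<^esub>"
   using RF.order_mult_of[OF cR(2)] cR(1) by (simp add: Multiplicative_Group.mult_of_simps Coset.order_def)
  moreover have "?h y [^]\<^bsub>residue_field P\<^esub> Suc (?R - 1) = ?h y [^]\<^bsub>residue_field P\<^esub> (?R - 1) \<otimes>\<^bsub>residue_field P\<^esub> ?h y"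
   by (rule RF.nat_pow_Suc)
  ultimately have "?h y [^]\<^bsub>residue_field P\<^esub> Suc (?R - 1) = ?h y" using hy by (simp del: RF.nat_pow_Suc)
  moreover have "Suc (?R - 1) = ?R" using R0 by simp
  ultimately show ?thesis by (simp only:)
 qed
 then have "?h (y ^ ?R) = ?h y" using residue_power[OF P y, of ?R] by simp
 then show ?thesis unfolding residue_hom(3)[OF P] .
qed

text \<open>Lifts a generator of the multiplicative group of the residue field, so that congruences
  between automorphisms and Frobenius powers can be tested on one element.\<close>

lemma residue_primitive:
 assumes P: "P : closed_points PX"
 obtains y where "y : P" "y ~: max_ideal P" "!!z. z : P ==> z : max_ideal P \<or> (\<exists>j. z - y ^ j : max_ideal P)"
proof -
 interpret RF: field "residue_field P" by (rule residue_hom(2)[OF P])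
 let ?h = "%y. max_ideal P +[P] y"
 obtain a where a: "a : carrier (Multiplicative_Group.mult_of (residue_field P))"
  "carrier (Multiplicative_Group.mult_of (residue_field P)) = {a [^]\<^bsub>residue_field P\<^esub> i | i::nat. i : UNIV}"
  using RF.finite_field_mult_group_has_gen[OF residue_field_finite(1)[OF P]] by blast
 then obtain y where y: "y : P" "a = ?h y" by (auto simp: carrier_residue_field)
 have "y ~: max_ideal P" using a(1) y residue_zero_iff[OF P, of y] by simp
 moreover have "z : max_ideal P \<or> (\<exists>j. z - y ^ j : max_ideal P)" if z: "z : P" for z
 proof (cases "z : max_ideal P")
  case False
  then have "?h z : carrier (Multiplicative_Group.mult_of (residue_field P))"
   using z residue_zero_iff[OF P, of z] by (auto simp: carrier_residue_field)
  then obtain j :: nat where "?h z = a [^]\<^bsub>residue_field P\<^esub> j" unfolding a(2) by blast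
  then have "?h z = ?h (y ^ j)" using residue_power[OF P y(1), of j] y(2) by simp
  then show ?thesis unfolding residue_hom(3)[OF P] by blast
 qed simp
 ultimately show ?thesis using that y by blast
qed

lemma incongruent_set:
 assumes P: "P : closed_points PX"
 obtains S where "S \<subseteq> P" "finite S" "card S = CARD('k) ^ point_degree \<iota> P"
  "!!s t. s : S ==> t : S ==> s - t : max_ideal P ==> s = t"
  "!!z. z : P ==> \<exists>s\<in>S. z - s : max_ideal P"
proof -
 let ?h = "%y. max_ideal P +[P] y"
 obtain S where S: "S \<subseteq> P" "inj_on ?h S" "?h ` S = ?h ` P"
  using subset_image_inj[of "?h ` P" ?h P] by auto
 have "card S = card (?h ` P)" using card_image[OF S(2)] S(3) by simp
 then have "card S = CARD('k) ^ point_degree \<iota> P" using residue_field_finite(2)[OF P] by (simp add: carrier_residue_field)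
 moreover have "finite S" using residue_field_finite(1)[OF P] S finite_image_iff[OF S(2)] by (simp add: carrier_residue_field)
 moreover have "s = t" if "s : S" "t : S" "s - t : max_ideal P" for s t
  using inj_onD[OF S(2) _ that(1,2)] residue_hom(3)[OF P, of s t] that(3) by blast
 moreover have "\<exists>s\<in>S. z - s : max_ideal P" if "z : P" for z
 proof -
  have "?h z : ?h ` S" unfolding S(3) using that by blast
  then obtain s where "s : S" "?h z = ?h s" by blast
  then show ?thesis using residue_hom(3)[OF P, of z s] by blast
 qed
 ultimately show ?thesis using that S(1) by blast
qed

end

subsection \<open>Field automorphisms\<close>

definition field_auto :: "('g::Fields.field => 'g) => bool" where
 "field_auto c \<longleftrightarrow> bij c & (\<forall>x y. c (x + y) = c x + c y) & (\<forall>x y. c (x * y) = c x * c y)"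

lemma field_autoD:
 assumes "field_auto c"
 shows "bij c" "c (x + y) = c x + c y" "c (x * y) = c x * c y" "c 0 = 0" "c 1 = 1" "c (- x) = - c x"
  "c (x - y) = c x - c y" "c x = 0 \<longleftrightarrow> x = 0" "c (inverse x) = inverse (c x)" "c (x ^ i) = c x ^ i"
  "c (x powi k) = c x powi k" "c (sum f I) = (\<Sum>i\<in>I. c (f i))" "c (prod f I) = (\<Prod>i\<in>I. c (f i))"
  "c x = c y \<longleftrightarrow> x = y"
proof -
 show b: "bij c" and a: "c (x + y) = c x + c y" and m: "c (x * y) = c x * c y" for x y
  using assms by (auto simp: field_auto_def)
 show inj: "c x = c y \<longleftrightarrow> x = y" for x y using b by (auto simp: bij_def inj_def)
 show 0: "c 0 = 0" using a[of 0 0] by (metis add_0 add_cancel_right_left)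
 show z: "c x = 0 \<longleftrightarrow> x = 0" for x using inj[of x 0] 0 by simp
 show 1: "c 1 = 1" using m[of 1 1] z[of 1] by simp
 show u: "c (- x) = - c x" for x using a[of x "- x"] 0 by (simp add: eq_neg_iff_add_eq_0 add.commute)
 show "c (x - y) = c x - c y" using a[of x "- y"] u by simp
 show i: "c (inverse x) = inverse (c x)" for x
 proof (cases "x = 0")
  case False
  then have "c x * c (inverse x) = 1" using m[of x "inverse x"] 1 by simp
  then show ?thesis using inverse_unique by metis
 qed (simp add: 0)
 show p: "c (x ^ i) = c x ^ i" for x i by (induction i) (simp_all add: 1 m)
 show "c (x powi k) = c x powi k" by (simp add: power_int_def p i)
 show "c (sum f I) = (\<Sum>i\<in>I. c (f i))" by (induction I rule: infinite_finite_induct) (simp_all add: 0 a)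
 show "c (prod f I) = (\<Prod>i\<in>I. c (f i))" by (induction I rule: infinite_finite_induct) (simp_all add: 1 m)
qed

lemma vimage_dvr:
 assumes c: "field_auto c" and Q: "dvr Q"
 shows "dvr (c -` Q)" "max_ideal (c -` Q) = c -` max_ideal Q" "val (c -` Q) x = val Q (c x)"
proof -
 interpret dvr Q by fact
 note ca = field_autoD[OF c]
 show m: "max_ideal (c -` Q) = c -` max_ideal Q" by (auto simp: max_ideal_def ca)
 have u: "uniformizer (c -` Q) \<pi>" if \<pi>: "c \<pi> = \<rho>" "uniformizer Q \<rho>" for \<pi> \<rho>
  unfolding uniformizer_def m
 proof (intro conjI allI impI)
  show "\<pi> : c -` max_ideal Q" using \<pi> by (simp add: uniformizer_def)
  show "\<pi> ~= 0" using \<pi> ca(4) by (auto simp: uniformizer_def)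
  fix x :: 'a assume "x ~= 0"
  then have "c x ~= 0" by (simp add: ca)
  then obtain k w where k: "w : Q - max_ideal Q" "c x = w * \<rho> powi k" using \<pi>(2) unfolding uniformizer_def by blast
  obtain v where v: "c v = w" using ca(1) by (metis bij_pointE)
  have "c x = c (v * \<pi> powi k)" using k v \<pi> by (simp add: ca(3,11))
  then have "x = v * \<pi> powi k" by (simp add: ca(14))
  moreover have "v : c -` Q - c -` max_ideal Q" using k v by simp
  ultimately show "\<exists>k. \<exists>u\<in>c -` Q - c -` max_ideal Q. x = u * \<pi> powi k" by blast
 qed
 obtain \<rho> where \<rho>: "uniformizer Q \<rho>" using ex_uniformizer by blast
 obtain \<pi> where \<pi>: "c \<pi> = \<rho>" using ca(1) by (metis bij_pointE)
 have "subring (c -` Q) ring_of_type_algebra"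
  unfolding subring_rota_iff by (simp add: ca closed)
 then show d: "dvr (c -` Q)" using u[OF \<pi> \<rho>] by unfold_locales (auto simp: discrete_valuation_ring_def)
 show "val (c -` Q) x = val Q (c x)"
 proof (cases "x = 0")
  case True

  \<comment> \<open>Zero has no representation as a unit times a power of a uniformizer, so both
    sides are the same empty description.\<close>
  have e: "(\<exists>\<pi>. \<exists>u\<in>R - max_ideal R. uniformizer R \<pi> & 0 = u * \<pi> powi k) = False" if "dvr R" for R :: "'a set" and k
  proof -
   have "u * \<pi> powi k ~= 0" if "u : R - max_ideal R" "uniformizer R \<pi>" for u \<pi>
    using that dvr.unit_iff[OF \<open>dvr R\<close>, of u] by (auto simp: uniformizer_def)
   then show ?thesis by (metis (no_types))
  qed
  show ?thesis unfolding val_def True ca(4) e[OF d] e[OF Q] ..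
 next
  case False
  then obtain w where w: "w : Q - max_ideal Q" "c x = w * \<rho> powi val Q (c x)" using val_rep[OF \<rho>, of "c x"] by (auto simp: ca)
  obtain v where v: "c v = w" using ca(1) by (metis bij_pointE)
  have "c x = c (v * \<pi> powi val Q (c x))" using w v \<pi> by (simp add: ca(3,11))
  then have "x = v * \<pi> powi val Q (c x)" by (simp add: ca(14))
  moreover have "v : c -` Q - max_ideal (c -` Q)" using w v m by simp
  ultimately show ?thesis using dvr.val_eqI[OF d u[OF \<pi> \<rho>]] by metis
 qed
qed

lemma vimage_vset: "field_auto c ==> dvr Q ==> vset (c -` Q) k = c -` vset Q k"
 by (auto simp: vset_def vimage_dvr(3) field_autoD(8))

subsection \<open>Unramified cyclic covers\<close>

text \<open>Units modulo \<open>d\<close> lift to units modulo \<open>n\<close>. With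
  \<open>t\<close> the product of the primes dividing \<open>n\<close> but neither \<open>d\<close>
  nor \<open>j\<close>, each prime factor of \<open>n\<close> divides exactly one of
  \<open>j\<close> and \<open>d * t\<close>, hence not their sum.\<close>

lemma coprime_lift:
 fixes d j n :: nat
 assumes "coprime j d" "d dvd n" "n > 0"
 obtains i where "i mod d = j mod d" "coprime i n"
proof -
 define t where "t = \<Prod>{p. Factorial_Ring.prime p & p dvd n & \<not> p dvd d & \<not> p dvd j}"
 have fin: "finite {p. Factorial_Ring.prime p & p dvd n & \<not> p dvd d & \<not> p dvd j}"
  by (rule finite_subset[of _ "{..n}"]) (use assms(3) in \<open>auto dest: dvd_imp_le\<close>)
 define i where "i = j + d * t"
 have "coprime i n"
 proof (rule ccontr)
  assume "\<not> coprime i n"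
  then obtain p where p: "Factorial_Ring.prime p" "p dvd i" "p dvd n"
   using prime_factor_nat[of "gcd i n"] by (auto simp: coprime_iff_gcd_eq_1)
  show False
  proof (cases "p dvd d")
   case True
   then have "p dvd j" using p(2) unfolding i_def by (metis dvd_add_left_iff dvd_mult2)
   then show False using True assms(1) p(1) by (metis coprime_common_divisor_nat not_prime_1)
  next
   case False
   show False
   proof (cases "p dvd j")
    case True
    then have "p dvd d * t" using p(2) unfolding i_def by (metis dvd_add_right_iff)
    then have "p dvd t" using False p(1) by (simp add: prime_dvd_mult_iff)
    then obtain r where r: "Factorial_Ring.prime r" "\<not> r dvd j" "p dvd r"
     unfolding t_def using prime_dvd_prod_iff[OF fin p(1), of id] by auto
    then have "p = r" using p(1) primes_dvd_imp_eq by blast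
    then show False using r True by simp
   next
    case nj: False
    then have "p dvd t" unfolding t_def using fin p False by (intro dvd_prodI) auto
    then have "p dvd j" using p(2) unfolding i_def by (metis dvd_add_left_iff dvd_mult)
    then show False using nj by simp
   qed
  qed
 qed
 moreover have "i mod d = j mod d" by (simp add: i_def)
 ultimately show ?thesis using that by blast
qed

locale cyclic_cover =
 fixes \<iota>X :: "'k::{Fields.field,finite} => 'f::Fields.field" and PX :: "'f set set"
  and \<iota>Y :: "'k => 'g::Fields.field" and PY :: "'g set set" and \<phi> :: "'f => 'g" and n :: nat
 assumes curve_X: "smooth_projective_curve \<iota>X PX"
  and curve_Y: "smooth_projective_curve \<iota>Y PY"
  and cover: "galois_cover \<iota>X PX \<iota>Y PY \<phi>" and unram: "unramified \<phi> PY"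
  and cyclic: "cyclic_group (galois_group \<phi>)" and order: "Coset.order (galois_group \<phi>) = n"
begin

sublocale X: curve \<iota>X PX by unfold_locales (rule curve_X)
sublocale Y: curve \<iota>Y PY by unfold_locales (rule curve_Y)

abbreviation PPX :: "'f set set" where "PPX \<equiv> closed_points PX"
abbreviation PPY :: "'g set set" where "PPY \<equiv> closed_points PY"
abbreviation C :: "('g => 'g) set" where "C \<equiv> carrier (galois_group \<phi>)"

lemma \<phi>_hom: "\<phi> : ring_hom ring_of_type_algebra ring_of_type_algebra"
 using cover by (simp add: galois_cover_def curve_morphism_def)

lemma \<phi>_add [simp]: "\<phi> (x + y) = \<phi> x + \<phi> y" and \<phi>_mult [simp]: "\<phi> (x * y) = \<phi> x * \<phi> y" and \<phi>_1 [simp]: "\<phi> 1 = 1"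
 using \<phi>_hom by (auto simp: ring_hom_rota_iff)

lemma \<phi>_0 [simp]: "\<phi> 0 = 0"
 using \<phi>_add[of 0 0] by (metis add_0 add_cancel_right_left)

lemma \<phi>_uminus [simp]: "\<phi> (- x) = - \<phi> x"
 using \<phi>_add[of x "- x"] by (simp del: \<phi>_add add: eq_neg_iff_add_eq_0 add.commute)

lemma \<phi>_diff [simp]: "\<phi> (x - y) = \<phi> x - \<phi> y"
 using \<phi>_add[of x "- y"] by (simp del: \<phi>_add)

lemma \<phi>_eq_0_iff [simp]: "\<phi> x = 0 \<longleftrightarrow> x = 0"
proof
 assume "\<phi> x = 0"
 show "x = 0"
 proof (rule ccontr)
  assume "x ~= 0"
  then have "\<phi> (x * inverse x) = 1" by simp
  then show False using \<open>\<phi> x = 0\<close> by (simp only: \<phi>_mult) simp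
 qed
qed simp

lemma \<phi>_eq_iff [simp]: "\<phi> x = \<phi> y \<longleftrightarrow> x = y"
 by (metis \<phi>_diff \<phi>_eq_0_iff eq_iff_diff_eq_0)

lemma \<phi>_inverse [simp]: "\<phi> (inverse x) = inverse (\<phi> x)"
proof (cases "x = 0")
 case False
 then have "\<phi> x * \<phi> (inverse x) = 1" using \<phi>_mult[of x "inverse x"] by (simp del: \<phi>_mult)
 then show ?thesis using inverse_unique by metis
qed simp

lemma \<phi>_power [simp]: "\<phi> (x ^ i) = \<phi> x ^ i" by (induction i) auto
lemma \<phi>_powi [simp]: "\<phi> (x powi k) = \<phi> x powi k" by (simp add: power_int_def)
lemma \<phi>_sum [simp]: "\<phi> (sum f I) = (\<Sum>i\<in>I. \<phi> (f i))"
 by (induction I rule: infinite_finite_induct) auto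

lemma \<phi>_\<iota> [simp]: "\<phi> (\<iota>X a) = \<iota>Y a"
 using cover unfolding galois_cover_def curve_morphism_def by (metis comp_apply)

lemma C_iff: "c : C \<longleftrightarrow> field_auto c & (\<forall>x. c (\<phi> x) = \<phi> x)"
proof
 assume "c : C"
 then show "field_auto c & (\<forall>x. c (\<phi> x) = \<phi> x)"
  by (simp add: galois_group_def ring_iso_def ring_hom_rota_iff field_auto_def)
next
 assume c: "field_auto c & (\<forall>x. c (\<phi> x) = \<phi> x)"
 then have "c 1 = 1" using field_autoD(5) by blast
 then show "c : C" using c
  by (simp add: galois_group_def ring_iso_def ring_hom_rota_iff field_auto_def)
qed

lemma C_auto: "c : C ==> field_auto c" and C_\<phi>: "c : C ==> c (\<phi> x) = \<phi> x"
 by (auto simp: C_iff)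

lemma C_\<iota>: "c : C ==> c (\<iota>Y a) = \<iota>Y a"
 using C_\<phi>[of c "\<iota>X a"] by simp

lemma C_id: "id : C" by (simp add: C_iff field_auto_def)

lemma C_comp: "c : C ==> e : C ==> c \<circ> e : C"
 by (auto simp: C_iff field_auto_def intro: bij_comp)

lemma C_inverse: assumes c: "c : C" shows "\<exists>e\<in>C. (\<forall>x. c (e x) = x) & (\<forall>x. e (c x) = x)"
proof -
 note ca = field_autoD[OF C_auto[OF c]]
 define e where "e = inv_into UNIV c"
 have ec: "e (c x) = x" for x using ca(1) by (simp add: e_def bij_def)
 have ce: "c (e x) = x" for x using ca(1) by (simp add: e_def bij_def surj_f_inv_f)
 have "bij e" unfolding e_def by (rule bij_imp_bij_inv[OF ca(1)])
 moreover have "e (x + y) = e x + e y" for x y by (metis ca(2) ce ec)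
 moreover have "e (x * y) = e x * e y" for x y by (metis ca(3) ce ec)
 moreover have "e (\<phi> x) = \<phi> x" for x by (metis C_\<phi>[OF c] ec)
 ultimately have "e : C" by (simp add: C_iff field_auto_def)
 then show ?thesis using ce ec by blast
qed

lemma finite_C: "finite C" and card_C: "card C = n"
 using cover order by (auto simp: galois_cover_def Coset.order_def)

lemma fixed_field: "(!!c. c : C ==> c y = y) ==> y : range \<phi>"
 using cover by (auto simp: galois_cover_def)

lemma galois_mult: "c \<otimes>\<^bsub>galois_group \<phi>\<^esub> e = c \<circ> e" and galois_one: "\<one>\<^bsub>galois_group \<phi>\<^esub> = id"
 by (simp_all add: galois_group_def)

lemma galois_group_group: "group (galois_group \<phi>)"
proof (rule groupI, goal_cases)
 case 1
 then show ?case using C_comp by (simp only: galois_mult)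
next
 case 2
 show ?case using C_id by (simp only: galois_one)
next
 case (3 x y z)
 show ?case by (simp only: galois_mult comp_assoc)
next
 case (4 x)
 show ?case by (simp only: galois_mult galois_one id_comp)
next
 case (5 x)
 obtain e where e: "e : C" "!!z. e (x z) = z" using C_inverse[OF 5] by blast
 then have "e \<circ> x = id" by (simp add: fun_eq_iff)
 then show ?case using e(1) by (intro bexI[of _ e]) (simp_all only: galois_mult galois_one)
qed

lemma galois_pow: "c [^]\<^bsub>galois_group \<phi>\<^esub> (i::nat) = c ^^ i"
proof (induction i)
 case (Suc i)
 have "c [^]\<^bsub>galois_group \<phi>\<^esub> Suc i = c [^]\<^bsub>galois_group \<phi>\<^esub> i \<otimes>\<^bsub>galois_group \<phi>\<^esub> c"
  by (simp add: nat_pow_def)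
 also have "\<dots> = (c ^^ i) \<circ> c" by (simp only: Suc galois_mult)
 also have "\<dots> = c ^^ Suc i" by (simp add: fun_eq_iff funpow_swap1)
 finally show ?case .
qed (simp add: nat_pow_def galois_group_def)

lemma C_pow: "c : C ==> c ^^ i : C"
 by (induction i) (auto intro: C_comp C_id)

lemma n_pos: "n > 0" using card_C finite_C C_id by (metis card_gt_0_iff empty_iff)

lemma C_pow_n: "c : C ==> c ^^ n = id"
 using group.pow_order_eq_1[OF galois_group_group, of c] order by (simp add: galois_pow) (simp add: galois_group_def)

lemma generator:
 obtains \<sigma> where "\<sigma> : C" "C = (%i. \<sigma> ^^ i) ` {..<n}" "inj_on (%i. \<sigma> ^^ i) {..<n}"
proof -
 interpret G: group "galois_group \<phi>" by (rule galois_group_group)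
 obtain \<sigma> where \<sigma>: "\<sigma> : C" "subgroup_generated (galois_group \<phi>) {\<sigma>} = galois_group \<phi>"
  using cyclic by (auto simp: cyclic_group_def)
 have CU: "C = (%i::int. \<sigma> [^]\<^bsub>galois_group \<phi>\<^esub> i) ` UNIV"
  using G.carrier_subgroup_generated_by_singleton[OF \<sigma>(1)] \<sigma>(2) by simp
 have pw: "\<sigma> [^]\<^bsub>galois_group \<phi>\<^esub> i : (%i. \<sigma> ^^ i) ` {..<n}" for i :: int
 proof -
  have "\<sigma> [^]\<^bsub>galois_group \<phi>\<^esub> i = \<sigma> [^]\<^bsub>galois_group \<phi>\<^esub> (int n * (i div int n) + i mod int n)" by simp
  also have "\<dots> = \<sigma> [^]\<^bsub>galois_group \<phi>\<^esub> (int n * (i div int n)) \<otimes>\<^bsub>galois_group \<phi>\<^esub> \<sigma> [^]\<^bsub>galois_group \<phi>\<^esub> (i mod int n)"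
   using \<sigma>(1) by (simp only: G.int_pow_mult)
  also have "\<sigma> [^]\<^bsub>galois_group \<phi>\<^esub> (int n * (i div int n)) = (\<sigma> [^]\<^bsub>galois_group \<phi>\<^esub> int n) [^]\<^bsub>galois_group \<phi>\<^esub> (i div int n)"
   using \<sigma>(1) by (simp add: G.int_pow_pow)
  also have "\<sigma> [^]\<^bsub>galois_group \<phi>\<^esub> int n = \<one>\<^bsub>galois_group \<phi>\<^esub>"
   using G.pow_order_eq_1[OF \<sigma>(1)] order by (simp add: int_pow_int)
  also have "\<sigma> [^]\<^bsub>galois_group \<phi>\<^esub> (i mod int n) = \<sigma> ^^ nat (i mod int n)"
   using n_pos galois_pow[of \<sigma> "nat (i mod int n)"] int_pow_int[of "galois_group \<phi>" \<sigma> "nat (i mod int n)"] by simp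
  finally have "\<sigma> [^]\<^bsub>galois_group \<phi>\<^esub> i = \<sigma> ^^ nat (i mod int n)"
   using C_pow[OF \<sigma>(1)] by simp
  moreover have "nat (i mod int n) < n" using n_pos by (simp add: nat_less_iff)
  ultimately show ?thesis by blast
 qed
 have sub: "C \<subseteq> (%i. \<sigma> ^^ i) ` {..<n}" by (subst CU) (rule image_subsetI, rule pw)
 then have eq: "C = (%i. \<sigma> ^^ i) ` {..<n}" using C_pow[OF \<sigma>(1)] by blast
 then have "card ((%i. \<sigma> ^^ i) ` {..<n}) = card {..<n}" using card_C by simp
 then have "inj_on (%i. \<sigma> ^^ i) {..<n}" by (simp add: eq_card_imp_inj_on)
 then show ?thesis using that \<sigma>(1) eq by blast
qed

lemma act_place: "c : C ==> Q : PPY ==> c -` Q : PPY"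
 by (rule Y.dvr_is_place[OF vimage_dvr(1)[OF C_auto Y.place_dvr]]) (auto simp: C_\<iota> Y.place_constants)

lemma infinite_UNIV_X: "infinite (UNIV :: 'f set)"
proof
 assume fin: "finite (UNIV :: 'f set)"
 obtain x where x: "x ~: range \<iota>X" by (rule X.exists_transcendental)
 have "\<not> inj (%i::nat. x ^ i)" using fin finite_subset[OF subset_UNIV fin] finite_imageD[of "%i::nat. x ^ i" UNIV] infinite_UNIV_nat by blast
 then obtain i j :: nat where ij: "x ^ i = x ^ j" "i ~= j" by (auto simp: inj_def)
 have mo: "X.ev x (Polynomial.monom 1 i) = x ^ i" for i by (induction i) (auto simp: monom_0 monom_Suc)
 have "X.ev x (Polynomial.monom 1 i - Polynomial.monom 1 j) = 0" using ij by (simp add: mo)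
 then have "Polynomial.monom (1::'k) i - Polynomial.monom 1 j = 0" by (rule X.transcendental_imp[OF x])
 then have "coeff (Polynomial.monom (1::'k) i - Polynomial.monom 1 j) i = 0" by simp
 then show False using ij(2) by simp
qed

text \<open>A morphism could send \<open>Q\<close> to the generic point, but then the infinite field
  of functions on X would embed into the finite residue field of \<open>Q\<close>.\<close>

lemma restrict_place: assumes Q: "Q : PPY" shows "\<phi> -` Q : PPX"
proof -
 have "\<phi> -` Q ~= UNIV"
 proof
  assume U: "\<phi> -` Q = UNIV"
  let ?h = "%x. max_ideal Q +[Q] \<phi> x"
  have "inj ?h"
  proof (rule injI)
   fix x y assume "?h x = ?h y"
   then have m: "\<phi> (x - y) : max_ideal Q" using Y.residue_hom(3)[OF Q] by simp
   have "inverse (\<phi> (x - y)) : Q" using U \<phi>_inverse[of "x - y"] by (metis UNIV_I vimage_eq)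
   then have "\<phi> (x - y) = 0" using m by (simp add: max_ideal_def del: \<phi>_diff)
   then show "x = y" using \<phi>_eq_0_iff[of "x - y"] by simp
  qed
  moreover have "range ?h \<subseteq> carrier (residue_field Q)" using U by (auto simp: Y.carrier_residue_field)
  then have "finite (range ?h)" using Y.residue_field_finite(1)[OF Q] finite_subset by blast
  ultimately show False using infinite_UNIV_X finite_imageD by blast
 qed
 moreover have "\<phi> -` Q : PX" using cover Q by (simp add: galois_cover_def curve_morphism_def closed_points_def)
 ultimately show ?thesis by (simp add: closed_points_def)
qed

text \<open>Unramifiedness says that one chosen uniformizer of the point below keeps value 1; units
  stay units, so all values are preserved.\<close>

lemma val_\<phi>: assumes Q: "Q : PPY" shows "val Q (\<phi> x) = val (\<phi> -` Q) x"
proof (cases "x = 0")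
 case True
 have e: "(\<exists>\<pi>. \<exists>u\<in>R - max_ideal R. uniformizer R \<pi> & 0 = u * \<pi> powi k) = False" if "dvr R" for R :: "'b::Fields.field set" and k
 proof -
  have "u * \<pi> powi k ~= 0" if "u : R - max_ideal R" "uniformizer R \<pi>" for u \<pi>
   using that dvr.unit_iff[OF \<open>dvr R\<close>, of u] by (auto simp: uniformizer_def)
  then show ?thesis by (metis (no_types))
 qed
 show ?thesis unfolding val_def True \<phi>_0 e[OF Y.place_dvr[OF Q]] e[OF X.place_dvr[OF restrict_place[OF Q]]] ..
next
 case False
 interpret Q: dvr Q by (rule Y.place_dvr[OF Q])
 interpret B: dvr "\<phi> -` Q" by (rule X.place_dvr[OF restrict_place[OF Q]])
 define \<pi> where "\<pi> = (SOME \<pi>. uniformizer (\<phi> -` Q) \<pi>)"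
 have \<pi>: "uniformizer (\<phi> -` Q) \<pi>" unfolding \<pi>_def by (rule someI_ex[OF B.ex_uniformizer])
 have v1: "val Q (\<phi> \<pi>) = 1" using unram Q by (simp add: unramified_def ramification_index_def \<pi>_def)
 have nz: "\<pi> ~= 0" using \<pi> by (auto simp: uniformizer_def)
 obtain u where u: "u : \<phi> -` Q - max_ideal (\<phi> -` Q)" "x = u * \<pi> powi val (\<phi> -` Q) x"
  using B.val_rep[OF \<pi> False] .
 then have "\<phi> u : Q - max_ideal Q" unfolding B.unit_iff Q.unit_iff by simp
 then have "val Q (\<phi> u) = 0" by (rule Q.val_unit)
 moreover have "u ~= 0" using u(1) unfolding B.unit_iff by simp
 ultimately have "val Q (\<phi> (u * \<pi> powi k)) = k" for k using v1 nz by (simp add: Q.val_mult Q.val_powi)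
 then show ?thesis using u(2) by metis
qed

lemma max_ideal_\<phi>: "Q : PPY ==> \<phi> x : max_ideal Q \<longleftrightarrow> x : max_ideal (\<phi> -` Q)"
 by (simp add: max_ideal_def)

lemma vset_\<phi>: "Q : PPY ==> \<phi> x : vset Q k \<longleftrightarrow> x : vset (\<phi> -` Q) k"
 by (simp add: vset_def val_\<phi>)

lemma restrict_act: "c : C ==> \<phi> -` (c -` Q) = \<phi> -` Q" by (auto simp: C_\<phi>)

text \<open>Chevalley's theorem for the image of \<open>b\<close> gives a place whose restriction
  contains \<open>b\<close>, and \<open>b\<close> is maximal.\<close>

lemma fiber_nonempty: assumes b: "b : PPX" shows "fiber \<phi> PY b ~= {}"
proof -
 interpret B: dvr b by (rule X.place_dvr[OF b])
 obtain \<pi> where \<pi>: "uniformizer b \<pi>" using B.ex_uniformizer by blast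
 have R: "subring (\<phi> ` b) ring_of_type_algebra"
  unfolding subring_rota_iff
 proof (intro conjI ballI)
  show "1 : \<phi> ` b" using B.closed(1) by (metis \<phi>_1 imageI)
  fix x y assume "x : \<phi> ` b" "y : \<phi> ` b"
  then obtain u v where "u : b" "v : b" "x = \<phi> u" "y = \<phi> v" by blast
  then show "x - y : \<phi> ` b" "x * y : \<phi> ` b" using B.closed(4,5) by (metis \<phi>_diff imageI, metis \<phi>_mult imageI)
 qed
 have \<pi>': "\<pi> : b" "\<pi> ~= 0" "inverse \<pi> ~: b" using \<pi> by (auto simp: uniformizer_def max_ideal_def)
 have K: "range \<iota>Y \<subseteq> \<phi> ` b" using X.place_constants[OF b] \<phi>_\<iota> by (metis imageI image_subsetI)
 have i: "inverse (\<phi> \<pi>) ~: \<phi> ` b" using \<pi>'(3) by (metis \<phi>_eq_iff \<phi>_inverse imageE)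
 obtain Q where Q: "Q : PPY" "\<phi> ` b \<subseteq> Q" "\<phi> \<pi> : max_ideal Q"
  by (rule Y.exists_place[OF R K _ _ i]) (use \<pi>' in auto)
 have "b \<subseteq> \<phi> -` Q" using Q by blast
 then have "\<phi> -` Q = b" using B.maximal_dvr[OF dvr.dvr[OF X.place_dvr[OF restrict_place[OF Q(1)]]]] by blast
 then show ?thesis using Q(1) by (auto simp: fiber_def)
qed

lemma fiberD: "Q : fiber \<phi> PY b ==> Q : PPY" "Q : fiber \<phi> PY b ==> \<phi> -` Q = b"
 by (auto simp: fiber_def)

lemma fiber_restrict: "Q : PPY ==> Q : fiber \<phi> PY (\<phi> -` Q)" by (simp add: fiber_def)

lemma C_perm: assumes "e : C" shows "(\<Prod>c\<in>C. f (e \<circ> c)) = (\<Prod>c\<in>C. f c :: 'a::comm_monoid_mult)"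
 "(\<Sum>c\<in>C. h (e \<circ> c)) = (\<Sum>c\<in>C. h c :: 'b::comm_monoid_add)"
proof -
 obtain e' where e': "e' : C" "!!x. e (e' x) = x" "!!x. e' (e x) = x" using C_inverse[OF assms] by blast
 have b: "bij_betw (%c. e \<circ> c) C C"
  by (rule bij_betwI[of _ _ _ "%c. e' \<circ> c"]) (use C_comp assms e' in \<open>auto simp: fun_eq_iff\<close>)
 show "(\<Prod>c\<in>C. f (e \<circ> c)) = (\<Prod>c\<in>C. f c)" by (rule prod.reindex_bij_betw[OF b])
 show "(\<Sum>c\<in>C. h (e \<circ> c)) = (\<Sum>c\<in>C. h c)" by (rule sum.reindex_bij_betw[OF b])
qed

text \<open>If the orbits were disjoint, some \<open>y\<close> would be near 0 along one and near 1
  along the other. Its norm comes from X, yet lies in the maximal ideal at \<open>Q\<close> and not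
  at \<open>Q'\<close>, although both lie over the same point.\<close>

lemma transitive:
 assumes Q: "Q : PPY" and Q': "Q' : PPY" and eq: "\<phi> -` Q = \<phi> -` Q'"
 shows "\<exists>c\<in>C. Q' = c -` Q"
proof (rule ccontr)
 assume n: "\<not> ?thesis"
 define A where "A = (%c. c -` Q) ` C"
 define A' where "A' = (%c. c -` Q') ` C"
 have disj: "A \<inter> A' = {}"
 proof (rule ccontr)
  assume "A \<inter> A' ~= {}"
  then obtain c e where ce: "c : C" "e : C" "c -` Q = e -` Q'" by (auto simp: A_def A'_def)
  obtain e' where e': "e' : C" "!!x. e (e' x) = x" "!!x. e' (e x) = x" using C_inverse[OF ce(2)] by blast
  have "e' -` (c -` Q) = Q'" unfolding ce(3) using e' by auto
  then have "Q' = (c \<circ> e') -` Q" by auto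
  then show False using n C_comp[OF ce(1) e'(1)] by blast
 qed
 have fin: "finite (A \<union> A')" using finite_C by (simp add: A_def A'_def)
 have dv: "\<forall>P\<in>A \<union> A'. dvr P" using act_place Q Q' Y.place_dvr by (auto simp: A_def A'_def)
 obtain y where y: "\<forall>P\<in>A \<union> A'. y - (if P : A then 0 else 1) : vset P 1"
  by (rule weak_approximation[OF fin dv, of "%P. if P : A then 0 else 1" "%_. 1"]) blast
 interpret Q: dvr Q by (rule Y.place_dvr[OF Q])
 interpret Q': dvr Q' by (rule Y.place_dvr[OF Q'])
 have cy: "c y : max_ideal Q" "c y - 1 : max_ideal Q'" if c: "c : C" for c
 proof -
  have "c -` Q : A" using c by (auto simp: A_def)
  then have "y - (if c -` Q : A then 0 else 1) : vset (c -` Q) 1" using y by blast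
  then have "y : vset (c -` Q) 1" using \<open>c -` Q : A\<close> by simp
  then show "c y : max_ideal Q" using vimage_vset[OF C_auto[OF c] Q.dvr_axioms] by simp
  have "c -` Q' : A'" using c by (auto simp: A'_def)
  then have "c -` Q' ~: A" "c -` Q' : A \<union> A'" using disj by auto
  then have "y - (if c -` Q' : A then 0 else 1) : vset (c -` Q') 1" using y by blast
  then have "y - 1 : vset (c -` Q') 1" using \<open>c -` Q' ~: A\<close> by simp
  then have "c (y - 1) : max_ideal Q'" using vimage_vset[OF C_auto[OF c] Q'.dvr_axioms] by auto
  then show "c y - 1 : max_ideal Q'" by (simp add: field_autoD[OF C_auto[OF c]])
 qed
 define N where "N = (\<Prod>c\<in>C. c y)"
 have "e N = N" if e: "e : C" for e
 proof -
  have "e N = (\<Prod>c\<in>C. (e \<circ> c) y)" by (simp add: N_def field_autoD(13)[OF C_auto[OF e]])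
  then show ?thesis using C_perm(1)[OF e, of "%c. c y"] by (simp add: N_def)
 qed
 then obtain z where z: "N = \<phi> z" using fixed_field by blast
 have NQ: "N : max_ideal Q"
 proof -
  have "N = id y * (\<Prod>c\<in>C - {id}. c y)" unfolding N_def by (rule prod.remove[OF finite_C C_id])
  moreover have "(\<Prod>c\<in>C - {id}. c y) : Q" using cy(1) Q.max_ideal_closed(5) by (intro Q.closed_prod) auto
  ultimately show ?thesis using Q.max_ideal_closed(4)[OF cy(1)[OF C_id]] by simp
 qed
 have u: "c y : Q' - max_ideal Q'" if "c : C" for c
 proof -
  have "(c y - 1) + 1 : Q'" using Q'.closed(1,3) Q'.max_ideal_closed(5)[OF cy(2)[OF that]] by blast
  moreover have "c y ~: max_ideal Q'"
  proof
   assume "c y : max_ideal Q'"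
   then have "c y - (c y - 1) : max_ideal Q'" using cy(2)[OF that] Q'.max_ideal_closed(2) by blast
   then show False using Q'.max_ideal_closed(7) by simp
  qed
  ultimately show ?thesis by simp
 qed
 have "(\<Prod>c\<in>D. c y) : Q' - max_ideal Q'" if "D \<subseteq> C" for D
  using finite_subset[OF that finite_C] that
  by (induction D rule: finite_induct) (use u Q'.unit_mult Q'.unit_one in auto)
 then have "N ~: max_ideal Q'" unfolding N_def by blast
 then show False using NQ unfolding z max_ideal_\<phi>[OF Q] max_ideal_\<phi>[OF Q'] eq by simp
qed

lemma fiber_orbit: "Q : PPY ==> fiber \<phi> PY (\<phi> -` Q) = (%c. c -` Q) ` C"
proof
 assume Q: "Q : PPY"
 show "fiber \<phi> PY (\<phi> -` Q) \<subseteq> (%c. c -` Q) ` C"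
 proof
  fix Q' assume "Q' : fiber \<phi> PY (\<phi> -` Q)"
  then have "Q' : PPY" "\<phi> -` Q = \<phi> -` Q'" by (simp_all add: fiber_def)
  from transitive[OF Q this] show "Q' : (%c. c -` Q) ` C" by (simp add: image_iff)
 qed
 show "(%c. c -` Q) ` C \<subseteq> fiber \<phi> PY (\<phi> -` Q)"
 proof (rule image_subsetI)
  fix c assume "c : C"
  then show "c -` Q : fiber \<phi> PY (\<phi> -` Q)"
   unfolding fiber_def using act_place[OF _ Q] restrict_act by simp
 qed
qed

lemma finite_fiber: "b : PPX ==> finite (fiber \<phi> PY b)"
proof -
 assume b: "b : PPX"
 obtain Q where Q: "Q : fiber \<phi> PY b" using fiber_nonempty[OF b] by blast
 then show ?thesis using fiber_orbit[OF fiberD(1)[OF Q]] fiberD(2)[OF Q] finite_C by simp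
qed

lemma point_degree_act: assumes c: "c : C" and Q: "Q : PPY" shows "point_degree \<iota>Y (c -` Q) = point_degree \<iota>Y Q"
proof -
 have le: "card (carrier (residue_field (c -` Q))) <= card (carrier (residue_field Q))" if c: "c : C" and Q: "Q : PPY" for c Q
 proof (rule card_inj_on_le)
  note ca = field_autoD[OF C_auto[OF c]]
  show "inj_on ((`) c) (carrier (residue_field (c -` Q)))" by (rule inj_onI) (use ca(1) in \<open>simp add: bij_def inj_image_eq_iff\<close>)
  show "(`) c ` carrier (residue_field (c -` Q)) \<subseteq> carrier (residue_field Q)"
  proof clarify
   fix A assume "A : carrier (residue_field (c -` Q))"
   then obtain y where y: "c y : Q" "A = (%h. h + y) ` max_ideal (c -` Q)"
    unfolding Y.carrier_residue_field coset_eq_image by auto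
   have "max_ideal Q = c ` max_ideal (c -` Q)"
    unfolding vimage_dvr(2)[OF C_auto[OF c] Y.place_dvr[OF Q]] using ca(1) by (simp add: bij_def surj_image_vimage_eq)
   then have "c ` A = (%h. h + c y) ` max_ideal Q" unfolding y(2) by (simp add: image_image ca(2))
   then show "c ` A : carrier (residue_field Q)" unfolding Y.carrier_residue_field coset_eq_image using y(1) by blast
  qed
  show "finite (carrier (residue_field Q))" by (rule Y.residue_field_finite(1)[OF Q])
 qed
 obtain e where e: "e : C" "!!x. c (e x) = x" "!!x. e (c x) = x" using C_inverse[OF c] by blast
 have "e -` (c -` Q) = Q" using e by auto
 then have "card (carrier (residue_field Q)) <= card (carrier (residue_field (c -` Q)))"
  using le[OF e(1) act_place[OF c Q]] by simp
 then have "CARD('k) ^ point_degree \<iota>Y (c -` Q) = CARD('k) ^ point_degree \<iota>Y Q"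
  using le[OF c Q] Y.residue_field_finite(2)[OF Q] Y.residue_field_finite(2)[OF act_place[OF c Q]] by simp
 then show ?thesis using Y.card_K_gt_1 power_inject_exp by blast
qed

text \<open>The inertia groups are trivial: if \<open>c\<close> acts trivially on the residue field, write
  \<open>z = z\<^sup>R + t z\<^sub>1\<close> with \<open>R\<close> the order of the residue field and \<open>t\<close> a uniformizer fixed by \<open>c\<close>.\<close>

lemma inertia_trivial:
 assumes c: "c : C" and Q: "Q : PPY" and st: "!!z. z : Q ==> c z - z : max_ideal Q"
 shows "c = id"
proof -
 interpret Q: dvr Q by (rule Y.place_dvr[OF Q])
 interpret B: dvr "\<phi> -` Q" by (rule X.place_dvr[OF restrict_place[OF Q]])
 note ca = field_autoD[OF C_auto[OF c]]
 let ?e = "point_degree \<iota>Y Q"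
 obtain \<pi> where \<pi>: "uniformizer (\<phi> -` Q) \<pi>" using B.ex_uniformizer by blast
 define t where "t = \<phi> \<pi>"
 have t: "t ~= 0" "val Q t = 1" "c t = t"
  using \<pi> by (auto simp: t_def val_\<phi>[OF Q] B.uniformizer_iff C_\<phi>[OF c])
 have R: "CARD('k) ^ ?e \<ge> 2"
 proof -
  have "CARD('k) ^ 1 <= CARD('k) ^ ?e" using Y.card_K_gt_1 Y.point_degree_pos[OF Q] by (intro power_increasing) auto
  then show ?thesis using Y.card_K_gt_1 by simp
 qed
 have step: "\<forall>z\<in>Q. c z - z : vset Q (int (Suc k))" for k
 proof (induction k)
  case 0
  then show ?case using st by simp
 next
  case (Suc k)
  show ?case
  proof
   fix z assume z: "z : Q"
   define w where "w = (z - z ^ (CARD('k) ^ ?e)) / t"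
   have "z ^ (CARD('k) ^ ?e) - z : vset Q 1" using Y.residue_power_card[OF Q z] by simp
   then have "z - z ^ (CARD('k) ^ ?e) : vset Q 1" using Q.vset_uminus by fastforce
   moreover have tw: "z - z ^ (CARD('k) ^ ?e) = t * w" using t by (simp add: w_def)
   ultimately have "t * w : vset Q 1" by simp
   then have w: "w : Q" using Q.vset_mult_iff[OF t(1), of w 1] t(2) by simp
   have zz: "z = z ^ (CARD('k) ^ ?e) + t * w" using tw by (simp add: algebra_simps)
   have "c z = c z ^ (CARD('k) ^ ?e) + t * c w" by (subst zz) (simp add: ca t(3))
   then have "c z - z = (c z ^ (CARD('k) ^ ?e) - z ^ (CARD('k) ^ ?e)) + t * (c w - w)"
    using zz by (simp add: algebra_simps)
   \<comment> \<open>The first summand has at least twice the value of \<open>c z - z\<close> since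
     \<open>R >= 2\<close>; the second gains 1 from \<open>t\<close> and the induction hypothesis
     for \<open>w\<close>. So the congruence improves by one order.\<close>
   then have eq: "c z - z = (c z - z) ^ (CARD('k) ^ ?e) + t * (c w - w)"
    by (subst Y.frobenius_power_diff)
   have cz: "c z - z : vset Q (int (Suc k))" using Suc z by blast
   have "(c z - z) ^ (CARD('k) ^ ?e) : vset Q (int (Suc (Suc k)))"
   proof (cases "c z - z = 0")
    case True
    have "(c z - z) ^ (CARD('k) ^ ?e) = 0" unfolding True using R by (intro zero_power) linarith
    then show ?thesis by (simp only: Q.zero_vset)
   next
    case False
    then have "int (Suc k) <= val Q (c z - z)" using cz by (simp add: vset_def)
    moreover have "2 * val Q (c z - z) <= int (CARD('k) ^ ?e) * val Q (c z - z)"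
    proof (rule mult_right_mono)
     show "2 <= int (CARD('k) ^ ?e)" using R by linarith
     show "0 <= val Q (c z - z)" using calculation by linarith
    qed
    ultimately have "int (Suc (Suc k)) <= int (CARD('k) ^ ?e) * val Q (c z - z)" by linarith
    then show ?thesis using False by (simp add: vset_def Q.val_power)
   qed
   moreover have "t * (c w - w) : vset Q (int (Suc (Suc k)))"
   proof -
    have "c w - w : vset Q (int (Suc k))" using Suc w by blast
    then show ?thesis using Q.vset_mult_iff[OF t(1), of "c w - w" "int (Suc (Suc k))"] t(2) by simp
   qed
   ultimately show "c z - z : vset Q (int (Suc (Suc k)))" using Q.vset_add eq by metis
  qed
 qed
 have cz: "c z = z" if z: "z : Q" for z
 proof (rule ccontr)
  assume "c z ~= z"
  then have "\<forall>k. int (Suc k) <= val Q (c z - z)" using step z by (auto simp: vset_def)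
  from this[rule_format, of "nat (val Q (c z - z))"] show False by linarith
 qed
 have "c x = x" for x
 proof (cases "x : Q")
  case False
  then have "x ~= 0" "val Q x < 0" by (auto simp: Q.mem_iff)
  then have "inverse x : Q" by (simp add: Q.mem_iff Q.val_inverse)
  then have "inverse (c x) = inverse x" using cz by (simp flip: ca(9))
  then show ?thesis by simp
 qed (rule cz)
 then show ?thesis by (simp add: fun_eq_iff)
qed

end

section \<open>Decomposition groups and Frobenius elements\<close>

lemma (in dvr) prod_in_max_ideal:
 assumes "finite I" "!!i. i : I ==> f i : P" "prod f I : max_ideal P"
 shows "\<exists>i\<in>I. f i : max_ideal P"
 using assms
proof (induction I rule: finite_induct)
 case empty
 then show ?case using max_ideal_closed(7) by simp
next
 case (insert i I)
 have "prod f I : P" using insert.prems by (intro closed_prod) auto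
 then have "f i : max_ideal P \<or> prod f I : max_ideal P"
  using insert max_ideal_prime[of "f i" "prod f I"] by simp
 then show ?case using insert by auto
qed

lemma (in dvr) power_cong:
 assumes "x : P" "y : P" "x - y : max_ideal P" shows "x ^ i - y ^ i : max_ideal P"
proof (induction i)
 case (Suc i)
 have "x ^ Suc i - y ^ Suc i = x * (x ^ i - y ^ i) + (x - y) * y ^ i" by (simp add: algebra_simps)
 moreover have "x * (x ^ i - y ^ i) : max_ideal P" by (rule max_ideal_closed(3)[OF assms(1) Suc])
 moreover have "(x - y) * y ^ i : max_ideal P" by (rule max_ideal_closed(4)[OF assms(3) closed(7)[OF assms(2)]])
 ultimately show ?case by (simp only: max_ideal_closed(1))
qed (simp add: max_ideal_closed)

lemma (in dvr) max_ideal_power: "x : P ==> x ^ i : max_ideal P ==> x : max_ideal P"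
 by (induction i) (use max_ideal_closed(7) max_ideal_prime closed(7) in auto)

lemma (in dvr) cong_trans: "x - y : max_ideal P ==> y - z : max_ideal P ==> x - z : max_ideal P"
 using max_ideal_closed(1)[of "x - y" "y - z"] by simp

lemma (in dvr) cong_sym: "x - y : max_ideal P ==> y - x : max_ideal P"
 using max_ideal_closed(2)[OF max_ideal_closed(6), of "x - y"] by simp

context cyclic_cover
begin

text \<open>The tower law for \<open>K\<close>, the residue field below and the residue field of
  \<open>Q\<close>, by cardinalities: a system of representatives below maps bijectively onto the
  subfield in \<open>inertial_degree\<close>.\<close>

lemma inertial_degree_card:
 assumes Q: "Q : PPY"
 shows "point_degree \<iota>Y Q = point_degree \<iota>X (\<phi> -` Q) * inertial_degree \<phi> Q"
proof -
 let ?b = "\<phi> -` Q"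
 have b: "?b : PPX" by (rule restrict_place[OF Q])
 interpret Q: dvr Q by (rule Y.place_dvr[OF Q])
 interpret B: dvr ?b by (rule X.place_dvr[OF b])
 interpret RF: field "residue_field Q" by (rule Y.residue_hom(2)[OF Q])
 let ?h = "%x. max_ideal Q +[Q] \<phi> x"
 let ?H = "%y. max_ideal Q +[Q] y"
 let ?K = "?h ` ?b"
 note hom = Y.residue_hom(1)[OF Q]
 have Kc: "?K \<subseteq> carrier (residue_field Q)" by (auto simp: Y.carrier_residue_field)
 have hadd: "?H (x + y) = ?H x \<oplus>\<^bsub>residue_field Q\<^esub> ?H y" and hmult: "?H (x * y) = ?H x \<otimes>\<^bsub>residue_field Q\<^esub> ?H y"
  if "x : Q" "y : Q" for x y
  using ring_hom_add[OF hom, of x y] ring_hom_mult[OF hom, of x y] that by simp_all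
 have h1: "?H 1 = \<one>\<^bsub>residue_field Q\<^esub>" using ring_hom_one[OF hom] by simp
 have hc: "?H x : carrier (residue_field Q)" if "x : Q" for x using that by (auto simp: Y.carrier_residue_field)
 have sr: "subring ?K (residue_field Q)"
 proof (rule RF.subringI[OF Kc])
  show "\<one>\<^bsub>residue_field Q\<^esub> : ?K" using h1 B.closed(1) by (intro image_eqI[of _ _ 1]) auto
  fix k assume "k : ?K"
  then obtain x where x: "x : ?b" "k = ?h x" by blast
  then have xQ: "\<phi> x : Q" by simp
  have "\<ominus>\<^bsub>residue_field Q\<^esub> k = ?h (- x)"
  proof (rule RF.minus_equality)
   have "?H (- \<phi> x + \<phi> x) = ?H (- \<phi> x) \<oplus>\<^bsub>residue_field Q\<^esub> ?H (\<phi> x)" using hadd Q.closed(6) xQ by blast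
   moreover have "?H 0 = \<zero>\<^bsub>residue_field Q\<^esub>" using Y.residue_zero_iff[OF Q, of 0] Q.max_ideal_closed(6) by simp
   ultimately show "?h (- x) \<oplus>\<^bsub>residue_field Q\<^esub> k = \<zero>\<^bsub>residue_field Q\<^esub>" using x by simp
  qed (use hc xQ Q.closed(6) x in auto)
  then show "\<ominus>\<^bsub>residue_field Q\<^esub> k : ?K" using B.closed(6)[OF x(1)] by blast
  fix l assume "l : ?K"
  then obtain y where y: "y : ?b" "l = ?h y" by blast
  have "k \<otimes>\<^bsub>residue_field Q\<^esub> l = ?h (x * y)" "k \<oplus>\<^bsub>residue_field Q\<^esub> l = ?h (x + y)"
   using hmult[of "\<phi> x" "\<phi> y"] hadd[of "\<phi> x" "\<phi> y"] x y by simp_all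
  then show "k \<otimes>\<^bsub>residue_field Q\<^esub> l : ?K" "k \<oplus>\<^bsub>residue_field Q\<^esub> l : ?K"
   using B.closed(5)[OF x(1) y(1)] B.closed(3)[OF x(1) y(1)] by blast+
 qed
 have sf: "subfield ?K (residue_field Q)"
 proof (rule RF.subfieldI'[OF sr])
  fix k assume k: "k : ?K - {\<zero>\<^bsub>residue_field Q\<^esub>}"
  then obtain x where x: "x : ?b" "k = ?h x" by blast
  then have "\<phi> x ~: max_ideal Q" using k Y.residue_zero_iff[OF Q, of "\<phi> x"] by simp
  then have u: "\<phi> x ~= 0" "inverse (\<phi> x) : Q" using x by (auto simp: max_ideal_def)
  have "?H (inverse (\<phi> x) * \<phi> x) = ?H (inverse (\<phi> x)) \<otimes>\<^bsub>residue_field Q\<^esub> ?H (\<phi> x)"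
   by (rule hmult[OF u(2)]) (use x in simp)
  then have "?h (inverse x) \<otimes>\<^bsub>residue_field Q\<^esub> k = \<one>\<^bsub>residue_field Q\<^esub>" using u x h1 by simp
  then have "inv\<^bsub>residue_field Q\<^esub> k = ?h (inverse x)"
   using RF.comm_inv_char[of k "?h (inverse x)"] hc u x RF.m_comm by simp
  moreover have "inverse x : ?b" using u(2) by simp
  ultimately show "inv\<^bsub>residue_field Q\<^esub> k : ?K" by (rule image_eqI)
 qed
 obtain S where S: "S \<subseteq> ?b" "finite S" "card S = CARD('k) ^ point_degree \<iota>X ?b"
  "!!s t. s : S ==> t : S ==> s - t : max_ideal ?b ==> s = t" "!!z. z : ?b ==> \<exists>s\<in>S. z - s : max_ideal ?b"
  by (rule X.incongruent_set[OF b]) blast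
 have heq: "?h x = ?h y \<longleftrightarrow> x - y : max_ideal ?b" for x y
  using Y.residue_hom(3)[OF Q, of "\<phi> x" "\<phi> y"] max_ideal_\<phi>[OF Q, of "x - y"] by simp
 have "?K = ?h ` S"
 proof
  show "?K \<subseteq> ?h ` S"
  proof (rule image_subsetI)
   fix z assume "z : ?b"
   then obtain s where "s : S" "z - s : max_ideal ?b" using S(5) by blast
   then show "?h z : ?h ` S" unfolding heq[symmetric] by blast
  qed
 qed (use S(1) in blast)
 have inS: "inj_on ?h S" using S(4) by (auto simp: inj_on_def heq)
 have cK: "card ?K = CARD('k) ^ point_degree \<iota>X ?b" unfolding \<open>?K = ?h ` S\<close> card_image[OF inS] by (rule S(3))
 have fK: "finite ?K" unfolding \<open>?K = ?h ` S\<close> by (rule finite_imageI[OF S(2)])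
 have "subalgebra ?K (carrier (residue_field Q)) (residue_field Q)" by (rule RF.carrier_is_subalgebra[OF Kc])
 from RF.card_dim_finite(2)[OF sf fK this Y.residue_field_finite(1)[OF Q]]
 have "CARD('k) ^ point_degree \<iota>Y Q = CARD('k) ^ (point_degree \<iota>X ?b * inertial_degree \<phi> Q)"
  unfolding Y.residue_field_finite(2)[OF Q] cK inertial_degree_def power_mult .
 then show ?thesis using Y.card_K_gt_1 power_inject_exp by blast
qed

lemma vimage_funpow_add: "(s ^^ (i + j)) -` Q = (s ^^ j) -` ((s ^^ i) -` Q)"
 by (auto simp: funpow_add)

definition is_gen :: "('g => 'g) => bool" where
 "is_gen s \<longleftrightarrow> s : C & C = (%i. s ^^ i) ` {..<n} & inj_on (%i. s ^^ i) {..<n}"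

lemma is_gen_C: "is_gen s ==> s : C"
 unfolding is_gen_def by (rule conjunct1)

lemma gen_pow_mod: "is_gen s ==> s ^^ i = s ^^ (i mod n)"
proof -
 assume s: "is_gen s"
 have "s ^^ i = s ^^ (n * (i div n) + i mod n)" by simp
 also have "\<dots> = (s ^^ (n * (i div n))) \<circ> (s ^^ (i mod n))" by (rule funpow_add)
 also have "s ^^ (n * (i div n)) = id"
 proof -
  have sC: "s : C" by (rule is_gen_C[OF s])
  have "s ^^ (n * (i div n)) = (s ^^ n) ^^ (i div n)" by (simp only: funpow_mult mult.commute)
  then show ?thesis by (simp only: C_pow_n[OF sC] id_funpow)
 qed
 also have "id \<circ> (s ^^ (i mod n)) = s ^^ (i mod n)" by simp
 finally show ?thesis .
qed

lemma gen_pow_eq_id: "is_gen s ==> s ^^ i = id \<longleftrightarrow> n dvd i"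
proof -
 assume s: "is_gen s"
 have "s ^^ i = id \<longleftrightarrow> s ^^ (i mod n) = s ^^ 0" using gen_pow_mod[OF s, of i] by simp
 also have "\<dots> \<longleftrightarrow> i mod n = 0"
  using inj_on_eq_iff[of "%i. s ^^ i" "{..<n}" "i mod n" 0] s n_pos unfolding is_gen_def by simp
 finally show ?thesis by auto
qed

text \<open>The return times of \<open>Q\<close> under \<open>s\<close> are the multiples of the
  least positive one, which is therefore the size of the orbit.\<close>

lemma orbit_structure:
 assumes s: "is_gen s" and Q: "Q : PPY"
 defines "m \<equiv> card (fiber \<phi> PY (\<phi> -` Q))"
 shows "m > 0" "m dvd n" "!!i. (s ^^ i) -` Q = Q \<longleftrightarrow> m dvd i"
  "fiber \<phi> PY (\<phi> -` Q) = (%i. (s ^^ i) -` Q) ` {..<m}" "inj_on (%i. (s ^^ i) -` Q) {..<m}"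
proof -
 have sC: "s : C" by (rule is_gen_C[OF s])
 define A where "A i = (s ^^ i) -` Q" for i
 have A0: "A 0 = Q" by (simp add: A_def)
 have Aadd: "A (i + j) = (s ^^ j) -` (A i)" for i j unfolding A_def by (rule vimage_funpow_add)
 have An: "A n = Q" using C_pow_n[OF sC] by (simp add: A_def)
 define m0 where "m0 = (LEAST i. i > 0 & A i = Q)"
 have m0: "m0 > 0" "A m0 = Q" using LeastI[of "%i. i > 0 & A i = Q" n] An n_pos by (auto simp: m0_def)
 have min: "i \<ge> m0" if "i > 0" "A i = Q" for i using Least_le[of "%i. i > 0 & A i = Q" i] that by (simp add: m0_def)
 have Am: "A (m0 * k) = Q" for k
 proof (induction k)
  case (Suc k)
  have "A (m0 + m0 * k) = (s ^^ (m0 * k)) -` A m0" by (rule Aadd)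
  then show ?case using Suc m0(2) by (simp add: A_def)
 qed (simp add: A0)
 have Amod: "A i = A (i mod m0)" for i
 proof -
  have "A (m0 * (i div m0) + i mod m0) = (s ^^ (i mod m0)) -` A (m0 * (i div m0))" by (rule Aadd)
  then show ?thesis unfolding Am by (simp add: A_def)
 qed
 have AQ: "A i = Q \<longleftrightarrow> m0 dvd i" for i
 proof
  assume "A i = Q"
  then have "A (i mod m0) = Q" using Amod by simp
  then have "\<not> i mod m0 > 0" using min[of "i mod m0"] m0(1) by (metis mod_less_divisor not_le)
  then show "m0 dvd i" by (simp add: dvd_eq_mod_eq_0)
 next
  assume "m0 dvd i" then show "A i = Q" using Am by (auto elim: dvdE)
 qed
 have inj: "inj_on A {..<m0}"
 proof -
  have "i = j" if ij: "A i = A j" "i <= j" "j < m0" for i j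
  proof -
   have "A (i + (m0 - j)) = A (j + (m0 - j))" unfolding Aadd ij(1) ..
   then have "A (i + (m0 - j)) = Q" using ij m0 by simp
   then have "i + (m0 - j) \<ge> m0" using min[of "i + (m0 - j)"] ij by simp
   then show ?thesis using ij by simp
  qed
  then show ?thesis by (metis (no_types, lifting) inj_onI lessThan_iff nat_le_linear)
 qed
 have fib: "fiber \<phi> PY (\<phi> -` Q) = A ` {..<m0}"
 proof -
  have "fiber \<phi> PY (\<phi> -` Q) = (%c. c -` Q) ` (%i. s ^^ i) ` {..<n}"
   using fiber_orbit[OF Q] s unfolding is_gen_def by simp
  also have "\<dots> = A ` {..<n}" by (auto simp: A_def)
  also have "\<dots> = A ` {..<m0}"
  proof
   show "A ` {..<n} \<subseteq> A ` {..<m0}"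
   proof (rule image_subsetI)
    fix i show "A i : A ` {..<m0}" using Amod[of i] m0(1) by auto
   qed
   have "m0 <= n" using min[of n] An n_pos by simp
   then show "A ` {..<m0} \<subseteq> A ` {..<n}" by auto
  qed
  finally show ?thesis .
 qed
 have "m = m0" unfolding m_def fib using card_image[OF inj] by simp
 then show "m > 0" "m dvd n" "!!i. (s ^^ i) -` Q = Q \<longleftrightarrow> m dvd i"
  "fiber \<phi> PY (\<phi> -` Q) = (%i. (s ^^ i) -` Q) ` {..<m}" "inj_on (%i. (s ^^ i) -` Q) {..<m}"
  using m0(1) AQ An fib inj unfolding A_def by auto
qed

lemma stab_cong:
 assumes c: "c : C" and Q: "Q : PPY" and st: "c -` Q = Q"
 shows "x : Q \<longleftrightarrow> c x : Q" "x : max_ideal Q \<longleftrightarrow> c x : max_ideal Q"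
proof -
 show "x : Q \<longleftrightarrow> c x : Q" using st by auto
 have "max_ideal (c -` Q) = c -` max_ideal Q" by (rule vimage_dvr(2)[OF C_auto[OF c] Y.place_dvr[OF Q]])
 then show "x : max_ideal Q \<longleftrightarrow> c x : max_ideal Q" unfolding st by auto
qed

text \<open>Residues other than 0 are powers of that of \<open>y\<close>, and raising to the power
  \<open>k\<close> commutes with taking powers. So agreement at \<open>y\<close> extends to all of
  \<open>Q\<close>.\<close>

lemma stab_primitive:
 assumes c: "c : C" and Q: "Q : PPY" and st: "c -` Q = Q"
  and y: "y : Q" "!!z. z : Q ==> z : max_ideal Q \<or> (\<exists>j. z - y ^ j : max_ideal Q)"
  and cy: "c y - y ^ k : max_ideal Q" and z: "z : Q" and k: "k > 0"
  "k = CARD('k) ^ e"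
 shows "c z - z ^ k : max_ideal Q"
proof -
 interpret Q: dvr Q by (rule Y.place_dvr[OF Q])
 note ca = field_autoD[OF C_auto[OF c]]
 show ?thesis
 proof (cases "z : max_ideal Q")
  case True
  then have "c z : max_ideal Q" using stab_cong(2)[OF c Q st] by blast
  moreover have "z ^ k : max_ideal Q"
  proof -
   have "z ^ k = z ^ (k - 1) * z" using k by (metis power_minus_mult)
   then show ?thesis using Q.max_ideal_closed(3)[OF Q.closed(7)[OF z] True] by simp
  qed
  ultimately show ?thesis by (rule Q.max_ideal_closed(2))
 next
  case False
  then obtain j where j: "z - y ^ j : max_ideal Q" using y(2)[OF z] by blast
  have yj: "y ^ j : Q" by (rule Q.closed(7)[OF y(1)])
  have cyQ: "c y : Q" using stab_cong(1)[OF c Q st] y(1) by blast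
  have 1: "c z - c y ^ j : max_ideal Q" using j stab_cong(2)[OF c Q st, of "z - y ^ j"] by (simp add: ca)
  have 2: "c y ^ j - (y ^ k) ^ j : max_ideal Q" by (rule Q.power_cong[OF cyQ Q.closed(7)[OF y(1)] cy])
  have 3: "(y ^ j) ^ k - z ^ k : max_ideal Q" by (rule Q.power_cong[OF yj z Q.cong_sym[OF j]])
  have "(y ^ k) ^ j = (y ^ j) ^ k" by (simp add: mult.commute flip: power_mult)
  then show ?thesis using Q.cong_trans[OF Q.cong_trans[OF 1 2]] 3 by simp
 qed
qed

text \<open>The product of \<open>T - c y\<close> over \<open>c\<close> in C has coefficients from
  the local ring below, whose residues are fixed by the power \<open>q'\<close>. Hence
  \<open>y ^ q'\<close> is again a root modulo \<open>Q\<close> and is congruent to some conjugate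
  \<open>c y\<close>.\<close>

lemma frobenius_exists:
 assumes Q: "Q : PPY"
 obtains c y where "c : C" "c -` Q = Q" "y : Q" "y ~: max_ideal Q"
  "!!z. z : Q ==> z : max_ideal Q \<or> (\<exists>j. z - y ^ j : max_ideal Q)"
  "!!z. z : Q ==> c z - z ^ (CARD('k) ^ point_degree \<iota>X (\<phi> -` Q)) : max_ideal Q"
proof -
 let ?b = "\<phi> -` Q"
 have b: "?b : PPX" by (rule restrict_place[OF Q])
 interpret Q: dvr Q by (rule Y.place_dvr[OF Q])
 define q' where "q' = CARD('k) ^ point_degree \<iota>X ?b"
 obtain y0 where y0: "y0 : Q" "y0 ~: max_ideal Q" "!!z. z : Q ==> z : max_ideal Q \<or> (\<exists>j. z - y0 ^ j : max_ideal Q)"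
  by (rule Y.residue_primitive[OF Q]) blast
 let ?F = "fiber \<phi> PY ?b"
 have QF: "Q : ?F" by (rule fiber_restrict[OF Q])
 have dvF: "\<forall>P\<in>?F. dvr P" using fiberD(1) Y.place_dvr by blast
 \<comment> \<open>\<open>y\<close> is primitive at \<open>Q\<close> and vanishes at the other
   points of the fibre. If \<open>c\<close> moved \<open>Q\<close>, then \<open>c y\<close>, hence
   \<open>y ^ q'\<close>, would vanish at \<open>Q\<close>.\<close>
 obtain y where y: "\<forall>P\<in>?F. y - (if P = Q then y0 else 0) : vset P 1"
  by (rule weak_approximation[OF finite_fiber[OF b] dvF, of "%P. if P = Q then y0 else 0" "%_. 1"]) blast
 have "y - (if Q = Q then y0 else 0) : vset Q 1" using y QF by blast
 then have yy0: "y - y0 : max_ideal Q" by simp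
 have yo: "y : max_ideal P" if "P : ?F" "P ~= Q" for P
 proof -
  have "y - (if P = Q then y0 else 0) : vset P 1" using y that by blast
  then show ?thesis using that dvr.vset_1[of P] dvF by simp
 qed
 have yQ: "y : Q" using Q.closed(3)[OF Q.max_ideal_closed(5)[OF yy0] y0(1)] by simp
 have yP: "y : P" if "P : ?F" for P
  using yQ yo[OF that] dvr.max_ideal_closed(5)[OF bspec[OF dvF that]] by (cases "P = Q") auto
 have ynm: "y ~: max_ideal Q"
 proof
  assume "y : max_ideal Q"
  then have "y - (y - y0) : max_ideal Q" using yy0 Q.max_ideal_closed(2) by blast
  then show False using y0(2) by simp
 qed
 have yprim: "z : max_ideal Q \<or> (\<exists>j. z - y ^ j : max_ideal Q)" if z: "z : Q" for z
 proof (cases "z : max_ideal Q")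
  case False
  then obtain j where "z - y0 ^ j : max_ideal Q" using y0(3)[OF z] by blast
  then have "z - y ^ j : max_ideal Q" using Q.cong_trans Q.power_cong[OF y0(1) yQ Q.cong_sym[OF yy0]] by blast
  then show ?thesis by blast
 qed simp
 have cyQ: "c y : Q" if c: "c : C" for c
 proof -
  have "c -` Q : ?F" using fiber_orbit[OF Q] c by blast
  from yP[OF this] show ?thesis by simp
 qed
 define p where "p = (\<Prod>c\<in>C. [:- c y, 1:])"
 have pr: "\<exists>h\<in>?b. coeff p i = \<phi> h" for i
 proof -
  have inv: "e (coeff p i) = coeff p i" if e: "e : C" for e
  proof -
   note ea = field_autoD[OF C_auto[OF e]]
   have ma: "map_poly e (p * r) = map_poly e p * map_poly e r" for p r :: "'g poly"
   proof (rule poly_eqI)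
    fix i show "coeff (map_poly e (p * r)) i = coeff (map_poly e p * map_poly e r) i"
     by (simp add: coeff_map_poly ea coeff_mult)
   qed
   have "map_poly e (\<Prod>c\<in>D. [:- c y, 1:]) = (\<Prod>c\<in>D. [:- (e \<circ> c) y, 1:])" for D
    by (induction D rule: infinite_finite_induct) (simp_all add: ma ea map_poly_pCons del: mult_pCons_left)
   then have "map_poly e p = p" unfolding p_def using C_perm(1)[OF e, of "%c. [:- c y, 1:]"] by simp
   then have "coeff (map_poly e p) i = coeff p i" by simp
   then show ?thesis by (simp add: coeff_map_poly ea)
  qed
  then obtain h where h: "coeff p i = \<phi> h" using fixed_field by blast
  have "coeff (\<Prod>c\<in>D. [:- c y, 1:]) i : Q" if "D \<subseteq> C" for D i
   using finite_subset[OF that finite_C] that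
  proof (induction D arbitrary: i rule: finite_induct)
   case empty
   then show ?case using Q.closed by (cases i) (auto simp: one_pCons coeff_pCons)
  next
   case (insert c D)
   have "coeff ([:- c y, 1:] * (\<Prod>c\<in>D. [:- c y, 1:])) i =
    - c y * coeff (\<Prod>c\<in>D. [:- c y, 1:]) i + (case i of 0 => 0 | Suc j => coeff (\<Prod>c\<in>D. [:- c y, 1:]) j)"
    by (simp add: coeff_pCons split: nat.split)
   moreover have "- c y * coeff (\<Prod>c\<in>D. [:- c y, 1:]) i : Q"
    using insert Q.closed(5)[OF Q.closed(6)[OF cyQ]] by auto
   moreover have "(case i of 0 => 0 | Suc j => coeff (\<Prod>c\<in>D. [:- c y, 1:]) j) : Q"
    using insert Q.closed(2) by (cases i) auto
   ultimately have "coeff ([:- c y, 1:] * (\<Prod>c\<in>D. [:- c y, 1:])) i : Q" by (simp only: Q.closed(3))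
   then show ?case using insert by (simp only: prod.insert not_False_eq_True)
  qed
  then have "coeff p i : Q" unfolding p_def by blast
  then show ?thesis using h by auto
 qed
 then obtain h where h: "!!i. h i : ?b" "!!i. coeff p i = \<phi> (h i)" by metis
 define D where "D = degree p"
 have alt: "poly p x = (\<Sum>i\<le>D. \<phi> (h i) * x ^ i)" for x by (simp add: poly_altdef D_def h(2))
 have py: "poly p y = 0"
  unfolding p_def poly_prod using finite_C C_id by (intro prod_zero) (auto intro!: bexI[of _ id])
 have q0: "q' > 0" by (simp add: q'_def)
 \<comment> \<open>Raising the equation for \<open>y\<close> to the power \<open>q'\<close> and
   subtracting it from \<open>poly p (y ^ q')\<close> leaves coefficients
   \<open>h i - h i ^ q'\<close>, which vanish modulo the point below.\<close>
 have "0 = (poly p y) ^ q'" using py q0 by (simp add: power_0_left)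
 also have "\<dots> = (\<Sum>i\<le>D. \<phi> (h i ^ q') * (y ^ q') ^ i)"
  unfolding alt q'_def Y.frobenius_power_sum by (simp add: power_mult_distrib mult.commute flip: power_mult)
 finally have s0: "(\<Sum>i\<le>D. \<phi> (h i ^ q') * (y ^ q') ^ i) = 0" by simp
 have "poly p (y ^ q') = poly p (y ^ q') - (\<Sum>i\<le>D. \<phi> (h i ^ q') * (y ^ q') ^ i)" using s0 by simp
 also have "\<dots> = (\<Sum>i\<le>D. \<phi> (h i - h i ^ q') * (y ^ q') ^ i)"
  unfolding alt by (simp add: sum_subtractf left_diff_distrib)
 finally have e: "poly p (y ^ q') = (\<Sum>i\<le>D. \<phi> (h i - h i ^ q') * (y ^ q') ^ i)" .
 have "\<phi> (h i - h i ^ q') * (y ^ q') ^ i : vset Q 1" for i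
 proof -
  have "h i ^ q' - h i : max_ideal ?b" unfolding q'_def by (rule X.residue_power_card[OF b h(1)])
  then have "h i - h i ^ q' : max_ideal ?b" by (rule dvr.cong_sym[OF X.place_dvr[OF b]])
  then have "\<phi> (h i - h i ^ q') : max_ideal Q" unfolding max_ideal_\<phi>[OF Q] .
  then show ?thesis using Q.max_ideal_closed(4) Q.closed(7)[OF Q.closed(7)[OF yQ]] by simp
 qed
 then have "poly p (y ^ q') : vset Q 1" unfolding e by (rule Q.vset_sum)
 then have "(\<Prod>c\<in>C. y ^ q' - c y) : max_ideal Q" by (simp add: p_def poly_prod)
 from Q.prod_in_max_ideal[OF finite_C _ this] obtain c where c: "c : C" "y ^ q' - c y : max_ideal Q"
  using Q.closed(4)[OF Q.closed(7)[OF yQ] cyQ] by blast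
 have st: "c -` Q = Q"
 proof (rule ccontr)
  assume ne: "c -` Q ~= Q"
  have "c -` Q : ?F" using fiber_orbit[OF Q] c by blast
  from yo[OF this ne] have "c y : max_ideal Q" unfolding vimage_dvr(2)[OF C_auto[OF c(1)] Q.dvr_axioms] by simp
  from Q.max_ideal_closed(1)[OF c(2) this] have "y ^ q' : max_ideal Q" by simp
  then show False using Q.max_ideal_power[OF yQ] ynm by blast
 qed
 have "c z - z ^ q' : max_ideal Q" if "z : Q" for z
  by (rule stab_primitive[OF c(1) Q st yQ yprim Q.cong_sym[OF c(2)] that q0 q'_def])
 then show ?thesis using that c(1) st yQ ynm yprim unfolding q'_def by blast
qed

text \<open>The stabilizer of \<open>Q\<close> has order exactly the inertial degree and is
  generated by Frobenius \<open>c = \<sigma> ^ (m j)\<close>, with \<open>j\<close> prime to this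
  order. Lifting \<open>j\<close> to some \<open>i\<close> prime to \<open>n\<close> makes
  \<open>\<sigma> ^ i\<close> a generator of C with \<open>m\<close>-th power
  \<open>c\<close>.\<close>

lemma frobenius_generator:
 assumes Q: "Q : PPY"
 obtains s where "is_gen s"
  "!!z. z : Q ==> (s ^^ card (fiber \<phi> PY (\<phi> -` Q))) z - z ^ (CARD('k) ^ point_degree \<iota>X (\<phi> -` Q)) : max_ideal Q"
  "n = card (fiber \<phi> PY (\<phi> -` Q)) * inertial_degree \<phi> Q"
proof -
 let ?b = "\<phi> -` Q"
 have b: "?b : PPX" by (rule restrict_place[OF Q])
 interpret Q: dvr Q by (rule Y.place_dvr[OF Q])
 define fb where "fb = point_degree \<iota>X ?b"
 define q' where "q' = CARD('k) ^ fb"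
 define r where "r = inertial_degree \<phi> Q"
 define m where "m = card (fiber \<phi> PY ?b)"
 have fbr: "point_degree \<iota>Y Q = fb * r" using inertial_degree_card[OF Q] by (simp add: fb_def r_def)
 have r0: "r > 0" using Y.point_degree_pos[OF Q] fbr by (cases r) auto
 have fb0: "fb > 0" using X.point_degree_pos[OF b] by (simp add: fb_def)
 have kQ: "CARD('k) ^ point_degree \<iota>Y Q = q' ^ r" by (simp add: fbr q'_def power_mult)
 have q'1: "q' > 1" unfolding q'_def by (rule one_less_power[OF Y.card_K_gt_1 fb0])
 obtain c y where c: "c : C" "c -` Q = Q" and y: "y : Q" "y ~: max_ideal Q"
  "!!z. z : Q ==> z : max_ideal Q \<or> (\<exists>j. z - y ^ j : max_ideal Q)"
  and Fr: "!!z. z : Q ==> c z - z ^ q' : max_ideal Q"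
  unfolding q'_def fb_def by (rule frobenius_exists[OF Q]) blast
 obtain \<sigma> where \<sigma>: "is_gen \<sigma>" using generator unfolding is_gen_def by metis
 note orb = orbit_structure[OF \<sigma> Q, folded m_def]
 have \<sigma>C: "\<sigma> : C" by (rule is_gen_C[OF \<sigma>])
 define d where "d = n div m"
 have nd: "n = m * d" using orb(2) by (simp add: d_def)
 have d0: "d > 0" using nd n_pos by (cases d) auto
 have Frpow: "(c ^^ i) z - z ^ (q' ^ i) : max_ideal Q & (c ^^ i) z : Q" if z: "z : Q" for i z
 proof (induction i)
  case 0
  then show ?case using Q.max_ideal_closed(6) z by simp
 next
  case (Suc i)
  then have IH: "(c ^^ i) z - z ^ (q' ^ i) : max_ideal Q" "(c ^^ i) z : Q" by auto
  have 1: "c ((c ^^ i) z) - ((c ^^ i) z) ^ q' : max_ideal Q" by (rule Fr[OF IH(2)])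
  have 2: "((c ^^ i) z) ^ q' - (z ^ (q' ^ i)) ^ q' : max_ideal Q" by (rule Q.power_cong[OF IH(2) Q.closed(7)[OF z] IH(1)])
  have "(z ^ (q' ^ i)) ^ q' = z ^ (q' ^ Suc i)" by (simp add: mult.commute flip: power_mult)
  then have "c ((c ^^ i) z) - z ^ (q' ^ Suc i) : max_ideal Q" using Q.cong_trans[OF 1 2] by simp
  moreover have "c ((c ^^ i) z) : Q" using stab_cong(1)[OF c(1) Q c(2)] IH(2) by blast
  ultimately show ?case by simp
 qed
 obtain S where S: "S \<subseteq> Q" "finite S" "card S = q' ^ r"
  "!!s t. s : S ==> t : S ==> s - t : max_ideal Q ==> s = t"
  using Y.incongruent_set[OF Q] unfolding kQ by metis
 \<comment> \<open>If \<open>c ^^ i = id\<close>, all \<open>q' ^ r\<close> residues are roots of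
   \<open>T ^ (q' ^ i) - T\<close>.\<close>
 have ord: "r <= i" if i: "c ^^ i = id" "i > 0" for i
 proof -
  define h where "h = Polynomial.monom 1 (q' ^ i) - [:0, 1 :: 'g:]"
  have qi: "q' ^ i > 1" by (rule one_less_power[OF q'1 i(2)])
  obtain j where "q' ^ i = Suc (Suc j)" using qi by (metis One_nat_def less_imp_Suc_add add_Suc)
  then have co: "coeff h (q' ^ i) = 1" unfolding h_def by (simp only: coeff_diff coeff_monom) simp
  have dh: "degree h <= q' ^ i"
  proof (rule degree_le)
   show "\<forall>j>q' ^ i. coeff h j = 0" using qi q'1 by (auto simp: h_def coeff_pCons split: nat.split)
  qed
  have "card S <= degree h"
  proof (rule Q.roots_mod_max_ideal[OF S(2,1,4)])
   show "coeff h j : Q" for j using Q.closed(1,2) Q.closed(4)[of 0 1] Q.closed(4)[of 1 1]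
    by (auto simp: h_def coeff_pCons split: nat.split)
   show "\<exists>j. coeff h j ~: max_ideal Q" using co Q.max_ideal_closed(7) by metis
   fix s assume "s : S"
   then have "(c ^^ i) s - s ^ (q' ^ i) : max_ideal Q" using Frpow S(1) by blast
   then have "s ^ (q' ^ i) - s : max_ideal Q" using i(1) Q.cong_sym by simp
   then show "poly h s : max_ideal Q" by (simp add: h_def poly_monom)
  qed
  then have "q' ^ r <= q' ^ i" using dh S(3) by linarith
  then show ?thesis using q'1 power_le_imp_le_exp by blast
 qed
 \<comment> \<open>\<open>c ^^ r\<close> induces the identity on the residue field, so it is the
   identity by triviality of inertia.\<close>
 have cr: "c ^^ r = id"
 proof (rule inertia_trivial[OF C_pow[OF c(1)] Q])
  fix z assume z: "z : Q"
  have "z ^ (q' ^ r) - z : max_ideal Q" using Y.residue_power_card[OF Q z] unfolding kQ .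
  then show "(c ^^ r) z - z : max_ideal Q" using Q.cong_trans Frpow[OF z] by blast
 qed
 define Stab where "Stab = (%i. \<sigma> ^^ (m * i)) ` {..<d}"
 have StabI: "e : Stab" if e: "e : C" "e -` Q = Q" for e
 proof -
  obtain i where i: "i < n" "e = \<sigma> ^^ i" using \<sigma> e(1) unfolding is_gen_def by blast
  then have "m dvd i" using orb(3)[of i] e(2) by simp
  then obtain k where k: "i = m * k" by blast
  then have "k < d" using i(1) nd by simp
  then show ?thesis using i k by (auto simp: Stab_def)
 qed
 have StabD: "e : C" "e -` Q = Q" if eS: "e : Stab" for e
 proof -
  obtain i where i: "e = \<sigma> ^^ (m * i)" using eS unfolding Stab_def by blast
  show "e : C" unfolding i by (rule C_pow[OF \<sigma>C])
  show "e -` Q = Q" unfolding i using orb(3)[of "m * i"] by (simp only: dvd_triv_left)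
 qed
 have cardStab: "card Stab = d"
 proof -
  have "inj_on (%i. \<sigma> ^^ (m * i)) {..<d}"
  proof (rule inj_onI)
   fix i j assume ij: "i : {..<d}" "j : {..<d}" "\<sigma> ^^ (m * i) = \<sigma> ^^ (m * j)"
   then have "m * i < n" "m * j < n" using nd orb(1) by auto
   moreover have "inj_on (%i. \<sigma> ^^ i) {..<n}" using \<sigma> unfolding is_gen_def by simp
   ultimately have "m * i = m * j" using inj_on_eq_iff[of "%i. \<sigma> ^^ i" "{..<n}" "m * i" "m * j"] ij(3) by simp
   then show "i = j" using orb(1) by simp
  qed
  then show ?thesis unfolding Stab_def by (simp add: card_image)
 qed
 have finStab: "finite Stab" by (simp add: Stab_def)
 have "r <= d"
 proof -
  have "inj_on (%i. c ^^ i) {..<r}"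
  proof -
   have "i = j" if ij: "c ^^ i = c ^^ j" "i <= j" "j < r" for i j
   proof (rule ccontr)
    assume "i ~= j"
    have "c ^^ (i + (r - j)) = c ^^ (j + (r - j))" unfolding funpow_add ij(1) ..
    then have "c ^^ (i + (r - j)) = id" using cr ij by simp
    then have "r <= i + (r - j)" using ord ij by simp
    then show False using ij \<open>i ~= j\<close> by simp
   qed
   then show ?thesis by (metis (no_types, lifting) inj_onI lessThan_iff nat_le_linear)
  qed
  moreover have "(%i. c ^^ i) ` {..<r} \<subseteq> Stab"
  proof (rule image_subsetI)
   fix i
   have "(c ^^ i) -` Q = Q" by (induction i) (use c(2) in \<open>auto simp: vimage_comp[symmetric]\<close>)
   then show "c ^^ i : Stab" using StabI C_pow[OF c(1)] by blast
  qed
  ultimately have "card {..<r} <= card Stab" by (rule card_inj_on_le) (rule finStab)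
  then show ?thesis using cardStab by simp
 qed
 \<comment> \<open>By pigeonhole, \<open>q' ^ (r + 1)\<close> coefficient vectors over
   \<open>q' ^ r\<close> residues give a polynomial of degree at most \<open>r\<close> from below
   with root \<open>y\<close> modulo \<open>Q\<close>. Its images under the stabilizer are further
   roots, distinct because inertia is trivial.\<close>
 moreover have "d <= r"
 proof -
  obtain Sb where Sb: "Sb \<subseteq> ?b" "finite Sb" "card Sb = q'"
   "!!s t. s : Sb ==> t : Sb ==> s - t : max_ideal ?b ==> s = t"
   using X.incongruent_set[OF b] unfolding q'_def fb_def by metis
  let ?G = "PiE {..r} (%_. Sb)"
  let ?v = "%g. max_ideal Q +[Q] (\<Sum>i\<le>r. \<phi> (g i) * y ^ i)"
  have cG: "card ?G = q' ^ Suc r" by (simp add: card_PiE Sb(3))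
  have inQ: "\<phi> x * y ^ i : Q" if "x : ?b" for x i using that Q.closed(5)[OF _ Q.closed(7)[OF y(1)]] by simp
  have "\<not> inj_on ?v ?G"
  proof
   assume "inj_on ?v ?G"
   moreover have "?v ` ?G \<subseteq> carrier (residue_field Q)"
   proof (rule image_subsetI)
    fix g assume "g : ?G"
    then have "g i : ?b" if "i <= r" for i using that Sb(1) by (auto simp: PiE_def)
    then have "(\<Sum>i\<le>r. \<phi> (g i) * y ^ i) : Q" using inQ by (intro Q.closed_sum) auto
    then show "?v g : carrier (residue_field Q)" unfolding Y.carrier_residue_field by blast
   qed
   ultimately have "card ?G <= card (carrier (residue_field Q))"
    by (rule card_inj_on_le) (rule Y.residue_field_finite(1)[OF Q])
   then have "q' ^ Suc r <= q' ^ r" unfolding cG Y.residue_field_finite(2)[OF Q] kQ .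
   then show False using q'1 by simp
  qed
  then obtain g g' where g: "g : ?G" "g' : ?G" "g ~= g'" "?v g = ?v g'" unfolding inj_on_def by blast
  obtain i0 where i0: "i0 <= r" "g i0 ~= g' i0" using PiE_ext[OF g(1,2)] g(3) by auto
  define h where "h = (\<Sum>i\<le>r. Polynomial.monom (\<phi> (g i - g' i)) i)"
  have gb: "g i : Sb" "g' i : Sb" if "i <= r" for i using g that by auto
  have ch: "coeff h i = (if i <= r then \<phi> (g i - g' i) else 0)" for i by (simp add: h_def coeff_sum)
  have ph: "poly h x = (\<Sum>i\<le>r. \<phi> (g i - g' i) * x ^ i)" for x by (simp add: h_def poly_sum poly_monom)
  have hy: "poly h y : max_ideal Q"
   using g(4) unfolding Y.residue_hom(3)[OF Q] ph by (simp add: sum_subtractf left_diff_distrib)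
  have "card ((%e. e y) ` Stab) <= degree h"
  proof (rule Q.roots_mod_max_ideal)
   show "finite ((%e. e y) ` Stab)" using finStab by simp
   show "(%e. e y) ` Stab \<subseteq> Q" using StabD stab_cong(1)[OF _ Q] y(1) by blast
   show "s = t" if st: "s : (%e. e y) ` Stab" "t : (%e. e y) ` Stab" "s - t : max_ideal Q" for s t
   proof -
    obtain e e' where e: "e : Stab" "s = e y" "e' : Stab" "t = e' y" using st by blast
    have ee: "e : C" "e' : C" "e -` Q = Q" "e' -` Q = Q" using StabD e by auto
    obtain f where f: "f : C" "!!x. e' (f x) = x" "!!x. f (e' x) = x" using C_inverse[OF ee(2)] by blast
    have fQ: "f -` Q = Q" using ee(4) f(2) by auto (metis ee(4) f(2) vimage_eq)+
    have "f (e y) - y : max_ideal Q"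
     using stab_cong(2)[OF f(1) Q fQ, of "e y - e' y"] st(3) e f(3) by (simp add: field_autoD[OF C_auto[OF f(1)]])
    then have fey: "(f \<circ> e) y - y ^ 1 : max_ideal Q" by simp
    have feC: "f \<circ> e : C" by (rule C_comp[OF f(1) ee(1)])
    have feQ: "(f \<circ> e) -` Q = Q" using ee(3) fQ by (simp add: vimage_comp[symmetric])
    have "(f \<circ> e) z - z : max_ideal Q" if "z : Q" for z
     using stab_primitive[OF feC Q feQ y(1) y(3) fey that, of 0] by simp
    then have "f \<circ> e = id" by (rule inertia_trivial[OF feC Q])
    then have "f (e y) = y" by (metis comp_apply id_apply)
    then show ?thesis using f(2) e by metis
   qed
   show "coeff h i : Q" for i unfolding ch
   proof (cases "i <= r")
    case True
    then have "g i - g' i : ?b" using gb[OF True] Sb(1) dvr.closed(4)[OF X.place_dvr[OF b]] by blast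
    then show "(if i <= r then \<phi> (g i - g' i) else 0) : Q" using True by (simp del: \<phi>_diff)
   qed (simp add: Q.closed)
   have "g i0 - g' i0 ~: max_ideal ?b" using Sb(4) gb[OF i0(1)] i0(2) by blast
   then have "coeff h i0 ~: max_ideal Q" unfolding ch using i0(1) max_ideal_\<phi>[OF Q, of "g i0 - g' i0"] by (simp del: \<phi>_diff)
   then show "\<exists>i. coeff h i ~: max_ideal Q" by blast
   fix s assume "s : (%e. e y) ` Stab"
   then obtain e where e: "e : Stab" "s = e y" by blast
   note ea = field_autoD[OF C_auto[OF StabD(1)[OF e(1)]]]
   have "poly h s = e (poly h y)" unfolding ph e(2)
    by (simp add: ea C_\<phi>[OF StabD(1)[OF e(1)]] del: \<phi>_diff)
   then show "poly h s : max_ideal Q" using hy stab_cong(2)[OF StabD(1)[OF e(1)] Q StabD(2)[OF e(1)]] by simp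
  qed
  moreover have "degree h <= r" by (rule degree_le) (simp add: ch)
  moreover have "card ((%e. e y) ` Stab) = card Stab"
  proof (rule card_image, rule inj_onI)
   fix e e' assume e: "e : Stab" "e' : Stab" "e y = e' y"
   have ee: "e : C" "e' : C" "e -` Q = Q" "e' -` Q = Q" using StabD e by auto
   obtain f where f: "f : C" "!!x. e' (f x) = x" "!!x. f (e' x) = x" using C_inverse[OF ee(2)] by blast
   have fQ: "f -` Q = Q" using ee(4) f(2) by auto (metis ee(4) f(2) vimage_eq)+
   have feC: "f \<circ> e : C" by (rule C_comp[OF f(1) ee(1)])
   have feQ: "(f \<circ> e) -` Q = Q" using ee(3) fQ by (simp add: vimage_comp[symmetric])
   have fey: "(f \<circ> e) y - y ^ 1 : max_ideal Q" using e(3) f(3) Q.max_ideal_closed(6) by simp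
   have "(f \<circ> e) z - z : max_ideal Q" if "z : Q" for z
    using stab_primitive[OF feC Q feQ y(1) y(3) fey that, of 0] by simp
   then have "f \<circ> e = id" by (rule inertia_trivial[OF feC Q])
   then have "f (e x) = x" for x by (metis comp_apply id_apply)
   then show "e = e'" using f(2) by (metis ext)
  qed
  ultimately show ?thesis using cardStab by linarith
 qed
 ultimately have dr: "d = r" by simp
 have "c : Stab" by (rule StabI[OF c])
 then obtain j where j: "j < d" "c = \<sigma> ^^ (m * j)" by (auto simp: Stab_def)
 \<comment> \<open>A common factor of \<open>j\<close> and \<open>d\<close> would make the order of
   \<open>c\<close> smaller than \<open>r = d\<close>.\<close>
 have cop: "coprime j d"
 proof (rule ccontr)
  assume "\<not> coprime j d"
  define g where "g = gcd j d"
  have g: "g > 1" using \<open>\<not> coprime j d\<close> d0 unfolding g_def coprime_iff_gcd_eq_1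
   by (metis gcd_pos_nat less_one nat_neq_iff not_gr_zero)
  obtain d' where d': "d = g * d'" unfolding g_def by (metis gcd_dvd2 dvdE)
  obtain j' where j': "j = g * j'" unfolding g_def by (metis gcd_dvd1 dvdE)
  have "c ^^ d' = \<sigma> ^^ (m * j * d')" unfolding j(2) by (simp add: funpow_mult mult.commute)
  moreover have "n dvd m * j * d'" unfolding nd d' j' by (simp add: ac_simps)
  ultimately have "c ^^ d' = id" using gen_pow_eq_id[OF \<sigma>] by simp
  moreover have "d' > 0" using d' d0 by (cases d') auto
  ultimately have "r <= d'" by (rule ord)
  moreover have "1 * d' < g * d'" using g \<open>d' > 0\<close> by (rule mult_strict_right_mono)
  ultimately show False using dr d' by linarith
 qed
 obtain i where i: "i mod d = j mod d" "coprime i n"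
  by (rule coprime_lift[OF cop _ n_pos]) (use nd in auto)
 define s where "s = \<sigma> ^^ i"
 have s: "is_gen s"
 proof -
  have sC: "s : C" unfolding s_def by (rule C_pow[OF \<sigma>C])
  have inj: "inj_on (%k. s ^^ k) {..<n}"
  proof -
   have "k = l" if kl: "s ^^ k = s ^^ l" "k <= l" "l < n" for k l
   proof (rule ccontr)
    assume "k ~= l"
    have "s ^^ (k + (n - l)) = s ^^ (l + (n - l))" unfolding funpow_add kl(1) ..
    then have "s ^^ (k + (n - l)) = id" using C_pow_n[OF sC] kl by simp
    then have "n dvd i * (k + (n - l))" using gen_pow_eq_id[OF \<sigma>] by (simp add: s_def funpow_mult)
    then have "n dvd k + (n - l)" using i(2) by (metis coprime_commute coprime_dvd_mult_right_iff)
    then show False using kl \<open>k ~= l\<close> by (auto dest: dvd_imp_le)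
   qed
   then show ?thesis by (metis (no_types, lifting) inj_onI lessThan_iff nat_le_linear)
  qed
  moreover have "(%k. s ^^ k) ` {..<n} = C"
  proof (rule card_subset_eq[OF finite_C])
   show "(%k. s ^^ k) ` {..<n} \<subseteq> C" using C_pow[OF sC] by blast
   show "card ((%k. s ^^ k) ` {..<n}) = card C" using card_image[OF inj] card_C by simp
  qed
  ultimately show ?thesis using sC unfolding is_gen_def by blast
 qed
 have "s ^^ m = c"
 proof -
  have "s ^^ m = \<sigma> ^^ (m * i)" by (simp add: s_def funpow_mult mult.commute)
  also have "\<dots> = \<sigma> ^^ ((m * i) mod n)" by (rule gen_pow_mod[OF \<sigma>])
  also have "(m * i) mod n = (m * j) mod n" unfolding nd using i(1) by (simp add: mult_mod_right[symmetric])
  also have "\<sigma> ^^ ((m * j) mod n) = \<sigma> ^^ (m * j)" by (rule gen_pow_mod[OF \<sigma>, symmetric])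
  finally show ?thesis using j(2) by simp
 qed
 then show ?thesis using that[OF s] Fr nd dr unfolding q'_def fb_def m_def r_def by simp
qed

end

section \<open>Pullback, translation and degree of divisors\<close>

context cyclic_cover
begin

lemma ramification_1: "Q : PPY ==> ramification_index \<phi> Q = 1"
 using unram by (simp add: unramified_def)

lemma sum_fiber_indicator:
 assumes "b : PPX" "Q : PPY"
 shows "(\<Sum>Q'\<in>fiber \<phi> PY b. if Q' = Q then k else 0) = (if \<phi> -` Q = b then k else (0::int))"
 using assms finite_fiber[OF assms(1)] by (simp add: fiber_def sum.delta)

lemma lookup_pullback:
 assumes D: "D : divisors PX" and Q: "Q : PPY"
 shows "lookup (pullback \<phi> PY D) Q = lookup D (\<phi> -` Q)"
proof -
 have k: "b : PPX" if "b : keys D" for b using D that by (auto simp: divisors_def)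
 have "lookup (pullback \<phi> PY D) Q =
  (\<Sum>b\<in>keys D. \<Sum>Q'\<in>fiber \<phi> PY b. if Q' = Q then lookup D b else 0)"
  unfolding pullback_def by (simp add: lookup_sum lookup_single when_def ramification_1[OF fiberD(1)] cong: sum.cong)
 also have "\<dots> = (\<Sum>b\<in>keys D. if \<phi> -` Q = b then lookup D b else 0)"
  by (rule sum.cong[OF refl]) (rule sum_fiber_indicator[OF k Q])
 also have "\<dots> = lookup D (\<phi> -` Q)" by (simp add: in_keys_iff)
 finally show ?thesis .
qed

lemma pullback_divisors: "pullback \<phi> PY D : divisors PY"
 unfolding pullback_def by (intro divisors_sum divisors_single fiberD(1))

lemma lookup_fiber_divisor:
 assumes "b : PPX" "Q : PPY"
 shows "lookup (fiber_divisor \<phi> PY b) Q = (if \<phi> -` Q = b then 1 else 0)"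
 using sum_fiber_indicator[OF assms, of 1]
 unfolding fiber_divisor_def lookup_sum lookup_single when_def .

lemma fiber_divisor_divisors: "fiber_divisor \<phi> PY b : divisors PY"
 unfolding fiber_divisor_def by (intro divisors_sum divisors_single fiberD(1))

lemma pullback_diff_point:
 assumes D: "D : divisors PX" and b: "b : PPX"
 shows "pullback \<phi> PY (D - single b 1) = pullback \<phi> PY D - fiber_divisor \<phi> PY b"
proof (rule Y.divisor_eqI[OF pullback_divisors divisors_diff[OF pullback_divisors fiber_divisor_divisors]])
 fix Q assume Q: "Q : PPY"
 show "lookup (pullback \<phi> PY (D - single b 1)) Q =
  lookup (pullback \<phi> PY D - fiber_divisor \<phi> PY b) Q"
  using D Q b by (simp add: lookup_pullback divisors_diff divisors_single lookup_fiber_divisor lookup_minus lookup_single when_def)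
qed

text \<open>By transitivity all points of a fibre have the same degree, and
  \<open>frobenius_generator\<close> supplies the relation between \<open>n\<close>, their number
  and the inertial degree.\<close>

lemma fiber_degree:
 assumes b: "b : PPX"
 shows "(\<Sum>Q\<in>fiber \<phi> PY b. int (point_degree \<iota>Y Q)) = int n * int (point_degree \<iota>X b)"
proof -
 obtain Q0 where Q0: "Q0 : fiber \<phi> PY b" using fiber_nonempty[OF b] by blast
 have P: "Q0 : PPY" "\<phi> -` Q0 = b" using fiberD Q0 by auto
 obtain s where n: "n = card (fiber \<phi> PY b) * inertial_degree \<phi> Q0"
  using frobenius_generator[OF P(1)] unfolding P(2) by metis
 have "int (point_degree \<iota>Y Q) = int (point_degree \<iota>X b * inertial_degree \<phi> Q0)" if "Q : fiber \<phi> PY b" for Q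
 proof -
  have "Q : PPY" "\<phi> -` Q0 = \<phi> -` Q" using fiberD[OF that] P by auto
  from transitive[OF P(1) this] obtain c where c: "c : C" "Q = c -` Q0" by blast
  show ?thesis unfolding c(2) point_degree_act[OF c(1) P(1)] inertial_degree_card[OF P(1)] P(2) ..
 qed
 then have "(\<Sum>Q\<in>fiber \<phi> PY b. int (point_degree \<iota>Y Q)) =
  (\<Sum>Q\<in>fiber \<phi> PY b. int (point_degree \<iota>X b * inertial_degree \<phi> Q0))" by (rule sum.cong[OF refl])
 also have "\<dots> = int (card (fiber \<phi> PY b)) * int (point_degree \<iota>X b * inertial_degree \<phi> Q0)" by simp
 also have "\<dots> = int n * int (point_degree \<iota>X b)" using n by (simp add: mult.assoc mult.left_commute)
 finally show ?thesis .
qed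

lemma deg_pullback:
 assumes D: "D : divisors PX"
 shows "Y.deg (pullback \<phi> PY D) = int n * X.deg D"
proof -
 have k: "b : PPX" if "b : keys D" for b using D that by (auto simp: divisors_def)
 have "Y.deg (pullback \<phi> PY D) =
  (\<Sum>b\<in>keys D. \<Sum>Q\<in>fiber \<phi> PY b. lookup D b * int (point_degree \<iota>Y Q))"
  unfolding pullback_def div_degree_sum div_degree_single by (simp add: ramification_1[OF fiberD(1)] cong: sum.cong)
 also have "\<dots> = (\<Sum>b\<in>keys D. lookup D b * (int n * int (point_degree \<iota>X b)))"
  unfolding sum_distrib_left[symmetric] by (rule sum.cong[OF refl]) (simp only: fiber_degree[OF k])
 also have "\<dots> = int n * X.deg D" unfolding div_degree_def sum_distrib_left by (rule sum.cong[OF refl]) simp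
 finally show ?thesis .
qed

lemma lookup_translate: "c : C ==> lookup (translate c A) Q = lookup A (c -` Q)"
proof -
 assume c: "c : C"
 have "inj (%Q. c -` Q)" using field_autoD(1)[OF C_auto[OF c]] by (metis bij_is_surj injI surj_image_vimage_eq)
 then show ?thesis unfolding translate_def by (simp add: map_key.rep_eq)
qed

lemma vimage_inverse:
 assumes "\<forall>x. c (e x) = x"
 shows "e -` (c -` Q) = Q"
 using assms by auto

lemma translate_divisors:
 assumes c: "c : C" and A: "A : divisors PY" shows "translate c A : divisors PY"
proof -
 obtain e where e: "e : C" "\<forall>x. c (e x) = x" using C_inverse[OF c] by blast
 have "Q : PPY" if "lookup A (c -` Q) ~= 0" for Q
 proof -
  have "c -` Q : PPY" using that A by (auto simp: divisors_def in_keys_iff)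
  then have "e -` (c -` Q) : PPY" by (rule act_place[OF e(1)])
  then show ?thesis unfolding vimage_inverse[of c e, OF e(2)] .
 qed
 then show ?thesis by (auto simp: divisors_def in_keys_iff lookup_translate[OF c])
qed

lemma deg_translate:
 assumes c: "c : C" and A: "A : divisors PY"
 shows "Y.deg (translate c A) = Y.deg A"
proof -
 obtain e where e: "e : C" "\<forall>x. c (e x) = x" "\<forall>x. e (c x) = x" using C_inverse[OF c] by blast
 show ?thesis unfolding div_degree_def
 proof (rule sum.reindex_bij_witness[of _ "%Q. e -` Q" "%Q. c -` Q"])
  fix Q assume Q: "Q : keys (translate c A)"
  then have QP: "Q : PPY" using translate_divisors[OF c A] by (auto simp: divisors_def)
  show "e -` (c -` Q) = Q" by (rule vimage_inverse[of c e, OF e(2)])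
  show "c -` Q : keys A" using Q by (simp add: in_keys_iff lookup_translate[OF c])
  show "lookup A (c -` Q) * int (point_degree \<iota>Y (c -` Q)) =
   lookup (translate c A) Q * int (point_degree \<iota>Y Q)"
   by (simp only: lookup_translate[OF c] point_degree_act[OF c QP])
 next
  fix Q assume Q: "Q : keys A"
  have v: "c -` (e -` Q) = Q" by (rule vimage_inverse[of e c, OF e(3)])
  show "c -` (e -` Q) = Q" by (rule v)
  show "e -` Q : keys (translate c A)" using Q by (simp only: in_keys_iff lookup_translate[OF c] v not_False_eq_True)
 qed
qed

text \<open>\<open>W\<close> is the least divisor on X whose pullback dominates \<open>A\<close>.
  The last clause says that its multiplicity is attained on each orbit, which lets an invariant form
  that vanishes on \<open>A\<close> vanish on this pullback.\<close>

lemma max_pushforward: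
 assumes A: "A : divisors PY"
 obtains W where "W : divisors PX" "!!Q. Q : PPY ==> lookup A Q <= lookup W (\<phi> -` Q)"
  "!!Q. Q : PPY ==> \<exists>c\<in>C. lookup A (c -` Q) = lookup W (\<phi> -` Q)"
proof -
 define w where "w b = (if b : PPX then Max (lookup A ` fiber \<phi> PY b) else 0)" for b
 have wm: "\<exists>Q\<in>fiber \<phi> PY b. w b = lookup A Q" if b: "b : PPX" for b
 proof -
  have "Max (lookup A ` fiber \<phi> PY b) : lookup A ` fiber \<phi> PY b"
   using finite_fiber[OF b] fiber_nonempty[OF b] by (intro Max_in) auto
  then show ?thesis unfolding w_def using b by auto
 qed
 have "{b. w b ~= 0} \<subseteq> (%Q. \<phi> -` Q) ` keys A"
 proof
  fix b assume "b : {b. w b ~= 0}"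
  then have "b : PPX" "w b ~= 0" by (auto simp: w_def split: if_splits)
  with wm obtain Q where "Q : fiber \<phi> PY b" "lookup A Q ~= 0" by metis
  then show "b : (%Q. \<phi> -` Q) ` keys A" using fiberD(2)[of Q b] by (intro image_eqI[of b _ Q]) (simp_all add: in_keys_iff)
 qed
 then have fin: "finite {b. w b ~= 0}" by (rule finite_subset) simp
 note W = divisor_of_function[OF fin, of PX]
 have w0: "w b = 0" if "b ~: PPX" for b using that by (simp add: w_def)
 have lw: "lookup (Abs_poly_mapping w) = w" by (rule W(1)) (rule w0)
 show ?thesis
 proof (rule that[of "Abs_poly_mapping w"])
  show "Abs_poly_mapping w : divisors PX" by (rule W(2)[OF w0])
  fix Q assume Q: "Q : PPY"
  have b: "\<phi> -` Q : PPX" by (rule restrict_place[OF Q])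
  show "lookup A Q <= lookup (Abs_poly_mapping w) (\<phi> -` Q)"
   unfolding lw using b finite_fiber[OF b] fiber_restrict[OF Q] by (simp add: w_def)
  obtain Q' where Q': "Q' : fiber \<phi> PY (\<phi> -` Q)" "w (\<phi> -` Q) = lookup A Q'" using wm[OF b] by blast
  then obtain c where "c : C" "Q' = c -` Q" unfolding fiber_orbit[OF Q] by blast
  then show "\<exists>c\<in>C. lookup A (c -` Q) = lookup (Abs_poly_mapping w) (\<phi> -` Q)"
   unfolding lw Q'(2) by blast
 qed
qed

definition act :: "('g => 'g) => ('g set => 'g) => 'g set => 'g" where
 "act c \<beta> = (%Q. c (\<beta> (c -` Q)))"

lemma act_reps: "c : C ==> \<beta> : Y.reps A ==> act c \<beta> : Y.reps (translate c A)"
 unfolding Y.reps_def act_def mem_Collect_eq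
proof
 fix Q assume c: "c : C" and \<beta>: "\<forall>P\<in>PPY. \<beta> P : vset P (- lookup A P)" and Q: "Q : PPY"
 have "\<beta> (c -` Q) : vset (c -` Q) (- lookup A (c -` Q))" using \<beta> act_place[OF c Q] by blast
 then show "c (\<beta> (c -` Q)) : vset Q (- lookup (translate c A) Q)"
  unfolding lookup_translate[OF c] vimage_vset[OF C_auto[OF c] Y.place_dvr[OF Q]] by (rule vimageD)
qed

lemma act_adeles: "c : C ==> \<beta> : Y.adeles ==> act c \<beta> : Y.adeles"
proof -
 assume c: "c : C" and "\<beta> : Y.adeles"
 then obtain A where A: "A : divisors PY" "\<beta> : Y.reps A" unfolding Y.adeles_def by blast
 show ?thesis by (rule Y.adelesI[OF translate_divisors[OF c A(1)] act_reps[OF c A(2)]])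
qed

lemma act_simps:
 assumes c: "c : C"
 shows "act c (%Q. \<beta> Q + \<gamma> Q) = (%Q. act c \<beta> Q + act c \<gamma> Q)"
  "act c (%Q. y * \<beta> Q) = (%Q. c y * act c \<beta> Q)" "act c (%_. y) = (%_. c y)"
 using field_autoD[OF C_auto[OF c]] by (simp_all add: act_def)

lemma act_comp: "act c (act d \<beta>) = act (c \<circ> d) \<beta>"
 by (simp add: act_def vimage_comp comp_def)

lemma act_id: "act id \<beta> = \<beta>" by (simp add: act_def)

lemma weil_act:
 assumes c: "c : C" and A: "A : divisors PY" and w: "Y.weil A \<omega>"
 obtains A' where "A' : divisors PY" "Y.weil A' (%\<beta>. \<omega> (act c \<beta>))"
proof -
 obtain e where e: "e : C" "\<forall>x. c (e x) = x" "\<forall>x. e (c x) = x" using C_inverse[OF c] by blast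
 have "act c \<beta> : Y.reps A" if "\<beta> : Y.reps (translate e A)" for \<beta>
 proof -
  have "translate c (translate e A) = A"
   by (rule poly_mapping_eqI) (simp only: lookup_translate[OF c] lookup_translate[OF e(1)] vimage_inverse[of c e, OF e(2)])
  then show ?thesis using act_reps[OF c that] by simp
 qed
 then have "Y.weil (translate e A) (%\<beta>. \<omega> (act c \<beta>))"
  using Y.weilD(1,2,3,4)[OF w] act_adeles[OF c] unfolding Y.weil_def act_simps[OF c] C_\<iota>[OF c] by simp
 then show ?thesis by (rule that[OF translate_divisors[OF e(1) A]])
qed

end

text \<open>Dedekind's argument: subtracting \<open>c0 x\<close> times the relation at
  \<open>y\<close> from the relation at \<open>x * y\<close> removes \<open>c0\<close> and
  multiplies the other coefficients by \<open>c x - c0 x\<close>.\<close>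

lemma dedekind_independence:
 fixes h :: "('g => 'g) => 'g::Fields.field"
 assumes "finite S" "!!c x y. c : S ==> c (x * y) = c x * c y" "!!c. c : S ==> c 1 = 1"
  and "!!y. (\<Sum>c\<in>S. h c * c y) = 0"
 shows "\<forall>c\<in>S. h c = 0"
 using assms
proof (induction S arbitrary: h rule: finite_induct)
 case (insert c0 S)
 have z: "(\<Sum>c\<in>S. h c * c y) = - (h c0 * c0 y)" for y
  using insert.prems(3)[of y] insert.hyps by (simp add: add_eq_0_iff)
 have "\<forall>c\<in>S. h c * (c x - c0 x) = 0" for x
 proof (rule insert.IH)
  fix y
  have "(\<Sum>c\<in>S. h c * (c x - c0 x) * c y) = (\<Sum>c\<in>S. h c * c (x * y)) - c0 x * (\<Sum>c\<in>S. h c * c y)"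
   unfolding sum_distrib_left sum_subtractf[symmetric]
   by (rule sum.cong[OF refl]) (simp add: insert.prems(1) algebra_simps)
  also have "\<dots> = 0" unfolding z by (simp add: insert.prems(1))
  finally show "(\<Sum>c\<in>S. h c * (c x - c0 x) * c y) = 0" .
 qed (use insert.prems in auto)
 moreover have "\<exists>x. c x ~= c0 x" if "c : S" for c using that insert.hyps by (metis ext)
 ultimately have "\<forall>c\<in>S. h c = 0" by (metis mult_eq_0_iff right_minus_eq)
 then show ?case using insert.prems(2,3)[of _] z[of 1] insert.prems(2)[of c0] by simp
qed simp

text \<open>The shift by 1 permutes the field, so summing over it shows that \<open>q\<close> is 0
  in K; then Bezout.\<close>

lemma of_nat_coprime_card:
 assumes "coprime n CARD('k::{Fields.field,finite})"
 shows "of_nat n ~= (0::'k)"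
proof
 assume n: "of_nat n = (0::'k)"
 have "(\<Sum>x\<in>UNIV. x + 1 :: 'k) = (\<Sum>x\<in>UNIV. x)"
  by (rule sum.reindex_bij_witness[of _ "%x. x - 1" "%x. x + 1"]) auto
 then have q: "of_nat CARD('k) = (0::'k)" by (simp add: sum.distrib)
 obtain u v where "u * int n + v * int CARD('k) = 1"
  using bezout_int[of "int n" "int CARD('k)"] assms by (auto simp: coprime_iff_gcd_eq_1)
 then have "of_int (u * int n + v * int CARD('k)) = (1::'k)" by simp
 then show False using n q by simp
qed

section \<open>Vanishing of the first cohomology of a pullback\<close>

context cyclic_cover
begin

definition lift :: "('f set => 'f) => 'g set => 'g" where
 "lift \<alpha> = (%Q. \<phi> (\<alpha> (\<phi> -` Q)))"

lemma lift_reps: "W : divisors PX ==> \<alpha> : X.reps W ==> lift \<alpha> : Y.reps (pullback \<phi> PY W)"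
 unfolding X.reps_def Y.reps_def lift_def using restrict_place
 by (auto simp: vset_\<phi> lookup_pullback)

lemma lift_adeles: "\<alpha> : X.adeles ==> lift \<alpha> : Y.adeles"
 unfolding X.adeles_def using lift_reps Y.adelesI[OF pullback_divisors] by blast

text \<open>Pole bounds on Y are dominated by a pullback, and \<open>vset_\<phi>\<close> transports
  them down to X.\<close>

lemma adeles_of_lift: assumes "lift \<alpha> : Y.adeles" shows "\<alpha> : X.adeles"
proof -
 obtain A where A: "A : divisors PY" "lift \<alpha> : Y.reps A" using assms unfolding Y.adeles_def by blast
 obtain W where W: "W : divisors PX" "!!Q. Q : PPY ==> lookup A Q <= lookup W (\<phi> -` Q)"
  by (rule max_pushforward[OF A(1)]) blast
 have "\<alpha> : X.reps W" unfolding X.reps_def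
 proof (rule CollectI, rule ballI)
  fix b assume b: "b : PPX"
  obtain Q where Q: "Q : PPY" "\<phi> -` Q = b" using fiber_nonempty[OF b] fiberD by blast
  have "\<phi> (\<alpha> b) : vset Q (- lookup A Q)" using A(2) Q unfolding Y.reps_def lift_def by auto
  then have "\<alpha> b : vset b (- lookup A Q)" using vset_\<phi>[OF Q(1)] Q(2) by simp
  then show "\<alpha> b : vset b (- lookup W b)"
   using dvr.vset_mono[OF X.place_dvr[OF b], of "- lookup W b" "- lookup A Q"] W(2)[OF Q(1)] Q(2) by auto
 qed
 then show ?thesis by (rule X.adelesI[OF W(1)])
qed

text \<open>The trace of a repartition is, up to an arbitrarily small error, lifted from \<open>X\<close>: approximate
  it on each fibre by a single function and take the trace of that function.\<close>

lemma trace_adele: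
 assumes \<beta>: "\<beta> : Y.adeles" and W: "W : divisors PX"
 obtains \<alpha> where "\<alpha> : X.adeles" "(%Q. (\<Sum>c\<in>C. act c \<beta> Q) - lift \<alpha> Q) : Y.reps (pullback \<phi> PY W)"
proof -
 have "\<exists>a. \<forall>Q\<in>fiber \<phi> PY b. (\<Sum>c\<in>C. act c \<beta> Q) - \<phi> a : vset Q (- lookup W b)" if b: "b : PPX" for b
 proof -
  obtain z where z: "\<forall>Q\<in>fiber \<phi> PY b. z - \<beta> Q : vset Q (- lookup W b)"
   by (rule weak_approximation[OF finite_fiber[OF b], of "\<beta>" "%_. - lookup W b"])
    (use Y.place_dvr fiberD in blast)+
  have "(\<Sum>c\<in>C. c z) : range \<phi>"
  proof (rule fixed_field)
   fix e assume e: "e : C"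
   have "e (\<Sum>c\<in>C. c z) = (\<Sum>c\<in>C. (e \<circ> c) z)" by (simp add: field_autoD[OF C_auto[OF e]])
   also have "\<dots> = (\<Sum>c\<in>C. c z)" by (rule C_perm(2)[OF e, of "%c. c z"])
   finally show "e (\<Sum>c\<in>C. c z) = (\<Sum>c\<in>C. c z)" .
  qed
  then obtain a where a: "(\<Sum>c\<in>C. c z) = \<phi> a" by blast
  have "(\<Sum>c\<in>C. act c \<beta> Q) - \<phi> a : vset Q (- lookup W b)" if Q: "Q : fiber \<phi> PY b" for Q
  proof -
   have QP: "Q : PPY" by (rule fiberD(1)[OF Q])
   interpret Q: dvr Q by (rule Y.place_dvr[OF QP])
   have "(\<Sum>c\<in>C. act c \<beta> Q) - \<phi> a = (\<Sum>c\<in>C. act c \<beta> Q - c z)" unfolding a[symmetric] sum_subtractf ..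
   also have "\<dots> : vset Q (- lookup W b)"
   proof (rule Q.vset_sum)
    fix c assume c: "c : C"
    have "c -` Q : fiber \<phi> PY b" using act_place[OF c QP] restrict_act[OF c] fiberD(2)[OF Q] by (simp add: fiber_def)
    then have "z - \<beta> (c -` Q) : vset (c -` Q) (- lookup W b)" using z by blast
    then have "c (z - \<beta> (c -` Q)) : vset Q (- lookup W b)"
     unfolding vimage_vset[OF C_auto[OF c] Q.dvr_axioms] by (rule vimageD)
    then have "- c (z - \<beta> (c -` Q)) : vset Q (- lookup W b)" by (rule Q.vset_uminus)
    then show "act c \<beta> Q - c z : vset Q (- lookup W b)"
     by (simp add: act_def field_autoD[OF C_auto[OF c]])
   qed
   finally show ?thesis .
  qed
  then show ?thesis by blast
 qed
 then obtain \<alpha> where \<alpha>: "!!b Q. b : PPX ==> Q : fiber \<phi> PY b ==>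
  (\<Sum>c\<in>C. act c \<beta> Q) - \<phi> (\<alpha> b) : vset Q (- lookup W b)" by metis
 have r: "(%Q. (\<Sum>c\<in>C. act c \<beta> Q) - lift \<alpha> Q) : Y.reps (pullback \<phi> PY W)"
  unfolding Y.reps_def lift_def
  using \<alpha>[OF restrict_place fiber_restrict] by (auto simp: lookup_pullback[OF W])
 have "(%Q. (\<Sum>c\<in>C. act c \<beta> Q) - ((\<Sum>c\<in>C. act c \<beta> Q) - lift \<alpha> Q)) : Y.adeles"
  by (intro Y.adeles_diff Y.adeles_sum Y.adelesI[OF pullback_divisors r] act_adeles[OF _ \<beta>])
 then have "lift \<alpha> : Y.adeles" by simp
 then show ?thesis using that adeles_of_lift r by blast
qed

text \<open>A nonzero Weil differential of X that vanishes on \<open>W\<close> forces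
  \<open>deg W <= 2 g - 2\<close>; the \<open>W\<close> constructed here has degree at least
  \<open>deg D\<close>, whence the bound \<open>2 g - 1\<close>.\<close>

lemma covers_pullback:
 assumes D: "D : divisors PX" and deg: "X.deg D \<ge> 2 * int X.gen - 1" and n: "of_nat n ~= (0::'k)"
 shows "Y.covers (pullback \<phi> PY D)"
proof (rule ccontr)
 assume nc: "\<not> Y.covers (pullback \<phi> PY D)"
 obtain \<omega> \<alpha>0 where w: "Y.weil (pullback \<phi> PY D) \<omega>" and \<alpha>0: "\<alpha>0 : Y.adeles" "\<omega> \<alpha>0 ~= 0"
  by (rule Y.weil_exists[OF pullback_divisors nc])
 note wD = Y.weilD[OF w]
 \<comment> \<open>Translates of \<omega> are Weil differentials again, so each is a multiple of
   \<omega>.\<close>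
 have "\<exists>h. \<forall>\<beta>\<in>Y.adeles. \<omega> (act c \<beta>) = \<omega> (%Q. h * \<beta> Q)" if c: "c : C" for c
 proof -
  obtain A' where A': "A' : divisors PY" "Y.weil A' (%\<beta>. \<omega> (act c \<beta>))" by (rule weil_act[OF c pullback_divisors w])
  show ?thesis by (rule Y.weil_one_dimensional[OF pullback_divisors w \<alpha>0 A']) blast
 qed
 moreover define J where "J c = inv_into UNIV c" for c :: "'g => 'g"
 have J: "J c : C" "J c (c x) = x" "c (J c x) = x" if c: "c : C" for c x
 proof -
  have b: "bij c" by (rule field_autoD(1)[OF C_auto[OF c]])
  show 1: "J c (c x) = x" for x unfolding J_def using b by (simp add: bij_is_inj)
  show "c (J c x) = x" unfolding J_def using b by (simp add: bij_is_surj surj_f_inv_f)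
  obtain e where e: "e : C" "\<forall>x. c (e x) = x" using C_inverse[OF c] by blast
  have "J c = e" using 1 e(2) by (metis ext)
  then show "J c : C" using e by simp
 qed
 ultimately have "\<exists>h. \<forall>\<beta>\<in>Y.adeles. \<omega> (act (J c) \<beta>) = \<omega> (%Q. h * \<beta> Q)" if "c : C" for c using that by blast
 then obtain h where h: "!!c \<beta>. c : C ==> \<beta> : Y.adeles ==> \<omega> (act (J c) \<beta>) = \<omega> (%Q. h c * \<beta> Q)" by metis
 have "h id ~= 0"
 proof
  assume "h id = 0"
  then have "\<omega> (act (J id) \<alpha>0) = 0" using h[OF C_id \<alpha>0(1)] wD(4)[of 0] by simp
  moreover have "J id = id" by (simp add: J_def)
  ultimately show False using \<alpha>0(2) by (simp add: act_id)
 qed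
 then have "\<not> (\<forall>c\<in>C. h c = 0)" using C_id by blast
 \<comment> \<open>Without such a \<open>y\<close>, Dedekind independence would force all
   \<open>h c\<close> to vanish, but \<open>h id\<close> is nonzero since \<omega> is.\<close>
 then obtain y where y: "(\<Sum>c\<in>C. h c * c y) ~= 0"
  using dedekind_independence[OF finite_C, of h] field_autoD(3,5)[OF C_auto] by blast
 define f where "f = (\<Sum>c\<in>C. h c * c y)"
 have f0: "f ~= 0" using y by (simp add: f_def)
 define \<omega>' where "\<omega>' \<beta> = \<omega> (%Q. f * \<beta> Q)" for \<beta>
 have sum: "\<omega> (%Q. \<Sum>c\<in>C. g c Q) = (\<Sum>c\<in>C. \<omega> (g c))" if "!!c. c : C ==> g c : Y.adeles" for g
  using wD(6)[of C g "%_. 1", OF that] by simp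
 \<comment> \<open>Pulling each factor \<open>c y\<close> through the inverse translate turns
   \<open>f \<omega>\<close> into a sum over the group, whose invariance is a mere
   reindexing.\<close>
 have alt: "\<omega>' \<beta> = (\<Sum>c\<in>C. \<omega> (%Q. y * act (J c) \<beta> Q))" if \<beta>: "\<beta> : Y.adeles" for \<beta>
 proof -
  have "\<omega>' \<beta> = \<omega> (%Q. \<Sum>c\<in>C. h c * (c y * \<beta> Q))" by (simp add: \<omega>'_def f_def sum_distrib_right mult.assoc)
  also have "\<dots> = (\<Sum>c\<in>C. \<omega> (%Q. h c * (c y * \<beta> Q)))" by (rule sum) (intro Y.adeles_mult \<beta>)
  also have "\<dots> = (\<Sum>c\<in>C. \<omega> (%Q. y * act (J c) \<beta> Q))"
  proof (rule sum.cong[OF refl])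
   fix c assume c: "c : C"
   have "\<omega> (%Q. h c * (c y * \<beta> Q)) = \<omega> (act (J c) (%Q. c y * \<beta> Q))" by (rule h[OF c Y.adeles_mult[OF \<beta>], symmetric])
   also have "act (J c) (%Q. c y * \<beta> Q) = (%Q. y * act (J c) \<beta> Q)" unfolding act_simps(2)[OF J(1)[OF c]] J(2)[OF c] ..
   finally show "\<omega> (%Q. h c * (c y * \<beta> Q)) = \<omega> (%Q. y * act (J c) \<beta> Q)" .
  qed
  finally show ?thesis .
 qed
 have invariant: "\<omega>' (act d \<beta>) = \<omega>' \<beta>" if d: "d : C" and \<beta>: "\<beta> : Y.adeles" for d \<beta>
 proof -
  have "\<omega>' (act d \<beta>) = (\<Sum>c\<in>C. \<omega> (%Q. y * act (J c \<circ> d) \<beta> Q))"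
   unfolding alt[OF act_adeles[OF d \<beta>]] act_comp ..
  also have "\<dots> = (\<Sum>c\<in>C. \<omega> (%Q. y * act (J (d \<circ> c) \<circ> d) \<beta> Q))"
   by (rule C_perm(2)[OF d, of "%c. \<omega> (%Q. y * act (J c \<circ> d) \<beta> Q)", symmetric])
  also have "\<dots> = (\<Sum>c\<in>C. \<omega> (%Q. y * act (J c) \<beta> Q))"
  proof (rule sum.cong[OF refl])
   fix c assume c: "c : C"
   have "J (d \<circ> c) \<circ> d = J c"
   proof
    fix x
    have "(d \<circ> c) (J c x) = d x" using J(3)[OF c] by simp
    then show "(J (d \<circ> c) \<circ> d) x = J c x" using J(2)[OF C_comp[OF d c], of "J c x"] by simp
   qed
   then show "\<omega> (%Q. y * act (J (d \<circ> c) \<circ> d) \<beta> Q) = \<omega> (%Q. y * act (J c) \<beta> Q)" by simp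
  qed
  also have "\<dots> = \<omega>' \<beta>" by (rule alt[OF \<beta>, symmetric])
  finally show ?thesis .
 qed
 define A where "A = pullback \<phi> PY D + Y.prin f"
 have A: "A : divisors PY" unfolding A_def by (intro divisors_add pullback_divisors Y.prin f0)
 have \<omega>'A: "\<omega>' \<beta> = 0" if "\<beta> : Y.reps A" for \<beta>
 proof -
  have fH: "f : H0 PY (- Y.prin f)" unfolding H0_def using f0 Y.prin(1)[OF f0] by simp
  have "(%Q. f * \<beta> Q) : Y.reps (- Y.prin f + A)" by (rule Y.reps_mult[OF fH that])
  then show ?thesis unfolding \<omega>'_def A_def by (intro wD(3)) simp
 qed
 have lin: "\<omega>' (%Q. \<beta> Q + \<gamma> Q) = \<omega>' \<beta> + \<omega>' \<gamma>" "\<omega>' (%Q. \<beta> Q - \<gamma> Q) = \<omega>' \<beta> - \<omega>' \<gamma>" "\<omega>' (%Q. \<iota>Y a * \<beta> Q) = a * \<omega>' \<beta>"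
  if "\<beta> : Y.adeles" "\<gamma> : Y.adeles" for \<beta> \<gamma> a
  using wD(1,5)[OF Y.adeles_mult[OF that(1)] Y.adeles_mult[OF that(2)], of f f] wD(2)[OF Y.adeles_mult[OF that(1)], of a f]
  by (simp_all add: \<omega>'_def algebra_simps)
 have sum': "\<omega>' (%Q. \<Sum>c\<in>C. g c Q) = (\<Sum>c\<in>C. \<omega>' (g c))" if "!!c. c : C ==> g c : Y.adeles" for g
  unfolding \<omega>'_def sum_distrib_left by (rule sum) (intro Y.adeles_mult that)
 obtain W where W: "W : divisors PX" "!!Q. Q : PPY ==> lookup A Q <= lookup W (\<phi> -` Q)"
  "!!Q. Q : PPY ==> \<exists>c\<in>C. lookup A (c -` Q) = lookup W (\<phi> -` Q)"
  by (rule max_pushforward[OF A]) blast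
 have "dle A (pullback \<phi> PY W)"
  by (rule Y.dleI[OF A pullback_divisors]) (simp add: lookup_pullback[OF W(1)] W(2))
 then have "Y.deg A <= int n * X.deg W" using div_degree_mono deg_pullback[OF W(1)] by metis
 moreover have "Y.deg A = int n * X.deg D" unfolding A_def div_degree_add deg_pullback[OF D] Y.deg_prin[OF f0] by simp
 ultimately have degW: "X.deg D <= X.deg W" using n_pos by simp
 have \<omega>'W: "\<omega>' \<beta> = 0" if \<beta>: "\<beta> : Y.reps (pullback \<phi> PY W)" for \<beta>
 proof -
  from W(3) obtain ch where ch: "!!Q. Q : PPY ==> ch Q : C"
   "!!Q. Q : PPY ==> lookup A (ch Q -` Q) = lookup W (\<phi> -` Q)" by metis
  \<comment> \<open>Splits \<beta> according to the translate at which the largest multiplicity in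
    the fibre is attained. Each piece is moved into \<open>Y.reps A\<close> by an element of C, so
    invariance gives it the value 0.\<close>
  define g where "g c Q = (if Q : PPY & ch Q = c then \<beta> Q else 0)" for c Q
  have \<beta>Q: "\<beta> Q : vset Q (- lookup W (\<phi> -` Q))" if "Q : PPY" for Q
   using \<beta> that lookup_pullback[OF W(1) that] unfolding Y.reps_def by auto
  have gr: "g c : Y.reps (translate c A)" if c: "c : C" for c
   unfolding Y.reps_def
  proof (rule CollectI, rule ballI)
   fix Q assume Q: "Q : PPY"
   show "g c Q : vset Q (- lookup (translate c A) Q)"
   proof (cases "ch Q = c")
    case True
    then show ?thesis using \<beta>Q[OF Q] ch(2)[OF Q] Q by (simp add: g_def lookup_translate[OF c])
   next
    case False
    then show ?thesis using dvr.zero_vset[OF Y.place_dvr[OF Q]] by (simp add: g_def)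
   qed
  qed
  have ga: "g c : Y.adeles" if c: "c : C" for c by (rule Y.adelesI[OF translate_divisors[OF c A] gr[OF c]])
  have g0: "\<omega>' (g c) = 0" if c: "c : C" for c
  proof -
   have "translate (J c) (translate c A) = A"
    by (rule poly_mapping_eqI) (simp only: lookup_translate[OF c] lookup_translate[OF J(1)[OF c]] vimage_inverse[of "J c" c, OF allI[OF J(2)[OF c]]])
   then have "act (J c) (g c) : Y.reps A" using act_reps[OF J(1)[OF c] gr[OF c]] by simp
   then have "\<omega>' (act (J c) (g c)) = 0" by (rule \<omega>'A)
   then show ?thesis using invariant[OF J(1)[OF c] ga[OF c]] by simp
  qed
  define \<gamma> where "\<gamma> = (%Q. \<Sum>c\<in>C. g c Q)"
  have \<gamma>a: "\<gamma> : Y.adeles" unfolding \<gamma>_def by (intro Y.adeles_sum ga)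
  have "\<omega>' \<gamma> = 0" unfolding \<gamma>_def using sum'[of g, OF ga] g0 by simp
  have \<gamma>Q: "\<gamma> Q = \<beta> Q" if "Q : PPY" for Q unfolding \<gamma>_def g_def using that ch(1)[OF that] finite_C by (simp add: sum.delta')
  have "(%Q. \<beta> Q - \<gamma> Q) : Y.reps A"
   unfolding Y.reps_def using \<gamma>Q dvr.zero_vset[OF Y.place_dvr] by simp
  then have "\<omega>' (%Q. \<beta> Q - \<gamma> Q) = 0" by (rule \<omega>'A)
  then show ?thesis using lin(2)[OF Y.adelesI[OF pullback_divisors \<beta>] \<gamma>a] \<open>\<omega>' \<gamma> = 0\<close> by simp
 qed
 define \<eta> where "\<eta> \<alpha> = \<omega>' (lift \<alpha>)" for \<alpha>
 have "X.weil W \<eta>" unfolding X.weil_def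
 proof (intro conjI ballI allI)
  fix \<alpha> \<beta> assume ab: "\<alpha> : X.adeles" "\<beta> : X.adeles"
  show "\<eta> (%P. \<alpha> P + \<beta> P) = \<eta> \<alpha> + \<eta> \<beta>"
   using lin(1)[OF lift_adeles[OF ab(1)] lift_adeles[OF ab(2)]] by (simp add: \<eta>_def lift_def)
 next
  fix a \<alpha> assume "\<alpha> : X.adeles"
  then show "\<eta> (%P. \<iota>X a * \<alpha> P) = a * \<eta> \<alpha>" using lin(3)[OF lift_adeles lift_adeles] by (simp add: \<eta>_def lift_def)
 next
  fix \<alpha> assume "\<alpha> : X.reps W"
  then show "\<eta> \<alpha> = 0" unfolding \<eta>_def by (intro \<omega>'W lift_reps W(1))
 next
  fix g show "\<eta> (%_. g) = 0" unfolding \<eta>_def \<omega>'_def lift_def by (rule wD(4))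
 qed
 \<comment> \<open>Dividing by \<open>f\<close> makes \<open>\<omega>' \<beta>0\<close> equal to
   \<open>\<omega> \<alpha>0\<close>, which is nonzero.\<close>
 define \<beta>0 where "\<beta>0 = (%Q. inverse f * \<alpha>0 Q)"
 have \<beta>0: "\<beta>0 : Y.adeles" unfolding \<beta>0_def by (rule Y.adeles_mult[OF \<alpha>0(1)])
 have \<omega>\<beta>0: "\<omega>' \<beta>0 ~= 0" using \<alpha>0(2) f0 by (simp add: \<omega>'_def \<beta>0_def mult.assoc[symmetric])
 obtain \<alpha> where \<alpha>: "\<alpha> : X.adeles" "(%Q. (\<Sum>c\<in>C. act c \<beta>0 Q) - lift \<alpha> Q) : Y.reps (pullback \<phi> PY W)"
  by (rule trace_adele[OF \<beta>0 W(1)])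
 have "\<omega>' (%Q. \<Sum>c\<in>C. act c \<beta>0 Q) - \<omega>' (lift \<alpha>) = 0"
  using \<omega>'W[OF \<alpha>(2)] lin(2)[OF Y.adeles_sum[of C "%c. act c \<beta>0"] lift_adeles[OF \<alpha>(1)]] act_adeles[OF _ \<beta>0] by simp
 \<comment> \<open>By invariance the trace multiplies the value by \<open>n\<close>, which is
   nonzero in K. Hence the form \<eta> on X does not vanish at \<alpha>.\<close>
 moreover have "\<omega>' (%Q. \<Sum>c\<in>C. act c \<beta>0 Q) = of_nat n * \<omega>' \<beta>0"
  using sum'[of "%c. act c \<beta>0"] act_adeles[OF _ \<beta>0] invariant[OF _ \<beta>0] card_C by simp
 ultimately have "\<eta> \<alpha> = of_nat n * \<omega>' \<beta>0" by (simp add: \<eta>_def)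
 then have "\<eta> \<alpha> ~= 0" using n \<omega>\<beta>0 by (simp only: mult_eq_0_iff not_False_eq_True simp_thms)
 from X.special_degree[OF W(1) \<open>X.weil W \<eta>\<close> \<alpha>(1) this] show False using deg degW by linarith
qed

end

text \<open>A linear relation stands for a map defined only on a subspace or only up to a choice. A
  basis of \<open>N\<close>, extended to one of the domain of \<open>R\<close>, allows a linear
  choice on the domain, extended to the whole space, that is 0 on \<open>N\<close>.\<close>

lemma linear_relation_section:
 fixes s1 :: "'k::Fields.field => 'v::ab_group_add => 'v" and s2 :: "'k => 'w::ab_group_add => 'w"
 assumes vs: "vector_space s1" "vector_space s2"
  and R: "(0, 0) : R" "!!x y x' y'. (x, y) : R ==> (x', y') : R ==> (x + x', y + y') : R"
   "!!a x y. (x, y) : R ==> (s1 a x, s2 a y) : R"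
  and N: "0 : N" "!!x y. x : N ==> y : N ==> x + y : N" "!!a x. x : N ==> s1 a x : N"
   "!!x. x : N ==> (x, 0) : R"
 obtains f where "!!x y. f (x + y) = f x + f y" "!!a x. f (s1 a x) = s2 a (f x)"
  "!!x y. (x, y) : R ==> (x, f x) : R" "!!x. x : N ==> f x = 0"
proof -
 interpret vs1: vector_space s1 by (rule vs(1))
 interpret vs2: vector_space s2 by (rule vs(2))
 interpret vp: vector_space_pair s1 s2 ..
 obtain B0 where B0: "B0 \<subseteq> N" "vs1.independent B0" "N \<subseteq> vs1.span B0"
  using vs1.maximal_independent_subset[of N] by metis
 have "B0 \<subseteq> Domain R" using B0(1) N(4) by blast
 from vs1.maximal_independent_subset_extend[OF this B0(2)]
 obtain B where B: "B0 \<subseteq> B" "B \<subseteq> Domain R" "vs1.independent B" "Domain R \<subseteq> vs1.span B" by metis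
 have "\<exists>y. (b, y) : R & (b : B0 --> y = 0)" if "b : B" for b
  using that B(2) B0(1) N(4) by (cases "b : B0") blast+
 then obtain y where y: "!!b. b : B ==> (b, y b) : R" "!!b. b : B ==> b : B0 ==> y b = 0" by metis
 obtain f where f: "Vector_Spaces.linear s1 s2 f" "\<forall>b\<in>B. f b = y b"
  using vp.linear_independent_extend[OF B(3), of y] by blast
 interpret f: Vector_Spaces.linear s1 s2 f by (rule f(1))
 have "vs1.subspace {x. (x, f x) : R}" unfolding vs1.subspace_def using R by (simp add: f.add f.scale f.zero)
 then have 1: "vs1.span B \<subseteq> {x. (x, f x) : R}" using f(2) y(1) by (intro vs1.span_minimal) auto
 have "vs1.subspace {x. f x = 0}" unfolding vs1.subspace_def by (simp add: f.add f.scale f.zero)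
 then have 2: "vs1.span B0 \<subseteq> {x. f x = 0}" using f(2) y(2) B(1) by (intro vs1.span_minimal) auto
 show ?thesis
 proof (rule that[of f])
  show "(x, f x) : R" if "(x, y) : R" for x y using that B(4) 1 by blast
  show "f x = 0" if "x : N" for x using that B0(3) 2 by blast
 qed (simp_all add: f.add f.scale)
qed

text \<open>Maschke's argument. The actions need not be unital, which permits actions that involve a
  projection.\<close>

lemma equivariant_section:
 fixes s1 :: "'k::Fields.field => 'v::ab_group_add => 'v" and s2 :: "'k => 'w::ab_group_add => 'w"
 assumes vs: "vector_space s1" "vector_space s2" and G: "group G" "finite (carrier G)"
  and card: "of_nat (card (carrier G)) ~= (0::'k)"
  and R: "(0, 0) : R" "!!x y x' y'. (x, y) : R ==> (x', y') : R ==> (x + x', y + y') : R"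
   "!!a x y. (x, y) : R ==> (s1 a x, s2 a y) : R"
   "!!c x y. c : carrier G ==> (x, y) : R ==> (A1 c x, A2 c y) : R"
   "!!x y. (x, y) : R ==> A1 \<one>\<^bsub>G\<^esub> x = x"
  and A1: "!!c x y. c : carrier G ==> A1 c (x + y) = A1 c x + A1 c y" "!!c a x. c : carrier G ==> A1 c (s1 a x) = s1 a (A1 c x)"
   "!!c d x. c : carrier G ==> d : carrier G ==> A1 (c \<otimes>\<^bsub>G\<^esub> d) x = A1 c (A1 d x)"
  and A2: "!!c x y. c : carrier G ==> A2 c (x + y) = A2 c x + A2 c y" "!!c a x. c : carrier G ==> A2 c (s2 a x) = s2 a (A2 c x)"
   "!!c d x. c : carrier G ==> d : carrier G ==> A2 (c \<otimes>\<^bsub>G\<^esub> d) x = A2 c (A2 d x)"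
 obtains f where "!!x y. f (x + y) = f x + f y" "!!a x. f (s1 a x) = s2 a (f x)"
  "!!c x. c : carrier G ==> f (A1 c x) = A2 c (f x)"
  "!!x y. (x, y) : R ==> (x, f x) : R" "!!x. A2 \<one>\<^bsub>G\<^esub> (f x) = f x"
proof -
 interpret vs1: vector_space s1 by (rule vs(1))
 interpret vs2: vector_space s2 by (rule vs(2))
 interpret G: group G by (rule G(1))
 obtain f0 where f0: "!!x y. f0 (x + y) = f0 x + f0 y" "!!a x. f0 (s1 a x) = s2 a (f0 x)"
  "!!x y. (x, y) : R ==> (x, f0 x) : R"
  by (rule linear_relation_section[OF vs R(1,2,3), of "{0}"]) (auto simp: R(1))
 define N where "N = (of_nat (card (carrier G)) :: 'k)"
 define H where "H x c = A2 (inv\<^bsub>G\<^esub> c) (f0 (A1 c x))" for x c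
 define f where "f x = s2 (1 / N) (\<Sum>c\<in>carrier G. H x c)" for x
 have A2_sum: "A2 c (\<Sum>i\<in>I. h i) = (\<Sum>i\<in>I. A2 c (h i))" if "c : carrier G" for c I and h :: "'c => 'w"
 proof -
  have "A2 c 0 = 0" using A2(1)[OF that, of 0 0] by simp
  then show ?thesis by (induction I rule: infinite_finite_induct) (simp_all add: A2(1)[OF that])
 qed
 show ?thesis
 proof (rule that[of f])
  fix x y
  have "H (x + y) c = H x c + H y c" if "c : carrier G" for c using that by (simp add: H_def A1 A2 f0)
  then show "f (x + y) = f x + f y" by (simp add: f_def sum.distrib vs2.scale_right_distrib)
 next
  fix a x
  have "H (s1 a x) c = s2 a (H x c)" if "c : carrier G" for c using that by (simp add: H_def A1 A2 f0)
  then show "f (s1 a x) = s2 a (f x)" by (simp add: f_def vs2.scale_sum_right mult.commute)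
 next
  fix d x assume d: "d : carrier G"
  have "H (A1 d x) c = A2 d (H x (c \<otimes>\<^bsub>G\<^esub> d))" if c: "c : carrier G" for c
  proof -
   have "A2 d (H x (c \<otimes>\<^bsub>G\<^esub> d)) = A2 (d \<otimes>\<^bsub>G\<^esub> inv\<^bsub>G\<^esub> (c \<otimes>\<^bsub>G\<^esub> d)) (f0 (A1 (c \<otimes>\<^bsub>G\<^esub> d) x))"
    using c d by (simp add: H_def A2(3))
   also have "d \<otimes>\<^bsub>G\<^esub> inv\<^bsub>G\<^esub> (c \<otimes>\<^bsub>G\<^esub> d) = inv\<^bsub>G\<^esub> c" using c d by (simp add: G.inv_mult_group flip: G.m_assoc)
   finally show ?thesis using c d by (simp add: H_def A1(3))
  qed
  then have "(\<Sum>c\<in>carrier G. H (A1 d x) c) = (\<Sum>c\<in>carrier G. A2 d (H x (c \<otimes>\<^bsub>G\<^esub> d)))" by (intro sum.cong refl)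
  also have "\<dots> = (\<Sum>c\<in>carrier G. A2 d (H x c))"
   by (rule sum.reindex_bij_witness[of _ "%c. c \<otimes>\<^bsub>G\<^esub> inv\<^bsub>G\<^esub> d" "%c. c \<otimes>\<^bsub>G\<^esub> d"]) (use d in \<open>simp_all add: G.m_assoc\<close>)
  finally show "f (A1 d x) = A2 d (f x)" by (simp add: f_def A2(2)[OF d] A2_sum[OF d])
 next
  fix x y assume xy: "(x, y) : R"
  have xH: "(x, H x c) : R" if c: "c : carrier G" for c
  proof -
   have "(A1 c x, f0 (A1 c x)) : R" by (rule f0(3)[OF R(4)[OF c xy]])
   from R(4)[OF G.inv_closed[OF c] this] have "(A1 (inv\<^bsub>G\<^esub> c) (A1 c x), H x c) : R" unfolding H_def .
   moreover have "A1 (inv\<^bsub>G\<^esub> c) (A1 c x) = x"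
    using A1(3)[OF G.inv_closed[OF c] c, of x] R(5)[OF xy] by (simp add: G.l_inv[OF c])
   ultimately show ?thesis by simp
  qed
  have S: "(\<Sum>c\<in>S. x, \<Sum>c\<in>S. H x c) : R" if "S \<subseteq> carrier G" for S
   using finite_subset[OF that G(2)] that
  proof (induction S rule: finite_induct)
   case (insert c S)
   then have "(x + (\<Sum>c\<in>S. x), H x c + (\<Sum>c\<in>S. H x c)) : R" by (intro R(2) xH) auto
   then show ?case using insert.hyps by (simp only: sum.insert not_False_eq_True)
  qed (simp add: R(1))
  from R(3)[OF S[OF subset_refl], of "1 / N"]
  have "(s1 (1 / N) (\<Sum>c\<in>carrier G. x), f x) : R" unfolding f_def .
  moreover have "(\<Sum>c\<in>carrier G. x) = s1 N x"
  proof -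
   have "(\<Sum>c\<in>S. x) = s1 (of_nat (card S)) x" if "finite S" for S :: "'c set"
    using that by (induction S rule: finite_induct) (simp_all add: vs1.scale_left_distrib)
   then show ?thesis using G(2) by (simp add: N_def)
  qed
  ultimately show "(x, f x) : R" using card by (simp add: N_def)
 next
  fix x
  have "A2 \<one>\<^bsub>G\<^esub> (H x c) = H x c" if c: "c : carrier G" for c
   using A2(3)[OF G.one_closed G.inv_closed[OF c], of "f0 (A1 c x)"] c by (simp add: H_def)
  then show "A2 \<one>\<^bsub>G\<^esub> (f x) = f x" unfolding f_def A2(2)[OF G.one_closed] A2_sum[OF G.one_closed] by simp
 qed
qed

subsection \<open>The twisted shift group\<close>

text \<open>A vector \<open>x\<close> in \<open>L\<^sup>m\<close> extends to a sequence with \<open>x (k + m) = x k ^ q\<close>, on which the twisted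
  shift is the ordinary shift.\<close>

definition ext :: "nat => nat => (nat => 'l::Fields.field) => nat => 'l" where
 "ext q m x k = x (k mod m) ^ (q ^ (k div m))"

definition shift_pow :: "nat => nat => nat => (nat => 'l::Fields.field) => nat => 'l" where
 "shift_pow q m i = restrict (%x k. if k < m then ext q m x (k + i) else 0) (ext_power_carrier m)"

lemma ext_less: "k < m ==> ext q m x k = x k"
 by (simp add: ext_def)

lemma ext_add: "m > 0 ==> ext q m x (k + m * d) = ext q m x k ^ (q ^ d)"
 by (simp add: ext_def power_add mult.commute flip: power_mult)

lemma shift_pow_closed: "x : ext_power_carrier m ==> shift_pow q m i x : ext_power_carrier m"
 by (simp add: shift_pow_def ext_power_carrier_def)

lemma shift_pow_apply: "x : ext_power_carrier m ==> shift_pow q m i x k = (if k < m then ext q m x (k + i) else 0)"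
 by (simp add: shift_pow_def)

lemma ext_shift_pow:
 assumes "m > 0" "x : ext_power_carrier m"
 shows "ext q m (shift_pow q m i x) k = ext q m x (k + i)"
proof -
 have "ext q m (shift_pow q m i x) k = ext q m x (k mod m + i) ^ (q ^ (k div m))"
  unfolding ext_def[of q m "shift_pow q m i x"] using assms by (simp add: shift_pow_apply)
 also have "\<dots> = ext q m x (k mod m + i + m * (k div m))" by (rule ext_add[OF assms(1), symmetric])
 also have "k mod m + i + m * (k div m) = k + i" by simp
 finally show ?thesis .
qed

lemma shift_pow_add:
 assumes "m > 0" "x : ext_power_carrier m"
 shows "shift_pow q m i (shift_pow q m j x) = shift_pow q m (i + j) x"
 by (rule ext) (simp add: shift_pow_apply[OF shift_pow_closed] shift_pow_apply assms ext_shift_pow add.assoc)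

lemma shift_pow_1: "m > 0 ==> shift_pow q m 1 = (twisted_shift q m :: (nat => 'l::Fields.field) => _)"
proof -
 assume m: "m > 0"
 have "ext q m x (Suc k) = (if Suc k < m then x (Suc k) else x 0 ^ q)" if "k < m" for x :: "nat => 'l" and k
 proof (cases "Suc k < m")
  case False
  then have "Suc k = m" using that by simp
  then show ?thesis using m by (simp add: ext_def)
 qed (simp add: ext_less)
 then show ?thesis unfolding shift_pow_def twisted_shift_def by (intro ext restrict_ext) auto
qed

lemma shift_pow_0: "x : ext_power_carrier m ==> shift_pow q m 0 x = x"
 by (rule ext) (auto simp: shift_pow_apply ext_less ext_power_carrier_def)

text \<open>\<open>T ^ (q ^ d) - T\<close> has at most \<open>q ^ d\<close> roots when
  \<open>d\<close> is positive.\<close>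

lemma frobenius_order:
 fixes q d e :: nat
 assumes L: "finite (UNIV :: 'l::Fields.field set)" "CARD('l) = q ^ e" and q: "q > 1" and d: "d < e"
  and eq: "!!z :: 'l. z ^ (q ^ d) = z"
 shows "d = 0"
proof (rule ccontr)
 assume "d ~= 0"
 then have qd: "q ^ d > 1" using q one_less_power by blast
 define h where "h = Polynomial.monom 1 (q ^ d) - [:0, 1 :: 'l:]"
 obtain j where "q ^ d = Suc (Suc j)" using qd by (metis One_nat_def less_imp_Suc_add add_Suc)
 then have co: "coeff h (q ^ d) = 1" unfolding h_def by (simp only: coeff_diff coeff_monom) simp
 then have "h ~= 0" by auto
 have "degree h <= q ^ d"
 proof (rule degree_le)
  show "\<forall>j>q ^ d. coeff h j = 0" using qd q by (auto simp: h_def coeff_pCons split: nat.split)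
 qed
 moreover have "card {z. poly h z = 0} <= degree h" by (rule card_poly_roots_bound[OF \<open>h ~= 0\<close>])
 moreover have "{z. poly h z = 0} = UNIV" by (auto simp: h_def poly_monom eq)
 ultimately have "q ^ e <= q ^ d" using L(2) by simp
 then show False using q d by (simp add: power_increasing_iff)
qed

text \<open>Makes the generated permutation group explicit as a cyclic group of order
  \<open>e * m\<close>: shifting by \<open>e * m\<close> raises all entries to the power
  \<open>q ^ e\<close>, which is the identity on \<open>L\<close>.\<close>

lemma twisted_shift_group:
 fixes q m e :: nat
 assumes m: "m > 0" and L: "finite (UNIV :: 'l::Fields.field set)" "CARD('l) = q ^ e" and q: "q > 1" and e: "e > 0"
 defines "G \<equiv> twisted_shift_group q m :: ((nat => 'l) => (nat => 'l)) monoid"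
 shows "group G" "carrier G = shift_pow q m ` {..<e * m}" "inj_on (shift_pow q m :: nat => (nat => 'l) => (nat => 'l)) {..<e * m}"
  "shift_pow q m (i mod (e * m)) = (shift_pow q m i :: (nat => 'l) => (nat => 'l))"
  "shift_pow q m i : carrier G" "shift_pow q m i \<otimes>\<^bsub>G\<^esub> shift_pow q m j = shift_pow q m (i + j)"
  "\<one>\<^bsub>G\<^esub> = shift_pow q m 0"
proof -
 let ?M = "ext_power_carrier m :: (nat => 'l) set"
 let ?p = "shift_pow q m :: nat => (nat => 'l) => (nat => 'l)"
 let ?B = "BijGroup ?M"
 interpret B: group ?B by (rule group_BijGroup)
 have pe: "?p i = ?p j" if "!!x. x : ?M ==> ?p i x = ?p j x" for i j
 proof
  fix x show "?p i x = ?p j x" by (cases "x : ?M") (simp_all add: that, simp add: shift_pow_def)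
 qed
 have period: "?p (i + e * m) = ?p i" for i
 proof (rule pe)
  fix x assume x: "x : ?M"
  have "ext q m x (k + (i + e * m)) = ext q m x (k + i)" for k
   using ext_add[OF m, of q x "k + i" e] finite_field_power_card[OF L(1), of "ext q m x (k + i)"]
   by (simp add: L(2) ac_simps)
  then show "?p (i + e * m) x = ?p i x" using x by (simp add: shift_pow_apply fun_eq_iff)
 qed
 have periods: "?p (i + e * m * k) = ?p i" for i k
 proof (induction k)
  case (Suc k)
  have "?p (i + e * m * Suc k) = ?p (i + e * m * k + e * m)" by (simp add: algebra_simps)
  then show ?case using period[of "i + e * m * k"] Suc by simp
 qed simp
 show pmod: "?p (i mod (e * m)) = ?p i" for i
 proof -
  have "?p i = ?p (i mod (e * m) + e * m * (i div (e * m)))" by simp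
  then show ?thesis unfolding periods by simp
 qed
 have em: "e * m > 0" using e m by simp
 have inverse: "?p i (?p (e * m * i - i) x) = x" "?p (e * m * i - i) (?p i x) = x" if x: "x : ?M" for i x
 proof -
  have 1: "i + (e * m * i - i) = 0 + e * m * i" "e * m * i - i + i = 0 + e * m * i" using em by auto
  show "?p i (?p (e * m * i - i) x) = x" "?p (e * m * i - i) (?p i x) = x"
   by (simp_all only: shift_pow_add[OF m x] 1 periods shift_pow_0[OF x])
 qed
 have pB: "?p i : carrier ?B" for i
 proof -
  have "bij_betw (?p i) ?M ?M"
   by (rule bij_betwI[where g = "?p (e * m * i - i)"]) (auto simp: inverse shift_pow_closed)
  moreover have "?p i : extensional ?M" unfolding shift_pow_def by simp
  ultimately show ?thesis by (simp add: BijGroup_def Bij_def)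
 qed
 have mult: "?p i \<otimes>\<^bsub>?B\<^esub> ?p j = ?p (i + j)" for i j
 proof -
  have "?p i \<otimes>\<^bsub>?B\<^esub> ?p j = compose ?M (?p i) (?p j)" using pB by (simp add: BijGroup_def)
  also have "\<dots> = ?p (i + j)"
  proof
   fix x show "compose ?M (?p i) (?p j) x = ?p (i + j) x"
    by (cases "x : ?M") (simp_all add: compose_def shift_pow_add[OF m], simp add: shift_pow_def)
  qed
  finally show ?thesis .
 qed
 have one_B: "\<one>\<^bsub>?B\<^esub> = ?p 0"
 proof
  fix x show "\<one>\<^bsub>?B\<^esub> x = ?p 0 x"
   by (cases "x : ?M") (simp_all add: BijGroup_def shift_pow_0, simp add: shift_pow_def)
 qed
 have inverse_B: "inv\<^bsub>?B\<^esub> (?p 1) = ?p (e * m - 1)"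
 proof (rule B.inv_equality)
  have "e * m - 1 + 1 = 0 + e * m * 1" using em by simp
  then show "?p (e * m - 1) \<otimes>\<^bsub>?B\<^esub> ?p 1 = \<one>\<^bsub>?B\<^esub>" unfolding mult one_B using periods[of 0 1] by simp
 qed (rule pB)+
 have Gdef: "G = ?B\<lparr>carrier := generate ?B {?p 1}\<rparr>"
  unfolding G_def twisted_shift_group_def subgroup_generated_def shift_pow_1[OF m, symmetric] using pB[of 1] by simp
 have gen: "generate ?B {?p 1} = range ?p"
 proof
  show "generate ?B {?p 1} \<subseteq> range ?p"
  proof
   fix c assume "c : generate ?B {?p 1}"
   then show "c : range ?p"
   proof (induction rule: generate.induct)
    case one then show ?case unfolding one_B by simp
   next
    case (incl h) then show ?case by simp
   next
    case (inv h) then show ?case using inverse_B by simp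
   next
    case (eng h1 h2)
    then obtain i j where "h1 = ?p i" "h2 = ?p j" by blast
    then show ?case using mult by simp
   qed
  qed
  have "?p i : generate ?B {?p 1}" for i
  proof (induction i)
   case 0 show ?case unfolding one_B[symmetric] by (rule generate.one)
  next
   case (Suc i)
   have "?p i \<otimes>\<^bsub>?B\<^esub> ?p 1 : generate ?B {?p 1}" by (rule generate.eng[OF Suc]) (rule generate.incl, simp)
   then show ?case unfolding mult by simp
  qed
  then show "range ?p \<subseteq> generate ?B {?p 1}" by blast
 qed
 show "carrier G = ?p ` {..<e * m}"
 proof -
  have "carrier G = range ?p" unfolding Gdef using gen by simp
  also have "\<dots> = ?p ` {..<e * m}"
  proof
   show "range ?p \<subseteq> ?p ` {..<e * m}"
   proof (rule image_subsetI)
    fix i show "?p i : ?p ` {..<e * m}" unfolding pmod[of i, symmetric] using em by simp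
   qed
  qed blast
  finally show ?thesis .
 qed
 have "{?p 1} \<subseteq> carrier ?B" using pB by blast
 from B.generate_is_subgroup[OF this]
 show "group G" unfolding Gdef by (rule subgroup.subgroup_is_group) (rule group_BijGroup)
 show "?p i : carrier G" unfolding Gdef using gen by simp
 show "?p i \<otimes>\<^bsub>G\<^esub> ?p j = ?p (i + j)" unfolding Gdef using mult by simp
 show "\<one>\<^bsub>G\<^esub> = ?p 0" unfolding Gdef using one_B by simp
 \<comment> \<open>Test vectors with a single entry at index 0: the entry 1 shows that
   \<open>m\<close> divides \<open>i\<close>, arbitrary entries that the remaining Frobenius power
   is trivial.\<close>
 have faithful: "i = 0" if i: "i < e * m" "?p i = ?p 0" for i
 proof -
  define x where "x z k = (if k = 0 then z else 0 :: 'l)" for z and k :: nat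
  have xM: "x z : ?M" for z using m by (simp add: x_def ext_power_carrier_def)
  have eq: "ext q m (x z) i = z" for z
  proof -
   have "?p i (x z) 0 = x z 0" unfolding i(2) shift_pow_0[OF xM] ..
   then show ?thesis using m xM by (simp add: shift_pow_apply x_def)
  qed
  have im: "i mod m = 0"
  proof (rule ccontr)
   assume "i mod m ~= 0"
   then have "ext q m (x 1) i = 0" using q by (simp add: ext_def x_def)
   then show False using eq[of 1] by simp
  qed
  have "z ^ (q ^ (i div m)) = z" for z :: 'l using eq[of z] im by (simp add: ext_def x_def)
  moreover have "i div m < e" using i(1) m by (simp add: less_mult_imp_div_less)
  ultimately have "i div m = 0" using frobenius_order[OF L q] by blast
  then show ?thesis using im m by (metis div_mult_mod_eq add_0 mult_0)
 qed
 show "inj_on ?p {..<e * m}"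
 proof -
  have "i = j" if ij: "?p i = ?p j" "i <= j" "j < e * m" for i j
  proof -
   have "?p (i + (e * m - j)) = ?p (j + (e * m - j))" unfolding mult[symmetric] ij(1) ..
   also have "j + (e * m - j) = 0 + e * m * 1" using ij by simp
   finally have "?p (i + (e * m - j)) = ?p 0" unfolding periods .
   then have f: "i + (e * m - j) < e * m ==> i + (e * m - j) = 0" by (rule faithful[rotated])
   show ?thesis
   proof (rule ccontr)
    assume "i ~= j"
    then have l: "i + (e * m - j) < e * m" "i + (e * m - j) ~= 0" using ij(2,3) by linarith+
    show False using l(2) f[OF l(1)] by contradiction
   qed
  qed
  then show ?thesis by (metis (no_types, lifting) inj_onI lessThan_iff nat_le_linear)
 qed
qed

subsection \<open>Embedding a residue field\<close>

lemma (in constants) ev_monom [simp]: "ev x (Polynomial.monom 1 j) = x ^ j"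
 by (induction j) (simp_all add: monom_Suc monom_0)

context curve
begin

text \<open>The residue field is \<open>K[T] / (h)\<close> for the minimal polynomial
  \<open>h\<close> of a primitive residue \<open>y\<close>. As \<open>h\<close> divides
  \<open>T ^ N - T\<close>, it has a root \<open>z\<close> in \<open>L\<close>, and
  \<open>y -> z\<close> gives the map; it is surjective by counting.\<close>

lemma residue_embedding:
 fixes \<iota>L :: "'k => 'l::Fields.field"
 assumes P: "P : closed_points PX" and L: "constants \<iota>L" "finite (UNIV :: 'l set)" "CARD('l) = CARD('k) ^ point_degree \<iota> P"
 obtains lm where "!!x y. x : P ==> y : P ==> lm (x + y) = lm x + lm y" "!!x y. x : P ==> y : P ==> lm (x * y) = lm x * lm y"
  "!!a. lm (\<iota> a) = \<iota>L a" "!!x y. x : P ==> y : P ==> lm x = lm y \<longleftrightarrow> x - y : max_ideal P" "!!z. \<exists>x\<in>P. lm x = (z :: 'l)"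
proof -
 interpret P: dvr P by (rule place_dvr[OF P])
 interpret L: constants \<iota>L by (rule L(1))
 define N where "N = CARD('k) ^ point_degree \<iota> P"
 obtain y where y: "y : P" "!!z. z : P ==> z : max_ideal P \<or> (\<exists>j. z - y ^ j : max_ideal P)"
  by (rule residue_primitive[OF P]) blast
 have evP: "ev y p : P" for p
  by (rule ev_mem_subring[OF P.subring _ y(1)]) (use place_constants[OF P] in blast)
 have span: "\<exists>p. z - ev y p : max_ideal P" if zP: "z : P" for z
 proof (cases "z : max_ideal P")
  case True
  then have "z - ev y 0 : max_ideal P" by simp
  then show ?thesis by blast
 next
  case False
  then obtain j where "z - ev y (Polynomial.monom 1 j) : max_ideal P" using y(2)[OF zP] by auto
  then show ?thesis by blast
 qed
 have N: "N > 1" unfolding N_def by (rule one_less_power[OF card_K_gt_1 point_degree_pos[OF P]])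
 define g :: "'k poly" where "g = Polynomial.monom 1 N - [:0, 1:]"
 obtain j where "N = Suc (Suc j)" using N by (metis One_nat_def less_imp_Suc_add add_Suc)
 then have "coeff g N = 1" unfolding g_def by (simp only: coeff_diff coeff_monom) simp
 then have g0: "g ~= 0" by auto
 have dg: "degree g <= N"
 proof (rule degree_le)
  show "\<forall>j>N. coeff g j = 0" using N by (auto simp: g_def coeff_pCons split: nat.split)
 qed
 have evg: "ev y g : max_ideal P"
  using residue_power_card[OF P y(1)] by (simp add: g_def N_def)
 have evLg: "L.ev z g = 0" for z using finite_field_power_card[OF L(2), of z] by (simp add: g_def N_def L(3))
 define h where "h = (ARG_MIN degree p. p ~= 0 & ev y p : max_ideal P)"
 have h: "h ~= 0" "ev y h : max_ideal P"
  using arg_min_natI[of "%p. p ~= 0 & ev y p : max_ideal P" g degree] g0 evg unfolding h_def by auto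
 have hmin: "degree h <= degree p" if "p ~= 0" "ev y p : max_ideal P" for p
  using arg_min_nat_le[of "%p. p ~= 0 & ev y p : max_ideal P" p degree] that unfolding h_def by auto
 have hdvd: "h dvd p" if p: "ev y p : max_ideal P" for p
 proof -
  have "ev y (p mod h) = ev y p - ev y (p div h) * ev y h"
  proof -
   have "ev y p = ev y (p div h * h + p mod h)" by simp
   then show ?thesis unfolding ev_add ev_mult by simp
  qed
  then have "ev y (p mod h) : max_ideal P" using P.max_ideal_closed(2)[OF p P.max_ideal_closed(3)[OF evP h(2)]] by simp
  then have "p mod h = 0" using hmin[of "p mod h"] degree_mod_less'[OF h(1), of p] by fastforce
  then show ?thesis by (rule mod_0_imp_dvd)
 qed
 \<comment> \<open>Otherwise the cofactor of \<open>h\<close> in \<open>T ^ N - T\<close> has all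
   \<open>N\<close> elements of \<open>L\<close> as roots, so \<open>h\<close> is constant.\<close>
 obtain z where z: "L.ev z h = 0"
 proof (rule ccontr)
  assume "\<not> thesis"
  then have nz: "L.ev z h ~= 0" for z using that by blast
  obtain k where k: "g = h * k" using hdvd[OF evg] by blast
  have "L.ev z k = 0" for z using evLg[of z] nz[of z] unfolding k by simp
  then have "{z. poly (map_poly \<iota>L k) z = 0} = UNIV" by (simp add: L.ev_def)
  moreover have mk: "map_poly \<iota>L k ~= 0" using g0 k by (simp add: map_poly_eq_0_iff)
  ultimately have "CARD('l) <= degree (map_poly \<iota>L k)" using card_poly_roots_bound[OF mk] by simp
  moreover have "degree (map_poly \<iota>L k) <= degree k" by (rule degree_le) (simp add: coeff_map_poly coeff_eq_0)
  moreover have "degree g = degree h + degree k" using g0 unfolding k by (simp add: degree_mult_eq)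
  ultimately have "degree h = 0" using dg L(3) N_def by linarith
  then obtain c where "h = [:c:]" by (rule degree_eq_zeroE)
  then have "c ~= 0" "\<iota> c : max_ideal P" using h by auto
  then show False using val_constant[OF P, of c] P.max_ideal_iff[of "\<iota> c"] by simp
 qed
 \<comment> \<open>Any polynomial representing the residue may be chosen: two choices differ by a
   multiple of \<open>h\<close>, which vanishes at \<open>z\<close>.\<close>
 define lm where "lm x = L.ev z (SOME p. x - ev y p : max_ideal P)" for x
 have lm: "lm x = L.ev z p" if "x - ev y p : max_ideal P" for x p
 proof -
  define p' where "p' = (SOME p. x - ev y p : max_ideal P)"
  have p': "x - ev y p' : max_ideal P" unfolding p'_def using that by (rule someI)
  have "(x - ev y p) - (x - ev y p') : max_ideal P" by (rule P.max_ideal_closed(2)[OF that p'])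
  then have "ev y (p' - p) : max_ideal P" by simp
  then obtain k where "p' - p = h * k" using hdvd by blast
  then have "L.ev z (p' - p) = 0" using z by simp
  then show ?thesis by (simp add: lm_def p'_def)
 qed
 have eq: "lm x = lm x' \<longleftrightarrow> x - x' : max_ideal P" if x: "x : P" "x' : P" for x x'
 proof -
  obtain p p' where p: "x - ev y p : max_ideal P" "x' - ev y p' : max_ideal P" using span x by metis
  have e: "lm x = lm x' \<longleftrightarrow> L.ev z (p - p') = 0" using lm[OF p(1)] lm[OF p(2)] by simp
  have "(x - ev y p) - (x' - ev y p') : max_ideal P" by (rule P.max_ideal_closed(2)[OF p])
  then have d: "(x - x') - ev y (p - p') : max_ideal P" by (simp add: algebra_simps)
  have m: "x - x' : max_ideal P \<longleftrightarrow> ev y (p - p') : max_ideal P"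
   using P.max_ideal_closed(1)[OF d, of "ev y (p - p')"] P.max_ideal_closed(2)[OF _ d, of "x - x'"] by auto
  have "L.ev z (p - p') = 0 \<longleftrightarrow> ev y (p - p') : max_ideal P"
  proof
   assume "ev y (p - p') : max_ideal P"
   then obtain k where "p - p' = h * k" using hdvd by blast
   then show "L.ev z (p - p') = 0" using z by simp
  next
   assume 0: "L.ev z (p - p') = 0"
   show "ev y (p - p') : max_ideal P"
   proof (rule ccontr)
    assume n: "ev y (p - p') ~: max_ideal P"
    then have u: "ev y (p - p') ~= 0" "inverse (ev y (p - p')) : P" using evP[of "p - p'"] by (auto simp: max_ideal_def)
    obtain k where "inverse (ev y (p - p')) - ev y k : max_ideal P" using span[OF u(2)] by blast
    from P.max_ideal_closed(3)[OF evP[of "p - p'"] this]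
    have "ev y (p - p') * (inverse (ev y (p - p')) - ev y k) : max_ideal P" .
    moreover have "ev y (p - p') * (inverse (ev y (p - p')) - ev y k) = ev y (1 - (p - p') * k)"
     unfolding ev_diff[of y 1] ev_mult ev_1 right_diff_distrib using u(1) by (simp del: ev_diff)
    ultimately have "h dvd 1 - (p - p') * k" using hdvd by simp
    then obtain k' where "1 - (p - p') * k = h * k'" by blast
    then have "L.ev z (1 - (p - p') * k) = 0" using z by simp
    moreover have "L.ev z (1 - (p - p') * k) = 1" unfolding L.ev_diff[of z 1] L.ev_mult 0 by simp
    ultimately show False by simp
   qed
  qed
  then show ?thesis using e m by simp
 qed
 show ?thesis
 proof (rule that[of lm, OF _ _ _ eq])
  fix x x' assume x: "x : P" "x' : P"
  obtain p p' where p: "x - ev y p : max_ideal P" "x' - ev y p' : max_ideal P" using span x by metis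
  have "(x + x') - ev y (p + p') : max_ideal P" using P.max_ideal_closed(1)[OF p] by (simp add: algebra_simps)
  from lm[OF this] show "lm (x + x') = lm x + lm x'" unfolding lm[OF p(1)] lm[OF p(2)] by simp
  have "x * (x' - ev y p') + (x - ev y p) * ev y p' : max_ideal P"
   by (rule P.max_ideal_closed(1)[OF P.max_ideal_closed(3)[OF x(1) p(2)] P.max_ideal_closed(4)[OF p(1) evP]])
  then have "x * x' - ev y (p * p') : max_ideal P" by (simp add: algebra_simps)
  from lm[OF this] show "lm (x * x') = lm x * lm x'" unfolding lm[OF p(1)] lm[OF p(2)] by simp
 next
  fix a show "lm (\<iota> a) = \<iota>L a" using lm[of "\<iota> a" "[:a:]"] P.max_ideal_closed(6) by simp
 next
  fix w :: 'l
  obtain S where S: "S \<subseteq> P" "finite S" "card S = N" "!!s t. s : S ==> t : S ==> s - t : max_ideal P ==> s = t"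
   unfolding N_def by (rule incongruent_set[OF P]) blast
  have "inj_on lm S"
  proof (rule inj_onI)
   fix s t assume "s : S" "t : S" "lm s = lm t"
   then show "s = t" using S(1,4) eq by blast
  qed
  then have "card (lm ` S) = CARD('l)" by (simp add: card_image S(3) L(3) N_def)
  then have "lm ` S = UNIV" by (intro card_subset_eq[OF L(2)]) auto
  then show "\<exists>x\<in>P. lm x = w" using S(1) by (metis UNIV_I imageE subsetD)
 qed
qed

end

text \<open>This replaces the products \<open>a i * b j + a j * b i\<close> by \<open>(a i + a j) * (b i + b j)\<close> and squares, so
  it needs no division by 2.\<close>

lemma symmetric_sum:
 fixes a b :: "nat => 'a::comm_ring" and Y :: "nat => nat => 'a"
 assumes sym: "!!i j. Y i j = Y j i"
 shows "(\<Sum>i<d. \<Sum>j<d. a i * b j * Y i j) = (\<Sum>i<d. \<Sum>j<d. (if i = j then a i else a i + a j) * (if i = j then b i else b i + b j) *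
  (if i = j then Y i i - (\<Sum>k<d. if i = k then 0 else Y i k) else if i < j then Y i j else 0))"
  (is "_ = (\<Sum>i<d. \<Sum>j<d. ?F i j)")
proof -
 define P where "P i j = (a i * b i + a i * b j) * Y i j" for i j
 define A where "A i j = (if i = j then a i * b i * (Y i i - (\<Sum>k<d. if i = k then 0 else Y i k)) else 0)" for i j
 have F: "?F i j = A i j + ((if i < j then P i j else 0) + (if i < j then P j i else 0))" for i j
  using sym[of i j] by (simp add: A_def P_def algebra_simps)
 have "(\<Sum>i<d. \<Sum>j<d. ?F i j) = (\<Sum>i<d. \<Sum>j<d. A i j) +
  ((\<Sum>i<d. \<Sum>j<d. if i < j then P i j else 0) + (\<Sum>i<d. \<Sum>j<d. if i < j then P j i else 0))"
  unfolding F sum.distrib ..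
 also have "(\<Sum>i<d. \<Sum>j<d. if i < j then P j i else 0) = (\<Sum>i<d. \<Sum>j<d. if j < i then P i j else 0)"
  by (rule sum.swap)
 also have "(\<Sum>i<d. \<Sum>j<d. A i j) = (\<Sum>i<d. \<Sum>j<d. if i = j then a i * b i * Y i i else - (a i * b i * Y i j))"
 proof (rule sum.cong[OF refl])
  fix i assume "i : {..<d}"
  then have i: "i < d" by simp
  have "(\<Sum>j<d. A i j) = a i * b i * Y i i - a i * b i * (\<Sum>k<d. if i = k then 0 else Y i k)"
   using i by (simp add: A_def sum.delta' right_diff_distrib)
  also have "a i * b i * Y i i = (\<Sum>j<d. if i = j then a i * b i * Y i i else 0)" using i by (simp add: sum.delta')
  finally have eq: "(\<Sum>j<d. A i j) = (\<Sum>j<d. if i = j then a i * b i * Y i i else 0) - a i * b i * (\<Sum>k<d. if i = k then 0 else Y i k)" .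
  show "(\<Sum>j<d. A i j) = (\<Sum>j<d. if i = j then a i * b i * Y i i else - (a i * b i * Y i j))"
   unfolding eq sum_distrib_left sum_subtractf[symmetric] by (intro sum.cong refl) simp
 qed
 finally have "(\<Sum>i<d. \<Sum>j<d. ?F i j) = (\<Sum>i<d. \<Sum>j<d. (if i = j then a i * b i * Y i i else - (a i * b i * Y i j)) +
  ((if i < j then P i j else 0) + (if j < i then P i j else 0)))"
  unfolding sum.distrib .
 also have "\<dots> = (\<Sum>i<d. \<Sum>j<d. a i * b j * Y i j)"
 proof (intro sum.cong refl)
  fix i j show "(if i = j then a i * b i * Y i i else - (a i * b i * Y i j)) +
   ((if i < j then P i j else 0) + (if j < i then P i j else 0)) = a i * b j * Y i j"
   by (cases i j rule: linorder_cases) (simp_all add: P_def algebra_simps)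
 qed
 finally show ?thesis by simp
qed

context constants
begin

lemma vector_space_field: "vector_space (%a x. \<iota> a * (x :: 'f))"
 by unfold_locales (simp_all add: algebra_simps)

end

lemma vector_space_sequences: "vector_space (%a (x :: nat => 'k::Fields.field) i. a * x i)"
 by unfold_locales (simp_all add: fun_eq_iff algebra_simps)

section \<open>Residue rings of effective divisors\<close>

context curve
begin

text \<open>Elements of the residue ring are handled through representatives in this ring: it maps
  onto the residue ring by \<open>res r\<close>, with kernel \<open>vanishing r\<close>.\<close>

definition semilocal :: "'f divisor => 'f set" where
 "semilocal r = {y. \<forall>Q\<in>keys r. y : Q}"

definition vanishing :: "'f divisor => 'f set" where
 "vanishing r = {y. \<forall>Q\<in>keys r. y : vset Q (lookup r Q)}"

definition res :: "'f divisor => 'f => 'f set => 'f set" where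
 "res r y = (\<lambda>Q\<in>keys r. ideal_stalk r Q +[Q] y)"

context
 fixes r :: "'f divisor"
 assumes r: "r : divisors PX" "effective r"
begin

lemma place_of_key: "Q : keys r ==> Q : closed_points PX"
 using r(1) by (auto simp: divisors_def)

lemma dvr_of_key: "Q : keys r ==> dvr Q"
 by (rule place_dvr[OF place_of_key])

lemma lookup_key_pos: "Q : keys r ==> 0 < lookup r Q"
 using r(2) unfolding effective_def in_keys_iff by (metis order_le_less)

lemma ideal_stalk_eq: "Q : keys r ==> ideal_stalk r Q = vset Q (lookup r Q)"
proof -
 assume Q: "Q : keys r"
 have "0 <= lookup r Q" using lookup_key_pos[OF Q] by simp
 then show ?thesis using dvr.mem_iff[OF dvr_of_key[OF Q]] by (auto simp: ideal_stalk_def vset_def)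
qed

lemma stalk_ideal: "Q : keys r ==> ideal (ideal_stalk r Q) (subring_of Q)"
proof -
 assume Q: "Q : keys r"
 show ?thesis unfolding ideal_stalk_eq[OF Q]
  by (rule residue_ring_ideal[OF dvr_of_key[OF Q]])
   (use place_constants[OF place_of_key[OF Q]] lookup_key_pos[OF Q] in auto)
qed

lemma stalk_hom:
 assumes Q: "Q : keys r"
 defines "h \<equiv> %y. ideal_stalk r Q +[Q] y"
 shows "x : Q ==> h x : carrier (stalk_quotient r Q)"
  "x : Q ==> y : Q ==> h (x + y) = h x \<oplus>\<^bsub>stalk_quotient r Q\<^esub> h y"
  "x : Q ==> y : Q ==> h (x * y) = h x \<otimes>\<^bsub>stalk_quotient r Q\<^esub> h y"
  "h x = h y \<longleftrightarrow> x - y : vset Q (lookup r Q)"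
  "carrier (stalk_quotient r Q) = h ` Q"
proof -
 interpret Q: dvr Q by (rule dvr_of_key[OF Q])
 have hom: "h : ring_hom (subring_of Q) (stalk_quotient r Q)"
  unfolding h_def stalk_quotient_def by (rule ideal.rcos_ring_hom[OF stalk_ideal[OF Q]])
 show "x : Q ==> h x : carrier (stalk_quotient r Q)" using ring_hom_closed[OF hom] by simp
 show "x : Q ==> y : Q ==> h (x + y) = h x \<oplus>\<^bsub>stalk_quotient r Q\<^esub> h y" using ring_hom_add[OF hom, of x y] by simp
 show "x : Q ==> y : Q ==> h (x * y) = h x \<otimes>\<^bsub>stalk_quotient r Q\<^esub> h y" using ring_hom_mult[OF hom, of x y] by simp
 show "h x = h y \<longleftrightarrow> x - y : vset Q (lookup r Q)"
  unfolding h_def ideal_stalk_eq[OF Q] by (rule coset_eq_iff) (simp_all add: Q.vset_diff)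
 show "carrier (stalk_quotient r Q) = h ` Q"
  by (auto simp: h_def stalk_quotient_def FactRing_def A_RCOSETS_def RCOSETS_def a_r_coset_def)
qed

lemma semilocalD: "x : semilocal r ==> Q : keys r ==> x : Q"
 by (simp add: semilocal_def)

lemma semilocal_closed:
 "x : semilocal r ==> y : semilocal r ==> x + y : semilocal r"
 "x : semilocal r ==> y : semilocal r ==> x * y : semilocal r"
 "\<iota> a : semilocal r"
 using dvr.closed(3,5)[OF dvr_of_key] place_constants[OF place_of_key] by (simp_all add: semilocal_def)

lemma semilocal_scale: "x : semilocal r ==> \<iota> a * x : semilocal r"
 by (rule semilocal_closed(2)[OF semilocal_closed(3)])

lemma semilocal_diff: "x : semilocal r ==> y : semilocal r ==> x - y : semilocal r"
 using dvr.closed(4)[OF dvr_of_key] by (simp add: semilocal_def)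

lemma semilocal_sum: "(!!i. i : S ==> f i : semilocal r) ==> sum f S : semilocal r"
 unfolding semilocal_def by (intro CollectI ballI dvr.closed_sum[OF dvr_of_key]) auto

lemma vanishing_subset: "vanishing r \<subseteq> semilocal r"
proof
 fix x assume x: "x : vanishing r"
 have "x : Q" if Q: "Q : keys r" for Q
 proof -
  interpret Q: dvr Q by (rule dvr_of_key[OF Q])
  have "x : vset Q (lookup r Q)" using x Q by (simp add: vanishing_def)
  then show ?thesis using Q.vset_mono[of 0 "lookup r Q"] lookup_key_pos[OF Q] by auto
 qed
 then show "x : semilocal r" by (simp add: semilocal_def)
qed

lemma vanishing_closed:
 "0 : vanishing r" "x : vanishing r ==> y : vanishing r ==> x + y : vanishing r"
 "x : semilocal r ==> y : vanishing r ==> x * y : vanishing r"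
 using dvr.zero_vset[OF dvr_of_key] dvr.vset_add[OF dvr_of_key] dvr.vset_mult_left[OF dvr_of_key]
 by (simp_all add: vanishing_def semilocal_def)

lemma res_eq_iff: "res r x = res r y \<longleftrightarrow> x - y : vanishing r"
proof -
 have "res r x = res r y \<longleftrightarrow> (\<forall>Q\<in>keys r. ideal_stalk r Q +[Q] x = ideal_stalk r Q +[Q] y)"
 proof
  assume e: "res r x = res r y"
  show "\<forall>Q\<in>keys r. ideal_stalk r Q +[Q] x = ideal_stalk r Q +[Q] y"
  proof
   fix Q assume "Q : keys r"
   then show "ideal_stalk r Q +[Q] x = ideal_stalk r Q +[Q] y"
    using fun_cong[OF e, of Q] by (simp add: res_def)
  qed
 next
  assume "\<forall>Q\<in>keys r. ideal_stalk r Q +[Q] x = ideal_stalk r Q +[Q] y"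
  then show "res r x = res r y" unfolding res_def by (intro restrict_ext) (rule bspec)
 qed
 then show ?thesis unfolding vanishing_def mem_Collect_eq using stalk_hom(4) by (simp cong: ball_cong)
qed

lemma res_closed: "x : semilocal r ==> res r x : carrier (residue_ring_div \<iota> r)"
 using stalk_hom(1) by (auto simp: residue_ring_div_def res_def semilocal_def)

lemma res_add:
 assumes "x : semilocal r" "y : semilocal r"
 shows "res r (x + y) = res r x \<oplus>\<^bsub>residue_ring_div \<iota> r\<^esub> res r y"
proof -
 have "ideal_stalk r Q +[Q] (x + y) =
  (ideal_stalk r Q +[Q] x) \<oplus>\<^bsub>stalk_quotient r Q\<^esub> (ideal_stalk r Q +[Q] y)"
  if Q: "Q : keys r" for Q by (rule stalk_hom(2)[OF Q semilocalD[OF assms(1) Q] semilocalD[OF assms(2) Q]])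
 then show ?thesis unfolding res_def residue_ring_div_def by (simp add: fun_eq_iff restrict_def)
qed

lemma res_mult:
 assumes "x : semilocal r" "y : semilocal r"
 shows "res r (x * y) = res r x \<otimes>\<^bsub>residue_ring_div \<iota> r\<^esub> res r y"
proof -
 have "ideal_stalk r Q +[Q] (x * y) =
  (ideal_stalk r Q +[Q] x) \<otimes>\<^bsub>stalk_quotient r Q\<^esub> (ideal_stalk r Q +[Q] y)"
  if Q: "Q : keys r" for Q by (rule stalk_hom(3)[OF Q semilocalD[OF assms(1) Q] semilocalD[OF assms(2) Q]])
 then show ?thesis unfolding res_def residue_ring_div_def by (simp add: fun_eq_iff restrict_def)
qed

lemma res_scale:
 assumes "x : semilocal r"
 shows "res r (\<iota> a * x) = a \<odot>\<^bsub>residue_ring_div \<iota> r\<^esub> res r x"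
proof -
 have "ideal_stalk r Q +[Q] (\<iota> a * x) =
  (ideal_stalk r Q +[Q] \<iota> a) \<otimes>\<^bsub>stalk_quotient r Q\<^esub> (ideal_stalk r Q +[Q] x)"
  if Q: "Q : keys r" for Q
  by (rule stalk_hom(3)[OF Q place_constants[OF place_of_key[OF Q]] semilocalD[OF assms Q]])
 then show ?thesis unfolding res_def residue_ring_div_def by (simp add: fun_eq_iff restrict_def)
qed

text \<open>The Chinese remainder theorem, from weak approximation at the points of the
  support.\<close>

lemma res_surj:
 assumes x: "x : carrier (residue_ring_div \<iota> r)"
 obtains y where "y : semilocal r" "res r y = x"
proof -
 have x': "x : (\<Pi>\<^sub>E Q\<in>keys r. carrier (stalk_quotient r Q))" using x by (simp add: residue_ring_div_def)
 have "\<exists>z\<in>Q. x Q = ideal_stalk r Q +[Q] z" if Q: "Q : keys r" for Q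
 proof -
  have "x Q : carrier (stalk_quotient r Q)" using x' Q by (rule PiE_mem)
  then show ?thesis unfolding stalk_hom(5)[OF Q] by blast
 qed
 then obtain z where z: "!!Q. Q : keys r ==> z Q : Q"
  "!!Q. Q : keys r ==> x Q = ideal_stalk r Q +[Q] z Q" by metis
 have "\<forall>Q\<in>keys r. dvr Q" using dvr_of_key by blast
 from weak_approximation[OF finite_keys this, of z "lookup r"]
 obtain y where y: "\<forall>Q\<in>keys r. y - z Q : vset Q (lookup r Q)" by blast
 have "y : Q" if Q: "Q : keys r" for Q
 proof -
  interpret Q: dvr Q by (rule dvr_of_key[OF Q])
  have "y - z Q : Q" using y Q Q.vset_mono[of 0 "lookup r Q"] lookup_key_pos[OF Q] by auto
  from Q.closed(3)[OF this z(1)[OF Q]] show ?thesis by simp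
 qed
 moreover have "res r y = x"
 proof (rule PiE_ext[OF _ x'])
  show "res r y : (\<Pi>\<^sub>E Q\<in>keys r. carrier (stalk_quotient r Q))"
   using res_closed[of y] calculation by (simp add: semilocal_def residue_ring_div_def)
  fix Q assume Q: "Q : keys r"
  show "res r y Q = x Q" unfolding z(2)[OF Q] using y Q by (simp add: res_def stalk_hom(4)[OF Q])
 qed
 ultimately show ?thesis using that[of y] unfolding semilocal_def by blast
qed

text \<open>Classes in the stalk at \<open>Q\<close> are incongruent modulo \<pi>^k with
  \<open>k = lookup r Q\<close>, and \<pi>^k is not a constant.\<close>

lemma finite_residue_ring: "finite (carrier (residue_ring_div \<iota> r))"
proof -
 have "finite (carrier (stalk_quotient r Q))" if Q: "Q : keys r" for Q
 proof -
  interpret Q: dvr Q by (rule dvr_of_key[OF Q])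
  let ?h = "%y. ideal_stalk r Q +[Q] y"
  obtain \<pi> where \<pi>: "uniformizer Q \<pi>" using Q.ex_uniformizer by blast
  define k where "k = nat (lookup r Q)"
  have k: "k > 0" "lookup r Q = int k" using lookup_key_pos[OF Q] by (auto simp: k_def)
  have \<pi>0: "\<pi> ~= 0" "val Q \<pi> = 1" using \<pi> by (auto simp: Q.uniformizer_iff)
  have vx: "val Q (\<pi> ^ k) = int k" "\<pi> ^ k ~= 0" using \<pi>0 by (simp_all add: Q.val_power)
  have xc: "\<pi> ^ k ~: range \<iota>"
  proof
   assume "\<pi> ^ k : range \<iota>"
   then obtain a where a: "\<pi> ^ k = \<iota> a" by blast
   then have "a ~= 0" using vx(2) by auto
   then show False using val_constant[OF place_of_key[OF Q]] a vx(1) k(1) by simp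
  qed
  have Wk: "ksub Q" unfolding ksub_def
   using Q.closed(2,3) Q.closed(5)[OF place_constants[OF place_of_key[OF Q]]] by simp
  have Wx: "\<pi> ^ k * w : Q" if "w : Q" for w
   using Q.closed(5)[OF Q.closed(7) that] \<pi> Q.max_ideal_closed(5) unfolding uniformizer_def by blast
  define lft where "lft K = (SOME y. y : Q & ?h y = K)" for K
  have lft: "lft K : Q & ?h (lft K) = K" if "K : carrier (stalk_quotient r Q)" for K
  proof -
   have "\<exists>y. y : Q & ?h y = K" using that unfolding stalk_hom(5)[OF Q] by blast
   then show ?thesis unfolding lft_def by (rule someI_ex)
  qed
  define S where "S = lft ` carrier (stalk_quotient r Q)"
  have "finite S"
  proof (rule incongruent_bound(1)[OF xc Wk Wx])
   show "S \<subseteq> Q" using lft by (auto simp: S_def)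
   fix s t assume st: "s : S" "t : S" "s - t : (*) (\<pi> ^ k) ` Q"
   then obtain K K' where K: "K : carrier (stalk_quotient r Q)" "s = lft K" "K' : carrier (stalk_quotient r Q)" "t = lft K'"
    by (auto simp: S_def)
   obtain w where w: "w : Q" "s - t = \<pi> ^ k * w" using st(3) by blast
   have "s - t : vset Q (int k)" unfolding w(2) Q.vset_mult_iff[OF vx(2)] vx(1) using w(1) by simp
   then have "?h s = ?h t" unfolding stalk_hom(4)[OF Q] k(2) .
   then show "s = t" using lft K by metis
  qed
  moreover have "inj_on lft (carrier (stalk_quotient r Q))" using lft by (metis inj_onI)
  ultimately show ?thesis unfolding S_def by (rule finite_imageD)
 qed
 then show ?thesis unfolding residue_ring_div_def by (simp add: finite_PiE)
qed

text \<open>Guarantees that the least length in \<open>sym_complexity\<close> is attained. The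
  product is expanded in a spanning family and \<open>symmetric_sum\<close> makes the resulting
  bilinear algorithm symmetric.\<close>

lemma symmetric_algorithm_exists:
 "\<exists>k. \<exists>T\<in>linear_maps ring_of_type_algebra (residue_ring_div \<iota> r) (power_algebra k).
   \<exists>U\<in>linear_maps ring_of_type_algebra (power_algebra k) (residue_ring_div \<iota> r).
    \<forall>x\<in>carrier (residue_ring_div \<iota> r). \<forall>y\<in>carrier (residue_ring_div \<iota> r).
     x \<otimes>\<^bsub>residue_ring_div \<iota> r\<^esub> y = U (T x \<otimes>\<^bsub>power_algebra k\<^esub> T y)"
proof -
 let ?A = "residue_ring_div \<iota> r"
 define lft where "lft x = (SOME y. y : semilocal r & res r y = x)" for x
 have lft: "lft x : semilocal r" "res r (lft x) = x" if x: "x : carrier ?A" for x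
 proof -
  have "\<exists>y. y : semilocal r & res r y = x" by (rule res_surj[OF x]) blast
  then have "lft x : semilocal r & res r (lft x) = x" unfolding lft_def by (rule someI_ex)
  then show "lft x : semilocal r" "res r (lft x) = x" by auto
 qed
 \<comment> \<open>All elements of the finite ring serve as spanning family; the length of the
   algorithm does not matter.\<close>
 define d where "d = card (carrier ?A)"
 obtain h where h: "bij_betw h {0..<d} (carrier ?A)" using ex_bij_betw_nat_finite[OF finite_residue_ring] unfolding d_def by blast
 define Y where "Y i = lft (h i)" for i
 have hA: "h i : carrier ?A" if "i < d" for i using h that by (auto simp: bij_betw_def)
 have Yr: "Y i : semilocal r" if "i < d" for i unfolding Y_def by (rule lft(1)[OF hA[OF that]])
 define comb where "comb c = (\<Sum>i<d. \<iota> (c i) * Y i)" for c :: "nat => 'k"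
 \<comment> \<open>Relates a function to its possible coordinate vectors. A linear choice that is 0
   on \<open>vanishing r\<close> depends on the residue class alone.\<close>
 define W where "W = {(y, c). y : semilocal r & y - comb c : vanishing r}"
 have comb_r: "comb c : semilocal r" for c unfolding comb_def using Yr by (intro semilocal_sum semilocal_scale) auto
 have scale: "\<iota> a * x : vanishing r" if "x : vanishing r" for a x by (rule vanishing_closed(3)[OF semilocal_closed(3) that])
 obtain f where f: "!!x y. f (x + y) = f x + f y" "!!a x. f (\<iota> a * x) = (%i. a * f x i)"
  "!!x y. (x, y) : W ==> (x, f x) : W" "!!x. x : vanishing r ==> f x = 0"
 proof (rule linear_relation_section[OF vector_space_field vector_space_sequences, of W "vanishing r"])
  have 0: "comb 0 = 0" by (simp add: comb_def)
  show "(x, 0) : W" if "x : vanishing r" for x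
   using that vanishing_subset by (auto simp: W_def 0)
  then show "(0, 0) : W" using vanishing_closed(1) by blast
  show "(x + x', y + y') : W" if w: "(x, y) : W" "(x', y') : W" for x y x' y'
  proof -
   have "(x - comb y) + (x' - comb y') : vanishing r" using w by (intro vanishing_closed(2)) (auto simp: W_def)
   moreover have "(x - comb y) + (x' - comb y') = (x + x') - comb (y + y')"
    by (simp add: comb_def algebra_simps sum.distrib)
   ultimately show ?thesis using w semilocal_closed(1) by (simp add: W_def)
  qed
  show "(\<iota> a * x, %i. a * y i) : W" if w: "(x, y) : W" for a x y
  proof -
   have "\<iota> a * (x - comb y) : vanishing r" using w by (intro scale) (auto simp: W_def)
   moreover have "\<iota> a * (x - comb y) = \<iota> a * x - comb (%i. a * y i)"
    by (simp add: comb_def algebra_simps sum_distrib_left)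
   ultimately show ?thesis using w semilocal_scale by (simp add: W_def)
  qed
 qed (use vanishing_closed scale that in auto)
 have fcomb: "y - comb (f y) : vanishing r" if y: "y : semilocal r" for y
 proof -
  have "res r y : h ` {0..<d}" using h res_closed[OF y] by (simp add: bij_betw_def)
  then obtain i where i: "i < d" "res r y = h i" by auto
  have "res r (Y i) = res r y" unfolding Y_def i(2) by (rule lft(2)[OF hA[OF i(1)]])
  then have "y - Y i : vanishing r" using res_eq_iff by metis
  moreover have "comb (%j. if j = i then 1 else 0) = Y i"
   unfolding comb_def using i(1) by (simp add: if_distrib if_distribR sum.delta cong: if_cong)
  ultimately have "(y, %j. if j = i then 1 else 0) : W" using y by (simp add: W_def)
  from f(3)[OF this] show ?thesis by (simp add: W_def)
 qed
 have fcong: "f x = f y" if "res r x = res r y" for x y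
 proof -
  have "x - y : vanishing r" using that res_eq_iff by blast
  then show ?thesis using f(1)[of "x - y" y] f(4) by simp
 qed
 define S where "S = {..<d} \<times> {..<d}"
 obtain e where e: "bij_betw e {0..<card S} S" using ex_bij_betw_nat_finite[of S] by (auto simp: S_def)
 define k where "k = card S"
 define L where "L y s = (case s of (i, j) => if i = j then f y i else f y i + f y j)" for y s
 define v where "v s = (case s of (i, j) => if i = j then Y i * Y i - (\<Sum>k<d. if i = k then 0 else Y i * Y k)
  else if i < j then Y i * Y j else 0)" for s
 have L: "L (x + y) s = L x s + L y s" "L (\<iota> a * x) s = a * L x s" for x y a s
  by (cases s; simp only: L_def prod.case f(1,2); simp add: algebra_simps)+
 have Lcong: "L x s = L y s" if "res r x = res r y" for x y s unfolding L_def fcong[OF that] ..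
 have "0 : semilocal r" using vanishing_closed(1) vanishing_subset by blast
 then have vr: "v s : semilocal r" if "s : S" for s
  using that Yr by (auto simp: v_def S_def intro!: semilocal_diff semilocal_sum semilocal_closed(2))
 define T where "T x p = (if p < k then L (lft x) (e p) else 0)" for x p
 define V where "V w = (\<Sum>p<k. \<iota> (w p) * v (e p))" for w
 have eS: "e p : S" if "p < k" for p using e that by (auto simp: bij_betw_def k_def)
 have Vr: "V w : semilocal r" for w unfolding V_def using vr eS by (intro semilocal_sum semilocal_scale) auto
 have T: "T : linear_maps ring_of_type_algebra ?A (power_algebra k)"
  unfolding linear_maps_def
 proof (intro CollectI conjI ballI)
  show "T : carrier ?A \<rightarrow> carrier (power_algebra k)" by (auto simp: T_def power_algebra_def)
  fix x assume x: "x : carrier ?A"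
  show "T (a \<odot>\<^bsub>?A\<^esub> x) = a \<odot>\<^bsub>power_algebra k\<^esub> T x" for a
  proof -
   have "res r (\<iota> a * lft x) = a \<odot>\<^bsub>?A\<^esub> x" using res_scale[OF lft(1)[OF x]] lft(2)[OF x] by simp
   moreover have "a \<odot>\<^bsub>?A\<^esub> x : carrier ?A" using res_closed[OF semilocal_scale[OF lft(1)[OF x]]] calculation by metis
   ultimately have "L (lft (a \<odot>\<^bsub>?A\<^esub> x)) s = L (\<iota> a * lft x) s" for s using lft(2) by (intro Lcong) simp
   then show ?thesis by (simp add: T_def power_algebra_def L fun_eq_iff)
  qed
  fix y assume y: "y : carrier ?A"
  have "res r (lft x + lft y) = x \<oplus>\<^bsub>?A\<^esub> y" using res_add lft x y by simp
  moreover have "x \<oplus>\<^bsub>?A\<^esub> y : carrier ?A" using res_closed[OF semilocal_closed(1)[OF lft(1)[OF x] lft(1)[OF y]]] calculation by metis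
  ultimately have "L (lft (x \<oplus>\<^bsub>?A\<^esub> y)) s = L (lft x + lft y) s" for s using lft(2) by (intro Lcong) simp
  then show "T (x \<oplus>\<^bsub>?A\<^esub> y) = T x \<oplus>\<^bsub>power_algebra k\<^esub> T y" by (simp add: T_def power_algebra_def L fun_eq_iff)
 qed
 have U: "(%w. res r (V w)) : linear_maps ring_of_type_algebra (power_algebra k) ?A"
  unfolding linear_maps_def
 proof (intro CollectI conjI ballI)
  show "(%w. res r (V w)) : carrier (power_algebra k) \<rightarrow> carrier ?A" using res_closed[OF Vr] by auto
  fix x :: "nat => 'k"
  show "res r (V (a \<odot>\<^bsub>power_algebra k\<^esub> x)) = a \<odot>\<^bsub>?A\<^esub> res r (V x)" for a
   unfolding res_scale[OF Vr, symmetric] by (simp add: V_def power_algebra_def sum_distrib_left mult.assoc)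
  fix y :: "nat => 'k"
  show "res r (V (x \<oplus>\<^bsub>power_algebra k\<^esub> y)) = res r (V x) \<oplus>\<^bsub>?A\<^esub> res r (V y)"
   unfolding res_add[OF Vr Vr, symmetric] by (simp add: V_def power_algebra_def sum.distrib distrib_right)
 qed
 have main: "x \<otimes>\<^bsub>?A\<^esub> y = res r (V (T x \<otimes>\<^bsub>power_algebra k\<^esub> T y))" if x: "x : carrier ?A" and y: "y : carrier ?A" for x y
 proof -
  define a where "a i = \<iota> (f (lft x) i)" for i
  define b where "b i = \<iota> (f (lft y) i)" for i
  have "V (T x \<otimes>\<^bsub>power_algebra k\<^esub> T y) = (\<Sum>p\<in>{0..<k}. \<iota> (L (lft x) (e p)) * \<iota> (L (lft y) (e p)) * v (e p))"
   unfolding V_def lessThan_atLeast0 by (rule sum.cong) (simp_all add: power_algebra_def T_def)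
  also have "\<dots> = (\<Sum>s\<in>S. \<iota> (L (lft x) s) * \<iota> (L (lft y) s) * v s)"
   unfolding k_def by (rule sum.reindex_bij_betw[OF e])
  also have "\<dots> = (\<Sum>i<d. \<Sum>j<d. \<iota> (L (lft x) (i, j)) * \<iota> (L (lft y) (i, j)) * v (i, j))"
   unfolding S_def sum.cartesian_product by (simp add: case_prod_beta)
  also have "\<dots> = (\<Sum>i<d. \<Sum>j<d. (if i = j then a i else a i + a j) * (if i = j then b i else b i + b j) *
   (if i = j then Y i * Y i - (\<Sum>k<d. if i = k then 0 else Y i * Y k) else if i < j then Y i * Y j else 0))"
   by (intro sum.cong refl) (simp add: L_def v_def a_def b_def)
  also have "\<dots> = (\<Sum>i<d. \<Sum>j<d. a i * b j * (Y i * Y j))"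
   by (rule symmetric_sum[symmetric]) (rule mult.commute)
  also have "\<dots> = comb (f (lft x)) * comb (f (lft y))"
   by (simp add: comb_def sum_product a_def b_def ac_simps)
  finally have "res r (V (T x \<otimes>\<^bsub>power_algebra k\<^esub> T y)) = res r (comb (f (lft x))) \<otimes>\<^bsub>?A\<^esub> res r (comb (f (lft y)))"
   by (simp add: res_mult[OF comb_r comb_r])
  moreover have "res r (comb (f (lft x))) = x" if x: "x : carrier ?A" for x
   using iffD2[OF res_eq_iff fcomb[OF lft(1)[OF x]]] lft(2)[OF x] by simp
  ultimately show ?thesis using x y by simp
 qed
 show ?thesis by (intro exI[of _ k] bexI[OF _ T] bexI[OF _ U] ballI) (rule main)
qed

end

end

section \<open>Lifting an algorithm to an equivariant one\<close>

lemma linear_mapsD: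
 assumes "f : linear_maps K V W"
 shows "x : carrier V ==> f x : carrier W"
  "x : carrier V ==> y : carrier V ==> f (x \<oplus>\<^bsub>V\<^esub> y) = f x \<oplus>\<^bsub>W\<^esub> f y"
  "a : carrier K ==> x : carrier V ==> f (a \<odot>\<^bsub>V\<^esub> x) = a \<odot>\<^bsub>W\<^esub> f x"
 using assms by (auto simp: linear_maps_def)

lemma additive_sum:
 fixes f :: "'a::ab_group_add => 'b::ab_group_add"
 assumes "!!x y. f (x + y) = f x + f y"
 shows "f (\<Sum>i\<in>I. h i) = (\<Sum>i\<in>I. f (h i))"
proof -
 have "f 0 = 0" using assms[of 0 0] by simp
 then show ?thesis by (induction I rule: infinite_finite_induct) (simp_all add: assms)
qed

text \<open>Elements of the twisted shift group are meaningful on \<open>L^m\<close> only, whereas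
  the vector space lemmas need maps on the whole type; composing with this projection makes them
  total and linear.\<close>

definition trunc :: "nat => (nat => 'l::Fields.field) => nat => 'l" where
 "trunc m x = (%k. if k < m then x k else 0)"

lemma trunc_closed: "trunc m x : ext_power_carrier m"
 by (simp add: trunc_def ext_power_carrier_def)

lemma trunc_id: "x : ext_power_carrier m ==> trunc m x = x"
 by (auto simp: trunc_def ext_power_carrier_def fun_eq_iff)

lemma (in constants) ext_linear:
 "ext CARD('k) m (trunc m (%k. x k + y k)) k = ext CARD('k) m (trunc m x) k + ext CARD('k) m (trunc m y) k"
 "ext CARD('k) m (trunc m (%k. \<iota> a * x k)) k = \<iota> a * ext CARD('k) m (trunc m x) k"
 by (simp_all add: ext_def trunc_def frobenius_power_add power_mult_distrib \<iota>_power_card)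

lemma vector_space_matrices: "vector_space (%a (x :: nat => 'c => 'k::Fields.field) i c. a * x i c)"
 by unfold_locales (simp_all add: fun_eq_iff algebra_simps)

lemma (in constants) vector_space_scaled_sequences: "vector_space (%a (x :: nat => 'f) i. \<iota> a * x i)"
 by unfold_locales (simp_all add: fun_eq_iff algebra_simps)

text \<open>The algebraic core without geometry. \<open>D\<close> will be the functions regular on
  the fibre over \<open>a\<close>, \<open>V\<close> and \<open>W\<close> the sections of
  \<open>E\<close> and \<open>2E\<close>, \<open>A\<close> the residue ring of \<open>r\<close>,
  \<rho> the restriction to \<open>r\<close>, \<open>g\<close> the Galois action, and
  \<open>T0\<close>, \<open>U0\<close> an algorithm for \<open>A\<close>. Evaluation is onto from
  \<open>V\<close>, and the last clause on \<rho> says that a section in \<open>W\<close> is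
  determined by its values at all translates of \<open>r\<close>.\<close>

locale lifting_data = Y: constants \<iota>Y + L: constants \<iota>L
 for \<iota>Y :: "'k::{Fields.field,finite} => 'g::Fields.field" and \<iota>L :: "'k => 'l::Fields.field" +
 fixes m k :: nat and G :: "((nat => 'l) => (nat => 'l)) monoid" and g :: "((nat => 'l) => (nat => 'l)) => 'g => 'g"
  and ev :: "'g => nat => 'l" and D V W :: "'g set"
  and A :: "('k, 'w) module" and \<rho> :: "'g => 'w" and T0 :: "'w => nat => 'k" and U0 :: "(nat => 'k) => 'w"
 assumes m: "m > 0" and G_eq: "G = twisted_shift_group CARD('k) m"
  and G: "group G" "finite (carrier G)" "of_nat (card (carrier G)) ~= (0::'k)"
  and G_shift: "!!c. c : carrier G ==> \<exists>i. c = shift_pow CARD('k) m i"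
  and G_mult: "!!c d x. c : carrier G ==> d : carrier G ==> x : ext_power_carrier m ==> (c \<otimes>\<^bsub>G\<^esub> d) x = c (d x)"
  and G_one: "!!x. x : ext_power_carrier m ==> \<one>\<^bsub>G\<^esub> x = x"
  and g: "!!c x y. c : carrier G ==> g c (x + y) = g c x + g c y" "!!c x y. c : carrier G ==> g c (x * y) = g c x * g c y"
   "!!c a. c : carrier G ==> g c (\<iota>Y a) = \<iota>Y a"
   "!!c d x. c : carrier G ==> d : carrier G ==> g (c \<otimes>\<^bsub>G\<^esub> d) x = g c (g d x)"
  and V: "0 : V" "!!x y. x : V ==> y : V ==> x + y : V" "!!a x. x : V ==> \<iota>Y a * x : V"
   "!!c x. c : carrier G ==> x : V ==> g c x : V" "V \<subseteq> D"
  and W: "0 : W" "!!x y. x : W ==> y : W ==> x + y : W" "!!a x. x : W ==> \<iota>Y a * x : W"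
   "!!c x. c : carrier G ==> x : W ==> g c x : W" "W \<subseteq> D" "!!x y. x : V ==> y : V ==> x * y : W"
  and ev: "!!x. ev x : ext_power_carrier m"
   "!!x y. x : D ==> y : D ==> ev (x + y) = (%i. ev x i + ev y i)" "!!x y. x : D ==> y : D ==> ev (x * y) = (%i. ev x i * ev y i)"
   "!!a x. x : D ==> ev (\<iota>Y a * x) = (%i. \<iota>L a * ev x i)"
   "!!c x. c : carrier G ==> x : D ==> ev (g c x) = c (ev x)"
   "!!x. x : ext_power_carrier m ==> \<exists>y\<in>V. ev y = x"
  and \<rho>: "!!x. x : V \<union> W ==> \<rho> x : carrier A" "!!x y. x : V ==> y : V ==> \<rho> (x + y) = \<rho> x \<oplus>\<^bsub>A\<^esub> \<rho> y"
   "!!x y. x : W ==> y : W ==> \<rho> (x + y) = \<rho> x \<oplus>\<^bsub>A\<^esub> \<rho> y"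
   "!!x y. x : V ==> y : V ==> \<rho> (x * y) = \<rho> x \<otimes>\<^bsub>A\<^esub> \<rho> y" "!!a x. x : V \<union> W ==> \<rho> (\<iota>Y a * x) = a \<odot>\<^bsub>A\<^esub> \<rho> x"
   "!!z z'. z : W ==> z' : W ==> (!!c. c : carrier G ==> \<rho> (g c z) = \<rho> (g c z')) ==> z = z'"
  and T0: "T0 : linear_maps ring_of_type_algebra A (power_algebra k)"
  and U0: "U0 : linear_maps ring_of_type_algebra (power_algebra k) A"
  and algorithm: "!!x y. x : carrier A ==> y : carrier A ==> x \<otimes>\<^bsub>A\<^esub> y = U0 (T0 x \<otimes>\<^bsub>power_algebra k\<^esub> T0 y)"
begin

sublocale G: group G by (rule G(1))

definition act :: "((nat => 'l) => (nat => 'l)) => (nat => 'l) => nat => 'l" where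
 "act c x = c (trunc m x)"

lemma G_closed: "c : carrier G ==> x : ext_power_carrier m ==> c x : ext_power_carrier m"
 using G_shift[of c] shift_pow_closed by auto

lemma act_closed: "c : carrier G ==> act c x : ext_power_carrier m"
 unfolding act_def by (rule G_closed[OF _ trunc_closed])

lemma act_linear:
 assumes c: "c : carrier G"
 shows "act c (x + y) = act c x + act c y" "act c (%i. \<iota>L a * x i) = (%i. \<iota>L a * act c x i)"
proof -
 obtain i where i: "c = shift_pow CARD('k) m i" using G_shift[OF c] by blast
 have a: "act c x j = (if j < m then ext CARD('k) m (trunc m x) (j + i) else 0)" for x j
  unfolding act_def i by (rule shift_pow_apply[OF trunc_closed])
 show "act c (x + y) = act c x + act c y"
  using L.ext_linear(1)[of m x y] by (simp add: a fun_eq_iff plus_fun_def)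
 show "act c (%i. \<iota>L a * x i) = (%i. \<iota>L a * act c x i)"
  using L.ext_linear(2)[of m a x] by (simp add: a fun_eq_iff)
qed

lemma act_mult: "c : carrier G ==> d : carrier G ==> act (c \<otimes>\<^bsub>G\<^esub> d) x = act c (act d x)"
 unfolding act_def by (simp add: G_mult trunc_closed trunc_id[OF G_closed[OF _ trunc_closed]])

lemma act_one: "act \<one>\<^bsub>G\<^esub> x = trunc m x"
 unfolding act_def by (rule G_one[OF trunc_closed])

lemma act_ev: "c : carrier G ==> x : D ==> act c (ev x) = ev (g c x)"
 by (simp add: act_def ev(1,5) trunc_id)

lemma section_exists:
 obtains S where "!!x y. S (x + y) = S x + S y" "!!a x. S (%i. \<iota>L a * x i) = \<iota>Y a * S x"
  "!!c x. c : carrier G ==> S (act c x) = g c (S x)"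
  "!!x. x : ext_power_carrier m ==> S x : V" "!!x. x : ext_power_carrier m ==> ev (S x) = x"
proof -
 \<comment> \<open>The converse of evaluation on \<open>V\<close>, as a relation: an equivariant
   section inside it picks preimages.\<close>
 define R where "R = {(ev y, y) | y. y : V}"
 show ?thesis
 proof (rule equivariant_section[OF L.vector_space_scaled_sequences Y.vector_space_field G, of R act g])
  have "ev 0 = 0" using ev(4)[of 0 0] V by (auto simp: fun_eq_iff)
  then show "(0, 0) : R" using V(1) by (auto simp: R_def)
  show "(x + x', y + y') : R" if "(x, y) : R" "(x', y') : R" for x y x' y'
  proof -
   have "x = ev y" "y : V" "x' = ev y'" "y' : V" using that by (auto simp: R_def)
   moreover from this have "ev (y + y') = x + x'" using V(5) ev(2)[of y y'] unfolding plus_fun_def by blast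
   ultimately show ?thesis using V(2)[of y y'] by (auto simp: R_def)
  qed
  show "(%i. \<iota>L a * x i, \<iota>Y a * y) : R" if "(x, y) : R" for a x y
   using that V(3,5) ev(4)[of y a] by (auto simp: R_def)
  show "(act c x, g c y) : R" if "c : carrier G" "(x, y) : R" for c x y
   using that V(4,5) act_ev[of c y] by (auto simp: R_def)
  show "act \<one>\<^bsub>G\<^esub> x = x" if "(x, y) : R" for x y
   using that ev(1) by (auto simp: R_def act_one trunc_id)
 next
  fix S assume S: "!!x y. S (x + y) = S x + S y" "!!a x. S (%i. \<iota>L a * x i) = \<iota>Y a * S x"
   "!!c x. c : carrier G ==> S (act c x) = g c (S x)" "!!x y. (x, y) : R ==> (x, S x) : R"
  show ?thesis
  proof (rule that[OF S(1,2,3)])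
   fix x :: "nat => 'l" assume "x : ext_power_carrier m"
   then obtain y where "y : V" "ev y = x" using ev(6) by blast
   then have "(x, y) : R" by (auto simp: R_def)
   from S(4)[OF this] show "S x : V" "ev (S x) = x" by (auto simp: R_def)
  qed
 qed (simp_all add: act_linear act_mult g)
qed

text \<open>Left multiplication by the group element \<open>d\<close> in each of the entries in
  \<open>K[C]\<close>.\<close>

definition translate_matrix :: "((nat => 'l) => (nat => 'l)) => (nat => ((nat => 'l) => (nat => 'l)) => 'k) => nat => ((nat => 'l) => (nat => 'l)) => 'k" where
 "translate_matrix d x = (%i c. if c : carrier G then x i (inv\<^bsub>G\<^esub> d \<otimes>\<^bsub>G\<^esub> c) else 0)"

abbreviation GP :: "((((nat => 'l) => (nat => 'l)) => 'k), nat => ((nat => 'l) => (nat => 'l)) => 'k) module" where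
 "GP \<equiv> group_power_algebra G k"

lemma carrier_GP: "x : carrier GP \<longleftrightarrow> (\<forall>i c. i \<ge> k \<or> c ~: carrier G --> x i c = 0)"
proof -
 have "x : carrier GP \<longleftrightarrow> (\<forall>i<k. \<forall>c. c ~: carrier G --> x i c = 0) & (\<forall>i\<ge>k. \<forall>c. x i c = 0)"
  by (simp add: group_power_algebra_def group_algebra_def fun_eq_iff)
 also have "\<dots> \<longleftrightarrow> (\<forall>i c. i \<ge> k \<or> c ~: carrier G --> x i c = 0)" using linorder_not_less by blast
 finally show ?thesis .
qed

lemma slice: "x : carrier GP ==> (%i. x i c) : carrier (power_algebra k)"
 by (simp add: carrier_GP power_algebra_def)

lemma GP_smult: "a \<odot>\<^bsub>GP\<^esub> x = (\<Sum>d\<in>carrier G. (%i c. a d * translate_matrix d x i c))"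
proof -
 have ap: "(\<Sum>d\<in>I. f d) i c = (\<Sum>d\<in>I. f d i c)" for I and f :: "((nat => 'l) => (nat => 'l)) => nat => ((nat => 'l) => (nat => 'l)) => 'k" and i c
  by (induction I rule: infinite_finite_induct) simp_all
 show ?thesis unfolding fun_eq_iff ap
  by (simp add: group_power_algebra_def group_algebra_def translate_matrix_def)
qed

lemma module_smult:
 assumes x: "x : ext_power_carrier m"
 shows "a \<odot>\<^bsub>ext_power_module \<iota>L m\<^esub> x = (\<Sum>d\<in>carrier G. (%i. \<iota>L (a d) * act d x i))"
proof -
 have ap: "(\<Sum>d\<in>I. f d) i = (\<Sum>d\<in>I. f d i)" for I and f :: "((nat => 'l) => (nat => 'l)) => nat => 'l" and i
  by (induction I rule: infinite_finite_induct) simp_all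
 show ?thesis unfolding fun_eq_iff ap act_def trunc_id[OF x]
  by (simp add: ext_power_module_def G_eq)
qed

lemma V_sum: "(!!i. i : I ==> h i : V) ==> sum h I : V"
 by (induction I rule: infinite_finite_induct) (simp_all add: V)

lemma T0_\<rho>:
 "x : V ==> y : V ==> T0 (\<rho> (x + y)) i = T0 (\<rho> x) i + T0 (\<rho> y) i"
 "x : V ==> T0 (\<rho> (\<iota>Y a * x)) i = a * T0 (\<rho> x) i"
 "x : V ==> i \<ge> k ==> T0 (\<rho> x) i = 0"
 using linear_mapsD(1)[OF T0 \<rho>(1)] linear_mapsD(2)[OF T0 \<rho>(1) \<rho>(1)] linear_mapsD(3)[OF T0 _ \<rho>(1)]
 by (simp_all add: \<rho> power_algebra_def)

lemma T0_\<rho>_sum: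
 assumes h: "!!j. j : I ==> h j : V"
 shows "T0 (\<rho> (\<Sum>j\<in>I. \<iota>Y (b j) * h j)) i = (\<Sum>j\<in>I. b j * T0 (\<rho> (h j)) i)"
 using h
proof (induction I rule: infinite_finite_induct)
 case (insert j I)
 have "(\<Sum>j\<in>I. \<iota>Y (b j) * h j) : V" by (intro V_sum V(3)) (use insert.prems in auto)
 then show ?case using insert by (simp add: T0_\<rho> V(3))
qed (use T0_\<rho>(2)[OF V(1), of 0] in simp_all)

lemma g_sum: "c : carrier G ==> g c (\<Sum>j\<in>I. \<iota>Y (b j) * h j) = (\<Sum>j\<in>I. \<iota>Y (b j) * g c (h j))"
 using additive_sum[of "g c" "%j. \<iota>Y (b j) * h j" I, OF g(1)] g(2,3) by simp

context
 fixes S :: "(nat => 'l) => 'g"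
 assumes S: "!!x y. S (x + y) = S x + S y" "!!a x. S (%i. \<iota>L a * x i) = \<iota>Y a * S x"
  "!!c x. c : carrier G ==> S (act c x) = g c (S x)"
  "!!x. x : ext_power_carrier m ==> S x : V" "!!x. x : ext_power_carrier m ==> ev (S x) = x"
begin

text \<open>At \<open>c\<close> stands \<open>T0\<close> of the values on \<open>r\<close> of the
  translate of \<open>S x\<close> by the inverse of \<open>c\<close>. The inverse makes the
  coefficient of \<open>d x\<close> at \<open>c\<close> equal to that of \<open>x\<close> at
  \<open>inv d c\<close>, as linearity over \<open>K[C]\<close> requires.\<close>

definition top :: "(nat => 'l) => nat => ((nat => 'l) => (nat => 'l)) => 'k" where
 "top x i c = (if c : carrier G then T0 (\<rho> (g (inv\<^bsub>G\<^esub> c) (S x))) i else 0)"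

lemma gS: "c : carrier G ==> x : ext_power_carrier m ==> g c (S x) : V"
 by (rule V(4)[OF _ S(4)])

lemma top_closed: "x : ext_power_carrier m ==> top x : carrier GP"
 unfolding carrier_GP using T0_\<rho>(3)[OF gS] by (auto simp: top_def)

lemma top_smult:
 assumes x: "x : ext_power_carrier m"
 shows "top (a \<odot>\<^bsub>ext_power_module \<iota>L m\<^esub> x) i c = (a \<odot>\<^bsub>GP\<^esub> top x) i c"
proof (cases "c : carrier G")
 case c: True
 have "S (a \<odot>\<^bsub>ext_power_module \<iota>L m\<^esub> x) = (\<Sum>d\<in>carrier G. \<iota>Y (a d) * g d (S x))"
  unfolding module_smult[OF x] additive_sum[of S, OF S(1)] by (rule sum.cong) (simp_all add: S(2,3))
 then have "g (inv\<^bsub>G\<^esub> c) (S (a \<odot>\<^bsub>ext_power_module \<iota>L m\<^esub> x)) = (\<Sum>d\<in>carrier G. \<iota>Y (a d) * g (inv\<^bsub>G\<^esub> c \<otimes>\<^bsub>G\<^esub> d) (S x))"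
  using c by (simp add: g_sum g(4))
 then have "top (a \<odot>\<^bsub>ext_power_module \<iota>L m\<^esub> x) i c = (\<Sum>d\<in>carrier G. a d * T0 (\<rho> (g (inv\<^bsub>G\<^esub> c \<otimes>\<^bsub>G\<^esub> d) (S x))) i)"
  using c by (simp add: top_def T0_\<rho>_sum[OF gS[OF _ x]])
 also have "\<dots> = (\<Sum>d\<in>carrier G. a d * top x i (inv\<^bsub>G\<^esub> d \<otimes>\<^bsub>G\<^esub> c))"
  by (rule sum.cong[OF refl]) (use c in \<open>simp add: top_def G.inv_mult_group\<close>)
 finally show ?thesis using c by (simp add: group_power_algebra_def group_algebra_def)
qed (simp add: top_def group_power_algebra_def group_algebra_def)

lemma top_linear: "top : linear_maps (group_algebra G) (ext_power_module \<iota>L m) GP"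
 unfolding linear_maps_def
proof (intro CollectI conjI ballI)
 have M: "carrier (ext_power_module \<iota>L m) = ext_power_carrier m" by (simp add: ext_power_module_def)
 show "top : carrier (ext_power_module \<iota>L m) \<rightarrow> carrier GP" unfolding M using top_closed by blast
 fix x assume "x : carrier (ext_power_module \<iota>L m)"
 then have x: "x : ext_power_carrier m" unfolding M .
 show "top (a \<odot>\<^bsub>ext_power_module \<iota>L m\<^esub> x) = a \<odot>\<^bsub>GP\<^esub> top x" for a
  using top_smult[OF x] by (simp add: fun_eq_iff)
 fix y assume "y : carrier (ext_power_module \<iota>L m)"
 then have y: "y : ext_power_carrier m" unfolding M .
 have "top (x + y) i c = top x i c + top y i c" for i c
  using T0_\<rho>(1)[OF gS[OF _ x] gS[OF _ y]] by (simp add: top_def S(1) g(1))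
 then show "top (x \<oplus>\<^bsub>ext_power_module \<iota>L m\<^esub> y) = top x \<oplus>\<^bsub>GP\<^esub> top y"
  by (simp add: ext_power_module_def group_power_algebra_def fun_eq_iff plus_fun_def)
qed

lemma U0_add: "x : carrier (power_algebra k) ==> y : carrier (power_algebra k) ==> U0 (%i. x i + y i) = U0 x \<oplus>\<^bsub>A\<^esub> U0 y"
 using linear_mapsD(2)[OF U0, of x y] by (simp add: power_algebra_def)

lemma U0_scale: "x : carrier (power_algebra k) ==> U0 (%i. a * x i) = a \<odot>\<^bsub>A\<^esub> U0 x"
 using linear_mapsD(3)[OF U0, of a x] by (simp add: power_algebra_def)

text \<open>The value of the second map is prescribed only where \<open>U0\<close> of all slices
  comes from the translates of one \<open>z\<close> in \<open>W\<close>. As a relation it can be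
  extended to the free module by \<open>equivariant_section\<close>.\<close>

definition bot_rel :: "((nat => ((nat => 'l) => (nat => 'l)) => 'k) \<times> (nat => 'l)) set" where
 "bot_rel = {(x, ev z) | x z. z : W & x : carrier GP & (\<forall>c\<in>carrier G. U0 (%i. x i c) = \<rho> (g (inv\<^bsub>G\<^esub> c) z))}"

lemma bot_relI: "z : W ==> x : carrier GP ==> (!!c. c : carrier G ==> U0 (%i. x i c) = \<rho> (g (inv\<^bsub>G\<^esub> c) z)) ==> y = ev z ==> (x, y) : bot_rel"
 unfolding bot_rel_def by blast

lemma bot_relE:
 assumes "(x, y) : bot_rel"
 obtains z where "z : W" "x : carrier GP" "!!c. c : carrier G ==> U0 (%i. x i c) = \<rho> (g (inv\<^bsub>G\<^esub> c) z)" "y = ev z"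
 using assms unfolding bot_rel_def by blast

lemma bot_rel_scale: "(x, y) : bot_rel ==> (%i c. a * x i c, %i. \<iota>L a * y i) : bot_rel"
proof (erule bot_relE)
 fix z assume z: "z : W" "x : carrier GP" "!!c. c : carrier G ==> U0 (%i. x i c) = \<rho> (g (inv\<^bsub>G\<^esub> c) z)" "y = ev z"
 show ?thesis
 proof (rule bot_relI[of "\<iota>Y a * z"])
  show "\<iota>Y a * z : W" by (rule W(3)[OF z(1)])
  show "(%i c. a * x i c) : carrier GP" using z(2) by (simp add: carrier_GP)
  show "U0 (%i. a * x i c) = \<rho> (g (inv\<^bsub>G\<^esub> c) (\<iota>Y a * z))" if c: "c : carrier G" for c
   using U0_scale[OF slice[OF z(2)], of a c] z(3)[OF c] \<rho>(5)[of "g (inv\<^bsub>G\<^esub> c) z" a] W(4)[OF G.inv_closed[OF c] z(1)] c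
   by (simp add: g(2,3))
  show "(%i. \<iota>L a * y i) = ev (\<iota>Y a * z)" using ev(4)[of z a] z(1,4) W(5) by auto
 qed
qed

lemma bot_rel_add: "(x, y) : bot_rel ==> (x', y') : bot_rel ==> (x + x', y + y') : bot_rel"
proof (elim bot_relE)
 fix z z' assume z: "z : W" "x : carrier GP" "!!c. c : carrier G ==> U0 (%i. x i c) = \<rho> (g (inv\<^bsub>G\<^esub> c) z)" "y = ev z"
  and z': "z' : W" "x' : carrier GP" "!!c. c : carrier G ==> U0 (%i. x' i c) = \<rho> (g (inv\<^bsub>G\<^esub> c) z')" "y' = ev z'"
 show ?thesis
 proof (rule bot_relI[of "z + z'"])
  show "z + z' : W" by (rule W(2)[OF z(1) z'(1)])
  show "x + x' : carrier GP" using z(2) z'(2) by (simp add: carrier_GP)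
  show "U0 (%i. (x + x') i c) = \<rho> (g (inv\<^bsub>G\<^esub> c) (z + z'))" if c: "c : carrier G" for c
   using U0_add[OF slice[OF z(2)] slice[OF z'(2)], of c c] z(3)[OF c] z'(3)[OF c]
    \<rho>(3)[OF W(4)[OF G.inv_closed[OF c] z(1)] W(4)[OF G.inv_closed[OF c] z'(1)]] c
   by (simp add: g(1))
  show "y + y' = ev (z + z')" using ev(2)[OF subsetD[OF W(5) z(1)] subsetD[OF W(5) z'(1)]] unfolding z(4) z'(4) plus_fun_def by simp
 qed
qed

lemma bot_rel_act: "d : carrier G ==> (x, y) : bot_rel ==> (translate_matrix d x, act d y) : bot_rel"
proof (erule bot_relE)
 fix z assume d: "d : carrier G"
  and z: "z : W" "x : carrier GP" "!!c. c : carrier G ==> U0 (%i. x i c) = \<rho> (g (inv\<^bsub>G\<^esub> c) z)" "y = ev z"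
 show ?thesis
 proof (rule bot_relI[of "g d z"])
  show "g d z : W" by (rule W(4)[OF d z(1)])
  show "translate_matrix d x : carrier GP" using z(2) by (simp add: carrier_GP translate_matrix_def)
  show "U0 (%i. translate_matrix d x i c) = \<rho> (g (inv\<^bsub>G\<^esub> c) (g d z))" if c: "c : carrier G" for c
   using z(3)[of "inv\<^bsub>G\<^esub> d \<otimes>\<^bsub>G\<^esub> c"] c d by (simp add: translate_matrix_def G.inv_mult_group g(4))
  show "act d y = ev (g d z)" unfolding z(4) using act_ev[OF d] z(1) W(5) by blast
 qed
qed

lemma translate_matrix_linear:
 "translate_matrix c (x + y) = translate_matrix c x + translate_matrix c y"
 "translate_matrix c (%i d. a * x i d) = (%i d. a * translate_matrix c x i d)"
 "c : carrier G ==> d : carrier G ==> translate_matrix (c \<otimes>\<^bsub>G\<^esub> d) x = translate_matrix c (translate_matrix d x)"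
 by (auto simp: translate_matrix_def fun_eq_iff G.inv_mult_group G.m_assoc)

text \<open>\<open>A\<close> is a bare record without module axioms, so the value at 0 is obtained
  from the algorithm for the product of zero with itself.\<close>

lemma U0_zero: "U0 (%i. 0) = \<rho> 0"
proof -
 have "T0 (\<rho> 0) = (%i. 0)" using T0_\<rho>(2)[OF V(1), of 0] by (simp add: fun_eq_iff)
 then show ?thesis using algorithm[OF \<rho>(1) \<rho>(1), of 0 0] \<rho>(4)[OF V(1) V(1)] V(1) by (simp add: power_algebra_def)
qed

lemma bot_exists:
 obtains U where "!!x y. U (x + y) = U x + U y" "!!a x. U (%i c. a * x i c) = (%i. \<iota>L a * U x i)"
  "!!d x. d : carrier G ==> U (translate_matrix d x) = act d (U x)"
  "!!x y. (x, y) : bot_rel ==> (x, U x) : bot_rel" "!!x. U x : ext_power_carrier m"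
proof (rule equivariant_section[OF vector_space_matrices L.vector_space_scaled_sequences G, of bot_rel translate_matrix act])
 show "(0, 0) : bot_rel"
 proof (rule bot_relI[OF W(1)])
  show "0 : carrier GP" by (simp add: carrier_GP)
  have "g c 0 = 0" if "c : carrier G" for c using additive_sum[of "g c" "%_. 0" "{}", OF g(1)[OF that]] by simp
  then show "U0 (%i. 0 i c) = \<rho> (g (inv\<^bsub>G\<^esub> c) 0)" if "c : carrier G" for c using that U0_zero by simp
  show "0 = ev 0" using ev(4)[of 0 0] W(1,5) by (auto simp: fun_eq_iff)
 qed
 show "translate_matrix \<one>\<^bsub>G\<^esub> x = x" if "(x, y) : bot_rel" for x y
  using that by (elim bot_relE) (auto simp: translate_matrix_def carrier_GP fun_eq_iff)
 fix U assume U: "!!x y. U (x + y) = U x + U y" "!!a x. U (%i c. a * x i c) = (%i. \<iota>L a * U x i)"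
  "!!d x. d : carrier G ==> U (translate_matrix d x) = act d (U x)"
  "!!x y. (x, y) : bot_rel ==> (x, U x) : bot_rel" "!!x. act \<one>\<^bsub>G\<^esub> (U x) = U x"
 show thesis
 proof (rule that[OF U(1,2,3,4)])
  show "U x : ext_power_carrier m" for x using act_closed[OF G.one_closed, of "U x"] U(5) by simp
 qed
qed (rule bot_rel_add bot_rel_scale bot_rel_act translate_matrix_linear act_linear act_mult; assumption)+

text \<open>The values at all translates determine \<open>z\<close>, so the relation really
  prescribes its second component.\<close>

lemma bot_single_valued:
 assumes "(x, y) : bot_rel" "(x, y') : bot_rel" shows "y = y'"
proof -
 obtain z where z: "z : W" "!!c. c : carrier G ==> U0 (%i. x i c) = \<rho> (g (inv\<^bsub>G\<^esub> c) z)" "y = ev z"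
  using assms(1) by (rule bot_relE) blast
 obtain z' where z': "z' : W" "!!c. c : carrier G ==> U0 (%i. x i c) = \<rho> (g (inv\<^bsub>G\<^esub> c) z')" "y' = ev z'"
  using assms(2) by (rule bot_relE) blast
 have "z = z'"
 proof (rule \<rho>(6)[OF z(1) z'(1)])
  fix c assume "c : carrier G"
  then show "\<rho> (g c z) = \<rho> (g c z')" using z(2)[of "inv\<^bsub>G\<^esub> c"] z'(2)[of "inv\<^bsub>G\<^esub> c"] by simp
 qed
 then show ?thesis using z(3) z'(3) by simp
qed

lemma product_rel:
 assumes x: "x : ext_power_carrier m" and y: "y : ext_power_carrier m"
 shows "(top x \<otimes>\<^bsub>GP\<^esub> top y, %i. x i * y i) : bot_rel"
proof (rule bot_relI[of "S x * S y"])
 show "S x * S y : W" by (rule W(6)[OF S(4)[OF x] S(4)[OF y]])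
 show "top x \<otimes>\<^bsub>GP\<^esub> top y : carrier GP"
  using top_closed[OF x] unfolding carrier_GP by (simp add: group_power_algebra_def)
 show "U0 (%i. (top x \<otimes>\<^bsub>GP\<^esub> top y) i c) = \<rho> (g (inv\<^bsub>G\<^esub> c) (S x * S y))" if c: "c : carrier G" for c
 proof -
  have ic: "inv\<^bsub>G\<^esub> c : carrier G" using c by simp
  have "(%i. (top x \<otimes>\<^bsub>GP\<^esub> top y) i c) = T0 (\<rho> (g (inv\<^bsub>G\<^esub> c) (S x))) \<otimes>\<^bsub>power_algebra k\<^esub> T0 (\<rho> (g (inv\<^bsub>G\<^esub> c) (S y)))"
   using c by (simp add: group_power_algebra_def power_algebra_def top_def)
  then show ?thesis using algorithm[of "\<rho> (g (inv\<^bsub>G\<^esub> c) (S x))" "\<rho> (g (inv\<^bsub>G\<^esub> c) (S y))"]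
    \<rho>(1)[of "g (inv\<^bsub>G\<^esub> c) (S x)"] \<rho>(1)[of "g (inv\<^bsub>G\<^esub> c) (S y)"] gS[OF ic x] gS[OF ic y] \<rho>(4)[OF gS[OF ic x] gS[OF ic y]]
   by (simp add: g(2)[OF ic])
 qed
 have "ev (S x * S y) = (%i. ev (S x) i * ev (S y) i)" using ev(3) S(4)[OF x] S(4)[OF y] V(5) by blast
 then show "(%i. x i * y i) = ev (S x * S y)" using S(5) x y by simp
qed

lemma nu_sym_le_aux: "nu_sym \<iota>L m <= k"
proof (rule bot_exists)
 fix U assume U: "!!x y. U (x + y) = U x + U y" "!!a x. U (%i c. a * x i c) = (%i. \<iota>L a * U x i)"
  "!!d x. d : carrier G ==> U (translate_matrix d x) = act d (U x)"
  "!!x y. (x, y) : bot_rel ==> (x, U x) : bot_rel" "!!x. U x : ext_power_carrier m"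
 have M: "carrier (ext_power_module \<iota>L m) = ext_power_carrier m" by (simp add: ext_power_module_def)
 have U_linear: "U : linear_maps (group_algebra G) GP (ext_power_module \<iota>L m)"
  unfolding linear_maps_def
 proof (intro CollectI conjI ballI)
  show "U : carrier GP \<rightarrow> carrier (ext_power_module \<iota>L m)" unfolding M using U(5) by blast
  fix x y
  show "U (x \<oplus>\<^bsub>GP\<^esub> y) = U x \<oplus>\<^bsub>ext_power_module \<iota>L m\<^esub> U y"
   using U(1)[of x y] by (simp add: ext_power_module_def group_power_algebra_def plus_fun_def)
  show "U (a \<odot>\<^bsub>GP\<^esub> x) = a \<odot>\<^bsub>ext_power_module \<iota>L m\<^esub> U x" for a
   unfolding GP_smult module_smult[OF U(5)] additive_sum[of U, OF U(1)]
   by (rule sum.cong) (simp_all add: U(2,3))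
 qed
 have main: "x \<otimes>\<^bsub>ext_power_module \<iota>L m\<^esub> y = U (top x \<otimes>\<^bsub>GP\<^esub> top y)"
  if "x : carrier (ext_power_module \<iota>L m)" "y : carrier (ext_power_module \<iota>L m)" for x y
 proof -
  have r: "(top x \<otimes>\<^bsub>GP\<^esub> top y, %i. x i * y i) : bot_rel" using product_rel that unfolding M by blast
  show ?thesis using bot_single_valued[OF r U(4)[OF r]] by (simp add: ext_power_module_def)
 qed
 show ?thesis unfolding nu_sym_def equivariant_sym_complexity_def G_eq[symmetric]
  by (rule Least_le) (intro bexI[OF _ top_linear] bexI[OF _ U_linear] ballI main)
qed

end

lemma nu_sym_le: "nu_sym \<iota>L m <= k"
proof (rule section_exists)
 fix S assume "!!x y. S (x + y) = S x + S y" "!!a x. S (%i. \<iota>L a * x i) = \<iota>Y a * S x"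
  "!!c x. c : carrier G ==> S (act c x) = g c (S x)"
  "!!x. x : ext_power_carrier m ==> S x : V" "!!x. x : ext_power_carrier m ==> ev (S x) = x"
 then show ?thesis by (rule nu_sym_le_aux)
qed

end

section \<open>Application to sections on the cover\<close>

context cyclic_cover
begin

lemma H0_act:
 assumes c: "c : C" and E: "!!Q. Q : PPY ==> lookup E (c -` Q) = lookup E Q"
  and f: "f : H0 PY E"
 shows "c f : H0 PY E"
 unfolding Y.H0_iff
proof
 fix Q assume Q: "Q : PPY"
 have "f : vset (c -` Q) (- lookup E (c -` Q))" using f act_place[OF c Q] unfolding Y.H0_iff by blast
 then show "c f : vset Q (- lookup E Q)"
  unfolding vimage_vset[OF C_auto[OF c] Y.place_dvr[OF Q]] E[OF Q] by (rule vimageD)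
qed

text \<open>Disjointness leaves at each point at most one translate of \<open>r\<close>, so the
  multiplicity in the sum is that of this translate and \<open>z\<close> vanishes to this order;
  \<open>E\<close> does not interfere, being 0 there.\<close>

lemma H0_of_vanishing_translates:
 assumes r: "r : divisors PY" "effective r"
  and disjoint: "!!c. c : C ==> c ~= id ==> keys r \<inter> keys (translate c r) = {}"
  and E: "!!c Q. c : C ==> Q : PPY ==> lookup E (c -` Q) = lookup E Q"
   "!!Q. Q : keys r ==> lookup E Q = 0"
  and z: "z : H0 PY E" "!!c. c : C ==> c z : Y.vanishing r"
 shows "z : H0 PY (E - (\<Sum>c\<in>C. translate c r))"
 unfolding Y.H0_iff
proof
 fix P assume P: "P : PPY"
 have l: "lookup (E - (\<Sum>c\<in>C. translate c r)) P =
  lookup E P - (\<Sum>c\<in>C. lookup r (c -` P))"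
  unfolding lookup_minus lookup_sum by (simp add: lookup_translate cong: sum.cong)
 show "z : vset P (- lookup (E - (\<Sum>c\<in>C. translate c r)) P)"
 proof (cases "\<exists>c\<in>C. lookup r (c -` P) ~= 0")
  case True
  then obtain c where c: "c : C" "lookup r (c -` P) ~= 0" by blast
  obtain e where e: "e : C" "\<forall>x. c (e x) = x" "\<forall>x. e (c x) = x" using C_inverse[OF c(1)] by blast
  have Q: "c -` P : keys r" using c(2) by (simp add: in_keys_iff)
  have others: "lookup r (c' -` P) = 0" if c': "c' : C" "c' ~= c" for c'
  proof (rule ccontr)
   assume nz: "lookup r (c' -` P) ~= 0"
   have cd: "c \<circ> (e \<circ> c') = c'" using e(2) by (simp add: fun_eq_iff)
   have d: "e \<circ> c' : C" by (rule C_comp[OF e(1) c'(1)])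
   have "e \<circ> c' ~= id"
   proof
    assume "e \<circ> c' = id"
    then have "c \<circ> id = c'" using cd by simp
    then show False using c'(2) by simp
   qed
   moreover have "(e \<circ> c') -` (c -` P) = c' -` P" unfolding vimage_comp cd ..
   then have "c -` P : keys (translate (e \<circ> c') r)"
    using nz by (simp only: in_keys_iff lookup_translate[OF d] not_False_eq_True)
   ultimately show False using disjoint[OF d] Q by blast
  qed
  have "(\<Sum>c\<in>C. lookup r (c -` P)) = lookup r (c -` P)"
   using sum.remove[OF finite_C c(1), of "%c. lookup r (c -` P)"] others by simp
  moreover have "lookup E P = 0" using E(1)[OF c(1) P] E(2)[OF Q] by simp
  moreover have "z : vset P (lookup r (c -` P))"
  proof -
   have "e z : vset (c -` P) (lookup r (c -` P))" using z(2)[OF e(1)] Q unfolding Y.vanishing_def by blast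
   then have "c (e z) : vset P (lookup r (c -` P))"
    unfolding vimage_vset[OF C_auto[OF c(1)] Y.place_dvr[OF P]] by (rule vimageD)
   then show ?thesis using e(2) by simp
  qed
  ultimately show ?thesis unfolding l by simp
 next
  case False
  then have "(\<Sum>c\<in>C. lookup r (c -` P)) = 0" by (intro sum.neutral) blast
  then show ?thesis using z(1) P unfolding l Y.H0_iff by simp
 qed
qed

text \<open>Entry \<open>k\<close> of \<open>ev y\<close> is the residue at \<open>Q\<close> of
  \<open>s ^ k\<close> applied to \<open>y\<close>, for \<open>k\<close> below \<open>m\<close>.
  Because \<open>s ^ m\<close> is Frobenius at \<open>Q\<close>, the extended sequence has this form
  for every \<open>k\<close>, so \<open>s\<close> acts as the twisted shift.\<close>

lemma evaluation_exists:
 fixes \<iota>L :: "'k => 'l::Fields.field"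
 assumes a: "a : PPX" "point_degree \<iota>X a = 1"
  and L: "constants \<iota>L" "finite (UNIV :: 'l set)" "CARD('l) = CARD('k) ^ e"
  and ne: "n = card (fiber \<phi> PY a) * e"
 defines "m \<equiv> card (fiber \<phi> PY a)" and "\<Delta> \<equiv> {y. \<forall>Q\<in>fiber \<phi> PY a. y : Q}"
 obtains s and ev :: "'g => nat => 'l" where "is_gen s" "!!x. ev x : ext_power_carrier m"
  "!!x y. x : \<Delta> ==> y : \<Delta> ==> ev (x + y) = (%i. ev x i + ev y i)"
  "!!x y. x : \<Delta> ==> y : \<Delta> ==> ev (x * y) = (%i. ev x i * ev y i)"
  "!!b x. x : \<Delta> ==> ev (\<iota>Y b * x) = (%i. \<iota>L b * ev x i)"
  "!!i x. x : \<Delta> ==> ev ((s ^^ i) x) = shift_pow CARD('k) m i (ev x)"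
  "!!E x. E : divisors PY ==> (!!Q. Q : fiber \<phi> PY a ==> lookup E Q = 0) ==>
   Y.covers (E - fiber_divisor \<phi> PY a) ==> x : ext_power_carrier m ==> \<exists>y\<in>H0 PY E. ev y = x"
proof -
 interpret L: constants \<iota>L by (rule L(1))
 obtain Q where QF: "Q : fiber \<phi> PY a" using fiber_nonempty[OF a(1)] by blast
 have Q: "Q : PPY" "\<phi> -` Q = a" using fiberD[OF QF] by auto
 interpret Q: dvr Q by (rule Y.place_dvr[OF Q(1)])
 let ?q = "CARD('k)"
 obtain s where s: "is_gen s"
  and Fr: "!!z. z : Q ==> (s ^^ m) z - z ^ ?q : max_ideal Q" and n: "n = m * inertial_degree \<phi> Q"
  using frobenius_generator[OF Q(1)] unfolding Q(2) a(2) m_def power_one_right by metis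
 note orb = orbit_structure[OF s Q(1), unfolded Q(2), folded m_def]
 have sC: "s : C" by (rule is_gen_C[OF s])
 have "inertial_degree \<phi> Q = e" using n ne orb(1) unfolding m_def by simp
 then have pd: "point_degree \<iota>Y Q = e" using inertial_degree_card[OF Q(1)] unfolding Q(2) a(2) by simp
 obtain lm where lm: "!!x y. x : Q ==> y : Q ==> lm (x + y) = lm x + lm y" "!!x y. x : Q ==> y : Q ==> lm (x * y) = lm x * lm y"
  "!!a. lm (\<iota>Y a) = \<iota>L a" "!!x y. x : Q ==> y : Q ==> lm x = lm y \<longleftrightarrow> x - y : max_ideal Q" "!!z. \<exists>x\<in>Q. lm x = (z :: 'l)"
  by (rule Y.residue_embedding[OF Q(1) L(1,2) L(3)[folded pd]]) blast
 have lm_power: "lm (x ^ j) = lm x ^ j" if "x : Q" for x j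
 proof (induction j)
  case 0 show ?case using lm(3)[of 1] by simp
 next
  case (Suc j) show ?case unfolding power_Suc lm(2)[OF that Q.closed(7)[OF that]] Suc ..
 qed
 note sa = field_autoD[OF C_auto[OF C_pow[OF sC]]]
 have sF: "(s ^^ i) -` Q : fiber \<phi> PY a" for i
  using act_place[OF C_pow[OF sC] Q(1)] restrict_act[OF C_pow[OF sC], of i Q] Q(2) by (simp add: fiber_def)
 have sQ: "(s ^^ i) x : Q" if x: "x : \<Delta>" for i x using bspec[OF x[unfolded \<Delta>_def mem_Collect_eq] sF[of i]] by simp
 define ev where "ev y = (%k. if k < m then lm ((s ^^ k) y) else 0)" for y
 \<comment> \<open>Each further \<open>s ^ m\<close> raises the residue to the power
   \<open>q\<close>, by the choice of \<open>s\<close>; the point \<open>a\<close> has degree one,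
   so no higher power occurs.\<close>
 have step: "lm ((s ^^ (k + m * d)) x) = lm ((s ^^ k) x) ^ (?q ^ d)" if x: "x : \<Delta>" for k d x
 proof (induction d)
  case (Suc d)
  let ?z = "(s ^^ (k + m * d)) x"
  have "(s ^^ (k + m * Suc d)) x = (s ^^ (m + (k + m * d))) x" by (simp add: ac_simps)
  also have "\<dots> = (s ^^ m) ?z" by (simp only: funpow_add comp_apply)
  finally have z: "(s ^^ (k + m * Suc d)) x = (s ^^ m) ?z" .
  have zQ: "?z : Q" "(s ^^ m) ?z : Q" using sQ[OF x] unfolding z[symmetric] by auto
  have "lm ((s ^^ m) ?z) = lm (?z ^ ?q)" using lm(4)[OF zQ(2) Q.closed(7)[OF zQ(1)]] Fr[OF zQ(1)] by blast
  then show ?case unfolding z lm_power[OF zQ(1)] Suc by (simp add: mult.commute flip: power_mult)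
 qed simp
 have ext_ev: "ext ?q m (ev x) k = lm ((s ^^ k) x)" if x: "x : \<Delta>" for x k
 proof -
  have "lm ((s ^^ (k mod m + m * (k div m))) x) = ext ?q m (ev x) k"
   unfolding step[OF x] ext_def ev_def using orb(1) by simp
  then show ?thesis by simp
 qed
 have evM: "ev x : ext_power_carrier m" for x by (simp add: ev_def ext_power_carrier_def)
 show ?thesis
 proof (rule that[of s ev, OF s evM])
  fix x y assume xy: "x : \<Delta>" "y : \<Delta>"
  show "ev (x + y) = (%i. ev x i + ev y i)" "ev (x * y) = (%i. ev x i * ev y i)"
   using lm(1,2) sQ[OF xy(1)] sQ[OF xy(2)] by (simp_all add: ev_def sa fun_eq_iff)
 next
  fix b x assume x: "x : \<Delta>"
  show "ev (\<iota>Y b * x) = (%i. \<iota>L b * ev x i)"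
   using lm(2)[OF Y.place_constants[OF Q(1)] sQ[OF x]] lm(3) by (simp add: ev_def sa fun_eq_iff C_\<iota>[OF C_pow[OF sC]])
 next
  fix i x assume x: "x : \<Delta>"
  show "ev ((s ^^ i) x) = shift_pow ?q m i (ev x)"
  proof
   fix k
   have "(s ^^ k) ((s ^^ i) x) = (s ^^ (k + i)) x" by (simp add: funpow_add)
   then show "ev ((s ^^ i) x) k = shift_pow ?q m i (ev x) k"
    unfolding shift_pow_apply[OF evM] ext_ev[OF x] by (simp add: ev_def)
  qed
 next
  fix E :: "'g divisor" and x :: "nat => 'l" assume E: "E : divisors PY" "!!Q. Q : fiber \<phi> PY a ==> lookup E Q = 0"
   and cov: "Y.covers (E - fiber_divisor \<phi> PY a)" and x: "x : ext_power_carrier m"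
  have "\<forall>k. \<exists>z. z : Q & lm z = x k" using lm(5) by blast
  from choice[OF this] obtain y where y: "!!k. y k : Q" "!!k. lm (y k) = x k" by blast
  have "\<exists>z. \<forall>i<m. Q' = (s ^^ i) -` Q --> (s ^^ i) z = y i" for Q'
  proof (cases "\<exists>i<m. Q' = (s ^^ i) -` Q")
   case True
   then obtain i where i: "i < m" "Q' = (s ^^ i) -` Q" by blast
   obtain z where z: "(s ^^ i) z = y i" using sa(1)[of i] by (metis bij_pointE)
   have "j = i" if "j < m" "Q' = (s ^^ j) -` Q" for j using inj_onD[OF orb(5), of j i] i that by simp
   then show ?thesis using z by blast
  qed blast
  then obtain t where t: "!!Q' i. i < m ==> Q' = (s ^^ i) -` Q ==> (s ^^ i) (t Q') = y i" by metis
  obtain w where w: "\<forall>Q'\<in>fiber \<phi> PY a. w - t Q' : vset Q' 1"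
   by (rule weak_approximation[OF finite_fiber[OF a(1)], of t "%_. 1"]) (use Y.place_dvr fiberD in blast)+
  \<comment> \<open>The repartition that equals \<open>w\<close> on the fibre and 0 elsewhere.
    Approximating it modulo \<open>E - B\<close> gives one function with the prescribed residues on
    the fibre and poles bounded by \<open>E\<close> elsewhere.\<close>
  define \<beta> where "\<beta> Q' = (\<Sum>P\<in>fiber \<phi> PY a. if Q' = P then w else 0)" for Q'
  have "\<beta> : Y.adeles" unfolding \<beta>_def by (rule Y.adeles_sum) (rule Y.adeles_local[OF fiberD(1)])
  then obtain f where f: "(%P. \<beta> P - f) : Y.reps (E - fiber_divisor \<phi> PY a)" using cov unfolding Y.covers_def by blast
  have fP: "\<beta> P - f : vset P (- (lookup E P - (if \<phi> -` P = a then 1 else 0)))" if P: "P : PPY" for P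
   using bspec[OF f[unfolded Y.reps_def mem_Collect_eq] P] by (simp add: lookup_minus lookup_fiber_divisor[OF a(1) P])
  have close: "w - f : vset P 1" if P: "P : fiber \<phi> PY a" for P
   using fP[OF fiberD(1)[OF P]] E(2)[OF P] fiberD(2)[OF P] P finite_fiber[OF a(1)] by (simp add: \<beta>_def sum.delta')
  have main: "(s ^^ i) f : Q & lm ((s ^^ i) f) = x i" if i: "i < m" for i
  proof -
   let ?P = "(s ^^ i) -` Q"
   interpret P: dvr ?P by (rule Y.place_dvr[OF fiberD(1)[OF sF]])
   have "w - t ?P - (w - f) : vset ?P 1" by (rule P.vset_diff[OF bspec[OF w sF[of i]] close[OF sF[of i]]])
   then have "f - t ?P : (s ^^ i) -` vset Q 1" unfolding vimage_vset[OF C_auto[OF C_pow[OF sC]] Q.dvr_axioms] by simp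
   then have c: "(s ^^ i) f - y i : max_ideal Q" using t[OF i refl] by (simp add: sa)
   have "(s ^^ i) f - y i + y i : Q" by (rule Q.closed(3)[OF Q.max_ideal_closed(5)[OF c] y(1)])
   then have fQ: "(s ^^ i) f : Q" by simp
   show ?thesis using fQ lm(4)[OF fQ y(1)] c y(2) by simp
  qed
  have "f : H0 PY E" unfolding Y.H0_iff
  proof
   fix P assume P: "P : PPY"
   show "f : vset P (- lookup E P)"
   proof (cases "\<phi> -` P = a")
    case True
    then have PF: "P : fiber \<phi> PY a" using P by (simp add: fiber_def)
    then obtain i where i: "i < m" "P = (s ^^ i) -` Q" using orb(4) by auto
    then have "f : P" using main[OF i(1)] by simp
    then show ?thesis using E(2)[OF PF] dvr.vset_0[OF Y.place_dvr[OF P]] by simp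
   next
    case False
    then have "P ~: fiber \<phi> PY a" by (simp add: fiber_def)
    then have "\<beta> P = 0" unfolding \<beta>_def by (intro sum.neutral) auto
    then have "- f : vset P (- lookup E P)" using fP[OF P] False by simp
    from dvr.vset_uminus[OF Y.place_dvr[OF P] this] show ?thesis by simp
   qed
  qed
  moreover have "ev f = x" using main x by (auto simp: ev_def fun_eq_iff ext_power_carrier_def)
  ultimately show "\<exists>y\<in>H0 PY E. ev y = x" by blast
 qed
qed

lemma nu_sym_le_core:
 fixes \<iota>L :: "'k => 'l::Fields.field"
 assumes a: "a : PPX" "point_degree \<iota>X a = 1"
  and L: "constants \<iota>L" "finite (UNIV :: 'l set)" "CARD('l) = CARD('k) ^ e"
  and ne: "n = card (fiber \<phi> PY a) * e" and n: "of_nat n ~= (0::'k)"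
  and r: "r : divisors PY" "effective r"
  and disjoint: "!!c. c : C ==> c ~= id ==> keys r \<inter> keys (translate c r) = {}"
  and E: "E : divisors PY" "!!c Q. c : C ==> Q : PPY ==> lookup E (c -` Q) = lookup E Q"
   "!!Q. Q : fiber \<phi> PY a ==> lookup E Q = 0" "!!Q. Q : keys r ==> lookup E Q = 0"
  and cov: "Y.covers (E - fiber_divisor \<phi> PY a)"
  and R: "H0 PY (E + E - (\<Sum>c\<in>C. translate c r)) = {0}"
 shows "nu_sym \<iota>L (card (fiber \<phi> PY a)) <= sym_complexity (residue_ring_div \<iota>Y r) (residue_ring_div \<iota>Y r)
  (%x y. x \<otimes>\<^bsub>residue_ring_div \<iota>Y r\<^esub> y)"
proof -
 define m where "m = card (fiber \<phi> PY a)"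
 define \<Delta> where "\<Delta> = {y. \<forall>Q\<in>fiber \<phi> PY a. y : Q}"
 define q where "q = CARD('k)"
 define G where "G = (twisted_shift_group q m :: ((nat => 'l) => (nat => 'l)) monoid)"
 define k where "k = sym_complexity (residue_ring_div \<iota>Y r) (residue_ring_div \<iota>Y r) (%x y. x \<otimes>\<^bsub>residue_ring_div \<iota>Y r\<^esub> y)"
 \<comment> \<open>Existence of some algorithm turns the least length into the length of an actual
   one.\<close>
 from LeastI_ex[OF Y.symmetric_algorithm_exists[OF r], folded sym_complexity_def, folded k_def]
 obtain T0 U0 where T0: "T0 : linear_maps ring_of_type_algebra (residue_ring_div \<iota>Y r) (power_algebra k)"
  and U0: "U0 : linear_maps ring_of_type_algebra (power_algebra k) (residue_ring_div \<iota>Y r)"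
  and alg: "!!x y. x : carrier (residue_ring_div \<iota>Y r) ==> y : carrier (residue_ring_div \<iota>Y r) ==>
   x \<otimes>\<^bsub>residue_ring_div \<iota>Y r\<^esub> y = U0 (T0 x \<otimes>\<^bsub>power_algebra k\<^esub> T0 y)" by blast
 obtain s and ev :: "'g => nat => 'l" where s: "is_gen s" and ev: "!!x. ev x : ext_power_carrier m"
  "!!x y. x : \<Delta> ==> y : \<Delta> ==> ev (x + y) = (%i. ev x i + ev y i)"
  "!!x y. x : \<Delta> ==> y : \<Delta> ==> ev (x * y) = (%i. ev x i * ev y i)"
  "!!b x. x : \<Delta> ==> ev (\<iota>Y b * x) = (%i. \<iota>L b * ev x i)"
  "!!i x. x : \<Delta> ==> ev ((s ^^ i) x) = shift_pow q m i (ev x)"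
  "!!E x. E : divisors PY ==> (!!Q. Q : fiber \<phi> PY a ==> lookup E Q = 0) ==>
   Y.covers (E - fiber_divisor \<phi> PY a) ==> x : ext_power_carrier m ==> \<exists>y\<in>H0 PY E. ev y = x"
  by (rule evaluation_exists[OF a L ne, folded m_def \<Delta>_def q_def]) blast
 have q1: "q > 1" unfolding q_def by (rule Y.card_K_gt_1)
 have n': "n = e * m" using ne by (simp add: m_def)
 have m0: "m > 0" and e0: "e > 0" using n' n_pos by (auto intro: Nat.gr0I)
 note tg = twisted_shift_group[OF m0 L(2) L(3)[folded q_def] q1 e0, folded G_def n']
 have sC: "s : C" by (rule is_gen_C[OF s])
 \<comment> \<open>The isomorphism to C that sends the twisted shift to \<open>s\<close>; by
   \<open>g_shift\<close> it does not depend on the exponent chosen.\<close>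
 define g where "g c = s ^^ (SOME i. i < n & c = shift_pow q m i)" for c :: "(nat => 'l) => nat => 'l"
 have g_shift: "g (shift_pow q m i) = s ^^ i" for i
 proof -
  define j where "j = (SOME j. j < n & (shift_pow q m i :: (nat => 'l) => nat => 'l) = shift_pow q m j)"
  have "i mod n < n & (shift_pow q m i :: (nat => 'l) => nat => 'l) = shift_pow q m (i mod n)"
   using n_pos tg(4)[of i] by simp
  then have j: "j < n & (shift_pow q m i :: (nat => 'l) => nat => 'l) = shift_pow q m j" unfolding j_def by (rule someI)
  then have "shift_pow q m j = (shift_pow q m (i mod n) :: (nat => 'l) => nat => 'l)" using tg(4)[of i] by simp
  then have "j = i mod n" using inj_onD[OF tg(3), of j "i mod n"] j n_pos by simp
  then show ?thesis unfolding g_def j_def[symmetric] using gen_pow_mod[OF s, of i] by simp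
 qed
 have G_shift: "\<exists>i. c = shift_pow q m i" if "c : carrier G" for c using that unfolding tg(2) by blast
 have gC: "g c : C" if "c : carrier G" for c
 proof -
  obtain i where i: "c = shift_pow q m i" using G_shift[OF \<open>c : carrier G\<close>] by blast
  show ?thesis unfolding i g_shift by (rule C_pow[OF sC])
 qed
 have g_mult: "g (c \<otimes>\<^bsub>G\<^esub> d) x = g c (g d x)" if cd: "c : carrier G" "d : carrier G" for c d x
 proof -
  obtain i where i: "c = shift_pow q m i" using G_shift[OF cd(1)] by blast
  obtain j where j: "d = shift_pow q m j" using G_shift[OF cd(2)] by blast
  show ?thesis unfolding i j tg(6) g_shift by (simp add: funpow_add)
 qed
 have g_surj: "\<exists>c'\<in>carrier G. g c' = c" if c: "c : C" for c
 proof -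
  obtain i where "c = s ^^ i" using c s unfolding is_gen_def by blast
  then show ?thesis using g_shift[of i] tg(5)[of i] by metis
 qed
 note ga = field_autoD[OF C_auto[OF gC]]
 have E2: "lookup (E + E) (c -` Q) = lookup (E + E) Q" if "c : C" "Q : PPY" for c Q
  using E(2)[OF that] by (simp add: lookup_add)
 have regular: "f : Q" if f: "f : H0 PY F" and Q: "Q : PPY" "lookup F Q = 0" for F f Q
  using f Q dvr.vset_0[OF Y.place_dvr[OF Q(1)]] unfolding Y.H0_iff by auto
 have HD: "H0 PY E \<subseteq> \<Delta>" "H0 PY (E + E) \<subseteq> \<Delta>"
  unfolding \<Delta>_def using regular fiberD(1) E(3) by (auto simp: lookup_add)
 have Hr: "H0 PY E \<subseteq> Y.semilocal r" "H0 PY (E + E) \<subseteq> Y.semilocal r"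
  unfolding Y.semilocal_def using regular Y.place_of_key[OF r] E(4) by (auto simp: lookup_add)
 note H = Y.ksubD[OF Y.ksub_H0]
 \<comment> \<open>Every element of C is a value of \<open>g\<close>. So all translates of
   \<open>z - z'\<close> vanish on \<open>r\<close>, and \<open>z - z'\<close> is a section of
   \<open>2E - R\<close>, which has none but 0.\<close>
 have sep: "z = z'" if z: "z : H0 PY (E + E)" "z' : H0 PY (E + E)"
  and eq: "!!c. c : carrier G ==> Y.res r (g c z) = Y.res r (g c z')" for z z'
 proof -
  have v: "c (z - z') : Y.vanishing r" if c: "c : C" for c
  proof -
   obtain c' where c': "c' : carrier G" "g c' = c" using g_surj[OF c] by blast
   show ?thesis using eq[OF c'(1)] unfolding Y.res_eq_iff[OF r] c'(2) by (simp add: field_autoD[OF C_auto[OF c]])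
  qed
  have "z - z' : H0 PY (E + E - (\<Sum>c\<in>C. translate c r))"
  proof (rule H0_of_vanishing_translates[OF r])
   show "lookup (E + E) Q = 0" if "Q : keys r" for Q using E(4)[OF that] by (simp add: lookup_add)
   show "z - z' : H0 PY (E + E)" by (rule H(5)[OF z])
  qed (fact disjoint E2 v)+
  then show ?thesis unfolding R by simp
 qed
 have card_G: "card (carrier G) = n" unfolding tg(2) using card_image[OF tg(3)] by simp
 have "lifting_data \<iota>Y \<iota>L m k G g ev \<Delta> (H0 PY E) (H0 PY (E + E)) (residue_ring_div \<iota>Y r) (Y.res r) T0 U0"
 proof (intro lifting_data.intro lifting_data_axioms.intro)
  show "constants \<iota>Y" by (rule Y.constants_axioms)
  show "constants \<iota>L" by (rule L(1))
  show "m > 0" by (rule m0)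
  show "G = twisted_shift_group CARD('k) m" by (simp add: G_def q_def)
  show "group G" by (rule tg(1))
  show "finite (carrier G)" unfolding tg(2) by simp
  show "of_nat (card (carrier G)) ~= (0 :: 'k)" unfolding card_G by (rule n)
  show "\<exists>i. c = shift_pow CARD('k) m i" if "c : carrier G" for c using G_shift[OF that] by (simp add: q_def)
  show "(c \<otimes>\<^bsub>G\<^esub> d) x = c (d x)" if cd: "c : carrier G" "d : carrier G" "x : ext_power_carrier m" for c d x
  proof -
   obtain i where i: "c = shift_pow q m i" using G_shift[OF cd(1)] by blast
   obtain j where j: "d = shift_pow q m j" using G_shift[OF cd(2)] by blast
   show ?thesis unfolding i j tg(6) shift_pow_add[OF m0 cd(3)] ..
  qed
  show "\<one>\<^bsub>G\<^esub> x = x" if "x : ext_power_carrier m" for x unfolding tg(7) by (rule shift_pow_0[OF that])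
  show "g c (x + y) = g c x + g c y" "g c (x * y) = g c x * g c y" if "c : carrier G" for c x y
   using ga[OF that] by simp_all
  show "g c (\<iota>Y b) = \<iota>Y b" if "c : carrier G" for c b by (rule C_\<iota>[OF gC[OF that]])
  show "g (c \<otimes>\<^bsub>G\<^esub> d) x = g c (g d x)" if "c : carrier G" "d : carrier G" for c d x by (rule g_mult[OF that])
  show "0 : H0 PY E" "0 : H0 PY (E + E)" by (rule H(1))+
  show "x + y : H0 PY E" if "x : H0 PY E" "y : H0 PY E" for x y by (rule H(2)[OF that])
  show "x + y : H0 PY (E + E)" if "x : H0 PY (E + E)" "y : H0 PY (E + E)" for x y by (rule H(2)[OF that])
  show "\<iota>Y b * x : H0 PY E" if "x : H0 PY E" for b x by (rule H(3)[OF that])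
  show "\<iota>Y b * x : H0 PY (E + E)" if "x : H0 PY (E + E)" for b x by (rule H(3)[OF that])
  show "g c x : H0 PY E" if "c : carrier G" "x : H0 PY E" for c x by (rule H0_act[OF gC[OF that(1)] E(2)[OF gC[OF that(1)]] that(2)])
  show "g c x : H0 PY (E + E)" if "c : carrier G" "x : H0 PY (E + E)" for c x
   by (rule H0_act[OF gC[OF that(1)] E2[OF gC[OF that(1)]] that(2)])
  show "H0 PY E \<subseteq> \<Delta>" "H0 PY (E + E) \<subseteq> \<Delta>" by (rule HD)+
  show "x * y : H0 PY (E + E)" if "x : H0 PY E" "y : H0 PY E" for x y by (rule Y.H0_mult[OF that])
  show "ev x : ext_power_carrier m" for x by (rule ev(1))
  show "ev (x + y) = (%i. ev x i + ev y i)" if "x : \<Delta>" "y : \<Delta>" for x y by (rule ev(2)[OF that])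
  show "ev (x * y) = (%i. ev x i * ev y i)" if "x : \<Delta>" "y : \<Delta>" for x y by (rule ev(3)[OF that])
  show "ev (\<iota>Y b * x) = (%i. \<iota>L b * ev x i)" if "x : \<Delta>" for b x by (rule ev(4)[OF that])
  show "ev (g c x) = c (ev x)" if cx: "c : carrier G" "x : \<Delta>" for c x
  proof -
   obtain i where i: "c = shift_pow q m i" using G_shift[OF cx(1)] by blast
   show ?thesis unfolding i g_shift by (rule ev(5)[OF cx(2)])
  qed
  show "\<exists>y\<in>H0 PY E. ev y = x" if "x : ext_power_carrier m" for x by (rule ev(6)[OF E(1,3) cov that])
  show "Y.res r x : carrier (residue_ring_div \<iota>Y r)" if "x : H0 PY E \<union> H0 PY (E + E)" for x
   by (rule Y.res_closed[OF r]) (use that Hr in blast)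
  show "Y.res r (x + y) = Y.res r x \<oplus>\<^bsub>residue_ring_div \<iota>Y r\<^esub> Y.res r y" if "x : H0 PY E" "y : H0 PY E" for x y
   by (rule Y.res_add[OF r]) (use that Hr in blast)+
  show "Y.res r (x + y) = Y.res r x \<oplus>\<^bsub>residue_ring_div \<iota>Y r\<^esub> Y.res r y" if "x : H0 PY (E + E)" "y : H0 PY (E + E)" for x y
   by (rule Y.res_add[OF r]) (use that Hr in blast)+
  show "Y.res r (x * y) = Y.res r x \<otimes>\<^bsub>residue_ring_div \<iota>Y r\<^esub> Y.res r y" if "x : H0 PY E" "y : H0 PY E" for x y
   by (rule Y.res_mult[OF r]) (use that Hr in blast)+
  show "Y.res r (\<iota>Y b * x) = b \<odot>\<^bsub>residue_ring_div \<iota>Y r\<^esub> Y.res r x" if "x : H0 PY E \<union> H0 PY (E + E)" for b x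
   by (rule Y.res_scale[OF r]) (use that Hr in blast)
 qed (fact sep T0 U0 alg)+
 from lifting_data.nu_sym_le[OF this] show ?thesis unfolding m_def k_def .
qed

end

section \<open>Moving the divisor, and the conclusion\<close>

lemma (in dvr) val_approx:
 assumes f: "f ~= 0" and w: "w - f : vset P (val P f + 1)"
 shows "w ~= 0" "val P w = val P f"
proof -
 have "w ~= 0 & val P w = val P f"
 proof (cases "w - f = 0")
  case False
  then have "val P f < val P (w - f)" using w by (simp add: vset_def)
  from val_add_less[OF f False this] show ?thesis by simp
 qed (use f in simp)
 then show "w ~= 0" "val P w = val P f" by auto
qed

text \<open>Approximating powers of uniformizers to one order beyond their value preserves the
  value. \<open>S\<close> is nonempty so that some prescribed value forces \<open>w\<close> to be
  nonzero.\<close>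

lemma (in curve) exists_with_values:
 assumes S: "finite S" "S \<subseteq> closed_points PX" "S ~= {}"
 obtains w where "w ~= 0" "!!P. P : S ==> val P w = k P"
proof -
 have d: "\<forall>P\<in>S. dvr P" using S(2) place_dvr by blast
 have "\<exists>f. f ~= 0 & val P f = k P" if "P : S" for P
 proof -
  interpret dvr P using d that by blast
  obtain \<pi> where "\<pi> ~= 0" "val P \<pi> = 1" using ex_uniformizer uniformizer_iff by blast
  then have "\<pi> powi k P ~= 0 & val P (\<pi> powi k P) = k P" by (simp add: val_powi)
  then show ?thesis by blast
 qed
 then obtain f where f: "!!P. P : S ==> f P ~= 0" "!!P. P : S ==> val P (f P) = k P" by metis
 from weak_approximation[OF S(1) d, of f "%P. val P (f P) + 1"]
 obtain w where w: "\<forall>P\<in>S. w - f P : vset P (val P (f P) + 1)" by blast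
 have "w ~= 0 & val P w = k P" if P: "P : S" for P
  using dvr.val_approx[of P "f P" w] d w f P by auto
 then show ?thesis using that S(3) by blast
qed

theorem theorem2:
  fixes \<iota>X :: "'k::{Fields.field,finite} \<Rightarrow> 'f::Fields.field" and PX :: "'f set set"
    and \<iota>Y :: "'k \<Rightarrow> 'g::Fields.field" and PY :: "'g set set"
    and \<phi> :: "'f \<Rightarrow> 'g"
    and \<iota>L :: "'k \<Rightarrow> 'l::Fields.field"
    and a :: "'f set" and D :: "'f divisor" and r R E B :: "'g divisor"
    and q n n1 n2 :: nat
  assumes q: "q = CARD('k)"
    and n: "n \<ge> 2" "coprime n q"
    and curve_X: "smooth_projective_curve \<iota>X PX"
    and curve_Y: "smooth_projective_curve \<iota>Y PY"
    and cover: "galois_cover \<iota>X PX \<iota>Y PY \<phi>" "unramified \<phi> PY"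
    and group: "cyclic_group (galois_group \<phi>)" "Coset.order (galois_group \<phi>) = n"
    and a: "a \<in> closed_points PX" "point_degree \<iota>X a = 1"
    and n1: "\<forall>Q\<in>fiber \<phi> PY a. inertial_degree \<phi> Q = n1"
    and n2: "n2 = n div n1"
    and B: "B = fiber_divisor \<phi> PY a"
    and r: "r \<in> divisors PY" "effective r"
    and disjoint: "\<forall>c\<in>carrier (galois_group \<phi>). c \<noteq> \<one>\<^bsub>galois_group \<phi>\<^esub> \<longrightarrow>
          Poly_Mapping.keys r \<inter> Poly_Mapping.keys (translate c r) = {}"
    and R: "R = (\<Sum>c\<in>carrier (galois_group \<phi>). translate c r)"
    and D: "D \<in> divisors PX"
    and E: "E = pullback \<phi> PY D"
    and cases: "(div_degree \<iota>X D \<ge> 2 * int (genus \<iota>X PX) \<and>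
                 div_degree \<iota>Y r \<ge> 2 * div_degree \<iota>X D + 1) \<or>
                (non_special \<iota>Y PY (E - B) \<and> dim_H0 \<iota>Y PY (E + E - R) = 0)"
    and L: "\<iota>L \<in> ring_hom ring_of_type_algebra ring_of_type_algebra"
           "ring.dimension ring_of_type_algebra n1 (range \<iota>L) (UNIV :: 'l set)"
  shows "nu_sym \<iota>L n2 \<le>
    sym_complexity (residue_ring_div \<iota>Y r) (residue_ring_div \<iota>Y r)
      (\<lambda>x y. x \<otimes>\<^bsub>residue_ring_div \<iota>Y r\<^esub> y)"
proof -
 interpret cyclic_cover \<iota>X PX \<iota>Y PY \<phi> n by unfold_locales fact+
 interpret L: constants \<iota>L by unfold_locales (rule L(1))
 \<comment> \<open>The degree of \<open>L\<close> enters as a cardinality, which is what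
   \<open>Y.residue_embedding\<close> compares with the residue field over \<open>a\<close>.\<close>
 have cardL: "finite (UNIV :: 'l set)" "CARD('l) = CARD('k) ^ n1"
  using rota.card_dimension[OF L.subfield_\<iota> L.card_range_\<iota>(1) L(2)] unfolding L.card_range_\<iota>(2) by auto
 have nK: "of_nat n ~= (0 :: 'k)" using of_nat_coprime_card n(2) unfolding q by blast
 obtain Q0 where Q0: "Q0 : fiber \<phi> PY a" using fiber_nonempty[OF a(1)] by blast
 have Q0': "Q0 : PPY" "\<phi> -` Q0 = a" using fiberD[OF Q0] by auto
 have ne: "n = card (fiber \<phi> PY a) * n1"
  using frobenius_generator[OF Q0'(1)] bspec[OF n1 Q0] unfolding Q0'(2) by metis
 have "n1 ~= 0"
 proof
  assume "n1 = 0"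
  then have "n = 0" using ne by simp
  then show False using n(1) by simp
 qed
 then have "card (fiber \<phi> PY a) * n1 div n1 = card (fiber \<phi> PY a)" by simp
 then have m: "card (fiber \<phi> PY a) = n2" unfolding n2 ne[symmetric] by (rule sym)
 \<comment> \<open>The points of X that the moved divisor must avoid: under E they contribute the
   fibre over \<open>a\<close> and the orbits of the support of \<open>r\<close>.\<close>
 let ?S = "insert a ((%Q. \<phi> -` Q) ` keys r)"
 have S: "?S \<subseteq> PPX" using a(1) restrict_place r(1) by (auto simp: divisors_def)
 obtain w where w: "w ~= 0" "!!P. P : ?S ==> val P w = lookup D P"
  by (rule X.exists_with_values[of ?S "lookup D"]) (use S in auto)
 define D' where "D' = D - X.prin w"
 have D': "D' : divisors PX" unfolding D'_def by (intro divisors_diff D X.prin(2) w(1))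
 have D'0: "lookup D' b = 0" if b: "b : ?S" for b
  using w(2)[OF b] X.prin(1)[OF w(1), of b] S b by (auto simp: D'_def lookup_minus)
 have degD': "X.deg D' = X.deg D" unfolding D'_def div_degree_diff X.deg_prin[OF w(1)] by simp
 define u where "u = \<phi> w"
 have u0: "u ~= 0" using w(1) by (simp add: u_def)
 define E' where "E' = pullback \<phi> PY D'"
 have E': "E' : divisors PY" unfolding E'_def by (rule pullback_divisors)
 have Edv: "E : divisors PY" unfolding E by (rule pullback_divisors)
 have Rdv: "R : divisors PY" unfolding R by (intro divisors_sum translate_divisors r(1))
 have Bdv: "B : divisors PY" unfolding B by (rule fiber_divisor_divisors)
 have E'E: "E' + Y.prin u = E"
 proof (rule Y.divisor_eqI[OF divisors_add[OF E' Y.prin(2)[OF u0]] Edv])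
  fix Q assume Q: "Q : PPY"
  show "lookup (E' + Y.prin u) Q = lookup E Q"
   unfolding E'_def E lookup_add lookup_pullback[OF D' Q] lookup_pullback[OF D Q] Y.prin(1)[OF u0 Q] unfolding u_def val_\<phi>[OF Q]
   using X.prin(1)[OF w(1) restrict_place[OF Q]] by (simp add: D'_def lookup_minus)
 qed
 have degR: "Y.deg R = int n * Y.deg r"
  unfolding R div_degree_sum using deg_translate[OF _ r(1)] card_C by simp
 have "Y.covers (E' - B) & H0 PY (E' + E' - R) = {0}"
  using cases
 proof
  assume i: "div_degree \<iota>X D \<ge> 2 * int (genus \<iota>X PX) & div_degree \<iota>Y r \<ge> 2 * div_degree \<iota>X D + 1"
  \<comment> \<open>\<open>E' - B\<close> is the pullback of \<open>D' - a\<close>. Since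
    \<open>a\<close> has degree one, case (i) leaves degree at least \<open>2 g - 1\<close>, as
    \<open>covers_pullback\<close> demands.\<close>
  have "X.deg (D' - single a 1) = X.deg D - 1"
   unfolding div_degree_diff degD' div_degree_single a(2) by simp
  then have "Y.covers (pullback \<phi> PY (D' - single a 1))"
   using i nK by (intro covers_pullback divisors_diff D' divisors_single a(1)) auto
  then have "Y.covers (E' - B)" unfolding pullback_diff_point[OF D' a(1)] E'_def B .
  moreover have "Y.deg (E' + E' - R) = int n * (2 * X.deg D - Y.deg r)"
   unfolding div_degree_diff div_degree_add degR E'_def deg_pullback[OF D'] degD' by (simp add: algebra_simps)
  then have "Y.deg (E' + E' - R) < 0" using i n_pos by (simp add: mult_less_0_iff)
  then have "H0 PY (E' + E' - R) = {0}" by (intro Y.H0_deg_neg divisors_diff divisors_add E' Rdv)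
  ultimately show ?thesis by blast
 next
  assume ii: "non_special \<iota>Y PY (E - B) & dim_H0 \<iota>Y PY (E + E - R) = 0"
  have EB: "E - B = (E' - B) + Y.prin u" unfolding E'E[symmetric] by simp
  have "Y.ell (E - B) = Y.ell (E' - B)" unfolding EB by (rule Y.ell_prin[OF divisors_diff[OF E' Bdv] u0])
  moreover have "Y.deg (E - B) = Y.deg (E' - B)" unfolding EB div_degree_add Y.deg_prin[OF u0] by simp
  ultimately have "Y.covers (E' - B)"
   using ii by (intro Y.covers_of_nonspecial divisors_diff E' Bdv) (simp add: non_special_def)
  moreover have "H0 PY (E' + E' - R) \<subseteq> {0}"
  proof
   fix f assume f: "f : H0 PY (E' + E' - R)"
   \<comment> \<open>The two divisors differ by that of \<open>u * u\<close>, so division by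
     \<open>u * u\<close> carries sections of one to sections of the other.\<close>
   have eq: "E + E - R = (E' + E' - R) + Y.prin u + Y.prin u" unfolding E'E[symmetric] by (simp add: algebra_simps)
   have h: "f / (u * u) : H0 PY (E + E - R)"
    unfolding eq Y.H0_mult_iff[OF u0] using f u0 by simp
   have fin: "finite (H0 PY (E + E - R))" by (intro Y.finite_H0 divisors_diff divisors_add Edv Rdv)
   have "card (H0 PY (E + E - R)) = 1" using Y.card_H0[OF fin] ii by simp
   then obtain z where "H0 PY (E + E - R) = {z}" by (rule card_1_singletonE)
   moreover have "0 : H0 PY (E + E - R)" by (rule Y.ksubD(1)[OF Y.ksub_H0])
   ultimately have "f / (u * u) = 0" using h by auto
   then show "f : {0}" using u0 by simp
  qed
  then have "H0 PY (E' + E' - R) = {0}" using Y.ksubD(1)[OF Y.ksub_H0, of "E' + E' - R"] by blast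
  ultimately show ?thesis by blast
 qed
 then have cov: "Y.covers (E' - fiber_divisor \<phi> PY a)" and R0: "H0 PY (E' + E' - (\<Sum>c\<in>C. translate c r)) = {0}"
  unfolding B R by auto
 show ?thesis
  unfolding m[symmetric]
 proof (rule nu_sym_le_core[OF a L.constants_axioms cardL ne nK r _ E' _ _ _ cov R0])
  show "keys r \<inter> keys (translate c r) = {}" if "c : C" "c ~= id" for c
   using disjoint that unfolding galois_one by blast
  show "lookup E' (c -` Q) = lookup E' Q" if c: "c : C" and Q: "Q : PPY" for c Q
   unfolding E'_def lookup_pullback[OF D' act_place[OF c Q]] lookup_pullback[OF D' Q] restrict_act[OF c] ..
  show "lookup E' Q = 0" if Q: "Q : fiber \<phi> PY a" for Q
   unfolding E'_def lookup_pullback[OF D' fiberD(1)[OF Q]] fiberD(2)[OF Q] by (rule D'0) simp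
  show "lookup E' Q = 0" if Q: "Q : keys r" for Q
   unfolding E'_def lookup_pullback[OF D' Y.place_of_key[OF r Q]] by (rule D'0) (use Q in blast)
 qed
qed

end
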